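(* Let $\mathscr{T}$ be a $\mathscr{J}$-theory and $\mathscr{C}$ a $\mathscr{V}$-category with $\mathscr{J}$-powers. There are isomorphisms $$[\mathscr{C}^{\mathrm{op}},\mathscr{T}\text{-}\mathrm{Alg}](\llbracket -,E\rrbracket,S)\;\cong\;\int S[E]$$ $\mathscr{V}'$-natural in $E\in\mathscr{T}\text{-}\mathrm{Alg}(\mathscr{C})$ and $S\in[\mathscr{C}^{\mathrm{op}},\mathscr{T}\text{-}\mathrm{Alg}]$. In particular, given a $\mathscr{T}$-algebra $E:\mathscr{T}\to\mathscr{C}$ and a $\mathscr{V}$-functor $S:\mathscr{C}^{\mathrm{op}}\to\mathscr{T}\text{-}\mathrm{Alg}$, there is a bijective correspondence between $\mathscr{V}$-natural transformations $\phi:\llbracket -,E\rrbracket\Rightarrow S$ and sections $\sigma$ of $S$ at $E$.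
   Context: Setting. $\mathscr{V}=(\mathscr{V},\otimes,I)$ is a symmetric monoidal closed category whose underlying ordinary category has finite limits. $\mathscr{V}$-categories may be large; $\mathscr{V}'$ is a symmetric monoidal closed category that has all limits and colimits that are small relative to a larger universe (for which all $\mathscr{V}$-categories considered are small), equipped with a fully faithful symmetric strong monoidal embedding $\mathscr{V}\hookrightarrow\mathscr{V}'$ that preserves all limits that exist in $\mathscr{V}$. $[\mathscr{C},\mathscr{D}]$ denotes the $\mathscr{V}'$-category of $\mathscr{V}$-functors $\mathscr{C}\to\mathscr{D}$. Systems of arities and theories. $\mathscr{J}\hookrightarrow\mathscr{V}$ is a system of arities, i.e. a full sub-$\mathscr{V}$-category closed under $\otimes$ and containing $I$. A power $C^X$ in a $\mathscr{V}$-category $\mathscr{C}$ is an object with $\mathscr{V}$-natural isomorphisms $\mathscr{C}(B,C^X)\cong\mathscr{V}(X,\mathscr{C}(B,C))$; $\mathscr{C}$ has $\mathscr{J}$-powers if it is equipped with a designated power $C^J$ for all $J\in\mathscr{J}$, $C\in\mathscr{C}$ (with $C^I=C$, and with counit $I\to\mathscr{C}(C,C)$ the identity). A $\mathscr{J}$-theory is a $\mathscr{V}$-category $\mathscr{T}$ with $\mathrm{ob}\,\mathscr{T}=\mathrm{ob}\,\mathscr{J}$, equipped with an identity-on-objects $\mathscr{V}$-functor $\mathscr{J}^{\mathrm{op}}\to\mathscr{T}$ that preserves $\mathscr{J}$-powers. Algebras. A $\mathscr{T}$-algebra in a $\mathscr{V}$-category $\mathscr{C}$ with $\mathscr{J}$-powers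 is a $\mathscr{V}$-functor $\mathscr{T}\to\mathscr{C}$ that preserves $\mathscr{J}$-powers; $\mathscr{T}\text{-}\mathrm{Alg}(\mathscr{C})$ is the full sub-$\mathscr{V}'$-category of $[\mathscr{T},\mathscr{C}]$ on these, and $\mathscr{T}\text{-}\mathrm{Alg}=\mathscr{T}\text{-}\mathrm{Alg}(\mathscr{V})$, with $G^{\mathscr{T}}:\mathscr{T}\text{-}\mathrm{Alg}\to\mathscr{V}$ evaluation at $I$. Throughout, $\mathscr{J}$ is amenable: for every $\mathscr{J}$-theory $\mathscr{T}$, $\mathscr{T}\text{-}\mathrm{Alg}$ exists as a $\mathscr{V}$-category and $G^{\mathscr{T}}$ has a left adjoint. Notation for this statement. For a $\mathscr{T}$-algebra $E:\mathscr{T}\to\mathscr{C}$, $\llbracket -,E\rrbracket:\mathscr{C}^{\mathrm{op}}\to\mathscr{T}\text{-}\mathrm{Alg}$ is the $\mathscr{V}$-functor $\llbracket C,E\rrbracket=\mathscr{C}(C,E-)$. Given a $\mathscr{V}$-functor $S:\mathscr{C}^{\mathrm{op}}\to\mathscr{T}\text{-}\mathrm{Alg}$ and a $\mathscr{T}$-algebra $E:\mathscr{T}\to\mathscr{C}$, $S[E]:\mathscr{T}^{\mathrm{op}}\otimes\mathscr{T}\to\mathscr{V}$ is the $\mathscr{V}$-functor $S[E](J,K)=(SEJ)K$. A section of $S$ at $E$ is a family $\sigma$ of morphisms $\sigma_J:I\to S[E](J,J)$ in $\mathscr{V}$ that are (extraordinarily) $\mathscr{V}$-natural in $J\in\mathscr{T}$.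 The object of sections is the end $\int S[E]:=\int_{J\in\mathscr{T}}S[E](J,J)$ in $\mathscr{V}'$.
   Formalization: The embedding of V into V' is additionally assumed to preserve internal homs (the canonical map from the image of [X,Y] to the internal hom of the images is invertible); with only ordinary full faithfulness, strong monoidality and limit preservation the isomorphism can fail. *)

theory Defs
  imports Main "HOL-Library.FuncSet" "HOL-Library.Equipollence"
begin

section \<open>Ordinary categories, limits\<close>

record ('o, 'm) cat =
  Obj :: "'o set"
  Arr :: "'m set"
  Dom :: "'m \<Rightarrow> 'o"
  Cod :: "'m \<Rightarrow> 'o"
  Idt :: "'o \<Rightarrow> 'm"
  Comp :: "'m \<Rightarrow> 'm \<Rightarrow> 'm"  (infixr "\<cdot>\<index>" 65)

definition hom :: "('o, 'm, 'z) cat_scheme \<Rightarrow> 'o \<Rightarrow> 'o \<Rightarrow> 'm set" where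
  "hom C X Y = {f \<in> Arr C. Dom C f = X \<and> Cod C f = Y}"

locale category =
  fixes C :: "('o, 'm, 'z) cat_scheme" (structure)
  assumes Dom_Obj: "f \<in> Arr C \<Longrightarrow> Dom C f \<in> Obj C"
    and Cod_Obj: "f \<in> Arr C \<Longrightarrow> Cod C f \<in> Obj C"
    and Idt_hom: "X \<in> Obj C \<Longrightarrow> Idt C X \<in> hom C X X"
    and Comp_hom: "f \<in> hom C X Y \<Longrightarrow> g \<in> hom C Y Z \<Longrightarrow> g \<cdot> f \<in> hom C X Z"
    and Idt_left: "f \<in> hom C X Y \<Longrightarrow> Idt C Y \<cdot> f = f"
    and Idt_right: "f \<in> hom C X Y \<Longrightarrow> f \<cdot> Idt C X = f"
    and Comp_assoc: "f \<in> hom C W X \<Longrightarrow> g \<in> hom C X Y \<Longrightarrow> h \<in> hom C Y Z \<Longrightarrow>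
      (h \<cdot> g) \<cdot> f = h \<cdot> (g \<cdot> f)"

definition inverse_arrows :: "('o, 'm, 'z) cat_scheme \<Rightarrow> 'm \<Rightarrow> 'm \<Rightarrow> bool" where
  "inverse_arrows C f g \<longleftrightarrow> f \<in> Arr C \<and> g \<in> hom C (Cod C f) (Dom C f) \<and>
     g \<cdot>\<^bsub>C\<^esub> f = Idt C (Dom C f) \<and> f \<cdot>\<^bsub>C\<^esub> g = Idt C (Cod C f)"

definition is_iso :: "('o, 'm, 'z) cat_scheme \<Rightarrow> 'm \<Rightarrow> bool" where
  "is_iso C f \<longleftrightarrow> (\<exists>g. inverse_arrows C f g)"

definition inv_arr :: "('o, 'm, 'z) cat_scheme \<Rightarrow> 'm \<Rightarrow> 'm" where
  "inv_arr C f = (THE g. inverse_arrows C f g)"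

definition dual :: "('o, 'm, 'z) cat_scheme \<Rightarrow> ('o, 'm) cat" where
  "dual C = \<lparr>Obj = Obj C, Arr = Arr C, Dom = Cod C, Cod = Dom C, Idt = Idt C,
     Comp = (\<lambda>g f. f \<cdot>\<^bsub>C\<^esub> g)\<rparr>"

record ('o, 'm, 'p, 'n) ofun =
  FOb :: "'o \<Rightarrow> 'p"
  FAr :: "'m \<Rightarrow> 'n"

definition ordinary_functor ::
  "('o, 'm, 'z) cat_scheme \<Rightarrow> ('p, 'n, 'y) cat_scheme \<Rightarrow> ('o, 'm, 'p, 'n, 'x) ofun_scheme \<Rightarrow> bool"
  where
  "ordinary_functor C D F \<longleftrightarrow>
     (\<forall>X\<in>Obj C. FOb F X \<in> Obj D \<and> FAr F (Idt C X) = Idt D (FOb F X)) \<and>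
     (\<forall>X Y. \<forall>f\<in>hom C X Y. FAr F f \<in> hom D (FOb F X) (FOb F Y)) \<and>
     (\<forall>X Y Z. \<forall>f\<in>hom C X Y. \<forall>g\<in>hom C Y Z. FAr F (g \<cdot>\<^bsub>C\<^esub> f) = FAr F g \<cdot>\<^bsub>D\<^esub> FAr F f)"

definition cone :: "('k, 'l, 'z) cat_scheme \<Rightarrow> ('o, 'm, 'y) cat_scheme \<Rightarrow>
    ('k, 'l, 'o, 'm, 'x) ofun_scheme \<Rightarrow> 'o \<Rightarrow> ('k \<Rightarrow> 'm) \<Rightarrow> bool" where
  "cone K C D L \<pi> \<longleftrightarrow> L \<in> Obj C \<and> (\<forall>k\<in>Obj K. \<pi> k \<in> hom C L (FOb D k)) \<and>
     (\<forall>f\<in>Arr K. FAr D f \<cdot>\<^bsub>C\<^esub> \<pi> (Dom K f) = \<pi> (Cod K f))"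

definition is_limit :: "('k, 'l, 'z) cat_scheme \<Rightarrow> ('o, 'm, 'y) cat_scheme \<Rightarrow>
    ('k, 'l, 'o, 'm, 'x) ofun_scheme \<Rightarrow> 'o \<Rightarrow> ('k \<Rightarrow> 'm) \<Rightarrow> bool" where
  "is_limit K C D L \<pi> \<longleftrightarrow> cone K C D L \<pi> \<and>
     (\<forall>M \<rho>. cone K C D M \<rho> \<longrightarrow>
        (\<exists>!h. h \<in> hom C M L \<and> (\<forall>k\<in>Obj K. \<pi> k \<cdot>\<^bsub>C\<^esub> h = \<rho> k)))"

definition has_limits_of_shapes :: "(('k, 'l) cat \<Rightarrow> bool) \<Rightarrow> ('o, 'm, 'z) cat_scheme \<Rightarrow> bool" where
  "has_limits_of_shapes P C \<longleftrightarrow>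
     (\<forall>K. category K \<and> P K \<longrightarrow>
        (\<forall>D :: ('k, 'l, 'o, 'm) ofun. ordinary_functor K C D \<longrightarrow> (\<exists>L \<pi>. is_limit K C D L \<pi>)))"

text \<open>Every finite category is isomorphic to one whose objects and arrows are natural numbers.\<close>

definition finitely_complete :: "('o, 'm, 'z) cat_scheme \<Rightarrow> bool" where
  "finitely_complete C \<longleftrightarrow> has_limits_of_shapes (\<lambda>K :: (nat, nat) cat. finite (Arr K)) C"

text \<open>
  The larger universe is represented by a set \<open>U\<close>: a set is small when its cardinality is strictly
  below that of \<open>U\<close> (for a Grothendieck universe, take \<open>U\<close> to be of the corresponding inaccessible
  cardinality). Every small category is isomorphic to one with objects and arrows in \<open>U\<close>.
\<close>

definition small :: "'u set \<Rightarrow> 'x set \<Rightarrow> bool" where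
  "small U X \<longleftrightarrow> X \<prec> U"

definition small_shape :: "'u set \<Rightarrow> ('u, 'u) cat \<Rightarrow> bool" where
  "small_shape U K \<longleftrightarrow> Obj K \<subseteq> U \<and> Arr K \<subseteq> U \<and> small U (Obj K) \<and> small U (Arr K)"

definition small_complete :: "'u set \<Rightarrow> ('o, 'm, 'z) cat_scheme \<Rightarrow> bool" where
  "small_complete U C \<longleftrightarrow> has_limits_of_shapes (small_shape U) C"

definition small_cocomplete :: "'u set \<Rightarrow> ('o, 'm, 'z) cat_scheme \<Rightarrow> bool" where
  "small_cocomplete U C \<longleftrightarrow> has_limits_of_shapes (small_shape U) (dual C)"

text \<open>Preservation is required for shapes of size up to and including that of \<open>U\<close>.\<close>

definition preserves_limits :: "'u set \<Rightarrow> ('o, 'm, 'z) cat_scheme \<Rightarrow> ('p, 'n, 'y) cat_scheme \<Rightarrow>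
    ('o, 'm, 'p, 'n, 'x) ofun_scheme \<Rightarrow> bool" where
  "preserves_limits U C D F \<longleftrightarrow>
     (\<forall>(K :: ('u, 'u) cat) (E :: ('u, 'u, 'o, 'm) ofun) L \<pi>.
        category K \<and> Obj K \<subseteq> U \<and> Arr K \<subseteq> U \<and> ordinary_functor K C E \<and> is_limit K C E L \<pi> \<longrightarrow>
        is_limit K D \<lparr>FOb = FOb F \<circ> FOb E, FAr = FAr F \<circ> FAr E\<rparr> (FOb F L) (FAr F \<circ> \<pi>))"

definition fully_faithful ::
  "('o, 'm, 'z) cat_scheme \<Rightarrow> ('p, 'n, 'y) cat_scheme \<Rightarrow> ('o, 'm, 'p, 'n, 'x) ofun_scheme \<Rightarrow> bool"
  where
  "fully_faithful C D F \<longleftrightarrow>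
     (\<forall>X\<in>Obj C. \<forall>Y\<in>Obj C. bij_betw (FAr F) (hom C X Y) (hom D (FOb F X) (FOb F Y)))"


section \<open>Symmetric monoidal closed categories\<close>

text \<open>\<open>ihom V X Y\<close> is the internal hom \<open>[X, Y]\<close>, with evaluation \<open>ev V X Y : [X, Y] \<otimes> X \<rightarrow> Y\<close>.\<close>

record ('o, 'm) smc = "('o, 'm) cat" +
  Ten :: "'o \<Rightarrow> 'o \<Rightarrow> 'o"  (infixr "\<otimes>\<index>" 70)
  TenA :: "'m \<Rightarrow> 'm \<Rightarrow> 'm"  (infixr "\<odot>\<index>" 70)
  Unt :: "'o"  ("\<one>\<index>")
  asc :: "'o \<Rightarrow> 'o \<Rightarrow> 'o \<Rightarrow> 'm"
  lun :: "'o \<Rightarrow> 'm"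
  run :: "'o \<Rightarrow> 'm"
  braid :: "'o \<Rightarrow> 'o \<Rightarrow> 'm"
  ihom :: "'o \<Rightarrow> 'o \<Rightarrow> 'o"
  ev :: "'o \<Rightarrow> 'o \<Rightarrow> 'm"

locale symmetric_monoidal_closed = category V
  for V :: "('o, 'm) smc" (structure) +
  assumes Unt_Obj: "\<one> \<in> Obj V"
    and Ten_Obj: "X \<in> Obj V \<Longrightarrow> Y \<in> Obj V \<Longrightarrow> X \<otimes> Y \<in> Obj V"
    and TenA_hom: "f \<in> hom V X X' \<Longrightarrow> g \<in> hom V Y Y' \<Longrightarrow> f \<odot> g \<in> hom V (X \<otimes> Y) (X' \<otimes> Y')"
    and TenA_Idt: "X \<in> Obj V \<Longrightarrow> Y \<in> Obj V \<Longrightarrow> Idt V X \<odot> Idt V Y = Idt V (X \<otimes> Y)"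
    and TenA_Comp: "f \<in> hom V X X' \<Longrightarrow> f' \<in> hom V X' X'' \<Longrightarrow> g \<in> hom V Y Y' \<Longrightarrow> g' \<in> hom V Y' Y'' \<Longrightarrow>
      (f' \<cdot> f) \<odot> (g' \<cdot> g) = (f' \<odot> g') \<cdot> (f \<odot> g)"
    and asc_hom: "X \<in> Obj V \<Longrightarrow> Y \<in> Obj V \<Longrightarrow> Z \<in> Obj V \<Longrightarrow>
      asc V X Y Z \<in> hom V ((X \<otimes> Y) \<otimes> Z) (X \<otimes> (Y \<otimes> Z))"
    and asc_iso: "X \<in> Obj V \<Longrightarrow> Y \<in> Obj V \<Longrightarrow> Z \<in> Obj V \<Longrightarrow> is_iso V (asc V X Y Z)"
    and asc_natural: "f \<in> hom V X X' \<Longrightarrow> g \<in> hom V Y Y' \<Longrightarrow> h \<in> hom V Z Z' \<Longrightarrow>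
      asc V X' Y' Z' \<cdot> ((f \<odot> g) \<odot> h) = (f \<odot> (g \<odot> h)) \<cdot> asc V X Y Z"
    and lun_hom: "X \<in> Obj V \<Longrightarrow> lun V X \<in> hom V (\<one> \<otimes> X) X"
    and lun_iso: "X \<in> Obj V \<Longrightarrow> is_iso V (lun V X)"
    and lun_natural: "f \<in> hom V X X' \<Longrightarrow> lun V X' \<cdot> (Idt V \<one> \<odot> f) = f \<cdot> lun V X"
    and run_hom: "X \<in> Obj V \<Longrightarrow> run V X \<in> hom V (X \<otimes> \<one>) X"
    and run_iso: "X \<in> Obj V \<Longrightarrow> is_iso V (run V X)"
    and run_natural: "f \<in> hom V X X' \<Longrightarrow> run V X' \<cdot> (f \<odot> Idt V \<one>) = f \<cdot> run V X"
    and pentagon: "W \<in> Obj V \<Longrightarrow> X \<in> Obj V \<Longrightarrow> Y \<in> Obj V \<Longrightarrow> Z \<in> Obj V \<Longrightarrow>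
      asc V W X (Y \<otimes> Z) \<cdot> asc V (W \<otimes> X) Y Z =
      (Idt V W \<odot> asc V X Y Z) \<cdot> asc V W (X \<otimes> Y) Z \<cdot> (asc V W X Y \<odot> Idt V Z)"
    and triangle: "X \<in> Obj V \<Longrightarrow> Y \<in> Obj V \<Longrightarrow>
      (Idt V X \<odot> lun V Y) \<cdot> asc V X \<one> Y = run V X \<odot> Idt V Y"
    and braid_hom: "X \<in> Obj V \<Longrightarrow> Y \<in> Obj V \<Longrightarrow> braid V X Y \<in> hom V (X \<otimes> Y) (Y \<otimes> X)"
    and braid_natural: "f \<in> hom V X X' \<Longrightarrow> g \<in> hom V Y Y' \<Longrightarrow>
      braid V X' Y' \<cdot> (f \<odot> g) = (g \<odot> f) \<cdot> braid V X Y"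
    and braid_symmetric: "X \<in> Obj V \<Longrightarrow> Y \<in> Obj V \<Longrightarrow> braid V Y X \<cdot> braid V X Y = Idt V (X \<otimes> Y)"
    and hexagon: "X \<in> Obj V \<Longrightarrow> Y \<in> Obj V \<Longrightarrow> Z \<in> Obj V \<Longrightarrow>
      asc V Y Z X \<cdot> braid V X (Y \<otimes> Z) \<cdot> asc V X Y Z =
      (Idt V Y \<odot> braid V X Z) \<cdot> asc V Y X Z \<cdot> (braid V X Y \<odot> Idt V Z)"
    and ihom_Obj: "X \<in> Obj V \<Longrightarrow> Y \<in> Obj V \<Longrightarrow> ihom V X Y \<in> Obj V"
    and ev_hom: "X \<in> Obj V \<Longrightarrow> Y \<in> Obj V \<Longrightarrow> ev V X Y \<in> hom V (ihom V X Y \<otimes> X) Y"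
    and closed: "X \<in> Obj V \<Longrightarrow> Z \<in> Obj V \<Longrightarrow> f \<in> hom V (Z \<otimes> X) Y \<Longrightarrow>
      \<exists>!g. g \<in> hom V Z (ihom V X Y) \<and> ev V X Y \<cdot> (g \<odot> Idt V X) = f"

text \<open>\<open>curry_arr V Z X f : Z \<rightarrow> [X, Y]\<close> is the transpose of \<open>f : Z \<otimes> X \<rightarrow> Y\<close>.\<close>

definition curry_arr :: "('o, 'm) smc \<Rightarrow> 'o \<Rightarrow> 'o \<Rightarrow> 'm \<Rightarrow> 'm" where
  "curry_arr V Z X f = (THE g. g \<in> hom V Z (ihom V X (Cod V f)) \<and>
     ev V X (Cod V f) \<cdot>\<^bsub>V\<^esub> (g \<odot>\<^bsub>V\<^esub> Idt V X) = f)"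

text \<open>The element \<open>I \<rightarrow> [X, Y]\<close> corresponding to \<open>f : X \<rightarrow> Y\<close>.\<close>

definition name_of :: "('o, 'm) smc \<Rightarrow> 'm \<Rightarrow> 'm" where
  "name_of V f = curry_arr V \<one>\<^bsub>V\<^esub> (Dom V f) (f \<cdot>\<^bsub>V\<^esub> lun V (Dom V f))"

text \<open>\<open>[f, Y] : [X', Y] \<rightarrow> [X, Y]\<close> for \<open>f : X \<rightarrow> X'\<close>.\<close>

definition ihom_pre :: "('o, 'm) smc \<Rightarrow> 'm \<Rightarrow> 'o \<Rightarrow> 'm" where
  "ihom_pre V f Y = curry_arr V (ihom V (Cod V f) Y) (Dom V f)
     (ev V (Cod V f) Y \<cdot>\<^bsub>V\<^esub> (Idt V (ihom V (Cod V f) Y) \<odot>\<^bsub>V\<^esub> f))"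

text \<open>The canonical isomorphism \<open>(W \<otimes> X) \<otimes> (Y \<otimes> Z) \<rightarrow> (W \<otimes> Y) \<otimes> (X \<otimes> Z)\<close>.\<close>

definition middle_four :: "('o, 'm) smc \<Rightarrow> 'o \<Rightarrow> 'o \<Rightarrow> 'o \<Rightarrow> 'o \<Rightarrow> 'm" where
  "middle_four V W X Y Z =
     inv_arr V (asc V W Y (X \<otimes>\<^bsub>V\<^esub> Z)) \<cdot>\<^bsub>V\<^esub>
     (Idt V W \<odot>\<^bsub>V\<^esub>
        (asc V Y X Z \<cdot>\<^bsub>V\<^esub> (braid V X Y \<odot>\<^bsub>V\<^esub> Idt V Z) \<cdot>\<^bsub>V\<^esub> inv_arr V (asc V X Y Z))) \<cdot>\<^bsub>V\<^esub>
     asc V W X (Y \<otimes>\<^bsub>V\<^esub> Z)"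

text \<open>
  Monoidal functors have structure maps \<open>FMul F X Y : F X \<otimes> F Y \<rightarrow> F (X \<otimes> Y)\<close> and
  \<open>FUnt F : I \<rightarrow> F I\<close>.
\<close>

record ('o, 'm, 'p, 'n) mfun = "('o, 'm, 'p, 'n) ofun" +
  FMul :: "'o \<Rightarrow> 'o \<Rightarrow> 'n"
  FUnt :: "'n"

definition symmetric_strong_monoidal ::
  "('o, 'm) smc \<Rightarrow> ('p, 'n) smc \<Rightarrow> ('o, 'm, 'p, 'n) mfun \<Rightarrow> bool" where
  "symmetric_strong_monoidal V W F \<longleftrightarrow>
     ordinary_functor V W F \<and>
     FUnt F \<in> hom W \<one>\<^bsub>W\<^esub> (FOb F \<one>\<^bsub>V\<^esub>) \<and> is_iso W (FUnt F) \<and>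
     (\<forall>X\<in>Obj V. \<forall>Y\<in>Obj V.
        FMul F X Y \<in> hom W (FOb F X \<otimes>\<^bsub>W\<^esub> FOb F Y) (FOb F (X \<otimes>\<^bsub>V\<^esub> Y)) \<and> is_iso W (FMul F X Y)) \<and>
     (\<forall>X X' Y Y'. \<forall>f\<in>hom V X X'. \<forall>g\<in>hom V Y Y'.
        FAr F (f \<odot>\<^bsub>V\<^esub> g) \<cdot>\<^bsub>W\<^esub> FMul F X Y = FMul F X' Y' \<cdot>\<^bsub>W\<^esub> (FAr F f \<odot>\<^bsub>W\<^esub> FAr F g)) \<and>
     (\<forall>X\<in>Obj V. \<forall>Y\<in>Obj V. \<forall>Z\<in>Obj V.
        FAr F (asc V X Y Z) \<cdot>\<^bsub>W\<^esub> FMul F (X \<otimes>\<^bsub>V\<^esub> Y) Z \<cdot>\<^bsub>W\<^esub> (FMul F X Y \<odot>\<^bsub>W\<^esub> Idt W (FOb F Z)) =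
        FMul F X (Y \<otimes>\<^bsub>V\<^esub> Z) \<cdot>\<^bsub>W\<^esub> (Idt W (FOb F X) \<odot>\<^bsub>W\<^esub> FMul F Y Z) \<cdot>\<^bsub>W\<^esub>
          asc W (FOb F X) (FOb F Y) (FOb F Z)) \<and>
     (\<forall>X\<in>Obj V.
        FAr F (lun V X) \<cdot>\<^bsub>W\<^esub> FMul F \<one>\<^bsub>V\<^esub> X \<cdot>\<^bsub>W\<^esub> (FUnt F \<odot>\<^bsub>W\<^esub> Idt W (FOb F X)) = lun W (FOb F X) \<and>
        FAr F (run V X) \<cdot>\<^bsub>W\<^esub> FMul F X \<one>\<^bsub>V\<^esub> \<cdot>\<^bsub>W\<^esub> (Idt W (FOb F X) \<odot>\<^bsub>W\<^esub> FUnt F) = run W (FOb F X)) \<and>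
     (\<forall>X\<in>Obj V. \<forall>Y\<in>Obj V.
        FAr F (braid V X Y) \<cdot>\<^bsub>W\<^esub> FMul F X Y = FMul F Y X \<cdot>\<^bsub>W\<^esub> braid W (FOb F X) (FOb F Y))"

text \<open>The canonical comparison \<open>F [X, Y] \<rightarrow> [F X, F Y]\<close>.\<close>

definition ihom_comparison ::
  "('o, 'm) smc \<Rightarrow> ('p, 'n) smc \<Rightarrow> ('o, 'm, 'p, 'n) mfun \<Rightarrow> 'o \<Rightarrow> 'o \<Rightarrow> 'n" where
  "ihom_comparison V W F X Y =
     curry_arr W (FOb F (ihom V X Y)) (FOb F X) (FAr F (ev V X Y) \<cdot>\<^bsub>W\<^esub> FMul F (ihom V X Y) X)"

text \<open>
  This says that \<open>F\<close> is fully faithful also in the sense of enriched category theory: \<open>V\<close>, as a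
  category enriched in \<open>W\<close> with hom-objects \<open>F [X, Y]\<close>, is a full subcategory of \<open>W\<close>.
\<close>

definition preserves_internal_homs ::
  "('o, 'm) smc \<Rightarrow> ('p, 'n) smc \<Rightarrow> ('o, 'm, 'p, 'n) mfun \<Rightarrow> bool" where
  "preserves_internal_homs V W F \<longleftrightarrow>
     (\<forall>X\<in>Obj V. \<forall>Y\<in>Obj V. is_iso W (ihom_comparison V W F X Y))"


section \<open>Enriched categories, functors and natural transformations\<close>

text \<open>\<open>EComp A x y z : A(y, z) \<otimes> A(x, y) \<rightarrow> A(x, z)\<close> and \<open>EId A x : I \<rightarrow> A(x, x)\<close>.\<close>

record ('x, 'o, 'm) ecat =
  EOb :: "'x set"
  EHom :: "'x \<Rightarrow> 'x \<Rightarrow> 'o"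
  EComp :: "'x \<Rightarrow> 'x \<Rightarrow> 'x \<Rightarrow> 'm"
  EId :: "'x \<Rightarrow> 'm"

locale enriched_category = symmetric_monoidal_closed V
  for V :: "('o, 'm) smc" (structure) +
  fixes A :: "('x, 'o, 'm) ecat"
  assumes EHom_Obj: "x \<in> EOb A \<Longrightarrow> y \<in> EOb A \<Longrightarrow> EHom A x y \<in> Obj V"
    and EComp_hom: "x \<in> EOb A \<Longrightarrow> y \<in> EOb A \<Longrightarrow> z \<in> EOb A \<Longrightarrow>
      EComp A x y z \<in> hom V (EHom A y z \<otimes> EHom A x y) (EHom A x z)"
    and EId_hom: "x \<in> EOb A \<Longrightarrow> EId A x \<in> hom V \<one> (EHom A x x)"
    and EComp_assoc: "w \<in> EOb A \<Longrightarrow> x \<in> EOb A \<Longrightarrow> y \<in> EOb A \<Longrightarrow> z \<in> EOb A \<Longrightarrow>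
      EComp A w x z \<cdot> (EComp A x y z \<odot> Idt V (EHom A w x)) =
      EComp A w y z \<cdot> (Idt V (EHom A y z) \<odot> EComp A w x y) \<cdot>
        asc V (EHom A y z) (EHom A x y) (EHom A w x)"
    and EId_left: "x \<in> EOb A \<Longrightarrow> y \<in> EOb A \<Longrightarrow>
      EComp A x y y \<cdot> (EId A y \<odot> Idt V (EHom A x y)) = lun V (EHom A x y)"
    and EId_right: "x \<in> EOb A \<Longrightarrow> y \<in> EOb A \<Longrightarrow>
      EComp A x x y \<cdot> (Idt V (EHom A x y) \<odot> EId A x) = run V (EHom A x y)"

text \<open>The \<open>V\<close>-category \<open>V\<close>.\<close>

definition self :: "('o, 'm) smc \<Rightarrow> ('o, 'o, 'm) ecat" where
  "self V = \<lparr>EOb = Obj V, EHom = ihom V,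
     EComp = (\<lambda>X Y Z. curry_arr V (ihom V Y Z \<otimes>\<^bsub>V\<^esub> ihom V X Y) X
       (ev V Y Z \<cdot>\<^bsub>V\<^esub> (Idt V (ihom V Y Z) \<odot>\<^bsub>V\<^esub> ev V X Y) \<cdot>\<^bsub>V\<^esub>
          asc V (ihom V Y Z) (ihom V X Y) X)),
     EId = (\<lambda>X. name_of V (Idt V X))\<rparr>"

definition full_sub :: "('x, 'o, 'm) ecat \<Rightarrow> 'x set \<Rightarrow> ('x, 'o, 'm) ecat" where
  "full_sub A S = A\<lparr>EOb := S\<rparr>"

definition op_cat :: "('o, 'm) smc \<Rightarrow> ('x, 'o, 'm) ecat \<Rightarrow> ('x, 'o, 'm) ecat" where
  "op_cat V A = \<lparr>EOb = EOb A, EHom = (\<lambda>x y. EHom A y x),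
     EComp = (\<lambda>x y z. EComp A z y x \<cdot>\<^bsub>V\<^esub> braid V (EHom A z y) (EHom A y x)),
     EId = EId A\<rparr>"

definition tensor_cat :: "('o, 'm) smc \<Rightarrow> ('x, 'o, 'm) ecat \<Rightarrow> ('y, 'o, 'm) ecat \<Rightarrow>
    ('x \<times> 'y, 'o, 'm) ecat" where
  "tensor_cat V A B = \<lparr>EOb = EOb A \<times> EOb B,
     EHom = (\<lambda>(a, b) (a', b'). EHom A a a' \<otimes>\<^bsub>V\<^esub> EHom B b b'),
     EComp = (\<lambda>(a, b) (a', b') (a'', b'').
       (EComp A a a' a'' \<odot>\<^bsub>V\<^esub> EComp B b b' b'') \<cdot>\<^bsub>V\<^esub>
       middle_four V (EHom A a' a'') (EHom B b' b'') (EHom A a a') (EHom B b b')),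
     EId = (\<lambda>(a, b). (EId A a \<odot>\<^bsub>V\<^esub> EId B b) \<cdot>\<^bsub>V\<^esub> inv_arr V (lun V \<one>\<^bsub>V\<^esub>))\<rparr>"

text \<open>
  A functor consists of an object map and arrows \<open>EFh F x y : A(x, y) \<rightarrow> B(F x, F y)\<close>. Both maps are
  \<open>undefined\<close> outside the objects of the domain, so that functors are equal as soon as they agree
  on the domain; \<open>mk_efun\<close> performs the truncation.
\<close>

record ('x, 'y, 'm) efun =
  EFo :: "'x \<Rightarrow> 'y"
  EFh :: "'x \<Rightarrow> 'x \<Rightarrow> 'm"

definition mk_efun ::
  "('x, 'o, 'm) ecat \<Rightarrow> ('x \<Rightarrow> 'y) \<Rightarrow> ('x \<Rightarrow> 'x \<Rightarrow> 'm) \<Rightarrow> ('x, 'y, 'm) efun" where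
  "mk_efun A fo fh = \<lparr>EFo = restrict fo (EOb A),
     EFh = (\<lambda>x y. if x \<in> EOb A \<and> y \<in> EOb A then fh x y else undefined)\<rparr>"

definition enriched_functor ::
  "('o, 'm) smc \<Rightarrow> ('x, 'o, 'm) ecat \<Rightarrow> ('y, 'o, 'm) ecat \<Rightarrow> ('x, 'y, 'm) efun \<Rightarrow> bool" where
  "enriched_functor V A B F \<longleftrightarrow>
     EFo F \<in> extensional (EOb A) \<and> case_prod (EFh F) \<in> extensional (EOb A \<times> EOb A) \<and>
     (\<forall>x\<in>EOb A. EFo F x \<in> EOb B) \<and>
     (\<forall>x\<in>EOb A. \<forall>y\<in>EOb A. EFh F x y \<in> hom V (EHom A x y) (EHom B (EFo F x) (EFo F y))) \<and>
     (\<forall>x\<in>EOb A. \<forall>y\<in>EOb A. \<forall>z\<in>EOb A.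
        EFh F x z \<cdot>\<^bsub>V\<^esub> EComp A x y z =
        EComp B (EFo F x) (EFo F y) (EFo F z) \<cdot>\<^bsub>V\<^esub> (EFh F y z \<odot>\<^bsub>V\<^esub> EFh F x y)) \<and>
     (\<forall>x\<in>EOb A. EFh F x x \<cdot>\<^bsub>V\<^esub> EId A x = EId B (EFo F x))"

definition id_fun :: "('o, 'm) smc \<Rightarrow> ('x, 'o, 'm) ecat \<Rightarrow> ('x, 'x, 'm) efun" where
  "id_fun V A = mk_efun A (\<lambda>x. x) (\<lambda>x y. Idt V (EHom A x y))"

text \<open>\<open>comp_fun V A G F\<close> is the composite of \<open>F\<close>, with domain \<open>A\<close>, followed by \<open>G\<close>.\<close>

definition comp_fun :: "('o, 'm) smc \<Rightarrow> ('x, 'o, 'm) ecat \<Rightarrow> ('y, 'z, 'm) efun \<Rightarrow>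
    ('x, 'y, 'm) efun \<Rightarrow> ('x, 'z, 'm) efun" where
  "comp_fun V A G F = mk_efun A (\<lambda>x. EFo G (EFo F x))
     (\<lambda>x y. EFh G (EFo F x) (EFo F y) \<cdot>\<^bsub>V\<^esub> EFh F x y)"

definition op_fun :: "('x, 'y, 'm) efun \<Rightarrow> ('x, 'y, 'm) efun" where
  "op_fun F = \<lparr>EFo = EFo F, EFh = (\<lambda>x y. EFh F y x)\<rparr>"

definition enriched_natural :: "('o, 'm) smc \<Rightarrow> ('x, 'o, 'm) ecat \<Rightarrow> ('y, 'o, 'm) ecat \<Rightarrow>
    ('x, 'y, 'm) efun \<Rightarrow> ('x, 'y, 'm) efun \<Rightarrow> ('x \<Rightarrow> 'm) \<Rightarrow> bool" where
  "enriched_natural V A B F G \<alpha> \<longleftrightarrow>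
     (\<forall>x\<in>EOb A. \<alpha> x \<in> hom V \<one>\<^bsub>V\<^esub> (EHom B (EFo F x) (EFo G x))) \<and>
     (\<forall>x\<in>EOb A. \<forall>y\<in>EOb A.
        EComp B (EFo F x) (EFo F y) (EFo G y) \<cdot>\<^bsub>V\<^esub> (\<alpha> y \<odot>\<^bsub>V\<^esub> EFh F x y) \<cdot>\<^bsub>V\<^esub>
          inv_arr V (lun V (EHom A x y)) =
        EComp B (EFo F x) (EFo G x) (EFo G y) \<cdot>\<^bsub>V\<^esub> (EFh G x y \<odot>\<^bsub>V\<^esub> \<alpha> x) \<cdot>\<^bsub>V\<^esub>
          inv_arr V (run V (EHom A x y)))"

definition natural_transformations :: "('o, 'm) smc \<Rightarrow> ('x, 'o, 'm) ecat \<Rightarrow> ('y, 'o, 'm) ecat \<Rightarrow>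
    ('x, 'y, 'm) efun \<Rightarrow> ('x, 'y, 'm) efun \<Rightarrow> ('x \<Rightarrow> 'm) set" where
  "natural_transformations V A B F G = {\<alpha> \<in> extensional (EOb A). enriched_natural V A B F G \<alpha>}"

text \<open>\<open>V\<close>-natural families of isomorphisms \<open>\<theta> x : F x \<rightarrow> G x\<close> in \<open>V\<close>, for \<open>F, G : A \<rightarrow> V\<close>.\<close>

definition enriched_natural_iso :: "('o, 'm) smc \<Rightarrow> ('x, 'o, 'm) ecat \<Rightarrow>
    ('x, 'o, 'm) efun \<Rightarrow> ('x, 'o, 'm) efun \<Rightarrow> ('x \<Rightarrow> 'm) \<Rightarrow> bool" where
  "enriched_natural_iso V A F G \<theta> \<longleftrightarrow>
     (\<forall>x\<in>EOb A. \<theta> x \<in> hom V (EFo F x) (EFo G x) \<and> is_iso V (\<theta> x)) \<and>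
     enriched_natural V A (self V) F G (\<lambda>x. name_of V (\<theta> x))"

text \<open>The functor \<open>A(a, -) : A \<rightarrow> V\<close>; then \<open>rep V (op_cat V A) a\<close> is \<open>A(-, a)\<close>.\<close>

definition rep :: "('o, 'm) smc \<Rightarrow> ('x, 'o, 'm) ecat \<Rightarrow> 'x \<Rightarrow> ('x, 'o, 'm) efun" where
  "rep V A a = mk_efun A (EHom A a) (\<lambda>b c. curry_arr V (EHom A b c) (EHom A a b) (EComp A a b c))"

text \<open>
  The functor \<open>A \<otimes> B \<rightarrow> V\<close> with partial functors \<open>L b : A \<rightarrow> V\<close> and \<open>R a : B \<rightarrow> V\<close>, where
  \<open>L b a = R a b\<close>; it acts on \<open>A(a, a') \<otimes> B(b, b')\<close> by first applying \<open>R a\<close> and then \<open>L b'\<close>.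
\<close>

definition bifunctor :: "('o, 'm) smc \<Rightarrow> ('x, 'o, 'm) ecat \<Rightarrow> ('y, 'o, 'm) ecat \<Rightarrow>
    ('y \<Rightarrow> ('x, 'o, 'm) efun) \<Rightarrow> ('x \<Rightarrow> ('y, 'o, 'm) efun) \<Rightarrow> ('x \<times> 'y, 'o, 'm) efun" where
  "bifunctor V A B L R = mk_efun (tensor_cat V A B) (\<lambda>(a, b). EFo (R a) b)
     (\<lambda>(a, b) (a', b').
        EComp (self V) (EFo (R a) b) (EFo (R a) b') (EFo (R a') b') \<cdot>\<^bsub>V\<^esub>
        (EFh (L b') a a' \<odot>\<^bsub>V\<^esub> EFh (R a) b b'))"

text \<open>\<open>D(F -, G -) : A\<^sup>o\<^sup>p \<otimes> B \<rightarrow> V\<close> for \<open>F : A \<rightarrow> D\<close> and \<open>G : B \<rightarrow> D\<close>.\<close>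

definition hom_bifunctor :: "('o, 'm) smc \<Rightarrow> ('z, 'o, 'm) ecat \<Rightarrow> ('x, 'o, 'm) ecat \<Rightarrow>
    ('y, 'o, 'm) ecat \<Rightarrow> ('x, 'z, 'm) efun \<Rightarrow> ('y, 'z, 'm) efun \<Rightarrow> ('x \<times> 'y, 'o, 'm) efun" where
  "hom_bifunctor V D A B F G = bifunctor V (op_cat V A) B
     (\<lambda>b. comp_fun V (op_cat V A) (rep V (op_cat V D) (EFo G b)) (op_fun F))
     (\<lambda>a. comp_fun V B (rep V D (EFo F a)) G)"

definition has_left_adjoint ::
  "('o, 'm) smc \<Rightarrow> ('x, 'o, 'm) ecat \<Rightarrow> ('y, 'o, 'm) ecat \<Rightarrow> ('x, 'y, 'm) efun \<Rightarrow> bool" where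
  "has_left_adjoint V A B G \<longleftrightarrow>
     (\<exists>F \<theta>. enriched_functor V B A F \<and>
        enriched_natural_iso V (tensor_cat V (op_cat V B) A)
          (hom_bifunctor V A B A F (id_fun V A)) (hom_bifunctor V B B A (id_fun V B) G) \<theta>)"


section \<open>Ends and functor categories\<close>

text \<open>For \<open>F : A\<^sup>o\<^sup>p \<otimes> A \<rightarrow> V\<close>: the partial actions \<open>A(b, c) \<rightarrow> [F(a, b), F(a, c)]\<close> and
  \<open>A(a, b) \<rightarrow> [F(b, c), F(a, c)]\<close>.\<close>

definition covariant_action :: "('o, 'm) smc \<Rightarrow> ('x, 'o, 'm) ecat \<Rightarrow> ('x \<times> 'x, 'o, 'm) efun \<Rightarrow>
    'x \<Rightarrow> 'x \<Rightarrow> 'x \<Rightarrow> 'm" where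
  "covariant_action V A F a b c = EFh F (a, b) (a, c) \<cdot>\<^bsub>V\<^esub>
     (EId A a \<odot>\<^bsub>V\<^esub> Idt V (EHom A b c)) \<cdot>\<^bsub>V\<^esub> inv_arr V (lun V (EHom A b c))"

definition contravariant_action :: "('o, 'm) smc \<Rightarrow> ('x, 'o, 'm) ecat \<Rightarrow> ('x \<times> 'x, 'o, 'm) efun \<Rightarrow>
    'x \<Rightarrow> 'x \<Rightarrow> 'x \<Rightarrow> 'm" where
  "contravariant_action V A F a b c = EFh F (b, c) (a, c) \<cdot>\<^bsub>V\<^esub>
     (Idt V (EHom A a b) \<odot>\<^bsub>V\<^esub> EId A c) \<cdot>\<^bsub>V\<^esub> inv_arr V (run V (EHom A a b))"

text \<open>Extraordinary \<open>V\<close>-naturality of a family \<open>\<sigma> a : Z \<rightarrow> F(a, a)\<close>, for \<open>F : A\<^sup>o\<^sup>p \<otimes> A \<rightarrow> V\<close>.\<close>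

definition wedge :: "('o, 'm) smc \<Rightarrow> ('x, 'o, 'm) ecat \<Rightarrow> ('x \<times> 'x, 'o, 'm) efun \<Rightarrow>
    'o \<Rightarrow> ('x \<Rightarrow> 'm) \<Rightarrow> bool" where
  "wedge V A F Z \<sigma> \<longleftrightarrow>
     (\<forall>a\<in>EOb A. \<sigma> a \<in> hom V Z (EFo F (a, a))) \<and>
     (\<forall>a\<in>EOb A. \<forall>b\<in>EOb A.
        ihom_pre V (\<sigma> a) (EFo F (a, b)) \<cdot>\<^bsub>V\<^esub> covariant_action V A F a a b =
        ihom_pre V (\<sigma> b) (EFo F (a, b)) \<cdot>\<^bsub>V\<^esub> contravariant_action V A F a b b)"

definition is_end :: "('o, 'm) smc \<Rightarrow> ('x, 'o, 'm) ecat \<Rightarrow> ('x \<times> 'x, 'o, 'm) efun \<Rightarrow>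
    'o \<Rightarrow> ('x \<Rightarrow> 'm) \<Rightarrow> bool" where
  "is_end V A F Z \<pi> \<longleftrightarrow> Z \<in> Obj V \<and> wedge V A F Z \<pi> \<and>
     (\<forall>Y \<sigma>. Y \<in> Obj V \<and> wedge V A F Y \<sigma> \<longrightarrow>
        (\<exists>!h. h \<in> hom V Y Z \<and> (\<forall>a\<in>EOb A. \<pi> a \<cdot>\<^bsub>V\<^esub> h = \<sigma> a)))"

definition has_end :: "('o, 'm) smc \<Rightarrow> ('x, 'o, 'm) ecat \<Rightarrow> ('x \<times> 'x, 'o, 'm) efun \<Rightarrow> bool" where
  "has_end V A F \<longleftrightarrow> (\<exists>Z \<pi>. is_end V A F Z \<pi>)"

definition chosen_end :: "('o, 'm) smc \<Rightarrow> ('x, 'o, 'm) ecat \<Rightarrow> ('x \<times> 'x, 'o, 'm) efun \<Rightarrow>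
    'o \<times> ('x \<Rightarrow> 'm)" where
  "chosen_end V A F = (SOME (Z, \<pi>). is_end V A F Z \<pi>)"

definition end_obj :: "('o, 'm) smc \<Rightarrow> ('x, 'o, 'm) ecat \<Rightarrow> ('x \<times> 'x, 'o, 'm) efun \<Rightarrow> 'o" where
  "end_obj V A F = fst (chosen_end V A F)"

definition end_proj :: "('o, 'm) smc \<Rightarrow> ('x, 'o, 'm) ecat \<Rightarrow> ('x \<times> 'x, 'o, 'm) efun \<Rightarrow> 'x \<Rightarrow> 'm" where
  "end_proj V A F = snd (chosen_end V A F)"

text \<open>The arrow into the end induced by a wedge \<open>\<sigma>\<close> with vertex \<open>Y\<close>.\<close>

definition end_lift :: "('o, 'm) smc \<Rightarrow> ('x, 'o, 'm) ecat \<Rightarrow> ('x \<times> 'x, 'o, 'm) efun \<Rightarrow>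
    'o \<Rightarrow> ('x \<Rightarrow> 'm) \<Rightarrow> 'm" where
  "end_lift V A F Y \<sigma> = (THE h. h \<in> hom V Y (end_obj V A F) \<and>
     (\<forall>a\<in>EOb A. end_proj V A F a \<cdot>\<^bsub>V\<^esub> h = \<sigma> a))"

text \<open>\<open>nat_bifunctor V A B F G\<close> is \<open>B(F -, G -) : A\<^sup>o\<^sup>p \<otimes> A \<rightarrow> V\<close>, whose end is the object of natural
  transformations.\<close>

abbreviation nat_bifunctor :: "('o, 'm) smc \<Rightarrow> ('x, 'o, 'm) ecat \<Rightarrow> ('y, 'o, 'm) ecat \<Rightarrow>
    ('x, 'y, 'm) efun \<Rightarrow> ('x, 'y, 'm) efun \<Rightarrow> ('x \<times> 'x, 'o, 'm) efun" where
  "nat_bifunctor V A B F G \<equiv> hom_bifunctor V B A A F G"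

text \<open>The functor category \<open>[A, B]\<close> (meaningful as soon as the ends involved exist in \<open>V\<close>). Its
  composition and identities are determined by compatibility with the end projections.\<close>

definition functor_cat :: "('o, 'm) smc \<Rightarrow> ('x, 'o, 'm) ecat \<Rightarrow> ('y, 'o, 'm) ecat \<Rightarrow>
    (('x, 'y, 'm) efun, 'o, 'm) ecat" where
  "functor_cat V A B = \<lparr>EOb = {F. enriched_functor V A B F},
     EHom = (\<lambda>F G. end_obj V A (nat_bifunctor V A B F G)),
     EComp = (\<lambda>F G H. end_lift V A (nat_bifunctor V A B F H)
       (end_obj V A (nat_bifunctor V A B G H) \<otimes>\<^bsub>V\<^esub> end_obj V A (nat_bifunctor V A B F G))
       (\<lambda>x. EComp B (EFo F x) (EFo G x) (EFo H x) \<cdot>\<^bsub>V\<^esub>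
          (end_proj V A (nat_bifunctor V A B G H) x \<odot>\<^bsub>V\<^esub> end_proj V A (nat_bifunctor V A B F G) x))),
     EId = (\<lambda>F. end_lift V A (nat_bifunctor V A B F F) \<one>\<^bsub>V\<^esub> (\<lambda>x. EId B (EFo F x)))\<rparr>"


section \<open>Passing from \<open>V\<close> to \<open>V'\<close>\<close>

text \<open>The \<open>V'\<close>-category, \<open>V'\<close>-functor, etc. obtained by applying the embedding \<open>i\<close> to hom-objects.\<close>

definition base_cat :: "('p, 'n) smc \<Rightarrow> ('o, 'm, 'p, 'n) mfun \<Rightarrow> ('x, 'o, 'm) ecat \<Rightarrow>
    ('x, 'p, 'n) ecat" where
  "base_cat V' i A = \<lparr>EOb = EOb A, EHom = (\<lambda>x y. FOb i (EHom A x y)),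
     EComp = (\<lambda>x y z. FAr i (EComp A x y z) \<cdot>\<^bsub>V'\<^esub> FMul i (EHom A y z) (EHom A x y)),
     EId = (\<lambda>x. FAr i (EId A x) \<cdot>\<^bsub>V'\<^esub> FUnt i)\<rparr>"

definition base_fun :: "('p, 'n) smc \<Rightarrow> ('o, 'm, 'p, 'n) mfun \<Rightarrow> ('x, 'o, 'm) ecat \<Rightarrow>
    ('x, 'y, 'm) efun \<Rightarrow> ('x, 'y, 'n) efun" where
  "base_fun V' i A F = mk_efun (base_cat V' i A) (EFo F) (\<lambda>x y. FAr i (EFh F x y))"

text \<open>The \<open>V'\<close>-functor \<open>A\<^sup>o\<^sup>p \<otimes> A \<rightarrow> V'\<close> given by \<open>F : A\<^sup>o\<^sup>p \<otimes> A \<rightarrow> V\<close> followed by the embedding.\<close>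

definition base_bifunctor :: "('o, 'm) smc \<Rightarrow> ('p, 'n) smc \<Rightarrow> ('o, 'm, 'p, 'n) mfun \<Rightarrow>
    ('x, 'o, 'm) ecat \<Rightarrow> ('x \<times> 'x, 'o, 'm) efun \<Rightarrow> ('x \<times> 'x, 'p, 'n) efun" where
  "base_bifunctor V V' i A F =
     mk_efun (tensor_cat V' (op_cat V' (base_cat V' i A)) (base_cat V' i A))
     (\<lambda>p. FOb i (EFo F p))
     (\<lambda>(a, b) (a', b'). ihom_comparison V V' i (EFo F (a, b)) (EFo F (a', b')) \<cdot>\<^bsub>V'\<^esub>
        FAr i (EFh F (a, b) (a', b')) \<cdot>\<^bsub>V'\<^esub> FMul i (EHom A a' a) (EHom A b b'))"

text \<open>The \<open>V'\<close>-category \<open>[A, B]\<close> of \<open>V\<close>-functors between \<open>V\<close>-categories \<open>A\<close> and \<open>B\<close>.\<close>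

definition big_functor_cat :: "('o, 'm) smc \<Rightarrow> ('p, 'n) smc \<Rightarrow> ('o, 'm, 'p, 'n) mfun \<Rightarrow>
    ('x, 'o, 'm) ecat \<Rightarrow> ('y, 'o, 'm) ecat \<Rightarrow> (('x, 'y, 'm) efun, 'p, 'n) ecat" where
  "big_functor_cat V V' i A B =
     (let N = functor_cat V' (base_cat V' i A) (base_cat V' i B); b = base_fun V' i A
      in \<lparr>EOb = {F. enriched_functor V A B F},
          EHom = (\<lambda>F G. EHom N (b F) (b G)),
          EComp = (\<lambda>F G H. EComp N (b F) (b G) (b H)),
          EId = (\<lambda>F. EId N (b F))\<rparr>)"

definition big_proj :: "('o, 'm) smc \<Rightarrow> ('p, 'n) smc \<Rightarrow> ('o, 'm, 'p, 'n) mfun \<Rightarrow>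
    ('x, 'o, 'm) ecat \<Rightarrow> ('y, 'o, 'm) ecat \<Rightarrow> ('x, 'y, 'm) efun \<Rightarrow> ('x, 'y, 'm) efun \<Rightarrow> 'x \<Rightarrow> 'n" where
  "big_proj V V' i A B F G = end_proj V' (base_cat V' i A)
     (nat_bifunctor V' (base_cat V' i A) (base_cat V' i B) (base_fun V' i A F) (base_fun V' i A G))"

definition big_lift :: "('o, 'm) smc \<Rightarrow> ('p, 'n) smc \<Rightarrow> ('o, 'm, 'p, 'n) mfun \<Rightarrow>
    ('x, 'o, 'm) ecat \<Rightarrow> ('y, 'o, 'm) ecat \<Rightarrow> ('x, 'y, 'm) efun \<Rightarrow> ('x, 'y, 'm) efun \<Rightarrow>
    'p \<Rightarrow> ('x \<Rightarrow> 'n) \<Rightarrow> 'n" where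
  "big_lift V V' i A B F G = end_lift V' (base_cat V' i A)
     (nat_bifunctor V' (base_cat V' i A) (base_cat V' i B) (base_fun V' i A F) (base_fun V' i A G))"


section \<open>Powers, theories and algebras\<close>

text \<open>\<open>P\<close> is a power \<open>c\<^sup>X\<close>, by way of isomorphisms \<open>\<theta> b : C(b, P) \<rightarrow> [X, C(b, c)]\<close> natural in \<open>b\<close>.\<close>

definition is_power :: "('o, 'm) smc \<Rightarrow> ('x, 'o, 'm) ecat \<Rightarrow> 'o \<Rightarrow> 'x \<Rightarrow> 'x \<Rightarrow> ('x \<Rightarrow> 'm) \<Rightarrow> bool" where
  "is_power V C X c P \<theta> \<longleftrightarrow> P \<in> EOb C \<and>
     enriched_natural_iso V (op_cat V C) (rep V (op_cat V C) P)
       (comp_fun V (op_cat V C) (rep V (self V) X) (rep V (op_cat V C) c)) \<theta>"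

text \<open>The counit \<open>X \<rightarrow> C(P, c)\<close> of such a power.\<close>

definition power_counit :: "('o, 'm) smc \<Rightarrow> ('x, 'o, 'm) ecat \<Rightarrow> 'o \<Rightarrow> 'x \<Rightarrow> 'x \<Rightarrow> ('x \<Rightarrow> 'm) \<Rightarrow> 'm" where
  "power_counit V C X c P \<theta> =
     ev V X (EHom C P c) \<cdot>\<^bsub>V\<^esub> ((\<theta> P \<cdot>\<^bsub>V\<^esub> EId C P) \<odot>\<^bsub>V\<^esub> Idt V X) \<cdot>\<^bsub>V\<^esub> inv_arr V (lun V X)"

definition system_of_arities :: "('o, 'm) smc \<Rightarrow> 'o set \<Rightarrow> bool" where
  "system_of_arities V J \<longleftrightarrow> J \<subseteq> Obj V \<and> \<one>\<^bsub>V\<^esub> \<in> J \<and> (\<forall>X\<in>J. \<forall>Y\<in>J. X \<otimes>\<^bsub>V\<^esub> Y \<in> J)"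

definition designated_powers :: "('o, 'm) smc \<Rightarrow> 'o set \<Rightarrow> ('x, 'o, 'm) ecat \<Rightarrow>
    ('o \<Rightarrow> 'x \<Rightarrow> 'x) \<Rightarrow> ('o \<Rightarrow> 'x \<Rightarrow> 'x \<Rightarrow> 'm) \<Rightarrow> bool" where
  "designated_powers V J C pw \<theta> \<longleftrightarrow>
     (\<forall>X\<in>J. \<forall>c\<in>EOb C. is_power V C X c (pw X c) (\<theta> X c)) \<and>
     (\<forall>c\<in>EOb C. pw \<one>\<^bsub>V\<^esub> c = c \<and> power_counit V C \<one>\<^bsub>V\<^esub> c c (\<theta> \<one>\<^bsub>V\<^esub> c) = EId C c)"

text \<open>Powers are preserved up to isomorphism: the image of the counit of a power is again the
  counit of a power.\<close>

definition preserves_powers :: "('o, 'm) smc \<Rightarrow> 'o set \<Rightarrow> ('x, 'o, 'm) ecat \<Rightarrow> ('y, 'o, 'm) ecat \<Rightarrow>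
    ('x, 'y, 'm) efun \<Rightarrow> bool" where
  "preserves_powers V J A B F \<longleftrightarrow>
     (\<forall>X\<in>J. \<forall>a\<in>EOb A. \<forall>P \<theta>. is_power V A X a P \<theta> \<longrightarrow>
        (\<exists>\<theta>'. is_power V B X (EFo F a) (EFo F P) \<theta>' \<and>
           power_counit V B X (EFo F a) (EFo F P) \<theta>' = EFh F P a \<cdot>\<^bsub>V\<^esub> power_counit V A X a P \<theta>))"

text \<open>\<open>\<tau> : J\<^sup>o\<^sup>p \<rightarrow> T\<close> is the structure functor of the theory.\<close>

definition J_theory :: "('o, 'm) smc \<Rightarrow> 'o set \<Rightarrow> ('o, 'o, 'm) ecat \<Rightarrow> ('o, 'o, 'm) efun \<Rightarrow> bool" where
  "J_theory V J T \<tau> \<longleftrightarrow> enriched_category V T \<and> EOb T = J \<and>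
     enriched_functor V (op_cat V (full_sub (self V) J)) T \<tau> \<and> (\<forall>X\<in>J. EFo \<tau> X = X) \<and>
     preserves_powers V J (op_cat V (full_sub (self V) J)) T \<tau>"

definition algebras :: "('o, 'm) smc \<Rightarrow> 'o set \<Rightarrow> ('o, 'o, 'm) ecat \<Rightarrow> ('x, 'o, 'm) ecat \<Rightarrow>
    ('o, 'x, 'm) efun set" where
  "algebras V J T C = {E. enriched_functor V T C E \<and> preserves_powers V J T C E}"

text \<open>\<open>T\<close>-Alg as a \<open>V\<close>-category, which exists when the ends defining its hom-objects exist in \<open>V\<close>.\<close>

definition Alg :: "('o, 'm) smc \<Rightarrow> 'o set \<Rightarrow> ('o, 'o, 'm) ecat \<Rightarrow> (('o, 'o, 'm) efun, 'o, 'm) ecat" where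
  "Alg V J T = full_sub (functor_cat V T (self V)) (algebras V J T (self V))"

definition Alg_exists :: "('o, 'm) smc \<Rightarrow> 'o set \<Rightarrow> ('o, 'o, 'm) ecat \<Rightarrow> bool" where
  "Alg_exists V J T \<longleftrightarrow> (\<forall>A\<in>algebras V J T (self V). \<forall>B\<in>algebras V J T (self V).
     has_end V T (nat_bifunctor V T (self V) A B))"

text \<open>The projection \<open>T-Alg(A, B) \<rightarrow> [A K, B K]\<close>, and evaluation at \<open>K\<close> as a functor
  \<open>T-Alg \<rightarrow> V\<close>.\<close>

definition Alg_proj :: "('o, 'm) smc \<Rightarrow> ('o, 'o, 'm) ecat \<Rightarrow> ('o, 'o, 'm) efun \<Rightarrow> ('o, 'o, 'm) efun \<Rightarrow>
    'o \<Rightarrow> 'm" where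
  "Alg_proj V T A B = end_proj V T (nat_bifunctor V T (self V) A B)"

definition evaluation :: "('o, 'm) smc \<Rightarrow> 'o set \<Rightarrow> ('o, 'o, 'm) ecat \<Rightarrow> 'o \<Rightarrow>
    (('o, 'o, 'm) efun, 'o, 'm) efun" where
  "evaluation V J T K = mk_efun (Alg V J T) (\<lambda>A. EFo A K) (\<lambda>A B. Alg_proj V T A B K)"

definition amenable :: "('o, 'm) smc \<Rightarrow> 'o set \<Rightarrow> bool" where
  "amenable V J \<longleftrightarrow> (\<forall>T \<tau>. J_theory V J T \<tau> \<longrightarrow>
     Alg_exists V J T \<and> has_left_adjoint V (Alg V J T) (self V) (evaluation V J T \<one>\<^bsub>V\<^esub>))"

text \<open>The \<open>V'\<close>-category \<open>T\<close>-Alg\<open>(C)\<close>.\<close>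

definition big_Alg :: "('o, 'm) smc \<Rightarrow> ('p, 'n) smc \<Rightarrow> ('o, 'm, 'p, 'n) mfun \<Rightarrow> 'o set \<Rightarrow>
    ('o, 'o, 'm) ecat \<Rightarrow> ('x, 'o, 'm) ecat \<Rightarrow> (('o, 'x, 'm) efun, 'p, 'n) ecat" where
  "big_Alg V V' i J T C = full_sub (big_functor_cat V V' i T C) (algebras V J T C)"


section \<open>The two sides of the isomorphism\<close>

text \<open>\<open>bracket_at V T C E c\<close> is \<open>\<lbrakk>c, E\<rbrakk> = C(c, E -)\<close>, and \<open>bracket V J T C E\<close> is
  \<open>\<lbrakk>-, E\<rbrakk> : C\<^sup>o\<^sup>p \<rightarrow> T-Alg\<close>.\<close>

definition bracket_at :: "('o, 'm) smc \<Rightarrow> ('o, 'o, 'm) ecat \<Rightarrow> ('x, 'o, 'm) ecat \<Rightarrow>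
    ('o, 'x, 'm) efun \<Rightarrow> 'x \<Rightarrow> ('o, 'o, 'm) efun" where
  "bracket_at V T C E c = comp_fun V T (rep V C c) E"

definition bracket :: "('o, 'm) smc \<Rightarrow> ('o, 'o, 'm) ecat \<Rightarrow> ('x, 'o, 'm) ecat \<Rightarrow>
    ('o, 'x, 'm) efun \<Rightarrow> ('x, ('o, 'o, 'm) efun, 'm) efun" where
  "bracket V T C E = mk_efun (op_cat V C) (bracket_at V T C E)
     (\<lambda>c d. end_lift V T (nat_bifunctor V T (self V) (bracket_at V T C E c) (bracket_at V T C E d))
        (EHom (op_cat V C) c d) (\<lambda>K. EFh (rep V (op_cat V C) (EFo E K)) c d))"

text \<open>The action \<open>T-Alg(C)(E, E') \<rightarrow> T-Alg(\<lbrakk>c, E\<rbrakk>, \<lbrakk>c, E'\<rbrakk>)\<close> of \<open>\<lbrakk>c, -\<rbrakk>\<close>, given at each \<open>K\<close> by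
  the action \<open>C(E K, E' K) \<rightarrow> [C(c, E K), C(c, E' K)]\<close> of \<open>C(c, -)\<close>.\<close>

definition bracket_action :: "('o, 'm) smc \<Rightarrow> ('p, 'n) smc \<Rightarrow> ('o, 'm, 'p, 'n) mfun \<Rightarrow> 'o set \<Rightarrow>
    ('o, 'o, 'm) ecat \<Rightarrow> ('x, 'o, 'm) ecat \<Rightarrow> ('o, 'x, 'm) efun \<Rightarrow> ('o, 'x, 'm) efun \<Rightarrow> 'x \<Rightarrow> 'n" where
  "bracket_action V V' i J T C E E' c =
     (THE h. h \<in> hom V' (EHom (big_Alg V V' i J T C) E E')
           (FOb i (EHom (Alg V J T) (bracket_at V T C E c) (bracket_at V T C E' c))) \<and>
        (\<forall>K\<in>EOb T.
           FAr i (Alg_proj V T (bracket_at V T C E c) (bracket_at V T C E' c) K) \<cdot>\<^bsub>V'\<^esub> h =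
           FAr i (EFh (rep V C c) (EFo E K) (EFo E' K)) \<cdot>\<^bsub>V'\<^esub> big_proj V V' i T C E E' K))"

text \<open>The \<open>V'\<close>-functor \<open>T-Alg(C) \<rightarrow> [C\<^sup>o\<^sup>p, T-Alg]\<close> sending \<open>E\<close> to \<open>\<lbrakk>-, E\<rbrakk>\<close>.\<close>

definition bracket_functor :: "('o, 'm) smc \<Rightarrow> ('p, 'n) smc \<Rightarrow> ('o, 'm, 'p, 'n) mfun \<Rightarrow> 'o set \<Rightarrow>
    ('o, 'o, 'm) ecat \<Rightarrow> ('x, 'o, 'm) ecat \<Rightarrow>
    (('o, 'x, 'm) efun, ('x, ('o, 'o, 'm) efun, 'm) efun, 'n) efun" where
  "bracket_functor V V' i J T C = mk_efun (big_Alg V V' i J T C) (bracket V T C)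
     (\<lambda>E E'. big_lift V V' i (op_cat V C) (Alg V J T) (bracket V T C E) (bracket V T C E')
        (EHom (big_Alg V V' i J T C) E E') (bracket_action V V' i J T C E E'))"

text \<open>The \<open>V'\<close>-functor \<open>T-Alg(C)\<^sup>o\<^sup>p \<otimes> [C\<^sup>o\<^sup>p, T-Alg] \<rightarrow> V'\<close> sending \<open>(E, S)\<close> to
  \<open>[C\<^sup>o\<^sup>p, T-Alg](\<lbrakk>-, E\<rbrakk>, S)\<close>.\<close>

definition transformations_functor :: "('o, 'm) smc \<Rightarrow> ('p, 'n) smc \<Rightarrow> ('o, 'm, 'p, 'n) mfun \<Rightarrow>
    'o set \<Rightarrow> ('o, 'o, 'm) ecat \<Rightarrow> ('x, 'o, 'm) ecat \<Rightarrow>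
    (('o, 'x, 'm) efun \<times> ('x, ('o, 'o, 'm) efun, 'm) efun, 'p, 'n) efun" where
  "transformations_functor V V' i J T C =
     (let Fun = big_functor_cat V V' i (op_cat V C) (Alg V J T)
      in hom_bifunctor V' Fun (big_Alg V V' i J T C) Fun
           (bracket_functor V V' i J T C) (id_fun V' Fun))"

text \<open>\<open>S[E] : T\<^sup>o\<^sup>p \<otimes> T \<rightarrow> V\<close>, \<open>S[E](K, L) = (S E K) L\<close>.\<close>

definition section_bifunctor :: "('o, 'm) smc \<Rightarrow> 'o set \<Rightarrow> ('o, 'o, 'm) ecat \<Rightarrow>
    ('x, 'o, 'm) ecat \<Rightarrow> ('x, ('o, 'o, 'm) efun, 'm) efun \<Rightarrow> ('o, 'x, 'm) efun \<Rightarrow>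
    ('o \<times> 'o, 'o, 'm) efun" where
  "section_bifunctor V J T C S E = bifunctor V (op_cat V T) T
     (\<lambda>L. comp_fun V (op_cat V T) (evaluation V J T L) (comp_fun V (op_cat V T) S (op_fun E)))
     (\<lambda>K. EFo S (EFo E K))"

definition sections :: "('o, 'm) smc \<Rightarrow> 'o set \<Rightarrow> ('o, 'o, 'm) ecat \<Rightarrow> ('x, 'o, 'm) ecat \<Rightarrow>
    ('x, ('o, 'o, 'm) efun, 'm) efun \<Rightarrow> ('o, 'x, 'm) efun \<Rightarrow> ('o \<Rightarrow> 'm) set" where
  "sections V J T C S E =
     {\<sigma> \<in> extensional (EOb T). wedge V T (section_bifunctor V J T C S E) \<one>\<^bsub>V\<^esub> \<sigma>}"

text \<open>\<open>S[E]\<close> followed by the embedding \<open>V \<rightarrow> V'\<close>, and its end \<open>\<integral>S[E]\<close>.\<close>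

definition big_section_bifunctor :: "('o, 'm) smc \<Rightarrow> ('p, 'n) smc \<Rightarrow> ('o, 'm, 'p, 'n) mfun \<Rightarrow>
    'o set \<Rightarrow> ('o, 'o, 'm) ecat \<Rightarrow> ('x, 'o, 'm) ecat \<Rightarrow> ('x, ('o, 'o, 'm) efun, 'm) efun \<Rightarrow>
    ('o, 'x, 'm) efun \<Rightarrow> ('o \<times> 'o, 'p, 'n) efun" where
  "big_section_bifunctor V V' i J T C S E =
     base_bifunctor V V' i T (section_bifunctor V J T C S E)"

definition section_object :: "('o, 'm) smc \<Rightarrow> ('p, 'n) smc \<Rightarrow> ('o, 'm, 'p, 'n) mfun \<Rightarrow>
    'o set \<Rightarrow> ('o, 'o, 'm) ecat \<Rightarrow> ('x, 'o, 'm) ecat \<Rightarrow> ('x, ('o, 'o, 'm) efun, 'm) efun \<Rightarrow>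
    ('o, 'x, 'm) efun \<Rightarrow> 'p" where
  "section_object V V' i J T C S E =
     end_obj V' (base_cat V' i T) (big_section_bifunctor V V' i J T C S E)"

text \<open>The arrow \<open>H \<rightarrow> [\<integral>F, \<integral>F']\<close> induced by a suitable family \<open>h a : H \<rightarrow> [F(a, a), F'(a, a)]\<close>.\<close>

definition end_action :: "('o, 'm) smc \<Rightarrow> ('x, 'o, 'm) ecat \<Rightarrow> ('x \<times> 'x, 'o, 'm) efun \<Rightarrow>
    ('x \<times> 'x, 'o, 'm) efun \<Rightarrow> 'o \<Rightarrow> ('x \<Rightarrow> 'm) \<Rightarrow> 'm" where
  "end_action V A F F' H h = curry_arr V H (end_obj V A F)
     (end_lift V A F' (H \<otimes>\<^bsub>V\<^esub> end_obj V A F)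
        (\<lambda>a. ev V (EFo F (a, a)) (EFo F' (a, a)) \<cdot>\<^bsub>V\<^esub> (h a \<odot>\<^bsub>V\<^esub> end_proj V A F a)))"

text \<open>The \<open>V'\<close>-functor \<open>T-Alg(C)\<^sup>o\<^sup>p \<otimes> [C\<^sup>o\<^sup>p, T-Alg] \<rightarrow> V'\<close> sending \<open>(E, S)\<close> to \<open>\<integral>S[E]\<close>. In \<open>E\<close>, the
  component at \<open>K\<close> of its action is
  \<open>T-Alg(C)(E', E) \<rightarrow> C(E' K, E K) \<rightarrow> T-Alg(S E K, S E' K) \<rightarrow> [(S E K) K, (S E' K) K]\<close>; in \<open>S\<close> it is
  \<open>[C\<^sup>o\<^sup>p, T-Alg](S, S') \<rightarrow> T-Alg(S E K, S' E K) \<rightarrow> [(S E K) K, (S' E K) K]\<close>.\<close>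

definition sections_functor :: "('o, 'm) smc \<Rightarrow> ('p, 'n) smc \<Rightarrow> ('o, 'm, 'p, 'n) mfun \<Rightarrow>
    'o set \<Rightarrow> ('o, 'o, 'm) ecat \<Rightarrow> ('x, 'o, 'm) ecat \<Rightarrow>
    (('o, 'x, 'm) efun \<times> ('x, ('o, 'o, 'm) efun, 'm) efun, 'p, 'n) efun" where
  "sections_functor V V' i J T C =
     (let Fun = big_functor_cat V V' i (op_cat V C) (Alg V J T);
          TC = big_Alg V V' i J T C;
          SE = (\<lambda>S E. big_section_bifunctor V V' i J T C S E);
          act = (\<lambda>A B K. ihom_comparison V V' i (EFo A K) (EFo B K) \<cdot>\<^bsub>V'\<^esub> FAr i (Alg_proj V T A B K))
      in bifunctor V' (op_cat V' TC) Fun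
           (\<lambda>S. mk_efun (op_cat V' TC) (section_object V V' i J T C S)
              (\<lambda>E E'. end_action V' (base_cat V' i T) (SE S E) (SE S E') (EHom TC E' E)
                 (\<lambda>K. act (EFo S (EFo E K)) (EFo S (EFo E' K)) K \<cdot>\<^bsub>V'\<^esub>
                    FAr i (EFh S (EFo E K) (EFo E' K)) \<cdot>\<^bsub>V'\<^esub> big_proj V V' i T C E' E K)))
           (\<lambda>E. mk_efun Fun (\<lambda>S. section_object V V' i J T C S E)
              (\<lambda>S S'. end_action V' (base_cat V' i T) (SE S E) (SE S' E) (EHom Fun S S')
                 (\<lambda>K. act (EFo S (EFo E K)) (EFo S' (EFo E K)) K \<cdot>\<^bsub>V'\<^esub>
                    big_proj V V' i (op_cat V C) (Alg V J T) S S' (EFo E K)))))"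

text \<open>The elements of \<open>[A, B](F, G)\<close> and of \<open>\<integral>S[E]\<close>, i.e. arrows from the unit object of \<open>V'\<close>,
  corresponding to a natural transformation and to a section.\<close>

definition transformation_element :: "('o, 'm) smc \<Rightarrow> ('p, 'n) smc \<Rightarrow> ('o, 'm, 'p, 'n) mfun \<Rightarrow>
    ('x, 'o, 'm) ecat \<Rightarrow> ('y, 'o, 'm) ecat \<Rightarrow> ('x, 'y, 'm) efun \<Rightarrow> ('x, 'y, 'm) efun \<Rightarrow>
    ('x \<Rightarrow> 'm) \<Rightarrow> 'n" where
  "transformation_element V V' i A B F G \<phi> =
     big_lift V V' i A B F G \<one>\<^bsub>V'\<^esub> (\<lambda>x. FAr i (\<phi> x) \<cdot>\<^bsub>V'\<^esub> FUnt i)"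

definition section_element :: "('o, 'm) smc \<Rightarrow> ('p, 'n) smc \<Rightarrow> ('o, 'm, 'p, 'n) mfun \<Rightarrow>
    'o set \<Rightarrow> ('o, 'o, 'm) ecat \<Rightarrow> ('x, 'o, 'm) ecat \<Rightarrow> ('x, ('o, 'o, 'm) efun, 'm) efun \<Rightarrow>
    ('o, 'x, 'm) efun \<Rightarrow> ('o \<Rightarrow> 'm) \<Rightarrow> 'n" where
  "section_element V V' i J T C S E \<sigma> =
     end_lift V' (base_cat V' i T) (big_section_bifunctor V V' i J T C S E) \<one>\<^bsub>V'\<^esub>
       (\<lambda>K. FAr i (\<sigma> K) \<cdot>\<^bsub>V'\<^esub> FUnt i)"

end

theory Submission
  imports Defs
begin

text \<open>
  The isomorphism is an instance of the Yoneda lemma: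
  \<open>[C\<^sup>o\<^sup>p, T-Alg](\<lbrakk>-, E\<rbrakk>, S)\<close> is the end over \<open>c\<close> and \<open>K\<close> of \<open>[C(c, E K), (S c) K]\<close>, that is, the end
  over \<open>K\<close> of \<open>(S E K) K\<close>. A transformation \<open>t\<close> corresponds to the section with components
  \<open>t\<^sub>E\<^sub>K\<close> applied to the identity of \<open>E K\<close>, and a section \<open>\<sigma>\<close> to the transformation that maps
  \<open>f : c \<rightarrow> E K\<close> to \<open>(S f) \<sigma>\<^sub>K\<close>. Powers matter only for \<open>\<lbrakk>c, E\<rbrakk>\<close> to be an algebra.

  These formulas make sense over an arbitrary symmetric monoidal closed base if elements of \<open>X\<close> are
  taken to be arrows to \<open>X\<close> from tensor products of finitely many objects, each carrying a name.
  Elements with disjoint names can be paired, pairing is strictly associative and symmetric up to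
  the structure isomorphisms of the target, and arrows are determined by their effect on elements.
\<close>

section \<open>Symmetric monoidal closed categories\<close>

text \<open>A monoidal base has no diagonals, so a variable may occur only once on each side of an
  equation, and arrows from the unit need not separate arrows; hence elements in arbitrary contexts,
  paired only when disjoint. The other obstacle is the pair of bases. Hom-objects of
  \<open>T-Alg\<close> are ends in \<open>V\<close>, those of the big functor categories are ends in
  \<open>V'\<close>. An arrow of \<open>V'\<close> into an embedded hom-object of
  \<open>T-Alg\<close> can be given by components only if the embedding keeps that object an end.
  Limit preservation provides this once ends are rewritten as limits over shapes coded inside
  \<open>U\<close>; since internal homs are preserved only up to isomorphism, the image diagram has
  to be corrected by the comparison maps. Afterwards everything is expressed through
  \<open>apl\<close> and \<open>ac\<close>, which obey the laws of applying a function to an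
  argument, so that the Yoneda argument can be followed literally. The bijection between ordinary
  transformations and sections is read off at arrows from the unit of \<open>V'\<close>, where full
  faithfulness returns the components to \<open>V\<close>.\<close>

context category
begin

lemma hom_iff: "f \<in> hom C X Y \<longleftrightarrow> f \<in> Arr C \<and> Dom C f = X \<and> Cod C f = Y"
  by (simp add: hom_def)

lemma Comp_arr [simp]:
  assumes "f \<in> Arr C" "g \<in> Arr C" "Dom C g = Cod C f"
  shows "g \<cdot> f \<in> Arr C" "Dom C (g \<cdot> f) = Dom C f" "Cod C (g \<cdot> f) = Cod C g"
  using Comp_hom[of f "Dom C f" "Cod C f" g "Cod C g"] assms by (auto simp: hom_iff)

lemma Idt_arr [simp]:
  assumes "X \<in> Obj C"
  shows "Idt C X \<in> Arr C" "Dom C (Idt C X) = X" "Cod C (Idt C X) = X"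
  using Idt_hom[OF assms] by (auto simp: hom_iff)

declare Dom_Obj [simp] Cod_Obj [simp]

lemma Comp_assoc' [simp]:
  assumes "f \<in> Arr C" "g \<in> Arr C" "h \<in> Arr C" "Dom C g = Cod C f" "Dom C h = Cod C g"
  shows "(h \<cdot> g) \<cdot> f = h \<cdot> (g \<cdot> f)"
  using Comp_assoc[of f "Dom C f" "Cod C f" g "Cod C g" h "Cod C h"] assms by (auto simp: hom_iff)

lemma Idt_Comp [simp]:
  assumes "f \<in> Arr C"
  shows "Cod C f = Y \<Longrightarrow> Idt C Y \<cdot> f = f" "Dom C f = X \<Longrightarrow> f \<cdot> Idt C X = f"
  using Idt_left[of f "Dom C f" "Cod C f"] Idt_right[of f "Dom C f" "Cod C f"] assms
  by (auto simp: hom_iff)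

lemma inverse_arrows_unique:
  assumes "inverse_arrows C f g" "inverse_arrows C f h"
  shows "g = h"
proof -
  have "g = g \<cdot> (f \<cdot> h)" using assms by (auto simp: inverse_arrows_def hom_iff)
  also have "\<dots> = (g \<cdot> f) \<cdot> h" using assms by (subst Comp_assoc') (auto simp: inverse_arrows_def hom_iff)
  also have "\<dots> = h" using assms by (auto simp: inverse_arrows_def hom_iff)
  finally show ?thesis .
qed

lemma inv_arr_eqI: "inverse_arrows C f g \<Longrightarrow> inv_arr C f = g"
  unfolding inv_arr_def by (rule the_equality) (auto intro: inverse_arrows_unique)

lemma inverse_arrows_inv: "is_iso C f \<Longrightarrow> inverse_arrows C f (inv_arr C f)"
  using inv_arr_eqI by (auto simp: is_iso_def)

lemma inv_arr [simp]:
  assumes "is_iso C f"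
  shows "inv_arr C f \<in> Arr C" "Dom C (inv_arr C f) = Cod C f" "Cod C (inv_arr C f) = Dom C f"
    "inv_arr C f \<cdot> f = Idt C (Dom C f)" "f \<cdot> inv_arr C f = Idt C (Cod C f)"
  using inverse_arrows_inv[OF assms] by (auto simp: inverse_arrows_def hom_iff)

lemma is_iso_arr: "is_iso C f \<Longrightarrow> f \<in> Arr C"
  by (auto simp: is_iso_def inverse_arrows_def)

lemma inv_arr_cancel [simp]:
  assumes "is_iso C f" "g \<in> Arr C"
  shows "Cod C g = Dom C f \<Longrightarrow> inv_arr C f \<cdot> (f \<cdot> g) = g"
    "Cod C g = Cod C f \<Longrightarrow> f \<cdot> (inv_arr C f \<cdot> g) = g"
  using assms is_iso_arr[OF assms(1)]
  by (simp_all add: Comp_assoc'[symmetric] del: Comp_assoc')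

lemma is_isoI:
  assumes "f \<in> Arr C" "g \<in> Arr C" "Dom C g = Cod C f" "Cod C g = Dom C f"
    "g \<cdot> f = Idt C (Dom C f)" "f \<cdot> g = Idt C (Cod C f)"
  shows "is_iso C f"
  using assms by (auto simp: is_iso_def inverse_arrows_def hom_iff)

lemma is_iso_Comp:
  assumes "is_iso C f" "is_iso C g" "Dom C g = Cod C f"
  shows "is_iso C (g \<cdot> f)"
  using assms is_iso_arr[OF assms(1)] is_iso_arr[OF assms(2)]
  by (intro is_isoI[where g = "inv_arr C f \<cdot> inv_arr C g"]) auto

lemma is_iso_inv [simp]: "is_iso C f \<Longrightarrow> is_iso C (inv_arr C f)"
  using is_iso_arr[of f] by (intro is_isoI[where g = f]) auto

lemma is_iso_Idt [simp]: "X \<in> Obj C \<Longrightarrow> is_iso C (Idt C X)"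
  by (intro is_isoI[where g = "Idt C X"]) auto

lemma iso_monic:
  assumes "is_iso C m" "m \<cdot> f = m \<cdot> g" "f \<in> Arr C" "g \<in> Arr C" "Cod C f = Dom C m" "Cod C g = Dom C m"
  shows "f = g"
proof -
  have "f = inv_arr C m \<cdot> (m \<cdot> f)" using inv_arr_cancel(1)[OF assms(1,3,5)] by (rule sym)
  also have "\<dots> = inv_arr C m \<cdot> (m \<cdot> g)" by (simp only: assms(2))
  also have "\<dots> = g" by (rule inv_arr_cancel(1)[OF assms(1,4,6)])
  finally show ?thesis .
qed

lemma iso_epic:
  assumes "is_iso C m" "f \<cdot> m = g \<cdot> m" "f \<in> Arr C" "g \<in> Arr C" "Dom C f = Cod C m" "Dom C g = Cod C m"
  shows "f = g"
proof -
  have "(f \<cdot> m) \<cdot> inv_arr C m = (g \<cdot> m) \<cdot> inv_arr C m"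
    by (simp only: assms(2))
  then have "f \<cdot> (m \<cdot> inv_arr C m) = g \<cdot> (m \<cdot> inv_arr C m)"
    using assms(1,3-) is_iso_arr[OF assms(1)] by (simp del: inv_arr(5))
  then show ?thesis using assms(1,3-) by simp
qed

text \<open>Simplification nests composites to the right, which hides the redex
  \<open>g \<cdot> f\<close> inside \<open>g \<cdot> (f \<cdot> h)\<close>. This form lets an
  equation for \<open>g \<cdot> f\<close> be used there.\<close>

lemma Comp_reassoc:
  assumes "g \<cdot> f = k" "f \<in> Arr C" "g \<in> Arr C" "h \<in> Arr C" "Dom C g = Cod C f" "Dom C f = Cod C h"
  shows "g \<cdot> (f \<cdot> h) = k \<cdot> h"
  using Comp_assoc'[of h f g] assms by simp

lemma inv_arr_Comp:
  assumes "is_iso C f" "is_iso C g" "Dom C g = Cod C f"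
  shows "inv_arr C (g \<cdot> f) = inv_arr C f \<cdot> inv_arr C g"
  using assms is_iso_arr[OF assms(1)] is_iso_arr[OF assms(2)]
  by (intro inv_arr_eqI) (auto simp: inverse_arrows_def hom_iff)

end

section \<open>Monoidal structure: typing, naturality and coherence of the units\<close>

context symmetric_monoidal_closed
begin

declare Unt_Obj [simp] Ten_Obj [simp] ihom_Obj [simp]

lemma TenA_arr [simp]:
  assumes "f \<in> Arr V" "g \<in> Arr V"
  shows "f \<odot> g \<in> Arr V" "Dom V (f \<odot> g) = Dom V f \<otimes> Dom V g" "Cod V (f \<odot> g) = Cod V f \<otimes> Cod V g"
  using TenA_hom[of f "Dom V f" "Cod V f" g "Dom V g" "Cod V g"] assms by (auto simp: hom_iff)

lemma struct_arr [simp]: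
  assumes "X \<in> Obj V"
  shows "lun V X \<in> Arr V" "Dom V (lun V X) = \<one> \<otimes> X" "Cod V (lun V X) = X"
    "run V X \<in> Arr V" "Dom V (run V X) = X \<otimes> \<one>" "Cod V (run V X) = X"
    "is_iso V (lun V X)" "is_iso V (run V X)"
    "Y \<in> Obj V \<Longrightarrow> braid V X Y \<in> Arr V"
    "Y \<in> Obj V \<Longrightarrow> Dom V (braid V X Y) = X \<otimes> Y"
    "Y \<in> Obj V \<Longrightarrow> Cod V (braid V X Y) = Y \<otimes> X"
    "Y \<in> Obj V \<Longrightarrow> ev V X Y \<in> Arr V"
    "Y \<in> Obj V \<Longrightarrow> Dom V (ev V X Y) = ihom V X Y \<otimes> X"
    "Y \<in> Obj V \<Longrightarrow> Cod V (ev V X Y) = Y"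
    "Y \<in> Obj V \<Longrightarrow> Z \<in> Obj V \<Longrightarrow> asc V X Y Z \<in> Arr V"
    "Y \<in> Obj V \<Longrightarrow> Z \<in> Obj V \<Longrightarrow> Dom V (asc V X Y Z) = (X \<otimes> Y) \<otimes> Z"
    "Y \<in> Obj V \<Longrightarrow> Z \<in> Obj V \<Longrightarrow> Cod V (asc V X Y Z) = X \<otimes> (Y \<otimes> Z)"
    "Y \<in> Obj V \<Longrightarrow> Z \<in> Obj V \<Longrightarrow> is_iso V (asc V X Y Z)"
  using assms lun_hom[of X] run_hom[of X] lun_iso[of X] run_iso[of X] braid_hom[of X Y] ev_hom[of X Y]
    asc_hom[of X Y Z] asc_iso[of X Y Z]
  by (auto simp: hom_iff)

lemma braid_braid [simp]: "X \<in> Obj V \<Longrightarrow> Y \<in> Obj V \<Longrightarrow> braid V Y X \<cdot> braid V X Y = Idt V (X \<otimes> Y)"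
  by (rule braid_symmetric)

lemma braid_braid' [simp]:
  assumes "X \<in> Obj V" "Y \<in> Obj V" "f \<in> Arr V" "Cod V f = X \<otimes> Y"
  shows "braid V Y X \<cdot> (braid V X Y \<cdot> f) = f"
  using assms by (simp add: Comp_assoc'[symmetric] del: Comp_assoc')

lemma braid_iso [simp]: "X \<in> Obj V \<Longrightarrow> Y \<in> Obj V \<Longrightarrow> is_iso V (braid V X Y)"
  by (intro is_isoI[where g = "braid V Y X"]) auto

lemma TenA_Idt' [simp]: "X \<in> Obj V \<Longrightarrow> Y \<in> Obj V \<Longrightarrow> Idt V X \<odot> Idt V Y = Idt V (X \<otimes> Y)"
  by (rule TenA_Idt)

text \<open>Oriented so that consecutive tensors of arrows are fused into one; the second form does
  the same at the head of a right-nested composite, where the first does not match.\<close>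

lemma TenA_merge [simp]:
  assumes "f \<in> Arr V" "g \<in> Arr V" "f' \<in> Arr V" "g' \<in> Arr V" "Dom V f' = Cod V f" "Dom V g' = Cod V g"
  shows "(f' \<odot> g') \<cdot> (f \<odot> g) = (f' \<cdot> f) \<odot> (g' \<cdot> g)"
    "h \<in> Arr V \<Longrightarrow> Cod V h = Dom V f \<otimes> Dom V g \<Longrightarrow>
      (f' \<odot> g') \<cdot> ((f \<odot> g) \<cdot> h) = ((f' \<cdot> f) \<odot> (g' \<cdot> g)) \<cdot> h"
proof -
  show 1: "(f' \<odot> g') \<cdot> (f \<odot> g) = (f' \<cdot> f) \<odot> (g' \<cdot> g)"
    using TenA_Comp[of f "Dom V f" "Cod V f" f' "Cod V f'" g "Dom V g" "Cod V g" g' "Cod V g'"] assms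
    by (simp add: hom_iff)
  assume h: "h \<in> Arr V" "Cod V h = Dom V f \<otimes> Dom V g"
  have "(f' \<odot> g') \<cdot> ((f \<odot> g) \<cdot> h) = ((f' \<odot> g') \<cdot> (f \<odot> g)) \<cdot> h"
    using assms h by (intro Comp_assoc'[symmetric]) auto
  then show "(f' \<odot> g') \<cdot> ((f \<odot> g) \<cdot> h) = ((f' \<cdot> f) \<odot> (g' \<cdot> g)) \<cdot> h"
    by (simp only: 1)
qed

lemma TenA_iso [simp]:
  assumes "is_iso V f" "is_iso V g"
  shows "is_iso V (f \<odot> g)"
  using assms is_iso_arr[OF assms(1)] is_iso_arr[OF assms(2)]
  by (intro is_isoI[where g = "inv_arr V f \<odot> inv_arr V g"]) auto

lemma inv_arr_TenA:
  assumes "is_iso V f" "is_iso V g"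
  shows "inv_arr V (f \<odot> g) = inv_arr V f \<odot> inv_arr V g"
  using assms is_iso_arr[OF assms(1)] is_iso_arr[OF assms(2)]
  by (intro inv_arr_eqI) (auto simp: inverse_arrows_def hom_iff)

lemma asc_nat:
  assumes "f \<in> Arr V" "g \<in> Arr V" "h \<in> Arr V" "Cod V f = X" "Cod V g = Y" "Cod V h = Z"
  shows "asc V X Y Z \<cdot> ((f \<odot> g) \<odot> h) = (f \<odot> (g \<odot> h)) \<cdot> asc V (Dom V f) (Dom V g) (Dom V h)"
  using asc_natural[of f "Dom V f" "Cod V f" g "Dom V g" "Cod V g" h "Dom V h" "Cod V h"] assms
  by (auto simp: hom_iff)

lemma lun_nat: "f \<in> Arr V \<Longrightarrow> Cod V f = X \<Longrightarrow> lun V X \<cdot> (Idt V \<one> \<odot> f) = f \<cdot> lun V (Dom V f)"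
  using lun_natural[of f "Dom V f" "Cod V f"] by (auto simp: hom_iff)

lemma run_nat: "f \<in> Arr V \<Longrightarrow> Cod V f = X \<Longrightarrow> run V X \<cdot> (f \<odot> Idt V \<one>) = f \<cdot> run V (Dom V f)"
  using run_natural[of f "Dom V f" "Cod V f"] by (auto simp: hom_iff)

lemma braid_nat:
  "f \<in> Arr V \<Longrightarrow> g \<in> Arr V \<Longrightarrow> Cod V f = X \<Longrightarrow> Cod V g = Y \<Longrightarrow>
    braid V X Y \<cdot> (f \<odot> g) = (g \<odot> f) \<cdot> braid V (Dom V f) (Dom V g)"
  using braid_natural[of f "Dom V f" "Cod V f" g "Dom V g" "Cod V g"] by (auto simp: hom_iff)

lemma comp_cong_left: "f = g \<Longrightarrow> f \<cdot> h = g \<cdot> h" by simp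

text \<open>The unitors make tensoring with the unit naturally isomorphic to the identity functor,
  which is faithful. Coherence laws may therefore be checked after adding a unit factor.\<close>

lemma unit_tensor_faithful:
  assumes "f \<in> Arr V" "g \<in> Arr V" "Dom V f = Dom V g" "Cod V f = Cod V g"
  shows "Idt V \<one> \<odot> f = Idt V \<one> \<odot> g \<Longrightarrow> f = g" "f \<odot> Idt V \<one> = g \<odot> Idt V \<one> \<Longrightarrow> f = g"
proof -
  assume "Idt V \<one> \<odot> f = Idt V \<one> \<odot> g"
  then have "f \<cdot> lun V (Dom V f) = g \<cdot> lun V (Dom V f)"
    using lun_nat[of f "Cod V f"] lun_nat[of g "Cod V g"] assms by metis
  then show "f = g" by (rule iso_epic[rotated]) (simp_all add: assms)
next
  assume "f \<odot> Idt V \<one> = g \<odot> Idt V \<one>"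
  then have "f \<cdot> run V (Dom V f) = g \<cdot> run V (Dom V f)"
    using run_nat[of f "Cod V f"] run_nat[of g "Cod V g"] assms by metis
  then show "f = g" by (rule iso_epic[rotated]) (simp_all add: assms)
qed

text \<open>Kelly's derivation of the second unit triangle. With an extra unit on the left, the
  pentagon and two instances of \<open>triangle\<close> connect both sides through an isomorphism;
  that isomorphism and the extra unit are then cancelled.\<close>

lemma lun_tensor:
  assumes [simp]: "X \<in> Obj V" "Y \<in> Obj V"
  shows "lun V (X \<otimes> Y) \<cdot> asc V \<one> X Y = lun V X \<odot> Idt V Y"
proof -
  let ?i = "asc V \<one> (\<one> \<otimes> X) Y \<cdot> (asc V \<one> \<one> X \<odot> Idt V Y)"
  have "((Idt V \<one> \<odot> lun V (X \<otimes> Y)) \<cdot> (Idt V \<one> \<odot> asc V \<one> X Y)) \<cdot> ?i =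
     (Idt V \<one> \<odot> lun V (X \<otimes> Y)) \<cdot> (asc V \<one> \<one> (X \<otimes> Y) \<cdot> asc V (\<one> \<otimes> \<one>) X Y)"
    by (subst pentagon) (simp_all)
  also have "\<dots> = (run V \<one> \<odot> (Idt V X \<odot> Idt V Y)) \<cdot> asc V (\<one> \<otimes> \<one>) X Y"
    by (subst Comp_reassoc[OF triangle]) simp_all
  also have "\<dots> = asc V \<one> X Y \<cdot> ((run V \<one> \<odot> Idt V X) \<odot> Idt V Y)"
    using asc_nat[of "run V \<one>" "Idt V X" "Idt V Y" \<one> X Y] by simp
  also have "\<dots> = asc V \<one> X Y \<cdot> (((Idt V \<one> \<odot> lun V X) \<odot> Idt V Y) \<cdot> (asc V \<one> \<one> X \<odot> Idt V Y))"
    by (subst triangle[symmetric]) simp_all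
  also have "\<dots> = (Idt V \<one> \<odot> (lun V X \<odot> Idt V Y)) \<cdot> ?i"
    using comp_cong_left[OF asc_nat[of "Idt V \<one>" "lun V X" "Idt V Y" \<one> X Y], of "asc V \<one> \<one> X \<odot> Idt V Y"]
    by simp
  finally have "(Idt V \<one> \<odot> (lun V (X \<otimes> Y) \<cdot> asc V \<one> X Y)) \<cdot> ?i = (Idt V \<one> \<odot> (lun V X \<odot> Idt V Y)) \<cdot> ?i"
    by simp
  then have "Idt V \<one> \<odot> (lun V (X \<otimes> Y) \<cdot> asc V \<one> X Y) = Idt V \<one> \<odot> (lun V X \<odot> Idt V Y)"
    by (rule iso_epic[rotated]) (auto intro!: is_iso_Comp is_iso_Idt)
  then show ?thesis by (rule unit_tensor_faithful(1)[rotated 4]) simp_all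
qed

text \<open>Naturality of the left unitor at itself identifies
  \<open>Idt V \<one> \<odot> lun V \<one>\<close> with
  \<open>lun V (\<one> \<otimes> \<one>)\<close>. Now \<open>lun_tensor\<close> and
  \<open>triangle\<close> evaluate the same composite, one to the left and one to the right
  unitor.\<close>

lemma lun_Unt: "lun V \<one> = run V \<one>"
proof -
  have "lun V \<one> \<cdot> (Idt V \<one> \<odot> lun V \<one>) = lun V \<one> \<cdot> lun V (\<one> \<otimes> \<one>)"
    by (subst lun_nat) simp_all
  then have 1: "Idt V \<one> \<odot> lun V \<one> = lun V (\<one> \<otimes> \<one>)"
    by (rule iso_monic[rotated]) simp_all
  have "lun V \<one> \<odot> Idt V \<one> = (Idt V \<one> \<odot> lun V \<one>) \<cdot> asc V \<one> \<one> \<one>"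
    unfolding 1 by (simp add: lun_tensor)
  also have "\<dots> = run V \<one> \<odot> Idt V \<one>" by (rule triangle) simp_all
  finally show ?thesis by (rule unit_tensor_faithful(2)[rotated 4]) simp_all
qed

text \<open>The hexagon with units in its last two places. The unit laws reduce all its sides to
  unitors and copies of \<open>braid V X \<one>\<close>, one of which is cancelled as an
  isomorphism.\<close>

lemma lun_braid:
  assumes [simp]: "X \<in> Obj V"
  shows "lun V X \<cdot> braid V X \<one> = run V X"
proof -
  have "braid V X \<one> \<cdot> (run V X \<odot> Idt V \<one>) = braid V X \<one> \<cdot> ((Idt V X \<odot> lun V \<one>) \<cdot> asc V X \<one> \<one>)"
    by (simp add: triangle)
  also have "\<dots> = (lun V \<one> \<odot> Idt V X) \<cdot> (braid V X (\<one> \<otimes> \<one>) \<cdot> asc V X \<one> \<one>)"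
    using comp_cong_left[OF braid_nat[of "Idt V X" "lun V \<one>" X \<one>], of "asc V X \<one> \<one>"] by simp
  also have "\<dots> = lun V (\<one> \<otimes> X) \<cdot> (asc V \<one> \<one> X \<cdot> (braid V X (\<one> \<otimes> \<one>) \<cdot> asc V X \<one> \<one>))"
    by (subst lun_tensor[symmetric]) simp_all
  also have "\<dots> = lun V (\<one> \<otimes> X) \<cdot> ((Idt V \<one> \<odot> braid V X \<one>) \<cdot> (asc V \<one> X \<one> \<cdot> (braid V X \<one> \<odot> Idt V \<one>)))"
    by (simp add: hexagon)
  also have "\<dots> = braid V X \<one> \<cdot> (lun V (X \<otimes> \<one>) \<cdot> (asc V \<one> X \<one> \<cdot> (braid V X \<one> \<odot> Idt V \<one>)))"
    using comp_cong_left[OF lun_nat[of "braid V X \<one>" "\<one> \<otimes> X"], of "asc V \<one> X \<one> \<cdot> (braid V X \<one> \<odot> Idt V \<one>)"] by simp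
  also have "\<dots> = braid V X \<one> \<cdot> ((lun V X \<odot> Idt V \<one>) \<cdot> (braid V X \<one> \<odot> Idt V \<one>))"
    by (subst lun_tensor[symmetric]) simp_all
  also have "\<dots> = braid V X \<one> \<cdot> ((lun V X \<cdot> braid V X \<one>) \<odot> Idt V \<one>)"
    by simp
  finally have "run V X \<odot> Idt V \<one> = (lun V X \<cdot> braid V X \<one>) \<odot> Idt V \<one>"
    by (rule iso_monic[rotated]) simp_all
  then have "run V X = lun V X \<cdot> braid V X \<one>"
    by (rule unit_tensor_faithful(2)[rotated 4]) simp_all
  then show ?thesis by (rule sym)
qed

lemma braid_Unt: "braid V \<one> \<one> = Idt V (\<one> \<otimes> \<one>)"
proof -
  have "lun V \<one> \<cdot> braid V \<one> \<one> = lun V \<one> \<cdot> Idt V (\<one> \<otimes> \<one>)"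
    by (simp add: lun_braid) (simp add: lun_Unt)
  then show ?thesis by (rule iso_monic[rotated]) simp_all
qed

end

section \<open>Generalized elements\<close>

text \<open>Names contain objects of an arbitrary type; the well-ordering theorem supplies a total
  order by which finite sets of names are listed canonically.\<close>

definition name_order :: "('n \<times> 'n) set" where
  "name_order = (SOME r. well_order_on UNIV r)"

definition name_less :: "'n \<Rightarrow> 'n \<Rightarrow> bool" where
  "name_less x y \<longleftrightarrow> x \<noteq> y \<and> (x, y) \<in> name_order"

lemma name_less_irrefl: "\<not> name_less x x"
  by (simp add: name_less_def)

lemma name_order:
  "antisym (name_order :: ('n \<times> 'n) set)" "trans (name_order :: ('n \<times> 'n) set)"
  "total (name_order :: ('n \<times> 'n) set)"
proof -
  have "well_order_on UNIV (name_order :: ('n \<times> 'n) set)"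
    unfolding name_order_def using well_order_on[of "UNIV :: 'n set"] by (rule someI_ex)
  then show "antisym (name_order :: ('n \<times> 'n) set)" "trans (name_order :: ('n \<times> 'n) set)"
    "total (name_order :: ('n \<times> 'n) set)"
    by (simp_all add: well_order_on_def linear_order_on_def partial_order_on_def preorder_on_def)
qed

lemma name_less_asym: "name_less x y \<Longrightarrow> \<not> name_less y x"
  unfolding name_less_def using antisymD[OF name_order(1), of x y] by auto

lemma name_less_trans: "name_less x y \<Longrightarrow> name_less y z \<Longrightarrow> name_less x z"
  using name_less_asym[of x y] transD[OF name_order(2), of x y z] unfolding name_less_def by auto

lemma name_less_total: "x \<noteq> y \<Longrightarrow> name_less x y \<or> name_less y x"
  using name_order(3) unfolding name_less_def total_on_def by auto

definition enum :: "'n set \<Rightarrow> 'n list" where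
  "enum S = (THE l. sorted_wrt name_less l \<and> set l = S)"

text \<open>The head of a sorted list is its least name, so the heads agree. As the order is strict
  the head does not recur, and removing it leaves tails with equal sets.\<close>

lemma sorted_name_unique:
  "sorted_wrt name_less l \<Longrightarrow> sorted_wrt name_less m \<Longrightarrow> set l = set m \<Longrightarrow> l = m"
proof (induction l arbitrary: m)
  case Nil
  then show ?case by simp
next
  case (Cons a l)
  then obtain b m' where m: "m = b # m'" by (cases m) auto
  have "a = b"
  proof (rule ccontr)
    assume "a \<noteq> b"
    then have "a \<in> set m'" "b \<in> set l" using Cons.prems m by auto
    then have "name_less b a" "name_less a b" using Cons.prems(1,2) m by auto
    then show False using name_less_asym[of a b] by simp
  qed
  moreover have "a \<notin> set l" "b \<notin> set m'"
    using Cons.prems(1,2) m name_less_irrefl[of a] name_less_irrefl[of b] by auto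
  ultimately have "set l = set m'" using Cons.prems(3) m by (simp add: insert_ident)
  then have "l = m'" using Cons.IH[of m'] Cons.prems m by simp
  then show ?case using m \<open>a = b\<close> by simp
qed

lemma enum_eqI: "sorted_wrt name_less l \<Longrightarrow> set l = S \<Longrightarrow> enum S = l"
  unfolding enum_def by (rule the_equality) (auto intro: sorted_name_unique)

lemma enum_exists: "finite S \<Longrightarrow> \<exists>l. sorted_wrt name_less l \<and> set l = S"
proof (induction S rule: finite_induct)
  case empty
  then show ?case by (intro exI[of _ "[]"]) simp
next
  case (insert x S)
  then obtain l where l: "sorted_wrt name_less l" "set l = S" by blast
  let ?l = "filter (\<lambda>y. name_less y x) l @ x # filter (\<lambda>y. name_less x y) l"
  have "sorted_wrt name_less ?l"
    using l(1) by (auto simp: sorted_wrt_append sorted_wrt_filter intro: name_less_trans)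
  moreover have "name_less y x \<or> name_less x y" if "y \<in> set l" for y
    using that l(2) insert.hyps name_less_total[of y x] by auto
  then have "set ?l = insert x S" using l(2) by auto
  ultimately show ?case by blast
qed

lemma enum: assumes "finite S" shows "sorted_wrt name_less (enum S)" "set (enum S) = S"
proof -
  obtain l where l: "sorted_wrt name_less l" "set l = S" using enum_exists[OF assms] by blast
  show "sorted_wrt name_less (enum S)" "set (enum S) = S" using enum_eqI[OF l] l by simp_all
qed

lemma enum_simps [simp]: "enum {} = []" "enum {n} = [n]"
  by (auto intro: enum_eqI)

text \<open>A sublist of a sorted list is sorted. So splitting an enumeration produces canonical
  enumerations again, and the two tensor factors depend only on the sets of names.\<close>

lemma filter_enum: "finite S \<Longrightarrow> filter P (enum S) = enum {n \<in> S. P n}"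
  using enum[of S] by (intro enum_eqI[symmetric]) (auto simp: sorted_wrt_filter)

text \<open>
  A name is an object together with a number. A finite set of names stands for the tensor product
  of its objects, taken in an arbitrary fixed order of all names; the unions of disjoint sets then
  provide a strictly associative and commutative description of tensor products.
\<close>

primrec ten :: "('o, 'm) smc \<Rightarrow> ('o \<times> nat) list \<Rightarrow> 'o" where
  "ten V [] = \<one>\<^bsub>V\<^esub>"
| "ten V (n # ns) = fst n \<otimes>\<^bsub>V\<^esub> ten V ns"

definition swap_first :: "('o, 'm) smc \<Rightarrow> 'o \<Rightarrow> 'o \<Rightarrow> 'o \<Rightarrow> 'm" where
  "swap_first V X Y Z = asc V Y X Z \<cdot>\<^bsub>V\<^esub> ((braid V X Y \<odot>\<^bsub>V\<^esub> Idt V Z) \<cdot>\<^bsub>V\<^esub> inv_arr V (asc V X Y Z))"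

text \<open>The unshuffle isomorphism: it separates the names that satisfy \<open>P\<close> from the
  others and keeps the order within each group. A name of the second group has to cross the whole
  first factor, whence \<open>swap_first\<close>.\<close>

primrec split_ten :: "('o, 'm) smc \<Rightarrow> ('o \<times> nat \<Rightarrow> bool) \<Rightarrow> ('o \<times> nat) list \<Rightarrow> 'm" where
  "split_ten V P [] = inv_arr V (lun V \<one>\<^bsub>V\<^esub>)"
| "split_ten V P (n # ns) =
    (if P n then inv_arr V (asc V (fst n) (ten V (filter P ns)) (ten V (filter (\<lambda>x. \<not> P x) ns)))
     else swap_first V (fst n) (ten V (filter P ns)) (ten V (filter (\<lambda>x. \<not> P x) ns)))
    \<cdot>\<^bsub>V\<^esub> (Idt V (fst n) \<odot>\<^bsub>V\<^esub> split_ten V P ns)"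

section \<open>Unshuffles of tensor products and their coherence\<close>

context symmetric_monoidal_closed
begin

lemma inv_asc_nat:
  assumes [simp]: "f \<in> Arr V" "g \<in> Arr V" "h \<in> Arr V" "Cod V f = X" "Cod V g = Y" "Cod V h = Z"
  shows "inv_arr V (asc V X Y Z) \<cdot> (f \<odot> (g \<odot> h)) =
    ((f \<odot> g) \<odot> h) \<cdot> inv_arr V (asc V (Dom V f) (Dom V g) (Dom V h))"
proof -
  have [simp]: "X \<in> Obj V" "Y \<in> Obj V" "Z \<in> Obj V" using assms Cod_Obj by blast+
  let ?a = "asc V X Y Z" and ?b = "asc V (Dom V f) (Dom V g) (Dom V h)"
  have "?a \<cdot> (((f \<odot> g) \<odot> h) \<cdot> inv_arr V ?b) = ?a \<cdot> (inv_arr V ?a \<cdot> (f \<odot> (g \<odot> h)))"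
    by (subst Comp_reassoc[OF asc_nat]) simp_all
  then have "?a \<cdot> (inv_arr V ?a \<cdot> (f \<odot> (g \<odot> h))) = ?a \<cdot> (((f \<odot> g) \<odot> h) \<cdot> inv_arr V ?b)"
    by (rule sym)
  then show ?thesis by (rule iso_monic[rotated]) simp_all
qed

lemma swap_first_arr [simp]:
  assumes "X \<in> Obj V" "Y \<in> Obj V" "Z \<in> Obj V"
  shows "swap_first V X Y Z \<in> Arr V" "Dom V (swap_first V X Y Z) = X \<otimes> (Y \<otimes> Z)"
    "Cod V (swap_first V X Y Z) = Y \<otimes> (X \<otimes> Z)" "is_iso V (swap_first V X Y Z)"
  using assms by (simp_all add: swap_first_def is_iso_Comp)

lemma swap_first_nat:
  assumes [simp]: "f \<in> Arr V" "g \<in> Arr V" "h \<in> Arr V" "Cod V f = X" "Cod V g = Y" "Cod V h = Z"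
  shows "swap_first V X Y Z \<cdot> (f \<odot> (g \<odot> h)) =
    (g \<odot> (f \<odot> h)) \<cdot> swap_first V (Dom V f) (Dom V g) (Dom V h)"
proof -
  have [simp]: "X \<in> Obj V" "Y \<in> Obj V" "Z \<in> Obj V" using assms Cod_Obj by blast+
  let ?b = "inv_arr V (asc V (Dom V f) (Dom V g) (Dom V h))"
  have "swap_first V X Y Z \<cdot> (f \<odot> (g \<odot> h)) =
      asc V Y X Z \<cdot> (((braid V X Y \<cdot> (f \<odot> g)) \<odot> h) \<cdot> ?b)"
    by (simp add: swap_first_def inv_asc_nat)
  also have "\<dots> = asc V Y X Z \<cdot> (((g \<odot> f) \<odot> h) \<cdot> ((braid V (Dom V f) (Dom V g) \<odot> Idt V (Dom V h)) \<cdot> ?b))"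
    by (simp add: braid_nat)
  also have "\<dots> = (g \<odot> (f \<odot> h)) \<cdot> swap_first V (Dom V f) (Dom V g) (Dom V h)"
    by (subst Comp_reassoc[OF asc_nat]) (simp_all add: swap_first_def)
  finally show ?thesis .
qed

text \<open>The other hexagon, for crossing a single factor with a product. By symmetry the inverse
  of each braiding is the opposite braiding, so it is the inverse of the given hexagon.\<close>

lemma swap_first_braid:
  assumes [simp]: "X \<in> Obj V" "Y \<in> Obj V" "Z \<in> Obj V"
  shows "swap_first V X Z Y \<cdot> (Idt V X \<odot> braid V Y Z) = braid V (X \<otimes> Y) Z \<cdot> inv_arr V (asc V X Y Z)"
proof -
  have "inv_arr V (asc V Z X Y) \<cdot> (braid V (X \<otimes> Y) Z \<cdot> inv_arr V (asc V X Y Z)) =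
     inv_arr V (asc V X Y Z \<cdot> (braid V Z (X \<otimes> Y) \<cdot> asc V Z X Y))"
    by (rule inv_arr_eqI[symmetric]) (auto simp: inverse_arrows_def hom_iff)
  also have "\<dots> = inv_arr V ((Idt V X \<odot> braid V Z Y) \<cdot> (asc V X Z Y \<cdot> (braid V Z X \<odot> Idt V Y)))"
    by (simp add: hexagon)
  also have "\<dots> = (braid V X Z \<odot> Idt V Y) \<cdot> (inv_arr V (asc V X Z Y) \<cdot> (Idt V X \<odot> braid V Y Z))"
    by (rule inv_arr_eqI) (auto simp: inverse_arrows_def hom_iff)
  finally have "asc V Z X Y \<cdot> (inv_arr V (asc V Z X Y) \<cdot> (braid V (X \<otimes> Y) Z \<cdot> inv_arr V (asc V X Y Z))) =
    asc V Z X Y \<cdot> ((braid V X Z \<odot> Idt V Y) \<cdot> (inv_arr V (asc V X Z Y) \<cdot> (Idt V X \<odot> braid V Y Z)))"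
    by simp
  then show ?thesis by (simp add: swap_first_def)
qed

lemma pentagon_inv:
  assumes [simp]: "N \<in> Obj V" "P \<in> Obj V" "Q \<in> Obj V" "R \<in> Obj V"
  shows "asc V (N \<otimes> P) Q R \<cdot> ((inv_arr V (asc V N P Q) \<odot> Idt V R) \<cdot> inv_arr V (asc V N (P \<otimes> Q) R)) =
    inv_arr V (asc V N P (Q \<otimes> R)) \<cdot> (Idt V N \<odot> asc V P Q R)"
proof -
  let ?i = "(inv_arr V (asc V N P Q) \<odot> Idt V R) \<cdot> inv_arr V (asc V N (P \<otimes> Q) R)"
  have "asc V N P (Q \<otimes> R) \<cdot> (asc V (N \<otimes> P) Q R \<cdot> ?i) =
      ((Idt V N \<odot> asc V P Q R) \<cdot> (asc V N (P \<otimes> Q) R \<cdot> (asc V N P Q \<odot> Idt V R))) \<cdot> ?i"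
    by (subst pentagon[symmetric]) simp_all
  also have "\<dots> = Idt V N \<odot> asc V P Q R" by simp
  also have "\<dots> = asc V N P (Q \<otimes> R) \<cdot> (inv_arr V (asc V N P (Q \<otimes> R)) \<cdot> (Idt V N \<odot> asc V P Q R))"
    by simp
  finally show ?thesis by (rule iso_monic[rotated]) simp_all
qed

text \<open>Only \<open>P\<close> is crossed, so no hexagon enters: the law is naturality of the
  associator at \<open>braid V N P\<close>, framed by the pentagon and its rearrangement
  \<open>pentagon_inv\<close>.\<close>

lemma swap_first_asc_left:
  assumes [simp]: "N \<in> Obj V" "P \<in> Obj V" "Q \<in> Obj V" "R \<in> Obj V"
  shows "asc V P (N \<otimes> Q) R \<cdot> ((swap_first V N P Q \<odot> Idt V R) \<cdot> inv_arr V (asc V N (P \<otimes> Q) R)) =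
    (Idt V P \<odot> inv_arr V (asc V N Q R)) \<cdot> (swap_first V N P (Q \<otimes> R) \<cdot> (Idt V N \<odot> asc V P Q R))"
proof -
  let ?k = "(inv_arr V (asc V N P Q) \<odot> Idt V R) \<cdot> inv_arr V (asc V N (P \<otimes> Q) R)"
  let ?b = "(braid V N P \<odot> Idt V Q) \<odot> Idt V R"
  have "(Idt V P \<odot> asc V N Q R) \<cdot>
      (asc V P (N \<otimes> Q) R \<cdot> ((swap_first V N P Q \<odot> Idt V R) \<cdot> inv_arr V (asc V N (P \<otimes> Q) R))) =
    ((Idt V P \<odot> asc V N Q R) \<cdot> (asc V P (N \<otimes> Q) R \<cdot> (asc V P N Q \<odot> Idt V R))) \<cdot> (?b \<cdot> ?k)"
    by (simp add: swap_first_def)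
  also have "\<dots> = asc V P N (Q \<otimes> R) \<cdot> (asc V (P \<otimes> N) Q R \<cdot> (?b \<cdot> ?k))"
    by (subst pentagon[symmetric]) simp_all
  also have "\<dots> = asc V P N (Q \<otimes> R) \<cdot> ((braid V N P \<odot> Idt V (Q \<otimes> R)) \<cdot> (asc V (N \<otimes> P) Q R \<cdot> ?k))"
    by (subst Comp_reassoc[OF asc_nat]) simp_all
  also have "\<dots> = swap_first V N P (Q \<otimes> R) \<cdot> (Idt V N \<odot> asc V P Q R)"
    by (subst pentagon_inv) (simp_all add: swap_first_def)
  also have "\<dots> = (Idt V P \<odot> asc V N Q R) \<cdot>
      ((Idt V P \<odot> inv_arr V (asc V N Q R)) \<cdot> (swap_first V N P (Q \<otimes> R) \<cdot> (Idt V N \<odot> asc V P Q R)))"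
    by simp
  finally show ?thesis by (rule iso_monic[rotated]) simp_all
qed

text \<open>Crossing a product at once is crossing its factors in turn. The hexagon says so for the
  product alone; \<open>swap_first_asc_left\<close> carries the remaining factor \<open>R\<close>
  along.\<close>

lemma swap_first_asc_right:
  assumes [simp]: "N \<in> Obj V" "P \<in> Obj V" "Q \<in> Obj V" "R \<in> Obj V"
  shows "asc V P Q (N \<otimes> R) \<cdot> swap_first V N (P \<otimes> Q) R =
    (Idt V P \<odot> swap_first V N Q R) \<cdot> (swap_first V N P (Q \<otimes> R) \<cdot> (Idt V N \<odot> asc V P Q R))"
proof -
  let ?k = "(swap_first V N P Q \<odot> Idt V R) \<cdot> inv_arr V (asc V N (P \<otimes> Q) R)"
  have hex: "asc V P Q N \<cdot> braid V N (P \<otimes> Q) = (Idt V P \<odot> braid V N Q) \<cdot> swap_first V N P Q"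
  proof -
    have "asc V P Q N \<cdot> braid V N (P \<otimes> Q) =
        (asc V P Q N \<cdot> (braid V N (P \<otimes> Q) \<cdot> asc V N P Q)) \<cdot> inv_arr V (asc V N P Q)" by simp
    also have "\<dots> = (Idt V P \<odot> braid V N Q) \<cdot> swap_first V N P Q"
      by (subst hexagon) (simp_all add: swap_first_def)
    finally show ?thesis .
  qed
  have "asc V P Q (N \<otimes> R) \<cdot> swap_first V N (P \<otimes> Q) R =
      (asc V P Q (N \<otimes> R) \<cdot> asc V (P \<otimes> Q) N R) \<cdot>
      ((braid V N (P \<otimes> Q) \<odot> Idt V R) \<cdot> inv_arr V (asc V N (P \<otimes> Q) R))"
    by (simp add: swap_first_def)
  also have "\<dots> = (Idt V P \<odot> asc V Q N R) \<cdot> (asc V P (Q \<otimes> N) R \<cdot>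
      (((asc V P Q N \<cdot> braid V N (P \<otimes> Q)) \<odot> Idt V R) \<cdot> inv_arr V (asc V N (P \<otimes> Q) R)))"
    by (subst pentagon) simp_all
  also have "\<dots> = (Idt V P \<odot> asc V Q N R) \<cdot> (asc V P (Q \<otimes> N) R \<cdot> (((Idt V P \<odot> braid V N Q) \<odot> Idt V R) \<cdot> ?k))"
    by (simp add: hex)
  also have "\<dots> = (Idt V P \<odot> asc V Q N R) \<cdot> ((Idt V P \<odot> (braid V N Q \<odot> Idt V R)) \<cdot> (asc V P (N \<otimes> Q) R \<cdot> ?k))"
    by (subst Comp_reassoc[OF asc_nat]) simp_all
  also have "\<dots> = (Idt V P \<odot> swap_first V N Q R) \<cdot> (swap_first V N P (Q \<otimes> R) \<cdot> (Idt V N \<odot> asc V P Q R))"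
    by (subst swap_first_asc_left) (simp_all add: swap_first_def)
  finally show ?thesis .
qed

text \<open>Crossing a unit is invisible: the triangle trades the associator for a right unitor, the
  braiding turns that into a left one, and \<open>lun_tensor\<close> moves it to the
  product.\<close>

lemma swap_first_lun:
  assumes [simp]: "X \<in> Obj V" "Y \<in> Obj V"
  shows "swap_first V X \<one> Y \<cdot> (Idt V X \<odot> inv_arr V (lun V Y)) = inv_arr V (lun V (X \<otimes> Y))"
proof -
  have 1: "inv_arr V (asc V X \<one> Y) \<cdot> (Idt V X \<odot> inv_arr V (lun V Y)) = inv_arr V (run V X) \<odot> Idt V Y"
  proof -
    have "inv_arr V (asc V X \<one> Y) \<cdot> (Idt V X \<odot> inv_arr V (lun V Y)) =
        inv_arr V ((Idt V X \<odot> lun V Y) \<cdot> asc V X \<one> Y)"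
      by (simp add: inv_arr_Comp inv_arr_TenA inv_arr_eqI[of "Idt V X" "Idt V X"] inverse_arrows_def hom_iff)
    then show ?thesis
      by (simp add: triangle inv_arr_TenA inv_arr_eqI[of "Idt V Y" "Idt V Y"] inverse_arrows_def hom_iff)
  qed
  have 2: "braid V X \<one> \<cdot> inv_arr V (run V X) = inv_arr V (lun V X)"
  proof -
    have "lun V X \<cdot> (braid V X \<one> \<cdot> inv_arr V (run V X)) = lun V X \<cdot> inv_arr V (lun V X)"
      by (subst Comp_reassoc[OF lun_braid]) simp_all
    then show ?thesis by (rule iso_monic[rotated]) simp_all
  qed
  have "swap_first V X \<one> Y \<cdot> (Idt V X \<odot> inv_arr V (lun V Y)) = asc V \<one> X Y \<cdot> (inv_arr V (lun V X) \<odot> Idt V Y)"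
    by (simp add: swap_first_def 1 2)
  then have "lun V (X \<otimes> Y) \<cdot> (swap_first V X \<one> Y \<cdot> (Idt V X \<odot> inv_arr V (lun V Y))) =
      (lun V (X \<otimes> Y) \<cdot> asc V \<one> X Y) \<cdot> (inv_arr V (lun V X) \<odot> Idt V Y)"
    by simp
  also have "\<dots> = lun V (X \<otimes> Y) \<cdot> inv_arr V (lun V (X \<otimes> Y))"
    by (subst lun_tensor) simp_all
  finally show ?thesis by (rule iso_monic[rotated]) simp_all
qed

lemma ten_Obj [simp]: "fst ` set l \<subseteq> Obj V \<Longrightarrow> ten V l \<in> Obj V"
  by (induction l) auto

lemma ten_filter_Obj [simp]: "fst ` set l \<subseteq> Obj V \<Longrightarrow> ten V (filter P l) \<in> Obj V"
  by (rule ten_Obj) auto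

lemma split_ten_arr [simp]:
  "fst ` set l \<subseteq> Obj V \<Longrightarrow> split_ten V P l \<in> Arr V \<and> Dom V (split_ten V P l) = ten V l \<and>
     Cod V (split_ten V P l) = ten V (filter P l) \<otimes> ten V (filter (\<lambda>x. \<not> P x) l) \<and>
     is_iso V (split_ten V P l)"
  by (induction l) (auto simp: is_iso_Comp)

lemma split_ten_False: "fst ` set l \<subseteq> Obj V \<Longrightarrow> split_ten V (\<lambda>_. False) l = inv_arr V (lun V (ten V l))"
  by (induction l) (auto simp: swap_first_lun)

text \<open>Commutativity of pairing in terms of shapes. A new name crosses the other group either
  before or after the two groups are exchanged, and \<open>swap_first_braid\<close> compares the
  two.\<close>

lemma split_ten_braid:
  "fst ` set l \<subseteq> Obj V \<Longrightarrow>
    split_ten V (\<lambda>x. \<not> P x) l =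
    braid V (ten V (filter P l)) (ten V (filter (\<lambda>x. \<not> P x) l)) \<cdot> split_ten V P l"
proof (induction l)
  case Nil
  then show ?case by (simp add: braid_Unt)
next
  case (Cons n l)
  let ?P = "ten V (filter P l)" and ?N = "ten V (filter (\<lambda>x. \<not> P x) l)" and ?n = "fst n"
  have [simp]: "?n \<in> Obj V" "fst ` set l \<subseteq> Obj V" using Cons.prems by auto
  let ?i = "Idt V ?n \<odot> split_ten V P l"
  show ?case
  proof (cases "P n")
    case True
    have "split_ten V (\<lambda>x. \<not> P x) (n # l) = (swap_first V ?n ?N ?P \<cdot> (Idt V ?n \<odot> braid V ?P ?N)) \<cdot> ?i"
      using True by (simp add: Cons.IH)
    also have "\<dots> = braid V (?n \<otimes> ?P) ?N \<cdot> (inv_arr V (asc V ?n ?P ?N) \<cdot> ?i)"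
      by (subst swap_first_braid) simp_all
    finally show ?thesis using True by simp
  next
    case False
    \<comment> \<open>A braiding and its inverse are inserted behind \<open>swap_first\<close>, so
      that \<open>swap_first_braid\<close> applies with the roles of the two groups
      exchanged.\<close>
    have "braid V ?P (?n \<otimes> ?N) \<cdot> (swap_first V ?n ?P ?N \<cdot> ?i) =
        braid V ?P (?n \<otimes> ?N) \<cdot> ((swap_first V ?n ?P ?N \<cdot> (Idt V ?n \<odot> braid V ?N ?P)) \<cdot>
          (Idt V ?n \<odot> (braid V ?P ?N \<cdot> split_ten V P l)))"
      by simp
    also have "\<dots> = inv_arr V (asc V ?n ?N ?P) \<cdot> (Idt V ?n \<odot> (braid V ?P ?N \<cdot> split_ten V P l))"
      by (subst swap_first_braid) simp_all
    finally show ?thesis using False by (simp add: Cons.IH)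
  qed
qed

text \<open>Associativity of pairing in terms of shapes: names are put into three groups either by
  splitting off the last group first or the first group first. Induction adds one name at a
  time.\<close>

lemma split_ten_asc:
  assumes "\<And>x. P x \<Longrightarrow> \<not> Q x"
  shows "fst ` set l \<subseteq> Obj V \<Longrightarrow>
    asc V (ten V (filter P l)) (ten V (filter Q l)) (ten V (filter (\<lambda>x. \<not> P x \<and> \<not> Q x) l)) \<cdot>
      ((split_ten V P (filter (\<lambda>x. P x \<or> Q x) l) \<odot> Idt V (ten V (filter (\<lambda>x. \<not> P x \<and> \<not> Q x) l))) \<cdot>
       split_ten V (\<lambda>x. P x \<or> Q x) l) =
    (Idt V (ten V (filter P l)) \<odot> split_ten V Q (filter (\<lambda>x. \<not> P x) l)) \<cdot> split_ten V P l"
proof (induction l)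
  case Nil
  have "asc V \<one> \<one> \<one> \<cdot> (inv_arr V (run V \<one>) \<odot> Idt V \<one>) = Idt V \<one> \<odot> inv_arr V (lun V \<one>)"
  proof -
    have "(Idt V \<one> \<odot> lun V \<one>) \<cdot> (asc V \<one> \<one> \<one> \<cdot> (inv_arr V (run V \<one>) \<odot> Idt V \<one>)) =
        (Idt V \<one> \<odot> lun V \<one>) \<cdot> (Idt V \<one> \<odot> inv_arr V (lun V \<one>))"
      by (subst Comp_reassoc[OF triangle]) simp_all
    then show ?thesis by (rule iso_monic[rotated]) simp_all
  qed
  then have "(asc V \<one> \<one> \<one> \<cdot> (inv_arr V (lun V \<one>) \<odot> Idt V \<one>)) \<cdot> inv_arr V (lun V \<one>) =
      (Idt V \<one> \<odot> inv_arr V (lun V \<one>)) \<cdot> inv_arr V (lun V \<one>)" by (simp only: lun_Unt)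
  then show ?case by simp
next
  case (Cons n l)
  have [simp]: "fst n \<in> Obj V" "fst ` set l \<subseteq> Obj V" using Cons.prems by auto
  \<comment> \<open>Since \<open>P\<close> and \<open>Q\<close> exclude each other, all iterated
    filters collapse to those of the three groups.\<close>
  have [simp]: "filter (\<lambda>x. \<not> P x \<and> (P x \<or> Q x)) l = filter Q l" "filter (\<lambda>x. P x \<and> (P x \<or> Q x)) l = filter P l" "filter (\<lambda>x. \<not> P x \<and> Q x) l = filter Q l"
    "filter (\<lambda>x. (P x \<or> Q x) \<and> \<not> P x) l = filter Q l" "filter (\<lambda>x. Q x \<and> \<not> P x) l = filter Q l"
    "filter (\<lambda>x. (P x \<or> Q x) \<and> P x) l = filter P l" "filter (\<lambda>x. \<not> Q x \<and> \<not> P x) l = filter (\<lambda>x. \<not> P x \<and> \<not> Q x) l"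
    using assms by (auto intro!: filter_cong)
  let ?n = "fst n" and ?P = "ten V (filter P l)" and ?Q = "ten V (filter Q l)"
    and ?R = "ten V (filter (\<lambda>x. \<not> P x \<and> \<not> Q x) l)"
  let ?s = "split_ten V P (filter (\<lambda>x. P x \<or> Q x) l)" and ?s' = "split_ten V (\<lambda>x. P x \<or> Q x) l"
    and ?t = "split_ten V Q (filter (\<lambda>x. \<not> P x) l)" and ?t' = "split_ten V P l"
  have sub[simp]: "fst ` set (filter X l) \<subseteq> Obj V" for X
    by (rule order_trans[OF image_mono[OF filter_is_subset]]) simp
  have [simp]: "?s \<in> Arr V" "Dom V ?s = ten V (filter (\<lambda>x. P x \<or> Q x) l)" "Cod V ?s = ?P \<otimes> ?Q"
    "?s' \<in> Arr V" "Dom V ?s' = ten V l" "Cod V ?s' = ten V (filter (\<lambda>x. P x \<or> Q x) l) \<otimes> ?R"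
    "?t \<in> Arr V" "Dom V ?t = ten V (filter (\<lambda>x. \<not> P x) l)" "Cod V ?t = ?Q \<otimes> ?R"
    "?t' \<in> Arr V" "Dom V ?t' = ten V l" "Cod V ?t' = ?P \<otimes> ten V (filter (\<lambda>x. \<not> P x) l)"
    using split_ten_arr[OF sub, of P "\<lambda>x. P x \<or> Q x"] split_ten_arr[OF sub, of Q "\<lambda>x. \<not> P x"] by simp_all
  have IH: "asc V ?P ?Q ?R \<cdot> ((?s \<odot> Idt V ?R) \<cdot> ?s') = (Idt V ?P \<odot> ?t) \<cdot> ?t'"
    using Cons.IH by simp
  \<comment> \<open>The group of the new name decides which groups it crosses: none, the first, or
    the first two. The cases rest on \<open>pentagon_inv\<close>, \<open>swap_first_asc_left\<close>
    and \<open>swap_first_asc_right\<close> respectively.\<close>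
  consider "P n" "\<not> Q n" | "\<not> P n" "Q n" | "\<not> P n" "\<not> Q n" using assms by blast
  then show ?case
  proof cases
    case 1
    have "asc V (?n \<otimes> ?P) ?Q ?R \<cdot> (((inv_arr V (asc V ?n ?P ?Q) \<cdot> (Idt V ?n \<odot> ?s)) \<odot> Idt V ?R) \<cdot>
        (inv_arr V (asc V ?n (ten V (filter (\<lambda>x. P x \<or> Q x) l)) ?R) \<cdot> (Idt V ?n \<odot> ?s'))) =
      asc V (?n \<otimes> ?P) ?Q ?R \<cdot> ((inv_arr V (asc V ?n ?P ?Q) \<odot> Idt V ?R) \<cdot>
        ((((Idt V ?n \<odot> ?s) \<odot> Idt V ?R) \<cdot>
        (inv_arr V (asc V ?n (ten V (filter (\<lambda>x. P x \<or> Q x) l)) ?R))) \<cdot> (Idt V ?n \<odot> ?s')))"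
      by simp
    also have "\<dots> = (asc V (?n \<otimes> ?P) ?Q ?R \<cdot> ((inv_arr V (asc V ?n ?P ?Q) \<odot> Idt V ?R) \<cdot> inv_arr V (asc V ?n (?P \<otimes> ?Q) ?R))) \<cdot>
        (Idt V ?n \<odot> ((?s \<odot> Idt V ?R) \<cdot> ?s'))"
      using inv_asc_nat[of "Idt V ?n" ?s "Idt V ?R" ?n "?P \<otimes> ?Q" ?R, symmetric] by simp
    also have "\<dots> = inv_arr V (asc V ?n ?P (?Q \<otimes> ?R)) \<cdot> (Idt V ?n \<odot> ((Idt V ?P \<odot> ?t) \<cdot> ?t'))"
      by (subst pentagon_inv) (simp_all add: IH)
    also have "\<dots> = (inv_arr V (asc V ?n ?P (?Q \<otimes> ?R)) \<cdot> (Idt V ?n \<odot> (Idt V ?P \<odot> ?t))) \<cdot> (Idt V ?n \<odot> ?t')"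
      by simp
    also have "\<dots> = (Idt V (?n \<otimes> ?P) \<odot> ?t) \<cdot> (inv_arr V (asc V ?n ?P (ten V (filter (\<lambda>x. \<not> P x) l))) \<cdot> (Idt V ?n \<odot> ?t'))"
      by (subst inv_asc_nat) simp_all
    finally show ?thesis using 1 by (simp add: conj_commute)
  next
    case 2
    have "asc V ?P (?n \<otimes> ?Q) ?R \<cdot> (((swap_first V ?n ?P ?Q \<cdot> (Idt V ?n \<odot> ?s)) \<odot> Idt V ?R) \<cdot>
        (inv_arr V (asc V ?n (ten V (filter (\<lambda>x. P x \<or> Q x) l)) ?R) \<cdot> (Idt V ?n \<odot> ?s'))) =
      asc V ?P (?n \<otimes> ?Q) ?R \<cdot> ((swap_first V ?n ?P ?Q \<odot> Idt V ?R) \<cdot>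
        ((((Idt V ?n \<odot> ?s) \<odot> Idt V ?R) \<cdot>
        (inv_arr V (asc V ?n (ten V (filter (\<lambda>x. P x \<or> Q x) l)) ?R))) \<cdot> (Idt V ?n \<odot> ?s')))"
      by simp
    also have "\<dots> = (asc V ?P (?n \<otimes> ?Q) ?R \<cdot> ((swap_first V ?n ?P ?Q \<odot> Idt V ?R) \<cdot> inv_arr V (asc V ?n (?P \<otimes> ?Q) ?R))) \<cdot>
        (Idt V ?n \<odot> ((?s \<odot> Idt V ?R) \<cdot> ?s'))"
      using inv_asc_nat[of "Idt V ?n" ?s "Idt V ?R" ?n "?P \<otimes> ?Q" ?R, symmetric] by simp
    also have "\<dots> = (Idt V ?P \<odot> inv_arr V (asc V ?n ?Q ?R)) \<cdot> (swap_first V ?n ?P (?Q \<otimes> ?R) \<cdot> (Idt V ?n \<odot> ((Idt V ?P \<odot> ?t) \<cdot> ?t')))"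
      by (subst swap_first_asc_left) (simp_all add: IH)
    also have "\<dots> = (Idt V ?P \<odot> inv_arr V (asc V ?n ?Q ?R)) \<cdot> ((swap_first V ?n ?P (?Q \<otimes> ?R) \<cdot> (Idt V ?n \<odot> (Idt V ?P \<odot> ?t))) \<cdot> (Idt V ?n \<odot> ?t'))"
      by simp
    also have "\<dots> = (Idt V ?P \<odot> (inv_arr V (asc V ?n ?Q ?R) \<cdot> (Idt V ?n \<odot> ?t))) \<cdot> (swap_first V ?n ?P (ten V (filter (\<lambda>x. \<not> P x) l)) \<cdot> (Idt V ?n \<odot> ?t'))"
      by (subst swap_first_nat) simp_all
    finally show ?thesis using 2 by (simp add: conj_commute)
  next
    case 3
    have "asc V ?P ?Q (?n \<otimes> ?R) \<cdot> ((?s \<odot> Idt V (?n \<otimes> ?R)) \<cdot>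
        (swap_first V ?n (ten V (filter (\<lambda>x. P x \<or> Q x) l)) ?R \<cdot> (Idt V ?n \<odot> ?s'))) =
      asc V ?P ?Q (?n \<otimes> ?R) \<cdot> (((?s \<odot> (Idt V ?n \<odot> Idt V ?R)) \<cdot>
        swap_first V ?n (ten V (filter (\<lambda>x. P x \<or> Q x) l)) ?R) \<cdot> (Idt V ?n \<odot> ?s'))"
      by simp
    also have "\<dots> = (asc V ?P ?Q (?n \<otimes> ?R) \<cdot> swap_first V ?n (?P \<otimes> ?Q) ?R) \<cdot> (Idt V ?n \<odot> ((?s \<odot> Idt V ?R) \<cdot> ?s'))"
      using swap_first_nat[of "Idt V ?n" ?s "Idt V ?R" ?n "?P \<otimes> ?Q" ?R, symmetric] by simp
    also have "\<dots> = (Idt V ?P \<odot> swap_first V ?n ?Q ?R) \<cdot> (swap_first V ?n ?P (?Q \<otimes> ?R) \<cdot> (Idt V ?n \<odot> ((Idt V ?P \<odot> ?t) \<cdot> ?t')))"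
      by (subst swap_first_asc_right) (simp_all add: IH)
    also have "\<dots> = (Idt V ?P \<odot> swap_first V ?n ?Q ?R) \<cdot> ((swap_first V ?n ?P (?Q \<otimes> ?R) \<cdot> (Idt V ?n \<odot> (Idt V ?P \<odot> ?t))) \<cdot> (Idt V ?n \<odot> ?t'))"
      by simp
    also have "\<dots> = (Idt V ?P \<odot> (swap_first V ?n ?Q ?R \<cdot> (Idt V ?n \<odot> ?t))) \<cdot> (swap_first V ?n ?P (ten V (filter (\<lambda>x. \<not> P x) l)) \<cdot> (Idt V ?n \<odot> ?t'))"
      by (subst swap_first_nat) simp_all
    finally show ?thesis using 3 by (simp add: conj_commute)
  qed
qed

end

text \<open>An element \<open>(S, x)\<close> of \<open>X\<close> is an arrow \<open>x\<close> to \<open>X\<close> from the tensor product of the names in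
  \<open>S\<close>. Pairing requires disjoint sets of names, expressed by \<open>dj\<close>; arrows out of a tensor product
  are then determined by their values at tuples of distinct variables.\<close>

type_synonym ('o, 'm) elt = "('o \<times> nat) set \<times> 'm"

definition elt :: "('o, 'm) smc \<Rightarrow> ('o, 'm) elt \<Rightarrow> bool" where
  "elt V x \<longleftrightarrow> finite (fst x) \<and> fst ` fst x \<subseteq> Obj V \<and> snd x \<in> Arr V \<and>
     Dom V (snd x) = ten V (enum (fst x))"

definition ty :: "('o, 'm) smc \<Rightarrow> ('o, 'm) elt \<Rightarrow> 'o" where
  "ty V x = Cod V (snd x)"

definition act :: "('o, 'm) smc \<Rightarrow> 'm \<Rightarrow> ('o, 'm) elt \<Rightarrow> ('o, 'm) elt"  (infixr "\<star>\<index>" 64) where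
  "f \<star>\<^bsub>V\<^esub> x = (fst x, f \<cdot>\<^bsub>V\<^esub> snd x)"

definition par :: "('o, 'm) smc \<Rightarrow> ('o, 'm) elt \<Rightarrow> ('o, 'm) elt \<Rightarrow> ('o, 'm) elt"  (infixr "\<parallel>\<index>" 63) where
  "x \<parallel>\<^bsub>V\<^esub> y = (fst x \<union> fst y,
     (snd x \<odot>\<^bsub>V\<^esub> snd y) \<cdot>\<^bsub>V\<^esub> split_ten V (\<lambda>n. n \<in> fst x) (enum (fst x \<union> fst y)))"

definition unit_elt :: "('o, 'm) smc \<Rightarrow> ('o, 'm) elt" where
  "unit_elt V = ({}, Idt V \<one>\<^bsub>V\<^esub>)"

text \<open>The tensor product of a one-element list still ends in the unit, so it is
  \<open>fst n \<otimes> \<one>\<close> and the variable itself is a right unitor.\<close>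

definition var :: "('o, 'm) smc \<Rightarrow> 'o \<times> nat \<Rightarrow> ('o, 'm) elt" where
  "var V n = ({n}, run V (fst n))"

definition dj :: "('o, 'm) elt \<Rightarrow> ('o, 'm) elt \<Rightarrow> bool" where
  "dj x y \<longleftrightarrow> fst x \<inter> fst y = {}"

lemma fst_elt [simp]:
  "fst (f \<star>\<^bsub>V\<^esub> x) = fst x" "fst (x \<parallel>\<^bsub>V\<^esub> y) = fst x \<union> fst y" "fst (unit_elt V) = {}" "fst (var V n) = {n}"
  by (simp_all add: act_def par_def unit_elt_def var_def)

lemma dj_simps [simp]:
  "dj (f \<star>\<^bsub>V\<^esub> x) y \<longleftrightarrow> dj x y" "dj y (f \<star>\<^bsub>V\<^esub> x) \<longleftrightarrow> dj y x"
  "dj (x \<parallel>\<^bsub>V\<^esub> y) z \<longleftrightarrow> dj x z \<and> dj y z" "dj z (x \<parallel>\<^bsub>V\<^esub> y) \<longleftrightarrow> dj z x \<and> dj z y"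
  "dj (unit_elt V) y" "dj y (unit_elt V)"
  by (auto simp: dj_def)

section \<open>Calculus of elements: action of arrows, pairing and extensionality\<close>

context symmetric_monoidal_closed
begin

lemma elt_act [simp]:
  assumes "elt V x" "f \<in> Arr V" "Dom V f = ty V x"
  shows "elt V (f \<star> x)" "ty V (f \<star> x) = Cod V f"
  using assms by (simp_all add: elt_def ty_def act_def)

lemma elt_ty [simp]: "elt V x \<Longrightarrow> ty V x \<in> Obj V"
  by (simp add: elt_def ty_def)

lemma elt_unit [simp]: "elt V (unit_elt V)" "ty V (unit_elt V) = \<one>"
  by (simp_all add: elt_def ty_def unit_elt_def)

lemma elt_var [simp]:
  assumes "fst n \<in> Obj V"
  shows "elt V (var V n)" "ty V (var V n) = fst n"
  using assms by (simp_all add: elt_def ty_def var_def)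

lemma split_enum:
  assumes "finite S" "finite T" "S \<inter> T = {}" "fst ` S \<subseteq> Obj V" "fst ` T \<subseteq> Obj V"
  shows "split_ten V (\<lambda>n. n \<in> S) (enum (S \<union> T)) \<in> Arr V"
    "Dom V (split_ten V (\<lambda>n. n \<in> S) (enum (S \<union> T))) = ten V (enum (S \<union> T))"
    "Cod V (split_ten V (\<lambda>n. n \<in> S) (enum (S \<union> T))) = ten V (enum S) \<otimes> ten V (enum T)"
    "is_iso V (split_ten V (\<lambda>n. n \<in> S) (enum (S \<union> T)))"
proof -
  have "{n \<in> S \<union> T. n \<in> S} = S" "{n \<in> S \<union> T. n \<notin> S} = T" using assms by auto
  then show "split_ten V (\<lambda>n. n \<in> S) (enum (S \<union> T)) \<in> Arr V"
    "Dom V (split_ten V (\<lambda>n. n \<in> S) (enum (S \<union> T))) = ten V (enum (S \<union> T))"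
    "Cod V (split_ten V (\<lambda>n. n \<in> S) (enum (S \<union> T))) = ten V (enum S) \<otimes> ten V (enum T)"
    "is_iso V (split_ten V (\<lambda>n. n \<in> S) (enum (S \<union> T)))"
    using assms split_ten_arr[of "enum (S \<union> T)" "\<lambda>n. n \<in> S"]
    by (simp_all add: enum filter_enum image_Un del: split_ten_arr)
qed

lemma ten_enum_Obj [simp]: "finite S \<Longrightarrow> fst ` S \<subseteq> Obj V \<Longrightarrow> ten V (enum S) \<in> Obj V"
  by (simp add: enum)

lemma elt_par [simp]:
  assumes "elt V x" "elt V y" "dj x y"
  shows "elt V (x \<parallel> y)" "ty V (x \<parallel> y) = ty V x \<otimes> ty V y"
  using assms split_enum[of "fst x" "fst y"]
  by (simp_all add: elt_def ty_def par_def dj_def image_Un)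

lemma act_Comp [simp]:
  assumes "elt V x" "f \<in> Arr V" "g \<in> Arr V" "Dom V g = Cod V f" "Dom V f = ty V x"
  shows "(g \<cdot> f) \<star> x = g \<star> (f \<star> x)"
  using assms by (simp add: elt_def ty_def act_def)

lemma act_Idt [simp]: "elt V x \<Longrightarrow> ty V x = X \<Longrightarrow> Idt V X \<star> x = x"
  by (simp add: elt_def ty_def act_def)

lemma act_TenA [simp]:
  assumes "elt V x" "elt V y" "dj x y" "f \<in> Arr V" "g \<in> Arr V" "Dom V f = ty V x" "Dom V g = ty V y"
  shows "(f \<odot> g) \<star> (x \<parallel> y) = f \<star> x \<parallel> g \<star> y"
proof -
  let ?s = "split_ten V (\<lambda>n. n \<in> fst x) (enum (fst x \<union> fst y))"
  have "(f \<odot> g) \<cdot> ((snd x \<odot> snd y) \<cdot> ?s) = ((f \<cdot> snd x) \<odot> (g \<cdot> snd y)) \<cdot> ?s"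
    using assms split_enum[of "fst x" "fst y"] by (subst TenA_merge) (simp_all add: elt_def ty_def dj_def)
  then show ?thesis by (simp add: act_def par_def)
qed

lemma split_ten_cong:
  "(\<And>n. n \<in> set l \<Longrightarrow> P n = Q n) \<Longrightarrow> split_ten V P l = split_ten V Q l"
proof (induction l)
  case (Cons n l)
  then have "filter P l = filter Q l" "filter (\<lambda>x. \<not> P x) l = filter (\<lambda>x. \<not> Q x) l"
    by (auto intro!: filter_cong)
  then show ?case using Cons by simp
qed simp

text \<open>Both pairs have the same domain because a union does not depend on the order of its
  parts. Only the unshuffles differ, and \<open>split_ten_braid\<close> relates them.\<close>

lemma act_braid [simp]:
  assumes "elt V x" "elt V y" "dj x y" "ty V x = X" "ty V y = Y"
  shows "braid V X Y \<star> (x \<parallel> y) = y \<parallel> x"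
proof -
  let ?l = "enum (fst x \<union> fst y)"
  let ?s = "split_ten V (\<lambda>n. n \<in> fst x) ?l" and ?t = "split_ten V (\<lambda>n. n \<in> fst y) ?l"
  have x: "finite (fst x)" "finite (fst y)" "fst x \<inter> fst y = {}" "fst ` fst x \<subseteq> Obj V" "fst ` fst y \<subseteq> Obj V"
    "snd x \<in> Arr V" "Dom V (snd x) = ten V (enum (fst x))" "Cod V (snd x) = X"
    "snd y \<in> Arr V" "Dom V (snd y) = ten V (enum (fst y))" "Cod V (snd y) = Y"
    using assms by (auto simp: elt_def ty_def dj_def)
  have l: "set ?l = fst x \<union> fst y" "fst ` set ?l \<subseteq> Obj V" using x by (simp_all add: enum image_Un)
  have sub: "{n \<in> fst x \<union> fst y. n \<in> fst x} = fst x" "{n \<in> fst x \<union> fst y. n \<notin> fst x} = fst y"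
    using x(3) by auto
  have f: "filter (\<lambda>n. n \<in> fst x) ?l = enum (fst x)" "filter (\<lambda>n. n \<notin> fst x) ?l = enum (fst y)"
    by (simp_all only: filter_enum[OF finite_UnI[OF x(1,2)]] sub)
  have "?t = split_ten V (\<lambda>n. n \<notin> fst x) ?l"
    using x(3) l(1) by (intro split_ten_cong) auto
  then have t: "?t = braid V (ten V (enum (fst x))) (ten V (enum (fst y))) \<cdot> ?s"
    using split_ten_braid[OF l(2), of "\<lambda>n. n \<in> fst x"] by (simp add: f)
  have "(snd y \<odot> snd x) \<cdot> ?t = braid V X Y \<cdot> ((snd x \<odot> snd y) \<cdot> ?s)"
    using x split_enum[of "fst x" "fst y"] Cod_Obj[of "snd x"] Cod_Obj[of "snd y"] unfolding t
    by (subst Comp_reassoc[OF braid_nat]) simp_all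
  then show ?thesis by (simp add: act_def par_def Un_commute[of "fst y" "fst x"])
qed

text \<open>Both bracketings start from the enumeration of the triple union;
  \<open>split_ten_asc\<close> relates their two ways of separating the names of \<open>x\<close>,
  \<open>y\<close> and \<open>z\<close>.\<close>

lemma act_asc [simp]:
  assumes "elt V x" "elt V y" "elt V z" "dj x y" "dj y z" "dj x z" "ty V x = X" "ty V y = Y" "ty V z = Z"
  shows "asc V X Y Z \<star> ((x \<parallel> y) \<parallel> z) = x \<parallel> (y \<parallel> z)"
proof -
  let ?l = "enum (fst x \<union> (fst y \<union> fst z))"
  let ?s = "split_ten V (\<lambda>n. n \<in> fst x) (enum (fst x \<union> fst y))"
    and ?s' = "split_ten V (\<lambda>n. n \<in> fst x \<or> n \<in> fst y) ?l"
    and ?t = "split_ten V (\<lambda>n. n \<in> fst y) (enum (fst y \<union> fst z))"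
    and ?t' = "split_ten V (\<lambda>n. n \<in> fst x) ?l"
  have x: "finite (fst x)" "finite (fst y)" "finite (fst z)" "fst x \<inter> fst y = {}" "fst x \<inter> fst z = {}"
    "fst y \<inter> fst z = {}" "fst ` fst x \<subseteq> Obj V" "fst ` fst y \<subseteq> Obj V" "fst ` fst z \<subseteq> Obj V"
    "snd x \<in> Arr V" "Dom V (snd x) = ten V (enum (fst x))" "Cod V (snd x) = X"
    "snd y \<in> Arr V" "Dom V (snd y) = ten V (enum (fst y))" "Cod V (snd y) = Y"
    "snd z \<in> Arr V" "Dom V (snd z) = ten V (enum (fst z))" "Cod V (snd z) = Z"
    using assms by (auto simp: elt_def ty_def dj_def)
  have l: "fst ` set ?l \<subseteq> Obj V" using x by (simp add: enum image_Un)
  have "{n \<in> fst x \<union> (fst y \<union> fst z). n \<in> fst x} = fst x"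
    "{n \<in> fst x \<union> (fst y \<union> fst z). n \<in> fst y} = fst y"
    "{n \<in> fst x \<union> (fst y \<union> fst z). n \<notin> fst x \<and> n \<notin> fst y} = fst z"
    "{n \<in> fst x \<union> (fst y \<union> fst z). n \<in> fst x \<or> n \<in> fst y} = fst x \<union> fst y"
    "{n \<in> fst x \<union> (fst y \<union> fst z). n \<notin> fst x} = fst y \<union> fst z"
    using x(4-6) by auto
  then have f: "filter (\<lambda>n. n \<in> fst x) ?l = enum (fst x)" "filter (\<lambda>n. n \<in> fst y) ?l = enum (fst y)"
    "filter (\<lambda>n. n \<notin> fst x \<and> n \<notin> fst y) ?l = enum (fst z)"
    "filter (\<lambda>n. n \<in> fst x \<or> n \<in> fst y) ?l = enum (fst x \<union> fst y)"
    "filter (\<lambda>n. n \<notin> fst x) ?l = enum (fst y \<union> fst z)"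
    using x(1-3) by (simp_all add: filter_enum)
  have arrs: "?s \<in> Arr V" "Dom V ?s = ten V (enum (fst x \<union> fst y))" "Cod V ?s = ten V (enum (fst x)) \<otimes> ten V (enum (fst y))"
    "?t \<in> Arr V" "Dom V ?t = ten V (enum (fst y \<union> fst z))" "Cod V ?t = ten V (enum (fst y)) \<otimes> ten V (enum (fst z))"
    "?s' \<in> Arr V" "Dom V ?s' = ten V ?l" "Cod V ?s' = ten V (enum (fst x \<union> fst y)) \<otimes> ten V (enum (fst z))"
    "?t' \<in> Arr V" "Dom V ?t' = ten V ?l" "Cod V ?t' = ten V (enum (fst x)) \<otimes> ten V (enum (fst y \<union> fst z))"
    using x l split_enum[of "fst x" "fst y"] split_enum[of "fst y" "fst z"]
      split_ten_arr[OF l, of "\<lambda>n. n \<in> fst x \<or> n \<in> fst y"] split_ten_arr[OF l, of "\<lambda>n. n \<in> fst x"]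
    by (simp_all add: f del: split_ten_arr)
  have obs: "X \<in> Obj V" "Y \<in> Obj V" "Z \<in> Obj V" "ten V (enum (fst x)) \<in> Obj V" "ten V (enum (fst y)) \<in> Obj V"
    "ten V (enum (fst z)) \<in> Obj V" "ten V (enum (fst x \<union> fst y)) \<in> Obj V" "ten V (enum (fst y \<union> fst z)) \<in> Obj V"
    using assms x by (auto simp: image_Un)
  have "asc V X Y Z \<cdot> ((((snd x \<odot> snd y) \<cdot> ?s) \<odot> snd z) \<cdot> ?s') =
      asc V X Y Z \<cdot> (((snd x \<odot> snd y) \<odot> snd z) \<cdot> ((?s \<odot> Idt V (ten V (enum (fst z)))) \<cdot> ?s'))"
    using x arrs obs by simp
  also have "\<dots> = (snd x \<odot> (snd y \<odot> snd z)) \<cdot> (asc V (ten V (enum (fst x))) (ten V (enum (fst y))) (ten V (enum (fst z))) \<cdot>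
      ((?s \<odot> Idt V (ten V (enum (fst z)))) \<cdot> ?s'))"
    using x arrs obs by (subst Comp_reassoc[OF asc_nat]) simp_all
  also have "asc V (ten V (enum (fst x))) (ten V (enum (fst y))) (ten V (enum (fst z))) \<cdot>
      ((?s \<odot> Idt V (ten V (enum (fst z)))) \<cdot> ?s') = (Idt V (ten V (enum (fst x))) \<odot> ?t) \<cdot> ?t'"
    using split_ten_asc[OF _ l, of "\<lambda>n. n \<in> fst x" "\<lambda>n. n \<in> fst y"] x(4)
    by (simp only: f) blast
  also have "(snd x \<odot> (snd y \<odot> snd z)) \<cdot> \<dots> = (snd x \<odot> ((snd y \<odot> snd z) \<cdot> ?t)) \<cdot> ?t'"
    using x arrs obs by simp
  finally show ?thesis by (simp add: act_def par_def Un_assoc)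
qed

lemma act_lun [simp]:
  assumes "elt V x" "ty V x = X"
  shows "lun V X \<star> (unit_elt V \<parallel> x) = x"
proof -
  have x: "finite (fst x)" "fst ` fst x \<subseteq> Obj V" "snd x \<in> Arr V" "Dom V (snd x) = ten V (enum (fst x))" "Cod V (snd x) = X"
    using assms by (auto simp: elt_def ty_def)
  have "lun V X \<cdot> ((Idt V \<one> \<odot> snd x) \<cdot> inv_arr V (lun V (ten V (enum (fst x))))) =
     snd x \<cdot> (lun V (ten V (enum (fst x))) \<cdot> inv_arr V (lun V (ten V (enum (fst x)))))"
    using x Cod_Obj[OF x(3)] by (subst Comp_reassoc[OF lun_nat]) simp_all
  also have "\<dots> = snd x" using x by simp
  finally show ?thesis
    using x by (simp add: act_def par_def unit_elt_def split_ten_False enum prod_eq_iff)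
qed

lemma act_run [simp]:
  assumes "elt V x" "ty V x = X"
  shows "run V X \<star> (x \<parallel> unit_elt V) = x"
proof -
  have [simp]: "X \<in> Obj V" using assms by auto
  have "run V X \<star> (x \<parallel> unit_elt V) = (lun V X \<cdot> braid V X \<one>) \<star> (x \<parallel> unit_elt V)"
    by (simp add: lun_braid)
  also have "\<dots> = x" using assms by simp
  finally show ?thesis .
qed

lemma act_inv_eqI:
  assumes "is_iso V f" "elt V x" "ty V x = Dom V f" "f \<star> x = y"
  shows "inv_arr V f \<star> y = x"
  using assms is_iso_arr[OF assms(1)] by (auto simp flip: act_Comp)

lemma act_inv [simp]:
  assumes "elt V x" "ty V x = X"
  shows "inv_arr V (lun V X) \<star> x = unit_elt V \<parallel> x" "inv_arr V (run V X) \<star> x = x \<parallel> unit_elt V"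
  using assms by (auto intro!: act_inv_eqI)

lemma act_inv_asc [simp]:
  assumes "elt V x" "elt V y" "elt V z" "dj x y" "dj y z" "dj x z" "ty V x = X" "ty V y = Y" "ty V z = Z"
  shows "inv_arr V (asc V X Y Z) \<star> (x \<parallel> (y \<parallel> z)) = (x \<parallel> y) \<parallel> z"
  using assms by (auto intro!: act_inv_eqI)

lemma act_inv_inverse [simp]:
  assumes "is_iso V f" "elt V x"
  shows "ty V x = Dom V f \<Longrightarrow> inv_arr V f \<star> (f \<star> x) = x" "ty V x = Cod V f \<Longrightarrow> f \<star> (inv_arr V f \<star> x) = x"
  using assms is_iso_arr[OF assms(1)] by (simp_all flip: act_Comp)

text \<open>A generic element is a universal one: being invertible, it can be cancelled, so an
  equation tested on it holds between arrows.\<close>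

definition generic :: "('o, 'm) elt \<Rightarrow> bool" where
  "generic x \<longleftrightarrow> elt V x \<and> is_iso V (snd x)"

lemma generic_var: "fst n \<in> Obj V \<Longrightarrow> generic (var V n)"
  by (simp add: generic_def) (simp add: var_def)

lemma generic_par: "generic x \<Longrightarrow> generic y \<Longrightarrow> dj x y \<Longrightarrow> generic (x \<parallel> y)"
  using split_enum[of "fst x" "fst y"] is_iso_arr[of "snd x"] is_iso_arr[of "snd y"]
  by (simp add: generic_def) (auto simp: par_def elt_def dj_def intro!: is_iso_Comp)

lemma generic_ext:
  assumes "generic x" "f \<star> x = g \<star> x" "f \<in> Arr V" "g \<in> Arr V" "Dom V f = ty V x" "Dom V g = ty V x"
  shows "f = g"
  using assms by (intro iso_epic[of "snd x" f g]) (auto simp: generic_def act_def ty_def)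

lemma ext1:
  assumes "f \<in> hom V X Y" "g \<in> hom V X Y"
    and "\<And>x. elt V x \<Longrightarrow> ty V x = X \<Longrightarrow> f \<star> x = g \<star> x"
  shows "f = g"
proof -
  have "X \<in> Obj V" using assms(1) by (auto simp: hom_iff)
  then show ?thesis
    using assms by (intro generic_ext[OF generic_var[of "(X, 0)"]]) (auto simp: hom_iff)
qed

lemma ext2:
  assumes "f \<in> hom V (X \<otimes> Y) Z" "g \<in> hom V (X \<otimes> Y) Z" "X \<in> Obj V" "Y \<in> Obj V"
    and "\<And>x y. elt V x \<Longrightarrow> elt V y \<Longrightarrow> ty V x = X \<Longrightarrow> ty V y = Y \<Longrightarrow> dj x y \<Longrightarrow> dj y x \<Longrightarrow>
      f \<star> (x \<parallel> y) = g \<star> (x \<parallel> y)"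
  shows "f = g"
proof -
  \<comment> \<open>The numbers keep the two names distinct even when \<open>X = Y\<close>.\<close>
  let ?x = "var V (X, 0)" and ?y = "var V (Y, 1)"
  have "dj ?x ?y" "dj ?y ?x" by (simp_all add: dj_def)
  then show ?thesis
    using assms by (intro generic_ext[of "?x \<parallel> ?y" f g] generic_par generic_var) (auto simp: hom_iff)
qed

lemma ext3:
  assumes "f \<in> hom V ((X \<otimes> Y) \<otimes> Z) W" "g \<in> hom V ((X \<otimes> Y) \<otimes> Z) W"
    "X \<in> Obj V" "Y \<in> Obj V" "Z \<in> Obj V"
    and "\<And>x y z. elt V x \<Longrightarrow> elt V y \<Longrightarrow> elt V z \<Longrightarrow> ty V x = X \<Longrightarrow> ty V y = Y \<Longrightarrow> ty V z = Z \<Longrightarrow>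
      dj x y \<Longrightarrow> dj y x \<Longrightarrow> dj x z \<Longrightarrow> dj z x \<Longrightarrow> dj y z \<Longrightarrow> dj z y \<Longrightarrow>
      f \<star> ((x \<parallel> y) \<parallel> z) = g \<star> ((x \<parallel> y) \<parallel> z)"
  shows "f = g"
proof -
  let ?x = "var V (X, 0)" and ?y = "var V (Y, 1)" and ?z = "var V (Z, 2)"
  have "dj ?x ?y" "dj ?y ?x" "dj ?x ?z" "dj ?z ?x" "dj ?y ?z" "dj ?z ?y" by (simp_all add: dj_def)
  then show ?thesis
    using assms by (intro generic_ext[of "(?x \<parallel> ?y) \<parallel> ?z" f g] generic_par generic_var) (auto simp: hom_iff)
qed

lemma curry_arr:
  assumes "f \<in> Arr V" "Dom V f = Z \<otimes> X" "Z \<in> Obj V" "X \<in> Obj V"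
  shows "curry_arr V Z X f \<in> Arr V" "Dom V (curry_arr V Z X f) = Z"
    "Cod V (curry_arr V Z X f) = ihom V X (Cod V f)"
    "ev V X (Cod V f) \<cdot> (curry_arr V Z X f \<odot> Idt V X) = f"
proof -
  have "\<exists>!g. g \<in> hom V Z (ihom V X (Cod V f)) \<and> ev V X (Cod V f) \<cdot> (g \<odot> Idt V X) = f"
    using assms by (intro closed) (auto simp: hom_iff)
  from theI'[OF this] show "curry_arr V Z X f \<in> Arr V" "Dom V (curry_arr V Z X f) = Z"
    "Cod V (curry_arr V Z X f) = ihom V X (Cod V f)"
    "ev V X (Cod V f) \<cdot> (curry_arr V Z X f \<odot> Idt V X) = f"
    by (auto simp: curry_arr_def hom_iff)
qed

declare curry_arr(1-3) [simp]

lemma app_curry [simp]: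
  assumes "f \<in> Arr V" "Dom V f = Z \<otimes> X" "Cod V f = Y" "elt V z" "elt V x" "dj z x" "ty V z = Z" "ty V x = X"
  shows "ev V X Y \<star> (curry_arr V Z X f \<star> z \<parallel> x) = f \<star> (z \<parallel> x)"
proof -
  have o: "Z \<in> Obj V" "X \<in> Obj V" "Y \<in> Obj V" using assms by auto
  have "ev V X Y \<star> (curry_arr V Z X f \<star> z \<parallel> x) = (ev V X Y \<cdot> (curry_arr V Z X f \<odot> Idt V X)) \<star> (z \<parallel> x)"
    using assms o by simp
  also have "\<dots> = f \<star> (z \<parallel> x)" using curry_arr(4)[OF assms(1,2) o(1,2)] assms(3) by simp
  finally show ?thesis .
qed

text \<open>Functional extensionality with free variables. As \<open>h\<close> and \<open>k\<close>
  use the same finitely many names, a fresh variable of \<open>X\<close> exists; the context of the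
  pair is then isomorphic to the context of \<open>h\<close> tensored with \<open>X\<close>, where
  transposes are unique.\<close>

lemma elt_ihom_ext:
  assumes "elt V h" "elt V k" "fst h = fst k" "ty V h = ihom V X Y" "ty V k = ihom V X Y" "X \<in> Obj V" "Y \<in> Obj V"
    and *: "\<And>x. elt V x \<Longrightarrow> ty V x = X \<Longrightarrow> dj h x \<Longrightarrow> dj x h \<Longrightarrow> dj k x \<Longrightarrow> dj x k \<Longrightarrow>
      ev V X Y \<star> (h \<parallel> x) = ev V X Y \<star> (k \<parallel> x)"
  shows "h = k"
proof -
  have fin: "finite (fst h)" using assms(1) by (simp add: elt_def)
  obtain n where "n \<notin> snd ` fst h" using ex_new_if_finite[of "snd ` fst h"] fin by auto
  then have n: "(X, n) \<notin> fst h" by force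
  let ?x = "var V (X, n)" and ?s = "split_ten V (\<lambda>m. m \<in> fst h) (enum (fst h \<union> {(X, n)}))"
  have x: "elt V ?x" "ty V ?x = X" using assms by auto
  have d: "dj h ?x" "dj ?x h" "dj k ?x" "dj ?x k" using n assms(3) by (auto simp: dj_def)
  have hk: "snd h \<in> Arr V" "snd k \<in> Arr V" "Dom V (snd h) = ten V (enum (fst h))" "Dom V (snd k) = ten V (enum (fst h))"
    "Cod V (snd h) = ihom V X Y" "Cod V (snd k) = ihom V X Y" "fst ` fst h \<subseteq> Obj V"
    using assms by (auto simp: elt_def ty_def)
  have s: "?s \<in> Arr V" "Cod V ?s = ten V (enum (fst h)) \<otimes> (X \<otimes> \<one>)" "is_iso V ?s"
    using split_enum[of "fst h" "{(X, n)}"] n fin hk assms by auto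
  have "ev V X Y \<cdot> ((snd h \<odot> run V X) \<cdot> ?s) = ev V X Y \<cdot> ((snd k \<odot> run V X) \<cdot> ?s)"
    using *[OF x d] assms(3) by (simp add: act_def par_def var_def)
  then have "(ev V X Y \<cdot> (snd h \<odot> Idt V X)) \<cdot> ((Idt V (ten V (enum (fst h))) \<odot> run V X) \<cdot> ?s) =
      (ev V X Y \<cdot> (snd k \<odot> Idt V X)) \<cdot> ((Idt V (ten V (enum (fst h))) \<odot> run V X) \<cdot> ?s)"
    using hk s assms fin by simp
  then have e: "ev V X Y \<cdot> (snd h \<odot> Idt V X) = ev V X Y \<cdot> (snd k \<odot> Idt V X)"
    by (rule iso_epic[rotated]) (use hk s assms fin in \<open>auto intro!: is_iso_Comp\<close>)
  have "\<exists>!g. g \<in> hom V (ten V (enum (fst h))) (ihom V X Y) \<and> ev V X Y \<cdot> (g \<odot> Idt V X) = ev V X Y \<cdot> (snd h \<odot> Idt V X)"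
    using hk assms fin by (intro closed) (auto simp: hom_iff)
  then have "snd h = snd k" using hk e by (auto simp: hom_iff)
  then show ?thesis using assms(3) by (simp add: prod_eq_iff)
qed

lemma ihom_ext:
  assumes "f \<in> hom V Z (ihom V X Y)" "g \<in> hom V Z (ihom V X Y)" "X \<in> Obj V" "Y \<in> Obj V"
    and *: "\<And>z x. elt V z \<Longrightarrow> ty V z = Z \<Longrightarrow> elt V x \<Longrightarrow> ty V x = X \<Longrightarrow> dj z x \<Longrightarrow> dj x z \<Longrightarrow>
      ev V X Y \<star> (f \<star> z \<parallel> x) = ev V X Y \<star> (g \<star> z \<parallel> x)"
  shows "f = g"
  using assms(1,2)
proof (rule ext1)
  fix z assume z: "elt V z" "ty V z = Z"
  show "f \<star> z = g \<star> z"
    by (rule elt_ihom_ext[where X=X and Y=Y]) (use z assms in \<open>auto simp: hom_iff\<close>)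
qed

lemma name_of_arr [simp]:
  assumes "f \<in> Arr V"
  shows "name_of V f \<in> Arr V" "Dom V (name_of V f) = \<one>" "Cod V (name_of V f) = ihom V (Dom V f) (Cod V f)"
  using assms by (simp_all add: name_of_def)

lemma app_name_of [simp]:
  assumes "f \<in> Arr V" "elt V x" "ty V x = X" "Dom V f = X" "Cod V f = Y"
  shows "ev V X Y \<star> (name_of V f \<star> unit_elt V \<parallel> x) = f \<star> x"
  using assms by (auto simp: name_of_def)

lemma ihom_pre_arr [simp]:
  assumes "f \<in> Arr V" "Y \<in> Obj V"
  shows "ihom_pre V f Y \<in> Arr V" "Dom V (ihom_pre V f Y) = ihom V (Cod V f) Y"
    "Cod V (ihom_pre V f Y) = ihom V (Dom V f) Y"
  using assms by (simp_all add: ihom_pre_def)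

lemma app_ihom_pre [simp]:
  assumes "f \<in> Arr V" "Y \<in> Obj V" "elt V h" "ty V h = ihom V (Cod V f) Y" "elt V x" "ty V x = X" "dj h x" "Dom V f = X"
  shows "ev V X Y \<star> (ihom_pre V f Y \<star> h \<parallel> x) = ev V (Cod V f) Y \<star> (h \<parallel> f \<star> x)"
  using assms by (auto simp: ihom_pre_def)

end

section \<open>Enriched categories in terms of elements\<close>

context enriched_category
begin

declare EHom_Obj [simp]

lemma EComp_arr [simp]:
  assumes "x \<in> EOb A" "y \<in> EOb A" "z \<in> EOb A"
  shows "EComp A x y z \<in> Arr V" "Dom V (EComp A x y z) = EHom A y z \<otimes> EHom A x y"
    "Cod V (EComp A x y z) = EHom A x z"
  using EComp_hom[OF assms] by (auto simp: hom_iff)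

lemma EId_arr [simp]:
  assumes "x \<in> EOb A"
  shows "EId A x \<in> Arr V" "Dom V (EId A x) = \<one>" "Cod V (EId A x) = EHom A x x"
  using EId_hom[OF assms] by (auto simp: hom_iff)

lemma comp_assoc:
  assumes "w \<in> EOb A" "x \<in> EOb A" "y \<in> EOb A" "z \<in> EOb A" "elt V h" "elt V g" "elt V f"
    "ty V h = EHom A y z" "ty V g = EHom A x y" "ty V f = EHom A w x" "dj h g" "dj g f" "dj h f"
  shows "EComp A w x z \<star> (EComp A x y z \<star> (h \<parallel> g) \<parallel> f) = EComp A w y z \<star> (h \<parallel> EComp A w x y \<star> (g \<parallel> f))"
proof -
  have "(EComp A w x z \<cdot> (EComp A x y z \<odot> Idt V (EHom A w x))) \<star> ((h \<parallel> g) \<parallel> f) =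
    (EComp A w y z \<cdot> (Idt V (EHom A y z) \<odot> EComp A w x y) \<cdot>
        asc V (EHom A y z) (EHom A x y) (EHom A w x)) \<star> ((h \<parallel> g) \<parallel> f)"
    using assms by (simp only: EComp_assoc)
  then show ?thesis using assms by simp
qed

lemma comp_id:
  assumes "x \<in> EOb A" "y \<in> EOb A" "elt V f" "ty V f = EHom A x y"
  shows "EComp A x y y \<star> (EId A y \<star> unit_elt V \<parallel> f) = f" "EComp A x x y \<star> (f \<parallel> EId A x \<star> unit_elt V) = f"
proof -
  have "(EComp A x y y \<cdot> (EId A y \<odot> Idt V (EHom A x y))) \<star> (unit_elt V \<parallel> f) = lun V (EHom A x y) \<star> (unit_elt V \<parallel> f)"
    "(EComp A x x y \<cdot> (Idt V (EHom A x y) \<odot> EId A x)) \<star> (f \<parallel> unit_elt V) = run V (EHom A x y) \<star> (f \<parallel> unit_elt V)"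
    using assms by (simp_all only: EId_left EId_right)
  then show "EComp A x y y \<star> (EId A y \<star> unit_elt V \<parallel> f) = f" "EComp A x x y \<star> (f \<parallel> EId A x \<star> unit_elt V) = f"
    using assms by simp_all
qed

end

context symmetric_monoidal_closed
begin

text \<open>Associativity is tested on triples of elements. The unit laws are first composed with
  inverse unitors, because testing on a variable of \<open>\<one>\<close> would not produce the
  \<open>unit_elt V\<close> of the hypotheses.\<close>

lemma enriched_categoryI:
  assumes ob: "\<And>x y. x \<in> EOb A \<Longrightarrow> y \<in> EOb A \<Longrightarrow> EHom A x y \<in> Obj V"
    and comp: "\<And>x y z. x \<in> EOb A \<Longrightarrow> y \<in> EOb A \<Longrightarrow> z \<in> EOb A \<Longrightarrow>
      EComp A x y z \<in> hom V (EHom A y z \<otimes> EHom A x y) (EHom A x z)"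
    and id: "\<And>x. x \<in> EOb A \<Longrightarrow> EId A x \<in> hom V \<one> (EHom A x x)"
    and assoc: "\<And>w x y z h g f. w \<in> EOb A \<Longrightarrow> x \<in> EOb A \<Longrightarrow> y \<in> EOb A \<Longrightarrow> z \<in> EOb A \<Longrightarrow>
      elt V h \<Longrightarrow> elt V g \<Longrightarrow> elt V f \<Longrightarrow>
      ty V h = EHom A y z \<Longrightarrow> ty V g = EHom A x y \<Longrightarrow> ty V f = EHom A w x \<Longrightarrow>
      dj h g \<Longrightarrow> dj g h \<Longrightarrow> dj g f \<Longrightarrow> dj f g \<Longrightarrow> dj h f \<Longrightarrow> dj f h \<Longrightarrow>
      EComp A w x z \<star> (EComp A x y z \<star> (h \<parallel> g) \<parallel> f) = EComp A w y z \<star> (h \<parallel> EComp A w x y \<star> (g \<parallel> f))"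
    and idl: "\<And>x y f. x \<in> EOb A \<Longrightarrow> y \<in> EOb A \<Longrightarrow> elt V f \<Longrightarrow> ty V f = EHom A x y \<Longrightarrow>
      EComp A x y y \<star> (EId A y \<star> unit_elt V \<parallel> f) = f"
    and idr: "\<And>x y f. x \<in> EOb A \<Longrightarrow> y \<in> EOb A \<Longrightarrow> elt V f \<Longrightarrow> ty V f = EHom A x y \<Longrightarrow>
      EComp A x x y \<star> (f \<parallel> EId A x \<star> unit_elt V) = f"
  shows "enriched_category V A"
proof -
  have cd: "EComp A x y z \<in> Arr V" "Dom V (EComp A x y z) = EHom A y z \<otimes> EHom A x y"
    "Cod V (EComp A x y z) = EHom A x z" if "x \<in> EOb A" "y \<in> EOb A" "z \<in> EOb A" for x y z
    using comp[OF that] by (auto simp: hom_iff)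
  have idd: "EId A x \<in> Arr V" "Dom V (EId A x) = \<one>" "Cod V (EId A x) = EHom A x x"
    if "x \<in> EOb A" for x using id[OF that] by (auto simp: hom_iff)
  show ?thesis
  proof
    fix w x y z assume xs: "w \<in> EOb A" "x \<in> EOb A" "y \<in> EOb A" "z \<in> EOb A"
    show "EComp A w x z \<cdot> (EComp A x y z \<odot> Idt V (EHom A w x)) =
      EComp A w y z \<cdot> (Idt V (EHom A y z) \<odot> EComp A w x y) \<cdot>
        asc V (EHom A y z) (EHom A x y) (EHom A w x)"
      by (rule ext3) (use xs in \<open>auto simp: hom_iff cd ob assoc\<close>)
  next
    fix x y assume xs: "x \<in> EOb A" "y \<in> EOb A"
    have "(EComp A x y y \<cdot> (EId A y \<odot> Idt V (EHom A x y))) \<cdot> inv_arr V (lun V (EHom A x y)) = Idt V (EHom A x y)"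
      by (rule ext1) (use xs in \<open>auto simp: hom_iff cd ob idd idl\<close>)
    then have "((EComp A x y y \<cdot> (EId A y \<odot> Idt V (EHom A x y))) \<cdot> inv_arr V (lun V (EHom A x y))) \<cdot> lun V (EHom A x y)
       = lun V (EHom A x y)" using xs by (simp add: ob)
    then show "EComp A x y y \<cdot> (EId A y \<odot> Idt V (EHom A x y)) = lun V (EHom A x y)"
      using xs by (simp add: cd ob idd)
  next
    fix x y assume xs: "x \<in> EOb A" "y \<in> EOb A"
    have "(EComp A x x y \<cdot> (Idt V (EHom A x y) \<odot> EId A x)) \<cdot> inv_arr V (run V (EHom A x y)) = Idt V (EHom A x y)"
      by (rule ext1) (use xs in \<open>auto simp: hom_iff cd ob idd idr\<close>)
    then have "((EComp A x x y \<cdot> (Idt V (EHom A x y) \<odot> EId A x)) \<cdot> inv_arr V (run V (EHom A x y))) \<cdot> run V (EHom A x y)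
       = run V (EHom A x y)" using xs by (simp add: ob)
    then show "EComp A x x y \<cdot> (Idt V (EHom A x y) \<odot> EId A x) = run V (EHom A x y)"
      using xs by (simp add: cd ob idd)
  qed (use ob comp id in auto)
qed

lemma self_simps [simp]: "EOb (self V) = Obj V" "EHom (self V) = ihom V"
  by (simp_all add: self_def)

lemma self_comp [simp]:
  assumes "X \<in> Obj V" "Y \<in> Obj V" "Z \<in> Obj V"
  shows "EComp (self V) X Y Z \<in> Arr V" "Dom V (EComp (self V) X Y Z) = ihom V Y Z \<otimes> ihom V X Y"
    "Cod V (EComp (self V) X Y Z) = ihom V X Z"
    "elt V h \<Longrightarrow> elt V g \<Longrightarrow> elt V x \<Longrightarrow> ty V h = ihom V Y Z \<Longrightarrow> ty V g = ihom V X Y \<Longrightarrow> ty V x = X \<Longrightarrow>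
      dj h g \<Longrightarrow> dj g x \<Longrightarrow> dj h x \<Longrightarrow>
      ev V X Z \<star> (EComp (self V) X Y Z \<star> (h \<parallel> g) \<parallel> x) = ev V Y Z \<star> (h \<parallel> ev V X Y \<star> (g \<parallel> x))"
  using assms by (simp_all add: self_def)

lemma self_id [simp]:
  assumes "X \<in> Obj V"
  shows "EId (self V) X \<in> Arr V" "Dom V (EId (self V) X) = \<one>" "Cod V (EId (self V) X) = ihom V X X"
    "elt V x \<Longrightarrow> ty V x = X \<Longrightarrow> ev V X X \<star> (EId (self V) X \<star> unit_elt V \<parallel> x) = x"
  using assms by (simp_all add: self_def)

lemma enriched_self: "enriched_category V (self V)"
proof (rule enriched_categoryI)
  fix w x y z h g f assume *: "w \<in> EOb (self V)" "x \<in> EOb (self V)" "y \<in> EOb (self V)" "z \<in> EOb (self V)"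
      "elt V h" "elt V g" "elt V f"
      "ty V h = EHom (self V) y z" "ty V g = EHom (self V) x y" "ty V f = EHom (self V) w x"
      "dj h g" "dj g h" "dj g f" "dj f g" "dj h f" "dj f h"
  show "EComp (self V) w x z \<star> (EComp (self V) x y z \<star> (h \<parallel> g) \<parallel> f) =
      EComp (self V) w y z \<star> (h \<parallel> EComp (self V) w x y \<star> (g \<parallel> f))"
    by (rule elt_ihom_ext[where X=w and Y=z]) (use * in \<open>auto simp: Un_assoc\<close>)
next
  fix x y f assume *: "x \<in> EOb (self V)" "y \<in> EOb (self V)" "elt V f" "ty V f = EHom (self V) x y"
  show "EComp (self V) x y y \<star> (EId (self V) y \<star> unit_elt V \<parallel> f) = f"
    by (rule elt_ihom_ext[where X=x and Y=y]) (use * in auto)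
  show "EComp (self V) x x y \<star> (f \<parallel> EId (self V) x \<star> unit_elt V) = f"
    by (rule elt_ihom_ext[where X=x and Y=y]) (use * in auto)
qed (auto simp: hom_iff)

end

section \<open>Opposites, enriched functors and representables\<close>

context enriched_category
begin

lemma op_simps [simp]:
  "EOb (op_cat V A) = EOb A" "EHom (op_cat V A) x y = EHom A y x" "EId (op_cat V A) = EId A"
  by (simp_all add: op_cat_def)

lemma op_comp [simp]:
  assumes "x \<in> EOb A" "y \<in> EOb A" "z \<in> EOb A"
  shows "EComp (op_cat V A) x y z \<in> Arr V" "Dom V (EComp (op_cat V A) x y z) = EHom A z y \<otimes> EHom A y x"
    "Cod V (EComp (op_cat V A) x y z) = EHom A z x"
    "elt V g \<Longrightarrow> elt V f \<Longrightarrow> ty V g = EHom A z y \<Longrightarrow> ty V f = EHom A y x \<Longrightarrow> dj g f \<Longrightarrow>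
      EComp (op_cat V A) x y z \<star> (g \<parallel> f) = EComp A z y x \<star> (f \<parallel> g)"
proof -
  show "EComp (op_cat V A) x y z \<in> Arr V" "Dom V (EComp (op_cat V A) x y z) = EHom A z y \<otimes> EHom A y x"
    "Cod V (EComp (op_cat V A) x y z) = EHom A z x"
    using assms by (simp_all add: op_cat_def)
  show "EComp (op_cat V A) x y z \<star> (g \<parallel> f) = EComp A z y x \<star> (f \<parallel> g)"
    if "elt V g" "elt V f" "ty V g = EHom A z y" "ty V f = EHom A y x" "dj g f"
    using assms that by (simp add: op_cat_def)
qed

lemma enriched_op: "enriched_category V (op_cat V A)"
  by (rule enriched_categoryI) (auto simp: hom_iff comp_assoc comp_id)

end

lemma mk_efun_simps [simp]:
  "x \<in> EOb A \<Longrightarrow> EFo (mk_efun A fo fh) x = fo x"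
  "x \<in> EOb A \<Longrightarrow> y \<in> EOb A \<Longrightarrow> EFh (mk_efun A fo fh) x y = fh x y"
  by (simp_all add: mk_efun_def)

lemma mk_efun_extensional [simp]:
  "EFo (mk_efun A fo fh) \<in> extensional (EOb A)"
  "case_prod (EFh (mk_efun A fo fh)) \<in> extensional (EOb A \<times> EOb A)"
  by (auto simp: mk_efun_def extensional_def)

locale enriched_fun = A: enriched_category V A + B: enriched_category V B
  for V :: "('o, 'm) smc" (structure) and A :: "('x, 'o, 'm) ecat" and B :: "('y, 'o, 'm) ecat" +
  fixes F :: "('x, 'y, 'm) efun"
  assumes F: "enriched_functor V A B F"
begin

lemma Fo [simp]: "x \<in> EOb A \<Longrightarrow> EFo F x \<in> EOb B"
  using F by (simp add: enriched_functor_def)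

lemma Fh [simp]:
  assumes "x \<in> EOb A" "y \<in> EOb A"
  shows "EFh F x y \<in> Arr V" "Dom V (EFh F x y) = EHom A x y" "Cod V (EFh F x y) = EHom B (EFo F x) (EFo F y)"
  using F assms by (auto simp: enriched_functor_def A.hom_iff)

lemma Fh_comp:
  assumes "x \<in> EOb A" "y \<in> EOb A" "z \<in> EOb A" "elt V g" "elt V f" "ty V g = EHom A y z" "ty V f = EHom A x y" "dj g f"
  shows "EFh F x z \<star> (EComp A x y z \<star> (g \<parallel> f)) =
    EComp B (EFo F x) (EFo F y) (EFo F z) \<star> (EFh F y z \<star> g \<parallel> EFh F x y \<star> f)"
proof -
  have "(EFh F x z \<cdot> EComp A x y z) \<star> (g \<parallel> f) =
      (EComp B (EFo F x) (EFo F y) (EFo F z) \<cdot> (EFh F y z \<odot> EFh F x y)) \<star> (g \<parallel> f)"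
    using F assms(1-3) by (simp add: enriched_functor_def)
  then show ?thesis using assms by simp
qed

lemma Fh_id:
  assumes "x \<in> EOb A"
  shows "EFh F x x \<star> (EId A x \<star> unit_elt V) = EId B (EFo F x) \<star> unit_elt V"
proof -
  have "(EFh F x x \<cdot> EId A x) \<star> unit_elt V = EId B (EFo F x) \<star> unit_elt V"
    using F assms by (simp add: enriched_functor_def)
  then show ?thesis using assms by simp
qed

end

lemma enriched_funI:
  "enriched_category V A \<Longrightarrow> enriched_category V B \<Longrightarrow> enriched_functor V A B F \<Longrightarrow> enriched_fun V A B F"
  by (simp add: enriched_fun_def enriched_fun_axioms_def)

lemma mk_enriched_fun:
  assumes "enriched_category V A" "enriched_category V B"
    and ob: "\<And>x. x \<in> EOb A \<Longrightarrow> fo x \<in> EOb B"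
    and arr: "\<And>x y. x \<in> EOb A \<Longrightarrow> y \<in> EOb A \<Longrightarrow> fh x y \<in> hom V (EHom A x y) (EHom B (fo x) (fo y))"
    and comp: "\<And>x y z g f. x \<in> EOb A \<Longrightarrow> y \<in> EOb A \<Longrightarrow> z \<in> EOb A \<Longrightarrow> elt V g \<Longrightarrow> elt V f \<Longrightarrow>
      ty V g = EHom A y z \<Longrightarrow> ty V f = EHom A x y \<Longrightarrow> dj g f \<Longrightarrow> dj f g \<Longrightarrow>
      fh x z \<star>\<^bsub>V\<^esub> (EComp A x y z \<star>\<^bsub>V\<^esub> (g \<parallel>\<^bsub>V\<^esub> f)) = EComp B (fo x) (fo y) (fo z) \<star>\<^bsub>V\<^esub> (fh y z \<star>\<^bsub>V\<^esub> g \<parallel>\<^bsub>V\<^esub> fh x y \<star>\<^bsub>V\<^esub> f)"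
    and id: "\<And>x. x \<in> EOb A \<Longrightarrow> fh x x \<star>\<^bsub>V\<^esub> (EId A x \<star>\<^bsub>V\<^esub> unit_elt V) = EId B (fo x) \<star>\<^bsub>V\<^esub> unit_elt V"
  shows "enriched_fun V A B (mk_efun A fo fh)"
proof -
  interpret A: enriched_category V A by fact
  interpret B: enriched_category V B by fact
  have fh: "fh x y \<in> Arr V" "Dom V (fh x y) = EHom A x y" "Cod V (fh x y) = EHom B (fo x) (fo y)"
    if "x \<in> EOb A" "y \<in> EOb A" for x y using arr[OF that] by (auto simp: A.hom_iff)
  have "enriched_functor V A B (mk_efun A fo fh)"
    unfolding enriched_functor_def
  proof (intro conjI ballI)
    fix x y z assume xs: "x \<in> EOb A" "y \<in> EOb A" "z \<in> EOb A"
    have "fh x z \<cdot>\<^bsub>V\<^esub> EComp A x y z = EComp B (fo x) (fo y) (fo z) \<cdot>\<^bsub>V\<^esub> (fh y z \<odot>\<^bsub>V\<^esub> fh x y)"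
      by (rule A.ext2) (use xs in \<open>auto simp: A.hom_iff fh ob comp\<close>)
    then show "EFh (mk_efun A fo fh) x z \<cdot>\<^bsub>V\<^esub> EComp A x y z =
      EComp B (EFo (mk_efun A fo fh) x) (EFo (mk_efun A fo fh) y) (EFo (mk_efun A fo fh) z) \<cdot>\<^bsub>V\<^esub>
      (EFh (mk_efun A fo fh) y z \<odot>\<^bsub>V\<^esub> EFh (mk_efun A fo fh) x y)" using xs by simp
  next
    fix x assume x: "x \<in> EOb A"
    have "snd (fh x x \<star>\<^bsub>V\<^esub> (EId A x \<star>\<^bsub>V\<^esub> unit_elt V)) = snd (EId B (fo x) \<star>\<^bsub>V\<^esub> unit_elt V)"
      using id[OF x] by simp
    then show "EFh (mk_efun A fo fh) x x \<cdot>\<^bsub>V\<^esub> EId A x = EId B (EFo (mk_efun A fo fh) x)"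
      using x ob[OF x] by (simp add: act_def unit_elt_def fh)
  qed (auto simp: fh ob A.hom_iff)
  then show ?thesis using assms(1,2) by (rule enriched_funI[rotated 2])
qed

context enriched_category
begin

lemma rep_fun:
  assumes "a \<in> EOb A"
  shows "enriched_fun V A (self V) (rep V A a)"
  unfolding rep_def
proof (rule mk_enriched_fun)
  show "enriched_category V A" ..
  show "enriched_category V (self V)" by (rule enriched_self)
next
  fix x y z g f
  assume *: "x \<in> EOb A" "y \<in> EOb A" "z \<in> EOb A" "elt V g" "elt V f" "ty V g = EHom A y z" "ty V f = EHom A x y"
    "dj g f" "dj f g"
  show "curry_arr V (EHom A x z) (EHom A a x) (EComp A a x z) \<star> (EComp A x y z \<star> (g \<parallel> f)) =
    EComp (self V) (EHom A a x) (EHom A a y) (EHom A a z) \<star>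
     (curry_arr V (EHom A y z) (EHom A a y) (EComp A a y z) \<star> g \<parallel>
      curry_arr V (EHom A x y) (EHom A a x) (EComp A a x y) \<star> f)"
    by (rule elt_ihom_ext[where X = "EHom A a x" and Y = "EHom A a z"]) (use assms * in \<open>auto simp: comp_assoc\<close>)
next
  fix x assume *: "x \<in> EOb A"
  show "curry_arr V (EHom A x x) (EHom A a x) (EComp A a x x) \<star> (EId A x \<star> unit_elt V) =
    EId (self V) (EHom A a x) \<star> unit_elt V"
    by (rule elt_ihom_ext[where X = "EHom A a x" and Y = "EHom A a x"]) (use assms * in \<open>auto simp: comp_id\<close>)
qed (use assms in \<open>auto simp: hom_iff\<close>)

lemma rep_simps [simp]:
  assumes "a \<in> EOb A" "b \<in> EOb A"
  shows "EFo (rep V A a) b = EHom A a b"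
    "c \<in> EOb A \<Longrightarrow> elt V g \<Longrightarrow> elt V f \<Longrightarrow> ty V g = EHom A b c \<Longrightarrow> ty V f = EHom A a b \<Longrightarrow> dj g f \<Longrightarrow>
      ev V (EHom A a b) (EHom A a c) \<star> (EFh (rep V A a) b c \<star> g \<parallel> f) = EComp A a b c \<star> (g \<parallel> f)"
  using assms by (simp_all add: rep_def)

end

lemma comp_fun_fun:
  assumes "enriched_fun V A B F" "enriched_fun V B D G"
  shows "enriched_fun V A D (comp_fun V A G F)"
proof -
  interpret F: enriched_fun V A B F by fact
  interpret G: enriched_fun V B D G by fact
  show ?thesis unfolding comp_fun_def
    by (rule mk_enriched_fun)
      (auto simp: F.A.hom_iff F.Fh_comp F.Fh_id G.Fh_comp G.Fh_id
         F.A.enriched_category_axioms G.B.enriched_category_axioms)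
qed

lemma comp_fun_simps [simp]:
  "x \<in> EOb A \<Longrightarrow> EFo (comp_fun V A G F) x = EFo G (EFo F x)"
  "x \<in> EOb A \<Longrightarrow> y \<in> EOb A \<Longrightarrow> EFh (comp_fun V A G F) x y = EFh G (EFo F x) (EFo F y) \<cdot>\<^bsub>V\<^esub> EFh F x y"
  by (simp_all add: comp_fun_def)

lemma op_fun_simps [simp]: "EFo (op_fun F) = EFo F" "EFh (op_fun F) x y = EFh F y x"
  by (simp_all add: op_fun_def)

lemma op_fun_fun:
  assumes "enriched_fun V A B F"
  shows "enriched_fun V (op_cat V A) (op_cat V B) (op_fun F)"
proof -
  interpret F: enriched_fun V A B F by fact
  have "enriched_functor V (op_cat V A) (op_cat V B) (op_fun F)"
    unfolding enriched_functor_def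
  proof (intro conjI ballI)
    show "case_prod (EFh (op_fun F)) \<in> extensional (EOb (op_cat V A) \<times> EOb (op_cat V A))"
      using F.F by (auto simp: enriched_functor_def extensional_def)
    show "EFo (op_fun F) \<in> extensional (EOb (op_cat V A))"
      using F.F by (auto simp: enriched_functor_def)
  next
    fix x y z assume xs: "x \<in> EOb (op_cat V A)" "y \<in> EOb (op_cat V A)" "z \<in> EOb (op_cat V A)"
    show "EFh (op_fun F) x z \<cdot>\<^bsub>V\<^esub> EComp (op_cat V A) x y z =
      EComp (op_cat V B) (EFo (op_fun F) x) (EFo (op_fun F) y) (EFo (op_fun F) z) \<cdot>\<^bsub>V\<^esub>
      (EFh (op_fun F) y z \<odot>\<^bsub>V\<^esub> EFh (op_fun F) x y)"
      by (rule F.A.ext2) (use xs in \<open>auto simp: F.A.hom_iff F.Fh_comp\<close>)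
  next
    fix x assume "x \<in> EOb (op_cat V A)"
    then show "EFh (op_fun F) x x \<cdot>\<^bsub>V\<^esub> EId (op_cat V A) x = EId (op_cat V B) (EFo (op_fun F) x)"
      using F.F by (simp add: enriched_functor_def)
  qed (auto simp: F.A.hom_iff)
  then show ?thesis using F.A.enriched_op F.B.enriched_op by (rule enriched_funI[rotated 2])
qed

section \<open>Ends and natural transformations\<close>

lemma (in symmetric_monoidal_closed) ext3':
  assumes "f \<in> hom V (X \<otimes> (Y \<otimes> Z)) W" "g \<in> hom V (X \<otimes> (Y \<otimes> Z)) W"
    "X \<in> Obj V" "Y \<in> Obj V" "Z \<in> Obj V"
    and "\<And>x y z. elt V x \<Longrightarrow> elt V y \<Longrightarrow> elt V z \<Longrightarrow> ty V x = X \<Longrightarrow> ty V y = Y \<Longrightarrow> ty V z = Z \<Longrightarrow>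
      dj x y \<Longrightarrow> dj y x \<Longrightarrow> dj x z \<Longrightarrow> dj z x \<Longrightarrow> dj y z \<Longrightarrow> dj z y \<Longrightarrow>
      f \<star> (x \<parallel> (y \<parallel> z)) = g \<star> (x \<parallel> (y \<parallel> z))"
  shows "f = g"
proof -
  have "f \<cdot> asc V X Y Z = g \<cdot> asc V X Y Z"
    by (rule ext3[where X=X and Y=Y and Z=Z and W=W]) (use assms(1-5) in \<open>auto simp: hom_iff assms(6)\<close>)
  then show ?thesis by (rule iso_epic[rotated]) (use assms in \<open>auto simp: hom_iff\<close>)
qed

text \<open>Records exactly the typing that wedges and ends refer to, so that ends can be treated
  without proving that \<open>F\<close> is a functor on the tensor category.\<close>

definition bif :: "('o, 'm) smc \<Rightarrow> ('x, 'o, 'm) ecat \<Rightarrow> ('x \<times> 'x, 'o, 'm) efun \<Rightarrow> bool" where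
  "bif V A F \<longleftrightarrow> (\<forall>a\<in>EOb A. \<forall>b\<in>EOb A. EFo F (a, b) \<in> Obj V \<and>
     covariant_action V A F a a b \<in> hom V (EHom A a b) (ihom V (EFo F (a, a)) (EFo F (a, b))) \<and>
     contravariant_action V A F a b b \<in> hom V (EHom A a b) (ihom V (EFo F (b, b)) (EFo F (a, b))))"

context enriched_category
begin

lemma bif_simps:
  assumes "bif V A F" "a \<in> EOb A" "b \<in> EOb A"
  shows "EFo F (a, b) \<in> Obj V" "covariant_action V A F a a b \<in> Arr V"
    "Dom V (covariant_action V A F a a b) = EHom A a b"
    "Cod V (covariant_action V A F a a b) = ihom V (EFo F (a, a)) (EFo F (a, b))"
    "contravariant_action V A F a b b \<in> Arr V"
    "Dom V (contravariant_action V A F a b b) = EHom A a b"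
    "Cod V (contravariant_action V A F a b b) = ihom V (EFo F (b, b)) (EFo F (a, b))"
  using assms by (auto simp: bif_def hom_iff)

lemma wedgeI:
  assumes F: "bif V A F"
    and ty: "\<And>a. a \<in> EOb A \<Longrightarrow> \<sigma> a \<in> hom V Z (EFo F (a, a))"
    and eq: "\<And>a b \<alpha> z. a \<in> EOb A \<Longrightarrow> b \<in> EOb A \<Longrightarrow> elt V \<alpha> \<Longrightarrow> ty V \<alpha> = EHom A a b \<Longrightarrow> elt V z \<Longrightarrow> ty V z = Z \<Longrightarrow>
       dj \<alpha> z \<Longrightarrow> dj z \<alpha> \<Longrightarrow>
       ev V (EFo F (a, a)) (EFo F (a, b)) \<star> (covariant_action V A F a a b \<star> \<alpha> \<parallel> \<sigma> a \<star> z) =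
       ev V (EFo F (b, b)) (EFo F (a, b)) \<star> (contravariant_action V A F a b b \<star> \<alpha> \<parallel> \<sigma> b \<star> z)"
  shows "wedge V A F Z \<sigma>"
  unfolding wedge_def
proof (intro conjI ballI ty)
  fix a b assume ab: "a \<in> EOb A" "b \<in> EOb A"
  have s: "\<sigma> c \<in> Arr V" "Dom V (\<sigma> c) = Z" "Cod V (\<sigma> c) = EFo F (c, c)" if "c \<in> EOb A" for c
    using ty[OF that] by (auto simp: hom_iff)
  have Z: "Z \<in> Obj V" using s(1,2)[OF ab(1)] by auto
  note simps = s bif_simps[OF F] ab Z
  show "ihom_pre V (\<sigma> a) (EFo F (a, b)) \<cdot> covariant_action V A F a a b =
    ihom_pre V (\<sigma> b) (EFo F (a, b)) \<cdot> contravariant_action V A F a b b"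
    by (rule ihom_ext[where X = Z and Y = "EFo F (a, b)" and Z = "EHom A a b"])
      (auto simp: simps hom_iff eq)
qed

text \<open>An element of a tensor product need not be a pair. Testing on triples shows that two
  arrows out of the triple tensor product agree, and these may be applied to any element of
  \<open>X \<otimes> Y\<close>.\<close>

lemma wedgeI2:
  assumes F: "bif V A F" and X: "X \<in> Obj V" "Y \<in> Obj V"
    and ty: "\<And>a. a \<in> EOb A \<Longrightarrow> \<sigma> a \<in> hom V (X \<otimes> Y) (EFo F (a, a))"
    and eq: "\<And>a b \<alpha> x y. a \<in> EOb A \<Longrightarrow> b \<in> EOb A \<Longrightarrow> elt V \<alpha> \<Longrightarrow> ty V \<alpha> = EHom A a b \<Longrightarrow>
       elt V x \<Longrightarrow> ty V x = X \<Longrightarrow> elt V y \<Longrightarrow> ty V y = Y \<Longrightarrow>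
       dj \<alpha> x \<Longrightarrow> dj x \<alpha> \<Longrightarrow> dj \<alpha> y \<Longrightarrow> dj y \<alpha> \<Longrightarrow> dj x y \<Longrightarrow> dj y x \<Longrightarrow>
       ev V (EFo F (a, a)) (EFo F (a, b)) \<star> (covariant_action V A F a a b \<star> \<alpha> \<parallel> \<sigma> a \<star> (x \<parallel> y)) =
       ev V (EFo F (b, b)) (EFo F (a, b)) \<star> (contravariant_action V A F a b b \<star> \<alpha> \<parallel> \<sigma> b \<star> (x \<parallel> y))"
  shows "wedge V A F (X \<otimes> Y) \<sigma>"
proof (rule wedgeI[OF F ty])
  have s: "\<sigma> c \<in> Arr V" "Dom V (\<sigma> c) = X \<otimes> Y" "Cod V (\<sigma> c) = EFo F (c, c)" if "c \<in> EOb A" for c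
    using ty[OF that] by (auto simp: hom_iff)
  note simps = s bif_simps[OF F] X
  fix a b \<alpha> z
  assume *: "a \<in> EOb A" "b \<in> EOb A" "elt V \<alpha>" "ty V \<alpha> = EHom A a b" "elt V z" "ty V z = X \<otimes> Y" "dj \<alpha> z" "dj z \<alpha>"
  let ?f = "ev V (EFo F (a, a)) (EFo F (a, b)) \<cdot> (covariant_action V A F a a b \<odot> \<sigma> a)"
    and ?g = "ev V (EFo F (b, b)) (EFo F (a, b)) \<cdot> (contravariant_action V A F a b b \<odot> \<sigma> b)"
  have "?f = ?g"
    by (rule ext3'[of _ "EHom A a b" X Y]) (use * in \<open>auto simp: hom_iff simps eq\<close>)
  then have "?f \<star> (\<alpha> \<parallel> z) = ?g \<star> (\<alpha> \<parallel> z)" by simp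
  then show "ev V (EFo F (a, a)) (EFo F (a, b)) \<star> (covariant_action V A F a a b \<star> \<alpha> \<parallel> \<sigma> a \<star> z) =
       ev V (EFo F (b, b)) (EFo F (a, b)) \<star> (contravariant_action V A F a b b \<star> \<alpha> \<parallel> \<sigma> b \<star> z)"
    using * by (simp add: simps)
qed

lemma wedgeD:
  assumes F: "bif V A F" and w: "wedge V A F Z \<sigma>"
    and a: "a \<in> EOb A" "b \<in> EOb A"
    and z: "elt V \<alpha>" "ty V \<alpha> = EHom A a b" "elt V z" "ty V z = Z" "dj \<alpha> z"
  shows "ev V (EFo F (a, a)) (EFo F (a, b)) \<star> (covariant_action V A F a a b \<star> \<alpha> \<parallel> \<sigma> a \<star> z) =
    ev V (EFo F (b, b)) (EFo F (a, b)) \<star> (contravariant_action V A F a b b \<star> \<alpha> \<parallel> \<sigma> b \<star> z)"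
proof -
  have s: "\<sigma> c \<in> Arr V" "Dom V (\<sigma> c) = Z" "Cod V (\<sigma> c) = EFo F (c, c)" if "c \<in> EOb A" for c
    using w that by (auto simp: wedge_def hom_iff)
  have Z: "Z \<in> Obj V" using z by auto
  note simps = s bif_simps[OF F] a Z z
  have "ev V Z (EFo F (a, b)) \<star> ((ihom_pre V (\<sigma> a) (EFo F (a, b)) \<cdot> covariant_action V A F a a b) \<star> \<alpha> \<parallel> z) =
    ev V Z (EFo F (a, b)) \<star> ((ihom_pre V (\<sigma> b) (EFo F (a, b)) \<cdot> contravariant_action V A F a b b) \<star> \<alpha> \<parallel> z)"
    using w a by (simp add: wedge_def)
  then show ?thesis by (simp add: simps)
qed

lemma wedge_precomp:
  assumes F: "bif V A F" and w: "wedge V A F Z \<sigma>" and h: "h \<in> hom V Y Z"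
  shows "wedge V A F Y (\<lambda>a. \<sigma> a \<cdot> h)"
proof (rule wedgeI[OF F])
  have s: "\<sigma> c \<in> Arr V" "Dom V (\<sigma> c) = Z" "Cod V (\<sigma> c) = EFo F (c, c)" if "c \<in> EOb A" for c
    using w that by (auto simp: wedge_def hom_iff)
  note simps = s h[unfolded hom_iff]
  show "\<sigma> a \<cdot> h \<in> hom V Y (EFo F (a, a))" if "a \<in> EOb A" for a
    using that by (auto simp: hom_iff simps)
  fix a b \<alpha> z
  assume *: "a \<in> EOb A" "b \<in> EOb A" "elt V \<alpha>" "ty V \<alpha> = EHom A a b" "elt V z" "ty V z = Y" "dj \<alpha> z"
  then show "ev V (EFo F (a, a)) (EFo F (a, b)) \<star> (covariant_action V A F a a b \<star> \<alpha> \<parallel> (\<sigma> a \<cdot> h) \<star> z) =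
       ev V (EFo F (b, b)) (EFo F (a, b)) \<star> (contravariant_action V A F a b b \<star> \<alpha> \<parallel> (\<sigma> b \<cdot> h) \<star> z)"
    using wedgeD[OF F w *(1-4), of "h \<star> z"] by (simp add: simps)
qed

end

locale an_end = enriched_category V A
  for V :: "('o, 'm) smc" (structure) and A :: "('x, 'o, 'm) ecat" +
  fixes F :: "('x \<times> 'x, 'o, 'm) efun" and Z :: 'o and \<pi> :: "'x \<Rightarrow> 'm"
  assumes bif: "bif V A F" and is_end: "is_end V A F Z \<pi>"
begin

lemma Z_Obj [simp]: "Z \<in> Obj V"
  using is_end by (simp add: is_end_def)

lemma proj_arr [simp]:
  assumes "a \<in> EOb A"
  shows "\<pi> a \<in> Arr V" "Dom V (\<pi> a) = Z" "Cod V (\<pi> a) = EFo F (a, a)"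
  using is_end assms by (auto simp: is_end_def wedge_def hom_iff)

lemma end_ext:
  assumes "f \<in> hom V Y Z" "g \<in> hom V Y Z" "\<And>a. a \<in> EOb A \<Longrightarrow> \<pi> a \<cdot> f = \<pi> a \<cdot> g"
  shows "f = g"
proof -
  have "wedge V A F Y (\<lambda>a. \<pi> a \<cdot> g)"
    using is_end assms(2) by (intro wedge_precomp[OF bif]) (auto simp: is_end_def)
  moreover have "Y \<in> Obj V" using assms(1) by (auto simp: hom_iff)
  ultimately have "\<exists>!h. h \<in> hom V Y Z \<and> (\<forall>a\<in>EOb A. \<pi> a \<cdot> h = \<pi> a \<cdot> g)"
    using is_end by (auto simp: is_end_def)
  then obtain h where "\<And>k. k \<in> hom V Y Z \<Longrightarrow> (\<forall>a\<in>EOb A. \<pi> a \<cdot> k = \<pi> a \<cdot> g) \<Longrightarrow> k = h"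
    by (elim ex1E) blast
  from this[of f] this[of g] show ?thesis using assms by simp
qed

text \<open>Two elements with the same names are arrows from one object, so joint monicity of the
  projections applies to them.\<close>

lemma elt_end_ext:
  assumes "elt V h" "elt V k" "fst h = fst k" "ty V h = Z" "ty V k = Z"
    "\<And>a. a \<in> EOb A \<Longrightarrow> \<pi> a \<star> h = \<pi> a \<star> k"
  shows "h = k"
proof -
  have "snd h = snd k"
    by (rule end_ext[where Y = "ten V (enum (fst k))"])
      (use assms in \<open>auto simp: elt_def ty_def hom_iff act_def prod_eq_iff\<close>)
  then show ?thesis using assms(3) by (simp add: prod_eq_iff)
qed

lemma end_lift_ex:
  assumes "wedge V A F Y \<sigma>" "Y \<in> Obj V"
  shows "\<exists>!h. h \<in> hom V Y Z \<and> (\<forall>a\<in>EOb A. \<pi> a \<cdot> h = \<sigma> a)"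
  using is_end assms by (auto simp: is_end_def)

end

lemma chosen_end:
  assumes "enriched_category V A" "bif V A F" "has_end V A F"
  shows "an_end V A F (end_obj V A F) (end_proj V A F)"
proof -
  have "\<exists>p. (case p of (Z, \<pi>) \<Rightarrow> is_end V A F Z \<pi>)" using assms(3) by (auto simp: has_end_def)
  from someI_ex[OF this] have "is_end V A F (end_obj V A F) (end_proj V A F)"
    unfolding end_obj_def end_proj_def chosen_end_def case_prod_unfold .
  then show ?thesis using assms by (simp add: an_end_def an_end_axioms_def)
qed

lemma end_lift:
  assumes "enriched_category V A" "bif V A F" "has_end V A F" "wedge V A F Y \<sigma>" "Y \<in> Obj V"
  shows "end_lift V A F Y \<sigma> \<in> Arr V" "Dom V (end_lift V A F Y \<sigma>) = Y"
    "Cod V (end_lift V A F Y \<sigma>) = end_obj V A F"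
    "a \<in> EOb A \<Longrightarrow> end_proj V A F a \<cdot>\<^bsub>V\<^esub> end_lift V A F Y \<sigma> = \<sigma> a"
    "a \<in> EOb A \<Longrightarrow> elt V y \<Longrightarrow> ty V y = Y \<Longrightarrow> end_proj V A F a \<star>\<^bsub>V\<^esub> (end_lift V A F Y \<sigma> \<star>\<^bsub>V\<^esub> y) = \<sigma> a \<star>\<^bsub>V\<^esub> y"
proof -
  interpret an_end V A F "end_obj V A F" "end_proj V A F" by (rule chosen_end[OF assms(1-3)])
  note * = theI'[OF end_lift_ex[OF assms(4,5)], folded end_lift_def]
  show 1: "end_lift V A F Y \<sigma> \<in> Arr V" "Dom V (end_lift V A F Y \<sigma>) = Y"
    "Cod V (end_lift V A F Y \<sigma>) = end_obj V A F" using * by (auto simp: hom_iff)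
  show 2: "end_proj V A F a \<cdot>\<^bsub>V\<^esub> end_lift V A F Y \<sigma> = \<sigma> a" if "a \<in> EOb A" for a using * that by auto
  show "end_proj V A F a \<star>\<^bsub>V\<^esub> (end_lift V A F Y \<sigma> \<star>\<^bsub>V\<^esub> y) = \<sigma> a \<star>\<^bsub>V\<^esub> y"
    if "a \<in> EOb A" "elt V y" "ty V y = Y"
    using that 1 2[OF that(1)] act_Comp[of y "end_lift V A F Y \<sigma>" "end_proj V A F a"] by simp
qed

lemma tensor_Ob [simp]: "EOb (tensor_cat V A B) = EOb A \<times> EOb B"
  by (simp add: tensor_cat_def)

lemma bifunctor_simps [simp]:
  "a \<in> EOb A \<Longrightarrow> b \<in> EOb B \<Longrightarrow> EFo (bifunctor V A B L R) (a, b) = EFo (R a) b"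
  "a \<in> EOb A \<Longrightarrow> b \<in> EOb B \<Longrightarrow> a' \<in> EOb A \<Longrightarrow> b' \<in> EOb B \<Longrightarrow>
     EFh (bifunctor V A B L R) (a, b) (a', b') =
     EComp (self V) (EFo (R a) b) (EFo (R a) b') (EFo (R a') b') \<cdot>\<^bsub>V\<^esub> (EFh (L b') a a' \<odot>\<^bsub>V\<^esub> EFh (R a) b b')"
  by (simp_all add: bifunctor_def)

section \<open>Bifunctors assembled from partial functors\<close>

locale bifun = A: enriched_category V A
  for V :: "('o, 'm) smc" (structure) and A :: "('x, 'o, 'm) ecat" +
  fixes L :: "'x \<Rightarrow> ('x, 'o, 'm) efun" and R :: "'x \<Rightarrow> ('x, 'o, 'm) efun"
  assumes L: "b \<in> EOb A \<Longrightarrow> enriched_fun V (op_cat V A) (self V) (L b)"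
    and R: "a \<in> EOb A \<Longrightarrow> enriched_fun V A (self V) (R a)"
    and LR: "a \<in> EOb A \<Longrightarrow> b \<in> EOb A \<Longrightarrow> EFo (L b) a = EFo (R a) b"
begin

abbreviation "F \<equiv> bifunctor V (op_cat V A) A L R"

text \<open>A partial action feeds an identity into the other variable. Functors preserve
  identities, so that factor of the composite in \<open>self V\<close> disappears.\<close>

lemma actions:
  assumes "a \<in> EOb A" "b \<in> EOb A" "c \<in> EOb A"
  shows "covariant_action V A F a b c = EFh (R a) b c" "contravariant_action V A F a b c = EFh (L c) b a"
proof -
  interpret Ra: enriched_fun V A "self V" "R a" by (rule R) fact
  interpret Rb: enriched_fun V A "self V" "R b" by (rule R) fact
  interpret Lc: enriched_fun V "op_cat V A" "self V" "L c" by (rule L) fact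
  have [simp]: "EFo (R a) b \<in> Obj V" "EFo (R a) c \<in> Obj V" "EFo (R b) c \<in> Obj V" "EFo (L c) a = EFo (R a) c"
    "EFo (L c) b = EFo (R b) c"
    using assms Ra.Fo[of b] Ra.Fo[of c] Rb.Fo[of c] by (auto simp: LR)
  have id1: "EFh (L c) a a \<star> (EId A a \<star> unit_elt V) = EId (self V) (EFo (R a) c) \<star> unit_elt V"
    using Lc.Fh_id[of a] assms by (simp add: LR)
  have id2: "EFh (R b) c c \<star> (EId A c \<star> unit_elt V) = EId (self V) (EFo (R b) c) \<star> unit_elt V"
    using Rb.Fh_id[of c] assms by simp
  show "covariant_action V A F a b c = EFh (R a) b c"
    unfolding covariant_action_def
    by (rule A.ihom_ext[where Z = "EHom A b c" and X = "EFo (R a) b" and Y = "EFo (R a) c"])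
      (use assms in \<open>auto simp: A.hom_iff id1\<close>)
  show "contravariant_action V A F a b c = EFh (L c) b a"
    unfolding contravariant_action_def
    by (rule A.ihom_ext[where Z = "EHom A a b" and X = "EFo (R b) c" and Y = "EFo (R a) c"])
      (use assms in \<open>auto simp: A.hom_iff id2\<close>)
qed

lemma bif: "bif V A F"
  unfolding bif_def
proof (intro ballI conjI)
  fix a b assume [simp]: "a \<in> EOb A" "b \<in> EOb A"
  interpret Ra: enriched_fun V A "self V" "R a" by (rule R) fact
  interpret Lb: enriched_fun V "op_cat V A" "self V" "L b" by (rule L) fact
  show "EFo F (a, b) \<in> Obj V" using Ra.Fo[of b] by simp
  show "covariant_action V A F a a b \<in> hom V (EHom A a b) (ihom V (EFo F (a, a)) (EFo F (a, b)))"
    by (simp add: actions A.hom_iff)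
  show "contravariant_action V A F a b b \<in> hom V (EHom A a b) (ihom V (EFo F (b, b)) (EFo F (a, b)))"
    by (simp add: actions A.hom_iff LR)
qed

lemma wedge_bifunI:
  assumes "\<And>a. a \<in> EOb A \<Longrightarrow> \<sigma> a \<in> hom V Z (EFo (R a) a)"
    "\<And>a b \<alpha> z. a \<in> EOb A \<Longrightarrow> b \<in> EOb A \<Longrightarrow> elt V \<alpha> \<Longrightarrow> ty V \<alpha> = EHom A a b \<Longrightarrow> elt V z \<Longrightarrow> ty V z = Z \<Longrightarrow>
       dj \<alpha> z \<Longrightarrow> dj z \<alpha> \<Longrightarrow>
       ev V (EFo (R a) a) (EFo (R a) b) \<star> (EFh (R a) a b \<star> \<alpha> \<parallel> \<sigma> a \<star> z) =
       ev V (EFo (R b) b) (EFo (R a) b) \<star> (EFh (L b) b a \<star> \<alpha> \<parallel> \<sigma> b \<star> z)"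
  shows "wedge V A F Z \<sigma>"
  using assms by (intro A.wedgeI[OF bif]) (simp_all add: actions)

lemma wedge_bifunI2:
  assumes "X \<in> Obj V" "Y \<in> Obj V" "\<And>a. a \<in> EOb A \<Longrightarrow> \<sigma> a \<in> hom V (X \<otimes> Y) (EFo (R a) a)"
    "\<And>a b \<alpha> x y. a \<in> EOb A \<Longrightarrow> b \<in> EOb A \<Longrightarrow> elt V \<alpha> \<Longrightarrow> ty V \<alpha> = EHom A a b \<Longrightarrow>
       elt V x \<Longrightarrow> ty V x = X \<Longrightarrow> elt V y \<Longrightarrow> ty V y = Y \<Longrightarrow>
       dj \<alpha> x \<Longrightarrow> dj x \<alpha> \<Longrightarrow> dj \<alpha> y \<Longrightarrow> dj y \<alpha> \<Longrightarrow> dj x y \<Longrightarrow> dj y x \<Longrightarrow>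
       ev V (EFo (R a) a) (EFo (R a) b) \<star> (EFh (R a) a b \<star> \<alpha> \<parallel> \<sigma> a \<star> (x \<parallel> y)) =
       ev V (EFo (R b) b) (EFo (R a) b) \<star> (EFh (L b) b a \<star> \<alpha> \<parallel> \<sigma> b \<star> (x \<parallel> y))"
  shows "wedge V A F (X \<otimes> Y) \<sigma>"
  using assms by (intro A.wedgeI2[OF bif]) (simp_all add: actions)

lemma wedge_bifunD:
  assumes "wedge V A F Z \<sigma>" "a \<in> EOb A" "b \<in> EOb A" "elt V \<alpha>" "ty V \<alpha> = EHom A a b" "elt V z" "ty V z = Z" "dj \<alpha> z"
  shows "ev V (EFo (R a) a) (EFo (R a) b) \<star> (EFh (R a) a b \<star> \<alpha> \<parallel> \<sigma> a \<star> z) =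
       ev V (EFo (R b) b) (EFo (R a) b) \<star> (EFh (L b) b a \<star> \<alpha> \<parallel> \<sigma> b \<star> z)"
  using A.wedgeD[OF bif assms] assms by (simp add: actions)

end

locale fun_pair = F: enriched_fun V A B F + G: enriched_fun V A B G
  for V :: "('o, 'm) smc" (structure) and A :: "('x, 'o, 'm) ecat" and B :: "('y, 'o, 'm) ecat"
    and F :: "('x, 'y, 'm) efun" and G :: "('x, 'y, 'm) efun"
begin

lemma nat_bifun: "bifun V A (\<lambda>b. comp_fun V (op_cat V A) (rep V (op_cat V B) (EFo G b)) (op_fun F))
     (\<lambda>a. comp_fun V A (rep V B (EFo F a)) G)"
proof (rule bifun.intro[OF F.A.enriched_category_axioms bifun_axioms.intro])
  fix a b assume a: "a \<in> EOb A" and b: "b \<in> EOb A"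
  interpret op: enriched_category V "op_cat V B" by (rule F.B.enriched_op)
  show "EFo (comp_fun V (op_cat V A) (rep V (op_cat V B) (EFo G b)) (op_fun F)) a =
       EFo (comp_fun V A (rep V B (EFo F a)) G) b"
    using a b by simp
next
  fix a assume a: "a \<in> EOb A"
  show "enriched_fun V A (self V) (comp_fun V A (rep V B (EFo F a)) G)"
    using a by (intro comp_fun_fun[OF G.enriched_fun_axioms] F.B.rep_fun) auto
next
  fix a assume a: "a \<in> EOb A"
  show "enriched_fun V (op_cat V A) (self V) (comp_fun V (op_cat V A) (rep V (op_cat V B) (EFo G a)) (op_fun F))"
    using a by (intro comp_fun_fun[OF op_fun_fun[OF F.enriched_fun_axioms]] enriched_category.rep_fun F.B.enriched_op) auto
qed

lemma bif_nat: "bif V A (nat_bifunctor V A B F G)"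
  unfolding hom_bifunctor_def by (rule bifun.bif[OF nat_bifun])

lemma nat_ob [simp]:
  "a \<in> EOb A \<Longrightarrow> b \<in> EOb A \<Longrightarrow> EFo (nat_bifunctor V A B F G) (a, b) = EHom B (EFo F a) (EFo G b)"
  by (simp add: hom_bifunctor_def)

text \<open>The covariant action of \<open>B(F -, G -)\<close> is postcomposition with the image
  under \<open>G\<close>, and by \<open>nat_right\<close> the contravariant one is precomposition
  with the image under \<open>F\<close>. Thus the wedge condition becomes a naturality
  square.\<close>

lemma nat_left:
  assumes "a \<in> EOb A" "b \<in> EOb A" "elt V \<alpha>" "ty V \<alpha> = EHom A a b"
    "elt V h" "ty V h = EHom B (EFo F a) (EFo G a)" "dj \<alpha> h"
  shows "ev V (EHom B (EFo F a) (EFo G a)) (EHom B (EFo F a) (EFo G b)) \<star>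
       (EFh (comp_fun V A (rep V B (EFo F a)) G) a b \<star> \<alpha> \<parallel> h) =
     EComp B (EFo F a) (EFo G a) (EFo G b) \<star> (EFh G a b \<star> \<alpha> \<parallel> h)"
proof -
  interpret r: enriched_fun V B "self V" "rep V B (EFo F a)" by (rule F.B.rep_fun) (simp add: assms)
  show ?thesis using assms by simp
qed

lemma nat_right:
  assumes "a \<in> EOb A" "b \<in> EOb A" "elt V \<alpha>" "ty V \<alpha> = EHom A a b"
    "elt V h" "ty V h = EHom B (EFo F b) (EFo G b)" "dj \<alpha> h"
  shows "ev V (EHom B (EFo F b) (EFo G b)) (EHom B (EFo F a) (EFo G b)) \<star>
       (EFh (comp_fun V (op_cat V A) (rep V (op_cat V B) (EFo G b)) (op_fun F)) b a \<star> \<alpha> \<parallel> h) =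
     EComp B (EFo F a) (EFo F b) (EFo G b) \<star> (h \<parallel> EFh F a b \<star> \<alpha>)"
proof -
  interpret op: enriched_category V "op_cat V B" by (rule F.B.enriched_op)
  interpret r: enriched_fun V "op_cat V B" "self V" "rep V (op_cat V B) (EFo G b)"
    by (rule op.rep_fun) (simp add: assms)
  show ?thesis
    using assms op.rep_simps(2)[of "EFo G b" "EFo F b" "EFo F a" "EFh F a b \<star> \<alpha>" h] by simp
qed

lemma wedge_natI:
  assumes "\<And>a. a \<in> EOb A \<Longrightarrow> \<sigma> a \<in> hom V Z (EHom B (EFo F a) (EFo G a))"
    "\<And>a b \<alpha> z. a \<in> EOb A \<Longrightarrow> b \<in> EOb A \<Longrightarrow> elt V \<alpha> \<Longrightarrow> ty V \<alpha> = EHom A a b \<Longrightarrow> elt V z \<Longrightarrow> ty V z = Z \<Longrightarrow>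
       dj \<alpha> z \<Longrightarrow> dj z \<alpha> \<Longrightarrow>
       EComp B (EFo F a) (EFo G a) (EFo G b) \<star> (EFh G a b \<star> \<alpha> \<parallel> \<sigma> a \<star> z) =
       EComp B (EFo F a) (EFo F b) (EFo G b) \<star> (\<sigma> b \<star> z \<parallel> EFh F a b \<star> \<alpha>)"
  shows "wedge V A (nat_bifunctor V A B F G) Z \<sigma>"
  unfolding hom_bifunctor_def
proof (rule bifun.wedge_bifunI[OF nat_bifun])
  fix a b \<alpha> z
  assume *: "a \<in> EOb A" "b \<in> EOb A" "elt V \<alpha>" "ty V \<alpha> = EHom A a b" "elt V z" "ty V z = Z" "dj \<alpha> z" "dj z \<alpha>"
  have s: "\<sigma> c \<in> Arr V" "Dom V (\<sigma> c) = Z" "Cod V (\<sigma> c) = EHom B (EFo F c) (EFo G c)" if "c \<in> EOb A" for c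
    using assms(1)[OF that] by (auto simp: F.A.hom_iff)
  show "ev V (EFo (comp_fun V A (rep V B (EFo F a)) G) a) (EFo (comp_fun V A (rep V B (EFo F a)) G) b) \<star>
       (EFh (comp_fun V A (rep V B (EFo F a)) G) a b \<star> \<alpha> \<parallel> \<sigma> a \<star> z) =
     ev V (EFo (comp_fun V A (rep V B (EFo F b)) G) b) (EFo (comp_fun V A (rep V B (EFo F a)) G) b) \<star>
       (EFh (comp_fun V (op_cat V A) (rep V (op_cat V B) (EFo G b)) (op_fun F)) b a \<star> \<alpha> \<parallel> \<sigma> b \<star> z)"
    using * s assms(2)[OF *] by (simp add: nat_left nat_right del: comp_fun_simps(2))
qed (use assms in simp)

lemma wedge_natI2:
  assumes X: "X \<in> Obj V" "Y \<in> Obj V"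
    and ty: "\<And>a. a \<in> EOb A \<Longrightarrow> \<sigma> a \<in> hom V (X \<otimes> Y) (EHom B (EFo F a) (EFo G a))"
    and eq: "\<And>a b \<alpha> x y. a \<in> EOb A \<Longrightarrow> b \<in> EOb A \<Longrightarrow> elt V \<alpha> \<Longrightarrow> ty V \<alpha> = EHom A a b \<Longrightarrow>
       elt V x \<Longrightarrow> ty V x = X \<Longrightarrow> elt V y \<Longrightarrow> ty V y = Y \<Longrightarrow>
       dj \<alpha> x \<Longrightarrow> dj x \<alpha> \<Longrightarrow> dj \<alpha> y \<Longrightarrow> dj y \<alpha> \<Longrightarrow> dj x y \<Longrightarrow> dj y x \<Longrightarrow>
       EComp B (EFo F a) (EFo G a) (EFo G b) \<star> (EFh G a b \<star> \<alpha> \<parallel> \<sigma> a \<star> (x \<parallel> y)) =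
       EComp B (EFo F a) (EFo F b) (EFo G b) \<star> (\<sigma> b \<star> (x \<parallel> y) \<parallel> EFh F a b \<star> \<alpha>)"
  shows "wedge V A (nat_bifunctor V A B F G) (X \<otimes> Y) \<sigma>"
  unfolding hom_bifunctor_def
proof (rule bifun.wedge_bifunI2[OF nat_bifun X])
  fix a b \<alpha> x y
  assume *: "a \<in> EOb A" "b \<in> EOb A" "elt V \<alpha>" "ty V \<alpha> = EHom A a b" "elt V x" "ty V x = X" "elt V y" "ty V y = Y"
    "dj \<alpha> x" "dj x \<alpha>" "dj \<alpha> y" "dj y \<alpha>" "dj x y" "dj y x"
  have s: "\<sigma> c \<in> Arr V" "Dom V (\<sigma> c) = X \<otimes> Y" "Cod V (\<sigma> c) = EHom B (EFo F c) (EFo G c)" if "c \<in> EOb A" for c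
    using ty[OF that] by (auto simp: F.A.hom_iff)
  show "ev V (EFo (comp_fun V A (rep V B (EFo F a)) G) a) (EFo (comp_fun V A (rep V B (EFo F a)) G) b) \<star>
       (EFh (comp_fun V A (rep V B (EFo F a)) G) a b \<star> \<alpha> \<parallel> \<sigma> a \<star> (x \<parallel> y)) =
     ev V (EFo (comp_fun V A (rep V B (EFo F b)) G) b) (EFo (comp_fun V A (rep V B (EFo F a)) G) b) \<star>
       (EFh (comp_fun V (op_cat V A) (rep V (op_cat V B) (EFo G b)) (op_fun F)) b a \<star> \<alpha> \<parallel> \<sigma> b \<star> (x \<parallel> y))"
    using * s eq[OF *] by (simp add: nat_left nat_right del: comp_fun_simps(2))
qed (use ty in simp)

lemma wedge_natD:
  assumes "wedge V A (nat_bifunctor V A B F G) Z \<sigma>"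
    and *: "a \<in> EOb A" "b \<in> EOb A" "elt V \<alpha>" "ty V \<alpha> = EHom A a b" "elt V z" "ty V z = Z" "dj \<alpha> z"
  shows "EComp B (EFo F a) (EFo G a) (EFo G b) \<star> (EFh G a b \<star> \<alpha> \<parallel> \<sigma> a \<star> z) =
       EComp B (EFo F a) (EFo F b) (EFo G b) \<star> (\<sigma> b \<star> z \<parallel> EFh F a b \<star> \<alpha>)"
proof -
  have s: "\<sigma> c \<in> Arr V" "Dom V (\<sigma> c) = Z" "Cod V (\<sigma> c) = EHom B (EFo F c) (EFo G c)" if "c \<in> EOb A" for c
    using assms(1) that by (auto simp: wedge_def F.A.hom_iff)
  show ?thesis
    using bifun.wedge_bifunD[OF nat_bifun assms(1)[unfolded hom_bifunctor_def] *] * s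
    by (simp add: nat_left nat_right del: comp_fun_simps(2))
qed

end

locale nat_end = fun_pair V A B F G + E: an_end V A "nat_bifunctor V A B F G" Z \<pi>
  for V :: "('o, 'm) smc" (structure) and A :: "('x, 'o, 'm) ecat" and B :: "('y, 'o, 'm) ecat"
    and F :: "('x, 'y, 'm) efun" and G :: "('x, 'y, 'm) efun" and Z \<pi>
begin

lemma natural:
  assumes "a \<in> EOb A" "b \<in> EOb A" "elt V \<alpha>" "ty V \<alpha> = EHom A a b" "elt V t" "ty V t = Z" "dj \<alpha> t"
  shows "EComp B (EFo F a) (EFo G a) (EFo G b) \<star> (EFh G a b \<star> \<alpha> \<parallel> \<pi> a \<star> t) =
       EComp B (EFo F a) (EFo F b) (EFo G b) \<star> (\<pi> b \<star> t \<parallel> EFh F a b \<star> \<alpha>)"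
  using E.is_end assms by (intro wedge_natD[of Z]) (auto simp: is_end_def)

end

lemma chosen_nat_end:
  assumes "enriched_fun V A B F" "enriched_fun V A B G" "has_end V A (nat_bifunctor V A B F G)"
  shows "nat_end V A B F G (end_obj V A (nat_bifunctor V A B F G)) (end_proj V A (nat_bifunctor V A B F G))"
proof -
  interpret fun_pair V A B F G using assms by (simp add: fun_pair_def)
  show ?thesis
    using chosen_end[OF F.A.enriched_category_axioms bif_nat assms(3)]
    by (simp add: nat_end_def fun_pair_axioms)
qed

text \<open>Vertical composition is well defined: the naturality squares of both factors are pasted
  by associativity in \<open>B\<close>, which is the wedge condition that \<open>end_lift\<close>
  relies on.\<close>

lemma functor_cat_comp:
  assumes "enriched_fun V A B F" "enriched_fun V A B G" "enriched_fun V A B H"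
    and "has_end V A (nat_bifunctor V A B F G)" "has_end V A (nat_bifunctor V A B G H)"
    and "has_end V A (nat_bifunctor V A B F H)"
  shows "EComp (functor_cat V A B) F G H \<in> hom V
      (end_obj V A (nat_bifunctor V A B G H) \<otimes>\<^bsub>V\<^esub> end_obj V A (nat_bifunctor V A B F G))
      (end_obj V A (nat_bifunctor V A B F H))"
    "a \<in> EOb A \<Longrightarrow> elt V t \<Longrightarrow> elt V s \<Longrightarrow> dj t s \<Longrightarrow>
      ty V t = end_obj V A (nat_bifunctor V A B G H) \<Longrightarrow> ty V s = end_obj V A (nat_bifunctor V A B F G) \<Longrightarrow>
      end_proj V A (nat_bifunctor V A B F H) a \<star>\<^bsub>V\<^esub> (EComp (functor_cat V A B) F G H \<star>\<^bsub>V\<^esub> (t \<parallel>\<^bsub>V\<^esub> s)) =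
      EComp B (EFo F a) (EFo G a) (EFo H a) \<star>\<^bsub>V\<^esub>
        (end_proj V A (nat_bifunctor V A B G H) a \<star>\<^bsub>V\<^esub> t \<parallel>\<^bsub>V\<^esub> end_proj V A (nat_bifunctor V A B F G) a \<star>\<^bsub>V\<^esub> s)"
proof -
  interpret FG: nat_end V A B F G "end_obj V A (nat_bifunctor V A B F G)" "end_proj V A (nat_bifunctor V A B F G)"
    by (rule chosen_nat_end) fact+
  interpret GH: nat_end V A B G H "end_obj V A (nat_bifunctor V A B G H)" "end_proj V A (nat_bifunctor V A B G H)"
    by (rule chosen_nat_end) fact+
  interpret FH: nat_end V A B F H "end_obj V A (nat_bifunctor V A B F H)" "end_proj V A (nat_bifunctor V A B F H)"
    by (rule chosen_nat_end) fact+
  let ?p = "end_proj V A (nat_bifunctor V A B G H)" and ?q = "end_proj V A (nat_bifunctor V A B F G)"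
  let ?Z = "end_obj V A (nat_bifunctor V A B G H) \<otimes>\<^bsub>V\<^esub> end_obj V A (nat_bifunctor V A B F G)"
  let ?\<sigma> = "\<lambda>x. EComp B (EFo F x) (EFo G x) (EFo H x) \<cdot>\<^bsub>V\<^esub> (?p x \<odot>\<^bsub>V\<^esub> ?q x)"
  have w: "wedge V A (nat_bifunctor V A B F H) ?Z ?\<sigma>"
  proof -
    have nat: "EComp B (EFo F a) (EFo H a) (EFo H b) \<star>\<^bsub>V\<^esub> (EFh H a b \<star>\<^bsub>V\<^esub> \<alpha> \<parallel>\<^bsub>V\<^esub> ?\<sigma> a \<star>\<^bsub>V\<^esub> (t \<parallel>\<^bsub>V\<^esub> s)) =
       EComp B (EFo F a) (EFo F b) (EFo H b) \<star>\<^bsub>V\<^esub> (?\<sigma> b \<star>\<^bsub>V\<^esub> (t \<parallel>\<^bsub>V\<^esub> s) \<parallel>\<^bsub>V\<^esub> EFh F a b \<star>\<^bsub>V\<^esub> \<alpha>)"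
      if *: "a \<in> EOb A" "b \<in> EOb A" "elt V \<alpha>" "ty V \<alpha> = EHom A a b" "elt V t" "elt V s"
        "ty V t = end_obj V A (nat_bifunctor V A B G H)" "ty V s = end_obj V A (nat_bifunctor V A B F G)"
        "dj \<alpha> t" "dj t \<alpha>" "dj \<alpha> s" "dj s \<alpha>" "dj t s" "dj s t" for a b \<alpha> t s
    proof -
      let ?Ca = "EComp B (EFo F a) (EFo H a) (EFo H b)" and ?Cb = "EComp B (EFo F a) (EFo F b) (EFo H b)"
      let ?Cm = "EComp B (EFo F a) (EFo G b) (EFo H b)" and ?Cg = "EComp B (EFo F a) (EFo G a) (EFo H b)"
      have "?Ca \<star>\<^bsub>V\<^esub> (EFh H a b \<star>\<^bsub>V\<^esub> \<alpha> \<parallel>\<^bsub>V\<^esub> ?\<sigma> a \<star>\<^bsub>V\<^esub> (t \<parallel>\<^bsub>V\<^esub> s)) =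
          ?Cg \<star>\<^bsub>V\<^esub> (EComp B (EFo G a) (EFo H a) (EFo H b) \<star>\<^bsub>V\<^esub> (EFh H a b \<star>\<^bsub>V\<^esub> \<alpha> \<parallel>\<^bsub>V\<^esub> ?p a \<star>\<^bsub>V\<^esub> t) \<parallel>\<^bsub>V\<^esub> ?q a \<star>\<^bsub>V\<^esub> s)"
        using * by (simp add: FG.F.B.comp_assoc)
      also have "\<dots> = ?Cg \<star>\<^bsub>V\<^esub> (EComp B (EFo G a) (EFo G b) (EFo H b) \<star>\<^bsub>V\<^esub> (?p b \<star>\<^bsub>V\<^esub> t \<parallel>\<^bsub>V\<^esub> EFh G a b \<star>\<^bsub>V\<^esub> \<alpha>) \<parallel>\<^bsub>V\<^esub> ?q a \<star>\<^bsub>V\<^esub> s)"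
        using * by (subst GH.natural) simp_all
      also have "\<dots> = ?Cm \<star>\<^bsub>V\<^esub> (?p b \<star>\<^bsub>V\<^esub> t \<parallel>\<^bsub>V\<^esub> EComp B (EFo F a) (EFo G a) (EFo G b) \<star>\<^bsub>V\<^esub> (EFh G a b \<star>\<^bsub>V\<^esub> \<alpha> \<parallel>\<^bsub>V\<^esub> ?q a \<star>\<^bsub>V\<^esub> s))"
        using * by (simp add: FG.F.B.comp_assoc)
      also have "\<dots> = ?Cm \<star>\<^bsub>V\<^esub> (?p b \<star>\<^bsub>V\<^esub> t \<parallel>\<^bsub>V\<^esub> EComp B (EFo F a) (EFo F b) (EFo G b) \<star>\<^bsub>V\<^esub> (?q b \<star>\<^bsub>V\<^esub> s \<parallel>\<^bsub>V\<^esub> EFh F a b \<star>\<^bsub>V\<^esub> \<alpha>))"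
        using * by (subst FG.natural) simp_all
      also have "\<dots> = ?Cb \<star>\<^bsub>V\<^esub> (?\<sigma> b \<star>\<^bsub>V\<^esub> (t \<parallel>\<^bsub>V\<^esub> s) \<parallel>\<^bsub>V\<^esub> EFh F a b \<star>\<^bsub>V\<^esub> \<alpha>)"
        using * by (simp add: FG.F.B.comp_assoc)
      finally show ?thesis .
    qed
    show ?thesis
      by (rule FH.wedge_natI2) (use nat in \<open>auto simp: FG.F.A.hom_iff\<close>)
  qed
  have c: "EComp (functor_cat V A B) F G H = end_lift V A (nat_bifunctor V A B F H) ?Z ?\<sigma>"
    by (simp add: functor_cat_def)
  have Z: "?Z \<in> Obj V" by simp
  note l = end_lift[OF FG.F.A.enriched_category_axioms FH.bif_nat assms(6) w Z]
  show "EComp (functor_cat V A B) F G H \<in> hom V ?Z (end_obj V A (nat_bifunctor V A B F H))"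
    unfolding c using l by (simp add: FG.F.A.hom_iff)
  show "end_proj V A (nat_bifunctor V A B F H) a \<star>\<^bsub>V\<^esub> (EComp (functor_cat V A B) F G H \<star>\<^bsub>V\<^esub> (t \<parallel>\<^bsub>V\<^esub> s)) =
      EComp B (EFo F a) (EFo G a) (EFo H a) \<star>\<^bsub>V\<^esub> (?p a \<star>\<^bsub>V\<^esub> t \<parallel>\<^bsub>V\<^esub> ?q a \<star>\<^bsub>V\<^esub> s)"
    if "a \<in> EOb A" "elt V t" "elt V s" "dj t s" "ty V t = end_obj V A (nat_bifunctor V A B G H)"
      "ty V s = end_obj V A (nat_bifunctor V A B F G)"
    using that unfolding c by (simp add: l)
qed

lemma functor_cat_id:
  assumes "enriched_fun V A B F" "has_end V A (nat_bifunctor V A B F F)"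
  shows "EId (functor_cat V A B) F \<in> hom V \<one>\<^bsub>V\<^esub> (end_obj V A (nat_bifunctor V A B F F))"
    "a \<in> EOb A \<Longrightarrow> end_proj V A (nat_bifunctor V A B F F) a \<star>\<^bsub>V\<^esub> (EId (functor_cat V A B) F \<star>\<^bsub>V\<^esub> unit_elt V) =
      EId B (EFo F a) \<star>\<^bsub>V\<^esub> unit_elt V"
proof -
  interpret F: nat_end V A B F F "end_obj V A (nat_bifunctor V A B F F)" "end_proj V A (nat_bifunctor V A B F F)"
    by (rule chosen_nat_end) fact+
  have id: "EComp B (EFo F a) (EFo F a) (EFo F b) \<star>\<^bsub>V\<^esub> (EFh F a b \<star>\<^bsub>V\<^esub> \<alpha> \<parallel>\<^bsub>V\<^esub> EId B (EFo F a) \<star>\<^bsub>V\<^esub> z) =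
     EComp B (EFo F a) (EFo F b) (EFo F b) \<star>\<^bsub>V\<^esub> (EId B (EFo F b) \<star>\<^bsub>V\<^esub> z \<parallel>\<^bsub>V\<^esub> EFh F a b \<star>\<^bsub>V\<^esub> \<alpha>)"
    if *: "a \<in> EOb A" "b \<in> EOb A" "elt V \<alpha>" "ty V \<alpha> = EHom A a b" "elt V z" "ty V z = \<one>\<^bsub>V\<^esub>" "dj \<alpha> z" for a b \<alpha> z
  proof -
    \<comment> \<open>The element \<open>z\<close> of the unit need not be
      \<open>unit_elt V\<close>. So the equation is proved between arrows, after composing with an
      inverse unitor that brings in the canonical element.\<close>
    let ?f = "EComp B (EFo F a) (EFo F a) (EFo F b) \<cdot>\<^bsub>V\<^esub> (EFh F a b \<odot>\<^bsub>V\<^esub> EId B (EFo F a))"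
      and ?g = "EComp B (EFo F a) (EFo F b) (EFo F b) \<cdot>\<^bsub>V\<^esub> ((EId B (EFo F b) \<odot>\<^bsub>V\<^esub> EFh F a b) \<cdot>\<^bsub>V\<^esub> braid V (EHom A a b) \<one>\<^bsub>V\<^esub>)"
    have "?f \<cdot>\<^bsub>V\<^esub> inv_arr V (run V (EHom A a b)) = ?g \<cdot>\<^bsub>V\<^esub> inv_arr V (run V (EHom A a b))"
      by (rule F.F.A.ext1) (use * in \<open>auto simp: F.F.A.hom_iff F.F.B.comp_id\<close>)
    then have "?f = ?g" by (rule F.F.A.iso_epic[rotated]) (use * in auto)
    then have "?f \<star>\<^bsub>V\<^esub> (\<alpha> \<parallel>\<^bsub>V\<^esub> z) = ?g \<star>\<^bsub>V\<^esub> (\<alpha> \<parallel>\<^bsub>V\<^esub> z)" by simp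
    moreover have "dj z \<alpha>" using *(7) by (auto simp: dj_def)
    ultimately show ?thesis using * by simp
  qed
  have w: "wedge V A (nat_bifunctor V A B F F) \<one>\<^bsub>V\<^esub> (\<lambda>x. EId B (EFo F x))"
    by (rule F.wedge_natI) (use id in \<open>auto simp: F.F.A.hom_iff\<close>)
  have c: "EId (functor_cat V A B) F = end_lift V A (nat_bifunctor V A B F F) \<one>\<^bsub>V\<^esub> (\<lambda>x. EId B (EFo F x))"
    by (simp add: functor_cat_def)
  note l = end_lift[OF F.F.A.enriched_category_axioms F.bif_nat assms(2) w F.F.A.Unt_Obj]
  show "EId (functor_cat V A B) F \<in> hom V \<one>\<^bsub>V\<^esub> (end_obj V A (nat_bifunctor V A B F F))"
    unfolding c using l by (simp add: F.F.A.hom_iff)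
  show "end_proj V A (nat_bifunctor V A B F F) a \<star>\<^bsub>V\<^esub> (EId (functor_cat V A B) F \<star>\<^bsub>V\<^esub> unit_elt V) =
      EId B (EFo F a) \<star>\<^bsub>V\<^esub> unit_elt V" if "a \<in> EOb A"
    using that unfolding c by (simp add: l)
qed

text \<open>The projections of an end are jointly monic and carry composition and identities to
  those of \<open>B\<close>, so the laws are inherited. The restriction to \<open>S\<close> covers
  \<open>T-Alg\<close> over \<open>V\<close>, where only the ends between algebras are assumed to
  exist.\<close>

lemma enriched_functor_cat:
  assumes "enriched_category V A" "enriched_category V B"
    and S: "\<And>F. F \<in> S \<Longrightarrow> enriched_fun V A B F"
    and ends: "\<And>F G. F \<in> S \<Longrightarrow> G \<in> S \<Longrightarrow> has_end V A (nat_bifunctor V A B F G)"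
  shows "enriched_category V (full_sub (functor_cat V A B) S)"
proof -
  interpret A: enriched_category V A by fact
  interpret B: enriched_category V B by fact
  have ne: "nat_end V A B F G (end_obj V A (nat_bifunctor V A B F G)) (end_proj V A (nat_bifunctor V A B F G))"
    if "F \<in> S" "G \<in> S" for F G using that by (intro chosen_nat_end S ends)
  have hom[simp]: "EHom (functor_cat V A B) F G = end_obj V A (nat_bifunctor V A B F G)" for F G
    by (simp add: functor_cat_def)
  have ob[simp]: "end_obj V A (nat_bifunctor V A B F G) \<in> Obj V" if "F \<in> S" "G \<in> S" for F G
  proof -
    interpret nat_end V A B F G "end_obj V A (nat_bifunctor V A B F G)" "end_proj V A (nat_bifunctor V A B F G)"
      using that by (rule ne)
    show ?thesis by simp
  qed
  have proj[simp]: "end_proj V A (nat_bifunctor V A B F G) a \<in> Arr V"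
    "Dom V (end_proj V A (nat_bifunctor V A B F G) a) = end_obj V A (nat_bifunctor V A B F G)"
    "Cod V (end_proj V A (nat_bifunctor V A B F G) a) = EHom B (EFo F a) (EFo G a)"
    if "F \<in> S" "G \<in> S" "a \<in> EOb A" for F G a
  proof -
    interpret nat_end V A B F G "end_obj V A (nat_bifunctor V A B F G)" "end_proj V A (nat_bifunctor V A B F G)"
      using that by (intro ne)
    show "end_proj V A (nat_bifunctor V A B F G) a \<in> Arr V"
    "Dom V (end_proj V A (nat_bifunctor V A B F G) a) = end_obj V A (nat_bifunctor V A B F G)"
    "Cod V (end_proj V A (nat_bifunctor V A B F G) a) = EHom B (EFo F a) (EFo G a)" using that by simp_all
  qed
  have Fo[simp]: "EFo F a \<in> EOb B" if "F \<in> S" "a \<in> EOb A" for F a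
    using S[OF that(1)] that(2) by (rule enriched_fun.Fo)
  have comp[simp]: "EComp (functor_cat V A B) F G H \<in> Arr V"
    "Dom V (EComp (functor_cat V A B) F G H) = end_obj V A (nat_bifunctor V A B G H) \<otimes>\<^bsub>V\<^esub> end_obj V A (nat_bifunctor V A B F G)"
    "Cod V (EComp (functor_cat V A B) F G H) = end_obj V A (nat_bifunctor V A B F H)"
    if "F \<in> S" "G \<in> S" "H \<in> S" for F G H
    using functor_cat_comp(1)[OF S S S ends ends ends, of F G H] that by (auto simp: A.hom_iff)
  have id[simp]: "EId (functor_cat V A B) F \<in> Arr V" "Dom V (EId (functor_cat V A B) F) = \<one>\<^bsub>V\<^esub>"
    "Cod V (EId (functor_cat V A B) F) = end_obj V A (nat_bifunctor V A B F F)"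
    if "F \<in> S" for F using functor_cat_id(1)[OF S ends, of F] that by (auto simp: A.hom_iff)
  note pc = functor_cat_comp(2)[OF S S S ends ends ends] and pid = functor_cat_id(2)[OF S ends]
  show ?thesis
  proof (rule A.enriched_categoryI)
    fix w x y z h g f
    assume *: "w \<in> EOb (full_sub (functor_cat V A B) S)" "x \<in> EOb (full_sub (functor_cat V A B) S)"
      "y \<in> EOb (full_sub (functor_cat V A B) S)" "z \<in> EOb (full_sub (functor_cat V A B) S)"
      "elt V h" "elt V g" "elt V f" "ty V h = EHom (full_sub (functor_cat V A B) S) y z"
      "ty V g = EHom (full_sub (functor_cat V A B) S) x y" "ty V f = EHom (full_sub (functor_cat V A B) S) w x"
      "dj h g" "dj g h" "dj g f" "dj f g" "dj h f" "dj f h"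
    then interpret n: nat_end V A B w z "end_obj V A (nat_bifunctor V A B w z)" "end_proj V A (nat_bifunctor V A B w z)"
      by (intro ne) (auto simp: full_sub_def)
    show "EComp (full_sub (functor_cat V A B) S) w x z \<star>\<^bsub>V\<^esub> (EComp (full_sub (functor_cat V A B) S) x y z \<star>\<^bsub>V\<^esub> (h \<parallel>\<^bsub>V\<^esub> g) \<parallel>\<^bsub>V\<^esub> f) =
      EComp (full_sub (functor_cat V A B) S) w y z \<star>\<^bsub>V\<^esub> (h \<parallel>\<^bsub>V\<^esub> EComp (full_sub (functor_cat V A B) S) w x y \<star>\<^bsub>V\<^esub> (g \<parallel>\<^bsub>V\<^esub> f))"
      by (rule n.E.elt_end_ext) (use * in \<open>auto simp: full_sub_def pc B.comp_assoc\<close>)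
  next
    fix x y f
    assume *: "x \<in> EOb (full_sub (functor_cat V A B) S)"
      "y \<in> EOb (full_sub (functor_cat V A B) S)" "elt V f" "ty V f = EHom (full_sub (functor_cat V A B) S) x y"
    then interpret n: nat_end V A B x y "end_obj V A (nat_bifunctor V A B x y)" "end_proj V A (nat_bifunctor V A B x y)"
      by (intro ne) (auto simp: full_sub_def)
    show "EComp (full_sub (functor_cat V A B) S) x y y \<star>\<^bsub>V\<^esub> (EId (full_sub (functor_cat V A B) S) y \<star>\<^bsub>V\<^esub> unit_elt V \<parallel>\<^bsub>V\<^esub> f) = f"
      by (rule n.E.elt_end_ext) (use * in \<open>auto simp: full_sub_def pc pid B.comp_id\<close>)
    show "EComp (full_sub (functor_cat V A B) S) x x y \<star>\<^bsub>V\<^esub> (f \<parallel>\<^bsub>V\<^esub> EId (full_sub (functor_cat V A B) S) x \<star>\<^bsub>V\<^esub> unit_elt V) = f"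
      by (rule n.E.elt_end_ext) (use * in \<open>auto simp: full_sub_def pc pid B.comp_id\<close>)
  qed (auto simp: full_sub_def A.hom_iff)
qed

section \<open>Ends as limits\<close>

lemma lepoll_iff_ordLeq: "A \<lesssim> B \<longleftrightarrow> (card_of (A), card_of (B)) \<in> ordLeq"
  by (simp add: lepoll_def card_of_ordLeq)

text \<open>An end is the limit of the objects \<open>F(a, a)\<close> over all cospans
  \<open>F(a, a) \<rightarrow> [A(a, b), F(a, b)] \<leftarrow> F(b, b)\<close>. In the shape, \<open>Inr (a, b)\<close> is the apex and
  \<open>Inr (True, a, b)\<close>, \<open>Inr (False, a, b)\<close> are the legs.\<close>

definition end_shape :: "'x set \<Rightarrow> ('x + 'x \<times> 'x, ('x + 'x \<times> 'x) + (bool \<times> 'x \<times> 'x)) cat" where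
  "end_shape X = \<lparr>Obj = X <+> (X \<times> X), Arr = (X <+> (X \<times> X)) <+> (UNIV \<times> X \<times> X),
     Dom = (\<lambda>f. case f of Inl k \<Rightarrow> k | Inr (e, a, b) \<Rightarrow> Inl (if e then a else b)),
     Cod = (\<lambda>f. case f of Inl k \<Rightarrow> k | Inr (e, a, b) \<Rightarrow> Inr (a, b)),
     Idt = Inl, Comp = (\<lambda>g f. case f of Inl _ \<Rightarrow> g | Inr _ \<Rightarrow> f)\<rparr>"

lemma end_shape_category: "category (end_shape X)"
  by standard (auto simp: end_shape_def hom_def split: sum.splits if_splits)

text \<open>For infinite \<open>X\<close>, sums and squares do not raise the cardinality, so the
  shape has at most as many arrows as \<open>X\<close> has elements. For finite \<open>X\<close> the
  shape is finite, and \<open>U\<close> is infinite.\<close>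

lemma end_shape_small:
  assumes "infinite U" "small U X"
  shows "small U (Arr (end_shape X))"
proof (cases "finite X")
  case True
  then have "finite (Arr (end_shape X))" by (simp add: end_shape_def)
  then show ?thesis using assms(1) by (simp add: small_def finite_lesspoll_infinite)
next
  case inf: False
  have XX: "(card_of (X \<times> X), card_of (X)) \<in> ordLeq" using card_of_Times_same_infinite[OF inf] by (rule ordIso_imp_ordLeq)
  note plus = card_of_Plus_ordLeq_infinite_Field[of "card_of X", OF _ _ _ card_of_Card_order]
    and times = card_of_Times_ordLeq_infinite_Field[of "card_of X", OF _ _ _ card_of_Card_order]
  have "(UNIV :: bool set) \<lesssim> X" using inf by (intro finite_lepoll_infinite) auto
  then have "(card_of (UNIV :: bool set), card_of (X)) \<in> ordLeq" by (simp add: lepoll_iff_ordLeq)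
  then have "(card_of (Arr (end_shape X)), card_of (X)) \<in> ordLeq"
    unfolding end_shape_def using XX inf card_of_mono1[OF subset_refl, of X]
    by (auto intro!: plus times simp: Field_card_of)
  then have "Arr (end_shape X) \<lesssim> X" by (simp add: lepoll_iff_ordLeq)
  then show ?thesis using assms(2) unfolding small_def by (rule lesspoll_trans1)
qed

text \<open>Replacing a shape by an isomorphic one whose objects and arrows lie in \<open>U\<close>; an object is
  encoded by its identity.\<close>

definition coded :: "('k, 'l) cat \<Rightarrow> ('l \<Rightarrow> 'u) \<Rightarrow> ('u, 'u) cat" where
  "coded K e = (let d = inv_into (Arr K) e in
     \<lparr>Obj = (\<lambda>k. e (Idt K k)) ` Obj K, Arr = e ` Arr K, Dom = (\<lambda>f. e (Idt K (Dom K (d f)))),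
      Cod = (\<lambda>f. e (Idt K (Cod K (d f)))), Idt = (\<lambda>k. k), Comp = (\<lambda>g f. e (Comp K (d g) (d f)))\<rparr>)"

definition coded_fun :: "('k, 'l) cat \<Rightarrow> ('l \<Rightarrow> 'u) \<Rightarrow> ('k, 'l, 'o, 'm) ofun \<Rightarrow> ('u, 'u, 'o, 'm) ofun" where
  "coded_fun K e D = (let d = inv_into (Arr K) e in
     \<lparr>FOb = (\<lambda>k. FOb D (Dom K (d k))), FAr = (\<lambda>f. FAr D (d f))\<rparr>)"

locale coding = K: category K for K :: "('k, 'l) cat" +
  fixes e :: "'l \<Rightarrow> 'u"
  assumes inj: "inj_on e (Arr K)"
begin

lemma dec [simp]: "f \<in> Arr K \<Longrightarrow> inv_into (Arr K) e (e f) = f"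
  by (rule inv_into_f_f[OF inj])

lemma coded_simps:
  "Obj (coded K e) = (\<lambda>k. e (Idt K k)) ` Obj K" "Arr (coded K e) = e ` Arr K"
  "f \<in> Arr K \<Longrightarrow> Dom (coded K e) (e f) = e (Idt K (Dom K f))"
  "f \<in> Arr K \<Longrightarrow> Cod (coded K e) (e f) = e (Idt K (Cod K f))"
  "Idt (coded K e) k = k"
  "f \<in> Arr K \<Longrightarrow> g \<in> Arr K \<Longrightarrow> Comp (coded K e) (e g) (e f) = e (Comp K g f)"
  by (simp_all add: coded_def Let_def)

lemma code_eq: "f \<in> Arr K \<Longrightarrow> g \<in> Arr K \<Longrightarrow> e f = e g \<longleftrightarrow> f = g"
  using inj by (auto dest: inj_onD)

lemma idt_eq: "k \<in> Obj K \<Longrightarrow> l \<in> Obj K \<Longrightarrow> e (Idt K k) = e (Idt K l) \<longleftrightarrow> k = l"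
  using K.Idt_arr[of k] K.Idt_arr[of l] by (metis code_eq)

lemma coded_hom:
  "x \<in> hom (coded K e) p q \<longleftrightarrow> (\<exists>f\<in>Arr K. x = e f \<and> p = e (Idt K (Dom K f)) \<and> q = e (Idt K (Cod K f)))"
  by (auto simp: hom_def coded_simps)

lemma coded_category: "category (coded K e)"
proof
  fix f assume "f \<in> Arr (coded K e)"
  then show "Dom (coded K e) f \<in> Obj (coded K e)" "Cod (coded K e) f \<in> Obj (coded K e)"
    by (auto simp: coded_simps)
next
  fix X assume "X \<in> Obj (coded K e)"
  then obtain k where "k \<in> Obj K" "X = e (Idt K k)" by (auto simp: coded_simps)
  then show "Idt (coded K e) X \<in> hom (coded K e) X X"
    unfolding coded_hom by (intro bexI[of _ "Idt K k"]) (auto simp: coded_simps)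
next
  fix f X Y g Z assume "f \<in> hom (coded K e) X Y" "g \<in> hom (coded K e) Y Z"
  then show "g \<cdot>\<^bsub>coded K e\<^esub> f \<in> hom (coded K e) X Z"
    by (auto simp: coded_hom coded_simps idt_eq intro!: bexI)
next
  fix f X Y assume "f \<in> hom (coded K e) X Y"
  then show "Idt (coded K e) Y \<cdot>\<^bsub>coded K e\<^esub> f = f" "f \<cdot>\<^bsub>coded K e\<^esub> Idt (coded K e) X = f"
    by (auto simp: coded_hom coded_simps)
next
  fix f W X g Y h Z
  assume "f \<in> hom (coded K e) W X" "g \<in> hom (coded K e) X Y" "h \<in> hom (coded K e) Y Z"
  then show "(h \<cdot>\<^bsub>coded K e\<^esub> g) \<cdot>\<^bsub>coded K e\<^esub> f = h \<cdot>\<^bsub>coded K e\<^esub> (g \<cdot>\<^bsub>coded K e\<^esub> f)"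
    by (auto simp: coded_hom coded_simps idt_eq)
qed

lemma coded_fun_simps:
  "k \<in> Obj K \<Longrightarrow> FOb (coded_fun K e D) (e (Idt K k)) = FOb D k"
  "f \<in> Arr K \<Longrightarrow> FAr (coded_fun K e D) (e f) = FAr D f"
  by (simp_all add: coded_fun_def Let_def)

lemma coded_functor:
  assumes "ordinary_functor K C D"
  shows "ordinary_functor (coded K e) C (coded_fun K e D)"
  using assms unfolding ordinary_functor_def
  by (auto simp: coded_hom coded_simps coded_fun_simps idt_eq hom_def)

lemma cone_iff: "cone (coded K e) C (coded_fun K e D) L \<pi> \<longleftrightarrow> cone K C D L (\<lambda>k. \<pi> (e (Idt K k)))"
  by (auto simp: cone_def coded_simps coded_fun_simps)

lemma cone_ext: "cone K C D L \<pi> \<Longrightarrow> (\<And>k. k \<in> Obj K \<Longrightarrow> \<pi>' k = \<pi> k) \<Longrightarrow> cone K C D L \<pi>'"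
  by (auto simp: cone_def)

lemma limit_iff: "is_limit (coded K e) C (coded_fun K e D) L \<pi> \<longleftrightarrow> is_limit K C D L (\<lambda>k. \<pi> (e (Idt K k)))"
proof -
  have "(\<forall>M \<rho>. cone K C D M (\<lambda>k. \<rho> (e (Idt K k))) \<longrightarrow>
      (\<exists>!h. h \<in> hom C M L \<and> (\<forall>k\<in>Obj K. \<pi> (e (Idt K k)) \<cdot>\<^bsub>C\<^esub> h = \<rho> (e (Idt K k))))) \<longleftrightarrow>
    (\<forall>M \<rho>. cone K C D M \<rho> \<longrightarrow> (\<exists>!h. h \<in> hom C M L \<and> (\<forall>k\<in>Obj K. \<pi> (e (Idt K k)) \<cdot>\<^bsub>C\<^esub> h = \<rho> k)))"
    (is "?l \<longleftrightarrow> ?r")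
  proof (intro iffI allI impI)
    fix M \<rho> assume l: ?l and c: "cone K C D M \<rho>"
    \<comment> \<open>A cone indexed by objects of \<open>K\<close> becomes one indexed by codes: a
      code is decoded to an identity arrow, whose domain is the object.\<close>
    let ?\<rho> = "\<lambda>x. \<rho> (Dom K (inv_into (Arr K) e x))"
    have r: "?\<rho> (e (Idt K k)) = \<rho> k" if "k \<in> Obj K" for k using that by simp
    have "cone K C D M (\<lambda>k. ?\<rho> (e (Idt K k)))" using r by (intro cone_ext[OF c]) auto
    with l[THEN spec[of _ M], THEN spec[of _ ?\<rho>]]
    have "\<exists>!h. h \<in> hom C M L \<and> (\<forall>k\<in>Obj K. \<pi> (e (Idt K k)) \<cdot>\<^bsub>C\<^esub> h = ?\<rho> (e (Idt K k)))" by (rule mp)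
    then show "\<exists>!h. h \<in> hom C M L \<and> (\<forall>k\<in>Obj K. \<pi> (e (Idt K k)) \<cdot>\<^bsub>C\<^esub> h = \<rho> k)" by (simp add: r)
  qed blast
  then show ?thesis by (simp add: is_limit_def cone_iff coded_simps)
qed

end

lemma is_limit_ext:
  assumes "is_limit K C D L \<pi>" "category K" "\<And>k. k \<in> Obj K \<Longrightarrow> \<pi>' k = \<pi> k"
    "\<And>k. k \<in> Obj K \<Longrightarrow> FOb D' k = FOb D k" "\<And>f. f \<in> Arr K \<Longrightarrow> FAr D' f = FAr D f"
  shows "is_limit K C D' L \<pi>'"
proof -
  interpret K: category K by fact
  have c: "cone K C D' M \<rho> = cone K C D M \<rho>" for M \<rho>
    using assms(4,5) by (simp add: cone_def cong: ball_cong)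
  have "cone K C D L \<pi>' = cone K C D L \<pi>" using assms(3) by (simp add: cone_def cong: ball_cong)
  then show ?thesis using assms(1,3) by (simp add: is_limit_def c cong: ball_cong)
qed

text \<open>Completeness speaks of shapes with objects and arrows in \<open>U\<close>. Smallness of
  the arrow set gives an injection of it into \<open>U\<close>; the objects follow along, being
  represented by identities.\<close>

lemma has_coded_limit:
  fixes K :: "('k, 'l) cat" and D :: "('k, 'l, 'o, 'm) ofun"
  assumes "small_complete U C" "category K" "infinite U" "small U (Arr K)" "ordinary_functor K C D"
  shows "\<exists>L \<pi>. is_limit K C D L \<pi>"
proof -
  interpret K: category K by fact
  obtain e where e: "inj_on e (Arr K)" "e ` Arr K \<subseteq> U"
    using lesspoll_imp_lepoll[OF assms(4)[unfolded small_def]] by (auto simp: lepoll_def)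
  interpret coding K e using e by unfold_locales
  have sub: "Obj (coded K e) \<subseteq> Arr (coded K e)" by (auto simp: coded_simps)
  have "small U (Arr (coded K e))" unfolding coded_simps small_def
    using assms(4) unfolding small_def by (rule lesspoll_trans1[OF image_lepoll])
  moreover from this have "small U (Obj (coded K e))" unfolding small_def
    by (rule lesspoll_trans1[OF subset_imp_lepoll[OF sub]])
  ultimately have "small_shape U (coded K e)" using e(2) sub by (auto simp: small_shape_def coded_simps)
  then obtain L \<pi> where "is_limit (coded K e) C (coded_fun K e D) L \<pi>"
    using assms(1) coded_category coded_functor[OF assms(5)]
    unfolding small_complete_def has_limits_of_shapes_def by blast
  then show ?thesis by (auto simp: limit_iff)
qed

lemma preserves_coded_limit:
  fixes K :: "('k, 'l) cat" and D :: "('k, 'l, 'o, 'm) ofun"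
  assumes "preserves_limits U C C' i" "category K" "small U (Arr K)" "ordinary_functor K C D" "is_limit K C D L \<pi>"
  shows "is_limit K C' \<lparr>FOb = FOb i \<circ> FOb D, FAr = FAr i \<circ> FAr D\<rparr> (FOb i L) (FAr i \<circ> \<pi>)"
proof -
  interpret K: category K by fact
  obtain e where e: "inj_on e (Arr K)" "e ` Arr K \<subseteq> U"
    using lesspoll_imp_lepoll[OF assms(3)[unfolded small_def]] by (auto simp: lepoll_def)
  interpret coding K e using e by unfold_locales
  let ?\<pi> = "\<lambda>x. \<pi> (Dom K (inv_into (Arr K) e x))"
  let ?D = "\<lparr>FOb = FOb i \<circ> FOb D, FAr = FAr i \<circ> FAr D\<rparr>"
  have sub: "Obj (coded K e) \<subseteq> U" "Arr (coded K e) \<subseteq> U" using e(2) by (auto simp: coded_simps)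
  have "is_limit K C D L (\<lambda>k. ?\<pi> (e (Idt K k)))" using assms(5) assms(2) by (rule is_limit_ext) auto
  then have "is_limit (coded K e) C (coded_fun K e D) L ?\<pi>" by (simp add: limit_iff)
  then have "is_limit (coded K e) C' \<lparr>FOb = FOb i \<circ> FOb (coded_fun K e D), FAr = FAr i \<circ> FAr (coded_fun K e D)\<rparr>
     (FOb i L) (FAr i \<circ> ?\<pi>)"
    using assms(1) coded_category sub coded_functor[OF assms(4)] unfolding preserves_limits_def by blast
  moreover have "\<lparr>FOb = FOb i \<circ> FOb (coded_fun K e D), FAr = FAr i \<circ> FAr (coded_fun K e D)\<rparr> = coded_fun K e ?D"
    by (simp add: coded_fun_def Let_def comp_def)
  ultimately have "is_limit K C' ?D (FOb i L) (\<lambda>k. (FAr i \<circ> ?\<pi>) (e (Idt K k)))" by (simp add: limit_iff)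
  then show ?thesis using assms(2) by (rule is_limit_ext) auto
qed

text \<open>The transpose \<open>X \<rightarrow> [P, Y]\<close> of an action \<open>P \<rightarrow> [X, Y]\<close>.\<close>

definition flip :: "('o, 'm) smc \<Rightarrow> 'o \<Rightarrow> 'o \<Rightarrow> 'o \<Rightarrow> 'm \<Rightarrow> 'm" where
  "flip V P X Y c = curry_arr V X P (ev V X Y \<cdot>\<^bsub>V\<^esub> ((c \<odot>\<^bsub>V\<^esub> Idt V X) \<cdot>\<^bsub>V\<^esub> braid V X P))"

lemma (in symmetric_monoidal_closed) flip:
  assumes "c \<in> Arr V" "Dom V c = P" "Cod V c = ihom V X Y" "X \<in> Obj V" "Y \<in> Obj V"
  shows "flip V P X Y c \<in> Arr V" "Dom V (flip V P X Y c) = X" "Cod V (flip V P X Y c) = ihom V P Y"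
    "elt V x \<Longrightarrow> ty V x = X \<Longrightarrow> elt V p \<Longrightarrow> ty V p = P \<Longrightarrow> dj x p \<Longrightarrow>
      ev V P Y \<star> (flip V P X Y c \<star> x \<parallel> p) = ev V X Y \<star> (c \<star> p \<parallel> x)"
proof -
  have [simp]: "P \<in> Obj V" using assms by auto
  show "flip V P X Y c \<in> Arr V" "Dom V (flip V P X Y c) = X" "Cod V (flip V P X Y c) = ihom V P Y"
    using assms by (simp_all add: flip_def)
  show "ev V P Y \<star> (flip V P X Y c \<star> x \<parallel> p) = ev V X Y \<star> (c \<star> p \<parallel> x)"
    if "elt V x" "ty V x = X" "elt V p" "ty V p = P" "dj x p"
  proof -
    have "dj p x" using that by (auto simp: dj_def)
    then show ?thesis using assms that by (simp add: flip_def)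
  qed
qed

definition end_diagram :: "('o, 'm) smc \<Rightarrow> ('x, 'o, 'm) ecat \<Rightarrow> ('x \<times> 'x, 'o, 'm) efun \<Rightarrow>
    ('x + 'x \<times> 'x, ('x + 'x \<times> 'x) + (bool \<times> 'x \<times> 'x), 'o, 'm) ofun" where
  "end_diagram V A F = (let ob = (\<lambda>k. case k of Inl a \<Rightarrow> EFo F (a, a) | Inr (a, b) \<Rightarrow> ihom V (EHom A a b) (EFo F (a, b))) in
     \<lparr>FOb = ob, FAr = (\<lambda>f. case f of Inl k \<Rightarrow> Idt V (ob k) | Inr (e, a, b) \<Rightarrow>
       (if e then flip V (EHom A a b) (EFo F (a, a)) (EFo F (a, b)) (covariant_action V A F a a b)
        else flip V (EHom A a b) (EFo F (b, b)) (EFo F (a, b)) (contravariant_action V A F a b b)))\<rparr>)"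

lemma ball_Plus: "(\<forall>k\<in>X <+> Y. P k) \<longleftrightarrow> (\<forall>a\<in>X. P (Inl a)) \<and> (\<forall>b\<in>Y. P (Inr b))"
  by auto

section \<open>Wedges as cones over the end diagram\<close>

context enriched_category
begin

abbreviation "flip_cov F a b \<equiv> flip V (EHom A a b) (EFo F (a, a)) (EFo F (a, b)) (covariant_action V A F a a b)"
abbreviation "flip_con F a b \<equiv> flip V (EHom A a b) (EFo F (b, b)) (EFo F (a, b)) (contravariant_action V A F a b b)"

lemma flip_actions:
  assumes "bif V A F" "a \<in> EOb A" "b \<in> EOb A"
  shows "flip_cov F a b \<in> Arr V" "Dom V (flip_cov F a b) = EFo F (a, a)"
    "Cod V (flip_cov F a b) = ihom V (EHom A a b) (EFo F (a, b))"
    "flip_con F a b \<in> Arr V" "Dom V (flip_con F a b) = EFo F (b, b)"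
    "Cod V (flip_con F a b) = ihom V (EHom A a b) (EFo F (a, b))"
  using bif_simps[OF assms] bif_simps(1)[OF assms(1,2,2)] bif_simps(1)[OF assms(1,3,3)] by (simp_all add: flip)

text \<open>The wedge condition equates arrows from \<open>A(a, b)\<close> to
  \<open>[Z, F(a, b)]\<close>. Transposed, it equates arrows from \<open>Z\<close> to
  \<open>[A(a, b), F(a, b)]\<close> that factor through \<open>\<sigma>\<close>, which is the form
  of a cone condition.\<close>

lemma wedge_iff_flip:
  assumes F: "bif V A F"
  shows "wedge V A F Z \<sigma> \<longleftrightarrow> (\<forall>a\<in>EOb A. \<sigma> a \<in> hom V Z (EFo F (a, a))) \<and>
    (\<forall>a\<in>EOb A. \<forall>b\<in>EOb A. flip_cov F a b \<cdot> \<sigma> a = flip_con F a b \<cdot> \<sigma> b)" (is "_ \<longleftrightarrow> ?ty \<and> ?eq")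
proof (intro iffI conjI)
  assume w: "wedge V A F Z \<sigma>"
  then show ty: ?ty by (simp add: wedge_def)
  show ?eq
  proof (intro ballI)
    fix a b assume ab: "a \<in> EOb A" "b \<in> EOb A"
    have s: "\<sigma> c \<in> Arr V" "Dom V (\<sigma> c) = Z" "Cod V (\<sigma> c) = EFo F (c, c)" if "c \<in> EOb A" for c
      using ty that by (auto simp: hom_iff)
    note simps = s ab flip_actions[OF F] bif_simps[OF F] flip(4)
    show "flip_cov F a b \<cdot> \<sigma> a = flip_con F a b \<cdot> \<sigma> b"
      by (rule ihom_ext[where Z=Z and X="EHom A a b" and Y="EFo F (a, b)"])
        (auto simp: hom_iff simps wedgeD[OF F w])
  qed
next
  assume *: "?ty \<and> ?eq"
  have s: "\<sigma> c \<in> Arr V" "Dom V (\<sigma> c) = Z" "Cod V (\<sigma> c) = EFo F (c, c)" if "c \<in> EOb A" for c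
    using * that by (auto simp: hom_iff)
  note simps = s flip_actions[OF F] bif_simps[OF F]
  show "wedge V A F Z \<sigma>"
  proof (rule wedgeI[OF F])
    fix a b \<alpha> z
    assume ab: "a \<in> EOb A" "b \<in> EOb A" "elt V \<alpha>" "ty V \<alpha> = EHom A a b" "elt V z" "ty V z = Z" "dj \<alpha> z" "dj z \<alpha>"
    have "ev V (EHom A a b) (EFo F (a, b)) \<star> ((flip_cov F a b \<cdot> \<sigma> a) \<star> z \<parallel> \<alpha>) =
        ev V (EHom A a b) (EFo F (a, b)) \<star> ((flip_con F a b \<cdot> \<sigma> b) \<star> z \<parallel> \<alpha>)"
      using * ab by simp
    then show "ev V (EFo F (a, a)) (EFo F (a, b)) \<star> (covariant_action V A F a a b \<star> \<alpha> \<parallel> \<sigma> a \<star> z) =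
       ev V (EFo F (b, b)) (EFo F (a, b)) \<star> (contravariant_action V A F a b b \<star> \<alpha> \<parallel> \<sigma> b \<star> z)"
      using ab by (simp add: simps flip(4))
  qed (use * in auto)
qed

lemma end_diagram_functor:
  assumes F: "bif V A F"
  shows "ordinary_functor (end_shape (EOb A)) V (end_diagram V A F)"
  unfolding ordinary_functor_def end_diagram_def Let_def end_shape_def hom_def
  using bif_simps(1)[OF F] flip_actions[OF F]
  by (auto split: sum.splits if_splits)

text \<open>Replacing the apexes by isomorphic objects makes room for the image of the canonical diagram
  under an embedding that preserves internal homs only up to isomorphism.\<close>

definition presents where
  "presents F D m \<longleftrightarrow>
     (\<forall>a\<in>EOb A. FOb D (Inl a) = EFo F (a, a)) \<and>
     (\<forall>k\<in>Obj (end_shape (EOb A)). FAr D (Inl k) = Idt V (FOb D k)) \<and>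
     (\<forall>a\<in>EOb A. \<forall>b\<in>EOb A. is_iso V (m a b) \<and> Dom V (m a b) = FOb D (Inr (a, b)) \<and>
        FAr D (Inr (True, a, b)) \<in> hom V (EFo F (a, a)) (FOb D (Inr (a, b))) \<and>
        FAr D (Inr (False, a, b)) \<in> hom V (EFo F (b, b)) (FOb D (Inr (a, b))) \<and>
        flip_cov F a b = m a b \<cdot> FAr D (Inr (True, a, b)) \<and>
        flip_con F a b = m a b \<cdot> FAr D (Inr (False, a, b)))"

lemma presents_end_diagram:
  assumes F: "bif V A F"
  shows "presents F (end_diagram V A F) (\<lambda>a b. Idt V (ihom V (EHom A a b) (EFo F (a, b))))"
  using flip_actions[OF F] bif_simps[OF F]
  by (auto simp: presents_def end_diagram_def Let_def hom_iff)

text \<open>A component at an apex is forced by the first leg. The second leg then demands equality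
  of two composites, which is the wedge condition after cancelling the isomorphism
  \<open>m a b\<close>.\<close>

lemma cone_end:
  assumes F: "bif V A F" and D: "presents F D m"
  shows "cone (end_shape (EOb A)) V D Z \<pi> \<longleftrightarrow>
    Z \<in> Obj V \<and> wedge V A F Z (\<lambda>a. \<pi> (Inl a)) \<and>
    (\<forall>a\<in>EOb A. \<forall>b\<in>EOb A. \<pi> (Inr (a, b)) = FAr D (Inr (True, a, b)) \<cdot> \<pi> (Inl a))" (is "?l \<longleftrightarrow> ?r")
proof
  assume l: ?l
  have ty: "\<pi> (Inl a) \<in> hom V Z (EFo F (a, a))" if "a \<in> EOb A" for a
  proof -
    have "Inl a \<in> Obj (end_shape (EOb A))" using that by (auto simp: end_shape_def)
    then have "\<pi> (Inl a) \<in> hom V Z (FOb D (Inl a))" using l unfolding cone_def by blast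
    then show ?thesis using D that by (simp add: presents_def)
  qed
  have eq: "FAr D (Inr (e, a, b)) \<cdot> \<pi> (Inl (if e then a else b)) = \<pi> (Inr (a, b))"
    if "a \<in> EOb A" "b \<in> EOb A" for e a b
  proof -
    have "Inr (e, a, b) \<in> Arr (end_shape (EOb A))" using that by (auto simp: end_shape_def)
    then have "FAr D (Inr (e, a, b)) \<cdot> \<pi> (Dom (end_shape (EOb A)) (Inr (e, a, b))) = \<pi> (Cod (end_shape (EOb A)) (Inr (e, a, b)))"
      using l unfolding cone_def by blast
    then show ?thesis by (simp add: end_shape_def)
  qed
  have "flip_cov F a b \<cdot> \<pi> (Inl a) = flip_con F a b \<cdot> \<pi> (Inl b)" if ab: "a \<in> EOb A" "b \<in> EOb A" for a b
  proof -
    have "m a b \<cdot> (FAr D (Inr (True, a, b)) \<cdot> \<pi> (Inl a)) = m a b \<cdot> (FAr D (Inr (False, a, b)) \<cdot> \<pi> (Inl b))"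
      using eq[OF ab, of True] eq[OF ab, of False] by simp
    then show ?thesis using D ab ty[OF ab(1)] ty[OF ab(2)] is_iso_arr[of "m a b"]
      by (simp add: presents_def hom_iff)
  qed
  then show ?r using ty eq[of _ _ True] l by (auto simp: wedge_iff_flip[OF F] cone_def)
next
  assume r: ?r
  then have w: "\<And>a. a \<in> EOb A \<Longrightarrow> \<pi> (Inl a) \<in> hom V Z (EFo F (a, a))"
    "\<And>a b. a \<in> EOb A \<Longrightarrow> b \<in> EOb A \<Longrightarrow> flip_cov F a b \<cdot> \<pi> (Inl a) = flip_con F a b \<cdot> \<pi> (Inl b)"
    by (auto simp: wedge_iff_flip[OF F])
  have ty: "\<pi> k \<in> hom V Z (FOb D k)" if "k \<in> Obj (end_shape (EOb A))" for k
  proof (cases k)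
    case (Inl a)
    then show ?thesis using that w(1)[of a] D by (auto simp: end_shape_def presents_def)
  next
    case (Inr p)
    then show ?thesis using that r w(1)[of "fst p"] D
      by (cases p) (auto simp: end_shape_def presents_def hom_iff)
  qed
  moreover have "FAr D f \<cdot> \<pi> (Dom (end_shape (EOb A)) f) = \<pi> (Cod (end_shape (EOb A)) f)"
    if f: "f \<in> Arr (end_shape (EOb A))" for f
  proof (cases f)
    case (Inl k)
    then have k: "k \<in> Obj (end_shape (EOb A))" using f by (auto simp: end_shape_def)
    then show ?thesis using Inl D ty[OF k] by (simp add: presents_def hom_iff) (simp add: end_shape_def)
  next
    case (Inr p)
    obtain e a b where p: "p = (e, a, b)" by (cases p)
    have ab: "a \<in> EOb A" "b \<in> EOb A" using f Inr p by (auto simp: end_shape_def)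
    have "m a b \<cdot> (FAr D (Inr (True, a, b)) \<cdot> \<pi> (Inl a)) = m a b \<cdot> (FAr D (Inr (False, a, b)) \<cdot> \<pi> (Inl b))"
      using w(2)[OF ab] D ab w(1)[OF ab(1)] w(1)[OF ab(2)] is_iso_arr[of "m a b"]
      by (simp add: presents_def hom_iff)
    then have "FAr D (Inr (True, a, b)) \<cdot> \<pi> (Inl a) = FAr D (Inr (False, a, b)) \<cdot> \<pi> (Inl b)"
      by (rule iso_monic[rotated])
        (use D ab w(1)[OF ab(1)] w(1)[OF ab(2)] in \<open>simp_all add: presents_def hom_iff\<close>)
    then show ?thesis using Inr p r ab by (cases e) (auto simp: end_shape_def)
  qed
  ultimately show ?l using r by (auto simp: cone_def)
qed

text \<open>Cones and wedges have the same mediating arrows, since compatibility at an apex follows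
  from compatibility at its first foot.\<close>

lemma limit_end:
  assumes F: "bif V A F" and D: "presents F D m" and l: "is_limit (end_shape (EOb A)) V D Z \<pi>"
  shows "is_end V A F Z (\<lambda>a. \<pi> (Inl a))"
proof -
  let ?u = "\<lambda>a b. FAr D (Inr (True, a, b))"
  have c: "cone (end_shape (EOb A)) V D Z \<pi>" using l by (simp add: is_limit_def)
  note c' = c[unfolded cone_end[OF F D]]
  show ?thesis
    unfolding is_end_def
  proof (intro conjI allI impI)
    fix Y \<sigma> assume Y: "Y \<in> Obj V \<and> wedge V A F Y \<sigma>"
    define \<rho> where "\<rho> k = (case k of Inl a \<Rightarrow> \<sigma> a | Inr (a, b) \<Rightarrow> ?u a b \<cdot> \<sigma> a)" for k
    have "cone (end_shape (EOb A)) V D Y \<rho>"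
      unfolding cone_end[OF F D] using Y by (simp add: \<rho>_def)
    then have "\<exists>!h. h \<in> hom V Y Z \<and> (\<forall>k\<in>Obj (end_shape (EOb A)). \<pi> k \<cdot> h = \<rho> k)"
      using l by (simp add: is_limit_def)
    moreover have "(\<forall>k\<in>Obj (end_shape (EOb A)). \<pi> k \<cdot> h = \<rho> k) \<longleftrightarrow> (\<forall>a\<in>EOb A. \<pi> (Inl a) \<cdot> h = \<sigma> a)"
      if h: "h \<in> hom V Y Z" for h
    proof -
      have "\<pi> (Inr (a, b)) \<cdot> h = ?u a b \<cdot> (\<pi> (Inl a) \<cdot> h)" if "a \<in> EOb A" "b \<in> EOb A" for a b
        using c' that h D by (auto simp: wedge_def hom_iff presents_def)
      then show ?thesis by (auto simp: end_shape_def \<rho>_def ball_Plus)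
    qed
    ultimately show "\<exists>!h. h \<in> hom V Y Z \<and> (\<forall>a\<in>EOb A. \<pi> (Inl a) \<cdot> h = \<sigma> a)" by (auto cong: conj_cong)
  qed (use c' in auto)
qed

text \<open>The converse for the canonical diagram. Through it, an end that already exists in
  \<open>V\<close> becomes a limit, to which preservation by the embedding applies.\<close>

lemma end_limit_diagram:
  assumes F: "bif V A F" and e: "is_end V A F Z \<pi>"
  shows "is_limit (end_shape (EOb A)) V (end_diagram V A F) Z
    (\<lambda>k. case k of Inl a \<Rightarrow> \<pi> a | Inr (a, b) \<Rightarrow> FAr (end_diagram V A F) (Inr (True, a, b)) \<cdot> \<pi> a)" (is "is_limit _ _ _ _ ?\<pi>")
  unfolding is_limit_def
proof (intro conjI allI impI)
  have c: "Z \<in> Obj V" "wedge V A F Z \<pi>" using e by (auto simp: is_end_def)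
  then show "cone (end_shape (EOb A)) V (end_diagram V A F) Z ?\<pi>"
    by (simp add: cone_end[OF F presents_end_diagram[OF F]])
  fix Y \<rho> assume "cone (end_shape (EOb A)) V (end_diagram V A F) Y \<rho>"
  note Y = this[unfolded cone_end[OF F presents_end_diagram[OF F]]]
  then have "\<exists>!h. h \<in> hom V Y Z \<and> (\<forall>a\<in>EOb A. \<pi> a \<cdot> h = \<rho> (Inl a))"
    using e by (simp add: is_end_def)
  moreover have "(\<forall>k\<in>Obj (end_shape (EOb A)). ?\<pi> k \<cdot> h = \<rho> k) \<longleftrightarrow> (\<forall>a\<in>EOb A. \<pi> a \<cdot> h = \<rho> (Inl a))"
    if h: "h \<in> hom V Y Z" for h
  proof -
    have "?\<pi> (Inr (a, b)) \<cdot> h = FAr (end_diagram V A F) (Inr (True, a, b)) \<cdot> (\<pi> a \<cdot> h)"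
      if "a \<in> EOb A" "b \<in> EOb A" for a b
      using c that h presents_end_diagram[OF F] by (auto simp: wedge_def hom_iff presents_def)
    then show ?thesis using Y by (auto simp: end_shape_def ball_Plus)
  qed
  ultimately show "\<exists>!h. h \<in> hom V Y Z \<and> (\<forall>k\<in>Obj (end_shape (EOb A)). ?\<pi> k \<cdot> h = \<rho> k)"
    by (auto cong: conj_cong)
qed

lemma small_has_end:
  assumes "small_complete U V" "infinite U" "small U (EOb A)" "bif V A F"
  shows "has_end V A F"
proof -
  obtain Z \<pi> where "is_limit (end_shape (EOb A)) V (end_diagram V A F) Z \<pi>"
    using has_coded_limit[OF assms(1) end_shape_category assms(2) end_shape_small[OF assms(2,3)] end_diagram_functor[OF assms(4)]]
    by blast
  from limit_end[OF assms(4) presents_end_diagram[OF assms(4)] this] show ?thesis by (auto simp: has_end_def)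
qed

end

section \<open>Change of base\<close>

locale base_change = V: symmetric_monoidal_closed V + W: symmetric_monoidal_closed V'
  for V :: "('v, 'a) smc" and V' :: "('w, 'b) smc" (structure) +
  fixes i :: "('v, 'a, 'w, 'b) mfun"
  assumes mon: "symmetric_strong_monoidal V V' i" and ff: "fully_faithful V V' i"
    and ih: "preserves_internal_homs V V' i"
begin

lemma i_functor: "ordinary_functor V V' i"
  using mon by (simp add: symmetric_strong_monoidal_def)

lemma i_Obj [simp]: "X \<in> Obj V \<Longrightarrow> FOb i X \<in> Obj V'"
  using i_functor by (simp add: ordinary_functor_def)

lemma i_Idt [simp]: "X \<in> Obj V \<Longrightarrow> FAr i (Idt V X) = Idt V' (FOb i X)"
  using i_functor by (simp add: ordinary_functor_def)

lemma i_hom: "f \<in> hom V X Y \<Longrightarrow> FAr i f \<in> hom V' (FOb i X) (FOb i Y)"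
  using i_functor by (simp add: ordinary_functor_def)

lemma i_arr [simp]:
  assumes "f \<in> Arr V"
  shows "FAr i f \<in> Arr V'" "Dom V' (FAr i f) = FOb i (Dom V f)" "Cod V' (FAr i f) = FOb i (Cod V f)"
  using i_hom[of f "Dom V f" "Cod V f"] assms by (auto simp: V.hom_iff W.hom_iff)

lemma i_Comp [simp]:
  assumes "f \<in> Arr V" "g \<in> Arr V" "Dom V g = Cod V f"
  shows "FAr i (g \<cdot>\<^bsub>V\<^esub> f) = FAr i g \<cdot> FAr i f"
  using i_functor assms unfolding ordinary_functor_def by (auto simp: V.hom_iff)

lemma FUnt [simp]: "FUnt i \<in> Arr V'" "Dom V' (FUnt i) = \<one>" "Cod V' (FUnt i) = FOb i \<one>\<^bsub>V\<^esub>" "is_iso V' (FUnt i)"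
  using mon by (auto simp: symmetric_strong_monoidal_def W.hom_iff)

lemma FMul [simp]:
  assumes "X \<in> Obj V" "Y \<in> Obj V"
  shows "FMul i X Y \<in> Arr V'" "Dom V' (FMul i X Y) = FOb i X \<otimes> FOb i Y" "Cod V' (FMul i X Y) = FOb i (X \<otimes>\<^bsub>V\<^esub> Y)"
    "is_iso V' (FMul i X Y)"
  using mon assms by (auto simp: symmetric_strong_monoidal_def W.hom_iff)

text \<open>With \<open>i_asc\<close>, \<open>i_braid\<close> and \<open>i_unit\<close>, this turns
  the axioms of a strong monoidal functor into rewrite rules on elements: embedded structure arrows
  of \<open>V\<close> act on pairs as those of \<open>V'\<close> do, with \<open>FMul i\<close> in
  between.\<close>

lemma i_TenA [simp]:
  assumes "f \<in> Arr V" "g \<in> Arr V" "Dom V f = X" "Dom V g = Y" "elt V' x" "elt V' y" "ty V' x = FOb i X" "ty V' y = FOb i Y" "dj x y"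
  shows "FAr i (f \<odot>\<^bsub>V\<^esub> g) \<star> (FMul i X Y \<star> (x \<parallel> y)) = FMul i (Cod V f) (Cod V g) \<star> (FAr i f \<star> x \<parallel> FAr i g \<star> y)"
proof -
  have "FAr i (f \<odot>\<^bsub>V\<^esub> g) \<cdot> FMul i X Y = FMul i (Cod V f) (Cod V g) \<cdot> (FAr i f \<odot> FAr i g)"
    using mon assms by (simp add: symmetric_strong_monoidal_def V.hom_iff)
  then have "(FAr i (f \<odot>\<^bsub>V\<^esub> g) \<cdot> FMul i X Y) \<star> (x \<parallel> y) = (FMul i (Cod V f) (Cod V g) \<cdot> (FAr i f \<odot> FAr i g)) \<star> (x \<parallel> y)"
    by simp
  moreover have "X \<in> Obj V" "Y \<in> Obj V" using assms by auto
  ultimately show ?thesis using assms by simp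
qed

lemma i_asc [simp]:
  assumes "X \<in> Obj V" "Y \<in> Obj V" "Z \<in> Obj V" "elt V' x" "elt V' y" "elt V' z"
    "ty V' x = FOb i X" "ty V' y = FOb i Y" "ty V' z = FOb i Z" "dj x y" "dj y z" "dj x z"
  shows "FAr i (asc V X Y Z) \<star> (FMul i (X \<otimes>\<^bsub>V\<^esub> Y) Z \<star> (FMul i X Y \<star> (x \<parallel> y) \<parallel> z)) =
    FMul i X (Y \<otimes>\<^bsub>V\<^esub> Z) \<star> (x \<parallel> FMul i Y Z \<star> (y \<parallel> z))"
proof -
  have "FAr i (asc V X Y Z) \<cdot> FMul i (X \<otimes>\<^bsub>V\<^esub> Y) Z \<cdot> (FMul i X Y \<odot> Idt V' (FOb i Z)) =
        FMul i X (Y \<otimes>\<^bsub>V\<^esub> Z) \<cdot> (Idt V' (FOb i X) \<odot> FMul i Y Z) \<cdot> asc V' (FOb i X) (FOb i Y) (FOb i Z)"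
    using mon assms by (simp add: symmetric_strong_monoidal_def)
  then have "(FAr i (asc V X Y Z) \<cdot> FMul i (X \<otimes>\<^bsub>V\<^esub> Y) Z \<cdot> (FMul i X Y \<odot> Idt V' (FOb i Z))) \<star> ((x \<parallel> y) \<parallel> z) =
        (FMul i X (Y \<otimes>\<^bsub>V\<^esub> Z) \<cdot> (Idt V' (FOb i X) \<odot> FMul i Y Z) \<cdot> asc V' (FOb i X) (FOb i Y) (FOb i Z)) \<star> ((x \<parallel> y) \<parallel> z)"
    by simp
  then show ?thesis using assms by simp
qed

lemma i_braid [simp]:
  assumes "X \<in> Obj V" "Y \<in> Obj V" "elt V' x" "elt V' y"
    "ty V' x = FOb i X" "ty V' y = FOb i Y" "dj x y"
  shows "FAr i (braid V X Y) \<star> (FMul i X Y \<star> (x \<parallel> y)) = FMul i Y X \<star> (y \<parallel> x)"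
proof -
  have "FAr i (braid V X Y) \<cdot> FMul i X Y = FMul i Y X \<cdot> braid V' (FOb i X) (FOb i Y)"
    using mon assms by (simp add: symmetric_strong_monoidal_def)
  then have "(FAr i (braid V X Y) \<cdot> FMul i X Y) \<star> (x \<parallel> y) = (FMul i Y X \<cdot> braid V' (FOb i X) (FOb i Y)) \<star> (x \<parallel> y)"
    by simp
  then show ?thesis using assms by simp
qed

abbreviation "iunit \<equiv> FUnt i \<star> unit_elt V'"

lemma i_unit [simp]:
  assumes "X \<in> Obj V" "elt V' x" "ty V' x = FOb i X"
  shows "FAr i (lun V X) \<star> (FMul i \<one>\<^bsub>V\<^esub> X \<star> (iunit \<parallel> x)) = x"
    "FAr i (run V X) \<star> (FMul i X \<one>\<^bsub>V\<^esub> \<star> (x \<parallel> iunit)) = x"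
    "FAr i (inv_arr V (lun V X)) \<star> x = FMul i \<one>\<^bsub>V\<^esub> X \<star> (iunit \<parallel> x)"
    "FAr i (inv_arr V (run V X)) \<star> x = FMul i X \<one>\<^bsub>V\<^esub> \<star> (x \<parallel> iunit)"
proof -
  have "FAr i (lun V X) \<cdot> FMul i \<one>\<^bsub>V\<^esub> X \<cdot> (FUnt i \<odot> Idt V' (FOb i X)) = lun V' (FOb i X)"
    "FAr i (run V X) \<cdot> FMul i X \<one>\<^bsub>V\<^esub> \<cdot> (Idt V' (FOb i X) \<odot> FUnt i) = run V' (FOb i X)"
    using mon assms by (auto simp: symmetric_strong_monoidal_def)
  then have "(FAr i (lun V X) \<cdot> FMul i \<one>\<^bsub>V\<^esub> X \<cdot> (FUnt i \<odot> Idt V' (FOb i X))) \<star> (unit_elt V' \<parallel> x) = lun V' (FOb i X) \<star> (unit_elt V' \<parallel> x)"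
    "(FAr i (run V X) \<cdot> FMul i X \<one>\<^bsub>V\<^esub> \<cdot> (Idt V' (FOb i X) \<odot> FUnt i)) \<star> (x \<parallel> unit_elt V') = run V' (FOb i X) \<star> (x \<parallel> unit_elt V')"
    by simp_all
  then show l: "FAr i (lun V X) \<star> (FMul i \<one>\<^bsub>V\<^esub> X \<star> (iunit \<parallel> x)) = x"
    and r: "FAr i (run V X) \<star> (FMul i X \<one>\<^bsub>V\<^esub> \<star> (x \<parallel> iunit)) = x"
    using assms by simp_all
  have "FAr i (inv_arr V (lun V X)) \<star> (FAr i (lun V X) \<star> y) = y"
    if "elt V' y" "ty V' y = FOb i (\<one>\<^bsub>V\<^esub> \<otimes>\<^bsub>V\<^esub> X)" for y
    using that assms(1) W.act_Comp[of y "FAr i (lun V X)" "FAr i (inv_arr V (lun V X))", symmetric]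
    by (simp del: W.act_Comp flip: i_Comp)
  from this[of "FMul i \<one>\<^bsub>V\<^esub> X \<star> (iunit \<parallel> x)"]
  show "FAr i (inv_arr V (lun V X)) \<star> x = FMul i \<one>\<^bsub>V\<^esub> X \<star> (iunit \<parallel> x)" using assms by (simp add: l)
  have "FAr i (inv_arr V (run V X)) \<star> (FAr i (run V X) \<star> y) = y"
    if "elt V' y" "ty V' y = FOb i (X \<otimes>\<^bsub>V\<^esub> \<one>\<^bsub>V\<^esub>)" for y
    using that assms(1) W.act_Comp[of y "FAr i (run V X)" "FAr i (inv_arr V (run V X))", symmetric]
    by (simp del: W.act_Comp flip: i_Comp)
  from this[of "FMul i X \<one>\<^bsub>V\<^esub> \<star> (x \<parallel> iunit)"]
  show "FAr i (inv_arr V (run V X)) \<star> x = FMul i X \<one>\<^bsub>V\<^esub> \<star> (x \<parallel> iunit)" using assms by (simp add: r)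
qed

lemma i_app_curry [simp]:
  assumes "f \<in> Arr V" "Dom V f = Z \<otimes>\<^bsub>V\<^esub> X" "Cod V f = Y" "elt V' z" "elt V' x" "dj z x" "ty V' z = FOb i Z" "ty V' x = FOb i X"
    "Z \<in> Obj V" "X \<in> Obj V"
  shows "FAr i (ev V X Y) \<star> (FMul i (ihom V X Y) X \<star> (FAr i (curry_arr V Z X f) \<star> z \<parallel> x)) = FAr i f \<star> (FMul i Z X \<star> (z \<parallel> x))"
proof -
  have Y: "Y \<in> Obj V" using assms by auto
  have "FAr i f \<star> (FMul i Z X \<star> (z \<parallel> x)) = FAr i (ev V X Y \<cdot>\<^bsub>V\<^esub> (curry_arr V Z X f \<odot>\<^bsub>V\<^esub> Idt V X)) \<star> (FMul i Z X \<star> (z \<parallel> x))"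
    using V.curry_arr(4)[of f Z X] assms by simp
  also have "\<dots> = FAr i (ev V X Y) \<star> (FMul i (ihom V X Y) X \<star> (FAr i (curry_arr V Z X f) \<star> z \<parallel> x))"
    using assms Y by simp
  finally show ?thesis by simp
qed

lemma comparison [simp]:
  assumes "X \<in> Obj V" "Y \<in> Obj V"
  shows "ihom_comparison V V' i X Y \<in> Arr V'" "Dom V' (ihom_comparison V V' i X Y) = FOb i (ihom V X Y)"
    "Cod V' (ihom_comparison V V' i X Y) = ihom V' (FOb i X) (FOb i Y)"
    "is_iso V' (ihom_comparison V V' i X Y)"
    "elt V' h \<Longrightarrow> elt V' x \<Longrightarrow> dj h x \<Longrightarrow> ty V' h = FOb i (ihom V X Y) \<Longrightarrow> ty V' x = FOb i X \<Longrightarrow>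
      ev V' (FOb i X) (FOb i Y) \<star> (ihom_comparison V V' i X Y \<star> h \<parallel> x) =
      FAr i (ev V X Y) \<star> (FMul i (ihom V X Y) X \<star> (h \<parallel> x))"
  using assms ih by (simp_all add: ihom_comparison_def preserves_internal_homs_def)

lemma faithful:
  assumes "f \<in> hom V X Y" "g \<in> hom V X Y" "FAr i f = FAr i g"
  shows "f = g"
proof -
  have "X \<in> Obj V" "Y \<in> Obj V" using assms(1) by (auto simp: V.hom_iff)
  then have "inj_on (FAr i) (hom V X Y)" using ff by (auto simp: fully_faithful_def bij_betw_def)
  then show ?thesis using assms by (auto dest: inj_onD)
qed

lemma full:
  assumes "h \<in> hom V' (FOb i X) (FOb i Y)" "X \<in> Obj V" "Y \<in> Obj V"
  shows "\<exists>f\<in>hom V X Y. FAr i f = h"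
proof -
  have "FAr i ` hom V X Y = hom V' (FOb i X) (FOb i Y)"
    using ff assms by (auto simp: fully_faithful_def bij_betw_def)
  then show ?thesis using assms(1) by (metis imageE)
qed

text \<open>The transport principle: an equation proved between arrows of \<open>V\<close> is
  applied to an element of \<open>V'\<close>, and the rewrite rules for \<open>i\<close> evaluate
  both sides.\<close>

lemma i_eq_act:
  "f = g \<Longrightarrow> FAr i f \<star> x = FAr i g \<star> x" by simp

lemma base_simps [simp]:
  "EOb (base_cat V' i A) = EOb A" "EHom (base_cat V' i A) x y = FOb i (EHom A x y)"
  "EComp (base_cat V' i A) x y z = FAr i (EComp A x y z) \<cdot> FMul i (EHom A y z) (EHom A x y)"
  "EId (base_cat V' i A) x = FAr i (EId A x) \<cdot> FUnt i"
  by (simp_all add: base_cat_def)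

lemma base_enriched:
  assumes "enriched_category V A"
  shows "enriched_category V' (base_cat V' i A)"
proof -
  interpret A: enriched_category V A by fact
  show ?thesis
  proof (rule W.enriched_categoryI)
    fix w x y z h g f
    assume "w \<in> EOb (base_cat V' i A)" "x \<in> EOb (base_cat V' i A)" "y \<in> EOb (base_cat V' i A)" "z \<in> EOb (base_cat V' i A)"
      "elt V' h" "elt V' g" "elt V' f" "ty V' h = EHom (base_cat V' i A) y z" "ty V' g = EHom (base_cat V' i A) x y"
      "ty V' f = EHom (base_cat V' i A) w x" "dj h g" "dj g h" "dj g f" "dj f g" "dj h f" "dj f h"
    then show "EComp (base_cat V' i A) w x z \<star> (EComp (base_cat V' i A) x y z \<star> (h \<parallel> g) \<parallel> f) =
      EComp (base_cat V' i A) w y z \<star> (h \<parallel> EComp (base_cat V' i A) w x y \<star> (g \<parallel> f))"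
      using i_eq_act[OF A.EComp_assoc, of w x y z
        "FMul i (EHom A y z \<otimes>\<^bsub>V\<^esub> EHom A x y) (EHom A w x) \<star> (FMul i (EHom A y z) (EHom A x y) \<star> (h \<parallel> g) \<parallel> f)"]
      by simp
  next
    fix x y f assume "x \<in> EOb (base_cat V' i A)" "y \<in> EOb (base_cat V' i A)" "elt V' f" "ty V' f = EHom (base_cat V' i A) x y"
    then show "EComp (base_cat V' i A) x y y \<star> (EId (base_cat V' i A) y \<star> unit_elt V' \<parallel> f) = f"
      "EComp (base_cat V' i A) x x y \<star> (f \<parallel> EId (base_cat V' i A) x \<star> unit_elt V') = f"
      using i_eq_act[OF A.EId_left, of x y "FMul i \<one>\<^bsub>V\<^esub> (EHom A x y) \<star> (iunit \<parallel> f)"]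
        i_eq_act[OF A.EId_right, of x y "FMul i (EHom A x y) \<one>\<^bsub>V\<^esub> \<star> (f \<parallel> iunit)"]
      by simp_all
  qed (auto simp: W.hom_iff)
qed

text \<open>Base change and passage to the opposite category commute on composition because
  \<open>i\<close> respects the braiding. Stating this on elements avoids identifying the two
  resulting categories.\<close>

lemma base_op_comp:
  assumes "enriched_category V A" "x \<in> EOb A" "y \<in> EOb A" "z \<in> EOb A" "elt V' g" "elt V' f"
    "ty V' g = FOb i (EHom A z y)" "ty V' f = FOb i (EHom A y x)" "dj g f"
  shows "EComp (base_cat V' i (op_cat V A)) x y z \<star> (g \<parallel> f) = EComp (base_cat V' i A) z y x \<star> (f \<parallel> g)"
proof -
  interpret A: enriched_category V A by fact
  interpret op: enriched_category V "op_cat V A" by (rule A.enriched_op)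
  have "dj f g" using assms by (auto simp: dj_def)
  then show ?thesis using assms(2-) by (simp add: op_cat_def)
qed

lemma base_fun_simps [simp]:
  "x \<in> EOb A \<Longrightarrow> EFo (base_fun V' i A F) x = EFo F x"
  "x \<in> EOb A \<Longrightarrow> y \<in> EOb A \<Longrightarrow> EFh (base_fun V' i A F) x y = FAr i (EFh F x y)"
  by (simp_all add: base_fun_def)

lemma base_fun_fun:
  assumes "enriched_fun V A B F"
  shows "enriched_fun V' (base_cat V' i A) (base_cat V' i B) (base_fun V' i A F)"
proof -
  interpret F: enriched_fun V A B F by fact
  show ?thesis
    unfolding base_fun_def
  proof (rule mk_enriched_fun)
    fix x y z g f
    assume *: "x \<in> EOb (base_cat V' i A)" "y \<in> EOb (base_cat V' i A)" "z \<in> EOb (base_cat V' i A)" "elt V' g" "elt V' f"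
      "ty V' g = EHom (base_cat V' i A) y z" "ty V' f = EHom (base_cat V' i A) x y" "dj g f" "dj f g"
    have "EFh F x z \<cdot>\<^bsub>V\<^esub> EComp A x y z = EComp B (EFo F x) (EFo F y) (EFo F z) \<cdot>\<^bsub>V\<^esub> (EFh F y z \<odot>\<^bsub>V\<^esub> EFh F x y)"
      using F.F * by (simp add: enriched_functor_def)
    from i_eq_act[OF this, of "FMul i (EHom A y z) (EHom A x y) \<star> (g \<parallel> f)"]
    show "FAr i (EFh F x z) \<star> (EComp (base_cat V' i A) x y z \<star> (g \<parallel> f)) =
       EComp (base_cat V' i B) (EFo F x) (EFo F y) (EFo F z) \<star> (FAr i (EFh F y z) \<star> g \<parallel> FAr i (EFh F x y) \<star> f)"
      using * by simp
  next
    fix x assume *: "x \<in> EOb (base_cat V' i A)"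
    have "EFh F x x \<cdot>\<^bsub>V\<^esub> EId A x = EId B (EFo F x)" using F.F * by (simp add: enriched_functor_def)
    from i_eq_act[OF this, of iunit]
    show "FAr i (EFh F x x) \<star> (EId (base_cat V' i A) x \<star> unit_elt V') = EId (base_cat V' i B) (EFo F x) \<star> unit_elt V'"
      using * by simp
  qed (auto simp: W.hom_iff base_enriched F.A.enriched_category_axioms F.B.enriched_category_axioms)
qed

end

lemma op_Ob [simp]: "EOb (op_cat V A) = EOb A"
  by (simp add: op_cat_def)

lemma (in symmetric_monoidal_closed) ext_unit:
  assumes "f \<in> hom V (X \<otimes> \<one>) Y" "g \<in> hom V (X \<otimes> \<one>) Y" "X \<in> Obj V"
    "\<And>x. elt V x \<Longrightarrow> ty V x = X \<Longrightarrow> f \<star> (x \<parallel> unit_elt V) = g \<star> (x \<parallel> unit_elt V)"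
  shows "f = g"
proof -
  have "f \<cdot> inv_arr V (run V X) = g \<cdot> inv_arr V (run V X)"
    by (rule ext1[where X=X and Y=Y]) (use assms(1-3) in \<open>auto simp: hom_iff assms(4)\<close>)
  then show ?thesis by (rule iso_epic[rotated]) (use assms(1-3) in \<open>auto simp: hom_iff\<close>)
qed

section \<open>Natural transformations as wedges from the unit\<close>

context fun_pair
begin

lemma natural_arr:
  assumes "enriched_natural V A B F G \<phi>" "a \<in> EOb A"
  shows "\<phi> a \<in> Arr V" "Dom V (\<phi> a) = \<one>" "Cod V (\<phi> a) = EHom B (EFo F a) (EFo G a)"
  using assms by (auto simp: enriched_natural_def F.A.hom_iff)

lemma naturalD:
  assumes "enriched_natural V A B F G \<phi>" "a \<in> EOb A" "b \<in> EOb A" "elt V \<alpha>" "ty V \<alpha> = EHom A a b"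
  shows "EComp B (EFo F a) (EFo F b) (EFo G b) \<star> (\<phi> b \<star> unit_elt V \<parallel> EFh F a b \<star> \<alpha>) =
    EComp B (EFo F a) (EFo G a) (EFo G b) \<star> (EFh G a b \<star> \<alpha> \<parallel> \<phi> a \<star> unit_elt V)"
proof -
  have "(EComp B (EFo F a) (EFo F b) (EFo G b) \<cdot> (\<phi> b \<odot> EFh F a b) \<cdot> inv_arr V (lun V (EHom A a b))) \<star> \<alpha> =
    (EComp B (EFo F a) (EFo G a) (EFo G b) \<cdot> (EFh G a b \<odot> \<phi> a) \<cdot> inv_arr V (run V (EHom A a b))) \<star> \<alpha>"
    using assms(1-3) by (simp add: enriched_natural_def)
  then show ?thesis using assms(2-) natural_arr[OF assms(1)] by simp
qed

lemma naturalI: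
  assumes ty: "\<And>a. a \<in> EOb A \<Longrightarrow> \<phi> a \<in> hom V \<one> (EHom B (EFo F a) (EFo G a))"
    and eq: "\<And>a b \<alpha>. a \<in> EOb A \<Longrightarrow> b \<in> EOb A \<Longrightarrow> elt V \<alpha> \<Longrightarrow> ty V \<alpha> = EHom A a b \<Longrightarrow>
      EComp B (EFo F a) (EFo F b) (EFo G b) \<star> (\<phi> b \<star> unit_elt V \<parallel> EFh F a b \<star> \<alpha>) =
      EComp B (EFo F a) (EFo G a) (EFo G b) \<star> (EFh G a b \<star> \<alpha> \<parallel> \<phi> a \<star> unit_elt V)"
  shows "enriched_natural V A B F G \<phi>"
  unfolding enriched_natural_def
proof (intro conjI ballI ty)
  have s: "\<phi> a \<in> Arr V" "Dom V (\<phi> a) = \<one>" "Cod V (\<phi> a) = EHom B (EFo F a) (EFo G a)" if "a \<in> EOb A" for a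
    using ty[OF that] by (auto simp: F.A.hom_iff)
  fix a b assume ab: "a \<in> EOb A" "b \<in> EOb A"
  show "EComp B (EFo F a) (EFo F b) (EFo G b) \<cdot> (\<phi> b \<odot> EFh F a b) \<cdot> inv_arr V (lun V (EHom A a b)) =
    EComp B (EFo F a) (EFo G a) (EFo G b) \<cdot> (EFh G a b \<odot> \<phi> a) \<cdot> inv_arr V (run V (EHom A a b))"
    by (rule F.A.ext1[where X="EHom A a b" and Y="EHom B (EFo F a) (EFo G b)"])
      (use ab in \<open>auto simp: F.A.hom_iff s eq\<close>)
qed

text \<open>The definition of naturality tests a wedge at \<open>unit_elt V\<close> alone. That
  suffices for every element of the unit, because by \<open>ext_unit\<close> the canonical element
  determines arrows out of \<open>X \<otimes> \<one>\<close>.\<close>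

lemma wedge_unit_natural: "wedge V A (nat_bifunctor V A B F G) \<one> \<phi> \<longleftrightarrow> enriched_natural V A B F G \<phi>"
proof
  assume w: "wedge V A (nat_bifunctor V A B F G) \<one> \<phi>"
  then show "enriched_natural V A B F G \<phi>"
    by (intro naturalI) (auto simp: wedge_def intro!: wedge_natD[OF w, symmetric] simp: dj_def)
next
  assume n: "enriched_natural V A B F G \<phi>"
  note s = natural_arr[OF n]
  show "wedge V A (nat_bifunctor V A B F G) \<one> \<phi>"
  proof (rule wedge_natI)
    show "\<phi> a \<in> hom V \<one> (EHom B (EFo F a) (EFo G a))" if "a \<in> EOb A" for a
      using s[OF that] by (simp add: F.A.hom_iff)
    fix a b \<alpha> z
    assume *: "a \<in> EOb A" "b \<in> EOb A" "elt V \<alpha>" "ty V \<alpha> = EHom A a b" "elt V z" "ty V z = \<one>" "dj \<alpha> z" "dj z \<alpha>"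
    let ?f = "EComp B (EFo F a) (EFo G a) (EFo G b) \<cdot> (EFh G a b \<odot> \<phi> a)"
      and ?g = "EComp B (EFo F a) (EFo F b) (EFo G b) \<cdot> ((\<phi> b \<odot> EFh F a b) \<cdot> braid V (EHom A a b) \<one>)"
    have "?f = ?g"
      by (rule F.A.ext_unit[where X="EHom A a b" and Y="EHom B (EFo F a) (EFo G b)"])
        (use * in \<open>auto simp: F.A.hom_iff s naturalD[OF n]\<close>)
    then have "?f \<star> (\<alpha> \<parallel> z) = ?g \<star> (\<alpha> \<parallel> z)" by simp
    then show "EComp B (EFo F a) (EFo G a) (EFo G b) \<star> (EFh G a b \<star> \<alpha> \<parallel> \<phi> a \<star> z) =
       EComp B (EFo F a) (EFo F b) (EFo G b) \<star> (\<phi> b \<star> z \<parallel> EFh F a b \<star> \<alpha>)"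
      using * s by simp
  qed
qed

end

context base_change
begin

lemma comparison_inj:
  assumes "X \<in> Obj V" "Y \<in> Obj V" "elt V' h" "elt V' k" "ty V' h = FOb i (ihom V X Y)" "ty V' k = FOb i (ihom V X Y)"
    "ihom_comparison V V' i X Y \<star> h = ihom_comparison V V' i X Y \<star> k"
  shows "h = k"
proof -
  have "h = inv_arr V' (ihom_comparison V V' i X Y) \<star> (ihom_comparison V V' i X Y \<star> h)"
    using W.act_inv_inverse(1)[of "ihom_comparison V V' i X Y" h] assms(1-6) by simp
  also have "\<dots> = k" unfolding assms(7) using assms by simp
  finally show ?thesis .
qed

text \<open>The comparison maps commute with transposition. This tells how the legs of an end
  diagram change under \<open>i\<close>, and thereby which isomorphisms correct the apexes.\<close>

lemma i_flip:
  assumes "c \<in> Arr V" "Dom V c = P" "Cod V c = ihom V X Y" "X \<in> Obj V" "Y \<in> Obj V"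
  shows "flip V' (FOb i P) (FOb i X) (FOb i Y) (ihom_comparison V V' i X Y \<cdot> FAr i c) =
    ihom_comparison V V' i P Y \<cdot> FAr i (flip V P X Y c)"
proof -
  have P: "P \<in> Obj V" using assms by auto
  have dj_sym: "dj x y \<Longrightarrow> dj y x" for x y :: "('w, 'b) elt" by (auto simp: dj_def)
  have f: "flip V P X Y c \<in> Arr V" "Dom V (flip V P X Y c) = X" "Cod V (flip V P X Y c) = ihom V P Y"
    using V.flip(1-3)[OF assms] by simp_all
  have e: "FAr i (ev V P Y) \<star> (FMul i (ihom V P Y) P \<star> (FAr i (flip V P X Y c) \<star> x \<parallel> p)) =
      FAr i (ev V X Y) \<star> (FMul i (ihom V X Y) X \<star> (FAr i c \<star> p \<parallel> x))"
    if "elt V' x" "ty V' x = FOb i X" "elt V' p" "ty V' p = FOb i P" "dj x p" for x p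
    unfolding flip_def by (subst i_app_curry) (use assms P that dj_sym[OF that(5)] in auto)
  show ?thesis
    by (rule W.ihom_ext[where Z="FOb i X" and X="FOb i P" and Y="FOb i Y"])
      (use assms P f in \<open>auto simp: W.hom_iff W.flip e\<close>)
qed

end

section \<open>Ends of base-changed bifunctors\<close>

locale base_bifun = base_change V V' i + B: bifun V A L R
  for V :: "('v, 'a) smc" and V' :: "('w, 'b) smc" (structure) and i :: "('v, 'a, 'w, 'b) mfun"
    and A :: "('x, 'v, 'a) ecat" and L R
begin

abbreviation "bA \<equiv> base_cat V' i A"
abbreviation "bF \<equiv> base_bifunctor V V' i A B.F"

sublocale bA: enriched_category V' bA
  by (rule base_enriched[OF B.A.enriched_category_axioms])

lemma Rob [simp]: "a \<in> EOb A \<Longrightarrow> b \<in> EOb A \<Longrightarrow> EFo (R a) b \<in> Obj V"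
  using enriched_fun.Fo[OF B.R, of a b] by simp

lemma R_arr [simp]:
  assumes "a \<in> EOb A" "b \<in> EOb A" "c \<in> EOb A"
  shows "EFh (R a) b c \<in> Arr V" "Dom V (EFh (R a) b c) = EHom A b c" "Cod V (EFh (R a) b c) = ihom V (EFo (R a) b) (EFo (R a) c)"
    "EFh (L c) a b \<in> Arr V" "Dom V (EFh (L c) a b) = EHom A b a" "Cod V (EFh (L c) a b) = ihom V (EFo (R a) c) (EFo (R b) c)"
  using enriched_fun.Fh[OF B.R, of a b c] enriched_fun.Fh[OF B.L, of c a b] assms by (simp_all add: B.LR)

lemma bF_ob [simp]: "a \<in> EOb A \<Longrightarrow> b \<in> EOb A \<Longrightarrow> EFo bF (a, b) = FOb i (EFo (R a) b)"
  by (simp add: base_bifunctor_def)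

lemma bF_actions:
  assumes "a \<in> EOb A" "b \<in> EOb A" "c \<in> EOb A"
  shows "covariant_action V' bA bF a b c = ihom_comparison V V' i (EFo (R a) b) (EFo (R a) c) \<cdot> FAr i (EFh (R a) b c)"
    "contravariant_action V' bA bF a b c = ihom_comparison V V' i (EFo (R b) c) (EFo (R a) c) \<cdot> FAr i (EFh (L c) b a)"
proof -
  have F: "EFh B.F (a, b) (a', b') \<in> Arr V" "Dom V (EFh B.F (a, b) (a', b')) = EHom A a' a \<otimes>\<^bsub>V\<^esub> EHom A b b'"
    "Cod V (EFh B.F (a, b) (a', b')) = ihom V (EFo (R a) b) (EFo (R a') b')"
    if "a \<in> EOb A" "b \<in> EOb A" "a' \<in> EOb A" "b' \<in> EOb A" for a b a' b'
    using that by (simp_all del: B.A.op_simps)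
  have bF: "EFh bF (a, b) (a', b') = ihom_comparison V V' i (EFo (R a) b) (EFo (R a') b') \<cdot>
        FAr i (EFh B.F (a, b) (a', b')) \<cdot> FMul i (EHom A a' a) (EHom A b b')"
    if "a \<in> EOb A" "b \<in> EOb A" "a' \<in> EOb A" "b' \<in> EOb A" for a b a' b'
    using that by (simp add: base_bifunctor_def del: bifunctor_simps(2))
  have c: "FAr i (covariant_action V A B.F a b c) \<star> z = FAr i (EFh B.F (a, b) (a, c)) \<star>
      (FMul i (EHom A a a) (EHom A b c) \<star> (FAr i (EId A a) \<star> iunit \<parallel> z))"
    if "elt V' z" "ty V' z = FOb i (EHom A b c)" for z
    using assms that by (simp add: covariant_action_def F del: bifunctor_simps)
  have d: "FAr i (contravariant_action V A B.F a b c) \<star> z = FAr i (EFh B.F (b, c) (a, c)) \<star>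
      (FMul i (EHom A a b) (EHom A c c) \<star> (z \<parallel> FAr i (EId A c) \<star> iunit))"
    if "elt V' z" "ty V' z = FOb i (EHom A a b)" for z
    using assms that by (simp add: contravariant_action_def F del: bifunctor_simps)
  show "covariant_action V' bA bF a b c = ihom_comparison V V' i (EFo (R a) b) (EFo (R a) c) \<cdot> FAr i (EFh (R a) b c)"
    unfolding covariant_action_def[of V']
    by (rule W.ext1[where X="FOb i (EHom A b c)" and Y="ihom V' (FOb i (EFo (R a) b)) (FOb i (EFo (R a) c))"])
      (use assms in \<open>auto simp: W.hom_iff bF F c[unfolded B.actions(1)[OF assms]] simp del: bifunctor_simps\<close>)
  show "contravariant_action V' bA bF a b c = ihom_comparison V V' i (EFo (R b) c) (EFo (R a) c) \<cdot> FAr i (EFh (L c) b a)"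
    unfolding contravariant_action_def[of V']
    by (rule W.ext1[where X="FOb i (EHom A a b)" and Y="ihom V' (FOb i (EFo (R b) c)) (FOb i (EFo (R a) c))"])
      (use assms in \<open>auto simp: W.hom_iff bF F d[unfolded B.actions(2)[OF assms]] simp del: bifunctor_simps\<close>)
qed

lemma bF_bif: "bif V' bA bF"
  unfolding bif_def by (auto simp: bF_actions W.hom_iff)

lemma bF_flip:
  assumes "a \<in> EOb A" "b \<in> EOb A"
  shows "bA.flip_cov bF a b = ihom_comparison V V' i (EHom A a b) (EFo (R a) b) \<cdot> FAr i (B.A.flip_cov B.F a b)"
    "bA.flip_con bF a b = ihom_comparison V V' i (EHom A a b) (EFo (R a) b) \<cdot> FAr i (B.A.flip_con B.F a b)"
  using assms by (simp_all add: bF_actions B.actions i_flip)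

text \<open>The image of the end diagram has apexes \<open>i [A(a, b), F(a, b)]\<close>, which are
  not internal homs of \<open>V'\<close>. The comparison isomorphisms play the part of
  \<open>m\<close> in \<open>presents\<close>, so the limit of the image diagram is still an
  end.\<close>

lemma preserves_end:
  assumes "preserves_limits U V V' i" "infinite U" "small U (EOb A)" "is_end V A B.F Z \<pi>"
  shows "is_end V' bA bF (FOb i Z) (\<lambda>a. FAr i (\<pi> a))"
proof -
  let ?D = "\<lparr>FOb = FOb i \<circ> FOb (end_diagram V A B.F), FAr = FAr i \<circ> FAr (end_diagram V A B.F)\<rparr>"
  have obs: "EFo B.F (a, b) = EFo (R a) b" if "a \<in> EOb A" "b \<in> EOb A" for a b using that by simp
  note l = preserves_coded_limit[OF assms(1) end_shape_category end_shape_small[OF assms(2,3)]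
      B.A.end_diagram_functor[OF B.bif] B.A.end_limit_diagram[OF B.bif assms(4)]]
  note fl = B.A.flip_actions[OF B.bif]
  have "bA.presents bF ?D (\<lambda>a b. ihom_comparison V V' i (EHom A a b) (EFo (R a) b))"
    unfolding bA.presents_def
  proof (intro conjI ballI)
    fix k assume "k \<in> Obj (end_shape (EOb bA))"
    then show "FAr ?D (Inl k) = Idt V' (FOb ?D k)"
      by (auto simp: end_shape_def end_diagram_def Let_def)
  next
    fix a b assume ab: "a \<in> EOb bA" "b \<in> EOb bA"
    then show "bA.flip_cov bF a b = ihom_comparison V V' i (EHom A a b) (EFo (R a) b) \<cdot> FAr ?D (Inr (True, a, b))"
      "bA.flip_con bF a b = ihom_comparison V V' i (EHom A a b) (EFo (R a) b) \<cdot> FAr ?D (Inr (False, a, b))"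
      using bF_flip[of a b] by (simp_all add: end_diagram_def Let_def del: bF_ob bifunctor_simps)
    show "FAr ?D (Inr (True, a, b)) \<in> hom V' (EFo bF (a, a)) (FOb ?D (Inr (a, b)))"
      "FAr ?D (Inr (False, a, b)) \<in> hom V' (EFo bF (b, b)) (FOb ?D (Inr (a, b)))"
      using ab fl[of a b] by (simp_all add: end_diagram_def Let_def W.hom_iff)
  qed (auto simp: end_diagram_def Let_def)
  from bA.limit_end[OF bF_bif this, unfolded base_simps, OF l] show ?thesis by simp
qed

lemma wedge_baseI:
  assumes "\<And>a. a \<in> EOb A \<Longrightarrow> \<sigma> a \<in> hom V' Z (FOb i (EFo (R a) a))"
    "\<And>a b \<alpha> z. a \<in> EOb A \<Longrightarrow> b \<in> EOb A \<Longrightarrow> elt V' \<alpha> \<Longrightarrow> ty V' \<alpha> = FOb i (EHom A a b) \<Longrightarrow> elt V' z \<Longrightarrow> ty V' z = Z \<Longrightarrow>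
       dj \<alpha> z \<Longrightarrow> dj z \<alpha> \<Longrightarrow>
       FAr i (ev V (EFo (R a) a) (EFo (R a) b)) \<star> (FMul i (ihom V (EFo (R a) a) (EFo (R a) b)) (EFo (R a) a) \<star>
         (FAr i (EFh (R a) a b) \<star> \<alpha> \<parallel> \<sigma> a \<star> z)) =
       FAr i (ev V (EFo (R b) b) (EFo (R a) b)) \<star> (FMul i (ihom V (EFo (R b) b) (EFo (R a) b)) (EFo (R b) b) \<star>
         (FAr i (EFh (L b) b a) \<star> \<alpha> \<parallel> \<sigma> b \<star> z))"
  shows "wedge V' bA bF Z \<sigma>"
  using assms(1)[unfolded W.hom_iff]
  by (intro bA.wedgeI[OF bF_bif]) (auto simp: bF_actions W.hom_iff assms(2))

lemma wedge_baseI2: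
  assumes "X \<in> Obj V'" "Y \<in> Obj V'" "\<And>a. a \<in> EOb A \<Longrightarrow> \<sigma> a \<in> hom V' (X \<otimes> Y) (FOb i (EFo (R a) a))"
    "\<And>a b \<alpha> x y. a \<in> EOb A \<Longrightarrow> b \<in> EOb A \<Longrightarrow> elt V' \<alpha> \<Longrightarrow> ty V' \<alpha> = FOb i (EHom A a b) \<Longrightarrow>
       elt V' x \<Longrightarrow> ty V' x = X \<Longrightarrow> elt V' y \<Longrightarrow> ty V' y = Y \<Longrightarrow>
       dj \<alpha> x \<Longrightarrow> dj x \<alpha> \<Longrightarrow> dj \<alpha> y \<Longrightarrow> dj y \<alpha> \<Longrightarrow> dj x y \<Longrightarrow> dj y x \<Longrightarrow>
       FAr i (ev V (EFo (R a) a) (EFo (R a) b)) \<star> (FMul i (ihom V (EFo (R a) a) (EFo (R a) b)) (EFo (R a) a) \<star>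
         (FAr i (EFh (R a) a b) \<star> \<alpha> \<parallel> \<sigma> a \<star> (x \<parallel> y))) =
       FAr i (ev V (EFo (R b) b) (EFo (R a) b)) \<star> (FMul i (ihom V (EFo (R b) b) (EFo (R a) b)) (EFo (R b) b) \<star>
         (FAr i (EFh (L b) b a) \<star> \<alpha> \<parallel> \<sigma> b \<star> (x \<parallel> y)))"
  shows "wedge V' bA bF (X \<otimes> Y) \<sigma>"
  using assms(3)[unfolded W.hom_iff]
  by (intro bA.wedgeI2[OF bF_bif assms(1,2)]) (auto simp: bF_actions W.hom_iff assms(1,2,4))

lemma wedge_baseD:
  assumes w: "wedge V' bA bF Z \<sigma>"
    and *: "a \<in> EOb A" "b \<in> EOb A" "elt V' \<alpha>" "ty V' \<alpha> = FOb i (EHom A a b)" "elt V' z" "ty V' z = Z" "dj \<alpha> z"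
  shows "FAr i (ev V (EFo (R a) a) (EFo (R a) b)) \<star> (FMul i (ihom V (EFo (R a) a) (EFo (R a) b)) (EFo (R a) a) \<star>
         (FAr i (EFh (R a) a b) \<star> \<alpha> \<parallel> \<sigma> a \<star> z)) =
       FAr i (ev V (EFo (R b) b) (EFo (R a) b)) \<star> (FMul i (ihom V (EFo (R b) b) (EFo (R a) b)) (EFo (R b) b) \<star>
         (FAr i (EFh (L b) b a) \<star> \<alpha> \<parallel> \<sigma> b \<star> z))"
proof -
  have s: "\<sigma> c \<in> Arr V'" "Dom V' (\<sigma> c) = Z" "Cod V' (\<sigma> c) = FOb i (EFo (R c) c)" if "c \<in> EOb A" for c
    using w that by (auto simp: wedge_def W.hom_iff)
  show ?thesis using bA.wedgeD[OF bF_bif w, of a b \<alpha> z] * s by (simp add: bF_actions)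
qed

text \<open>The wedge equation in \<open>V'\<close> is the embedded equation of \<open>V\<close>
  with a comparison map in front and \<open>FUnt i\<close> behind. Both are invertible, and
  \<open>i\<close> is faithful.\<close>

lemma unit_wedge:
  assumes "\<And>a. a \<in> EOb A \<Longrightarrow> \<sigma> a \<in> hom V \<one>\<^bsub>V\<^esub> (EFo (R a) a)"
  shows "wedge V' bA bF \<one> (\<lambda>a. FAr i (\<sigma> a) \<cdot> FUnt i) \<longleftrightarrow> wedge V A B.F \<one>\<^bsub>V\<^esub> \<sigma>"
proof -
  have s: "\<sigma> c \<in> Arr V" "Dom V (\<sigma> c) = \<one>\<^bsub>V\<^esub>" "Cod V (\<sigma> c) = EFo (R c) c" if "c \<in> EOb A" for c
    using assms that by (auto simp: V.hom_iff)
  note fl = B.A.flip_actions[OF B.bif]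
  have "bA.flip_cov bF a b \<cdot> (FAr i (\<sigma> a) \<cdot> FUnt i) = bA.flip_con bF a b \<cdot> (FAr i (\<sigma> b) \<cdot> FUnt i) \<longleftrightarrow>
      B.A.flip_cov B.F a b \<cdot>\<^bsub>V\<^esub> \<sigma> a = B.A.flip_con B.F a b \<cdot>\<^bsub>V\<^esub> \<sigma> b" (is "?l \<longleftrightarrow> ?r")
    if ab: "a \<in> EOb A" "b \<in> EOb A" for a b
  proof -
    let ?c = "ihom_comparison V V' i (EHom A a b) (EFo (R a) b)"
    let ?f = "B.A.flip_cov B.F a b \<cdot>\<^bsub>V\<^esub> \<sigma> a" and ?g = "B.A.flip_con B.F a b \<cdot>\<^bsub>V\<^esub> \<sigma> b"
    have fg: "?f \<in> hom V \<one>\<^bsub>V\<^esub> (ihom V (EHom A a b) (EFo (R a) b))" "?g \<in> hom V \<one>\<^bsub>V\<^esub> (ihom V (EHom A a b) (EFo (R a) b))"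
      using ab s fl[of a b] by (simp_all add: V.hom_iff)
    have "?l \<longleftrightarrow> ?c \<cdot> (FAr i ?f \<cdot> FUnt i) = ?c \<cdot> (FAr i ?g \<cdot> FUnt i)"
      unfolding bF_flip[OF ab] using ab s fl[of a b] by simp
    also have "\<dots> \<longleftrightarrow> FAr i ?f = FAr i ?g"
    proof
      assume "?c \<cdot> (FAr i ?f \<cdot> FUnt i) = ?c \<cdot> (FAr i ?g \<cdot> FUnt i)"
      then have "FAr i ?f \<cdot> FUnt i = FAr i ?g \<cdot> FUnt i"
        by (rule W.iso_monic[rotated]) (use ab fg in \<open>auto simp: V.hom_iff simp del: i_Comp\<close>)
      then show "FAr i ?f = FAr i ?g"
        by (rule W.iso_epic[rotated]) (use ab fg in \<open>auto simp: V.hom_iff simp del: i_Comp\<close>)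
    qed simp
    also have "\<dots> \<longleftrightarrow> ?r" using faithful[OF fg] by auto
    finally show ?thesis .
  qed
  then show ?thesis
    unfolding bA.wedge_iff_flip[OF bF_bif] B.A.wedge_iff_flip[OF B.bif] using s by (auto simp: W.hom_iff V.hom_iff)
qed

end

context base_change
begin

text \<open>Evaluating an embedded naturality square at an element gives the naturality equation
  over \<open>V'\<close>; conversely, the equation on all elements determines the embedded square,
  and \<open>i\<close> is faithful.\<close>

lemma natural_base_iff:
  assumes "enriched_fun V A B F" "enriched_fun V A B G" "\<And>a. a \<in> EOb A \<Longrightarrow> \<phi> a \<in> hom V \<one>\<^bsub>V\<^esub> (EHom B (EFo F a) (EFo G a))"
  shows "enriched_natural V' (base_cat V' i A) (base_cat V' i B) (base_fun V' i A F) (base_fun V' i A G) (\<lambda>a. FAr i (\<phi> a) \<cdot> FUnt i)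
    \<longleftrightarrow> enriched_natural V A B F G \<phi>"
proof -
  interpret FG: fun_pair V A B F G using assms by (simp add: fun_pair_def)
  interpret b: fun_pair V' "base_cat V' i A" "base_cat V' i B" "base_fun V' i A F" "base_fun V' i A G"
    using assms by (simp add: fun_pair_def base_fun_fun)
  have s: "\<phi> c \<in> Arr V" "Dom V (\<phi> c) = \<one>\<^bsub>V\<^esub>" "Cod V (\<phi> c) = EHom B (EFo F c) (EFo G c)" if "c \<in> EOb A" for c
    using assms(3) that by (auto simp: V.hom_iff)
  let ?f = "\<lambda>a b. EComp B (EFo F a) (EFo F b) (EFo G b) \<cdot>\<^bsub>V\<^esub> (\<phi> b \<odot>\<^bsub>V\<^esub> EFh F a b) \<cdot>\<^bsub>V\<^esub> inv_arr V (lun V (EHom A a b))"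
    and ?g = "\<lambda>a b. EComp B (EFo F a) (EFo G a) (EFo G b) \<cdot>\<^bsub>V\<^esub> (EFh G a b \<odot>\<^bsub>V\<^esub> \<phi> a) \<cdot>\<^bsub>V\<^esub> inv_arr V (run V (EHom A a b))"
  show ?thesis
  proof
    assume n: "enriched_natural V A B F G \<phi>"
    show "enriched_natural V' (base_cat V' i A) (base_cat V' i B) (base_fun V' i A F) (base_fun V' i A G) (\<lambda>a. FAr i (\<phi> a) \<cdot> FUnt i)"
    proof (rule b.naturalI)
      show "FAr i (\<phi> a) \<cdot> FUnt i \<in> hom V' \<one> (EHom (base_cat V' i B) (EFo (base_fun V' i A F) a) (EFo (base_fun V' i A G) a))"
        if "a \<in> EOb (base_cat V' i A)" for a
        using that s by (simp add: W.hom_iff)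
      fix a b \<alpha> assume *: "a \<in> EOb (base_cat V' i A)" "b \<in> EOb (base_cat V' i A)" "elt V' \<alpha>" "ty V' \<alpha> = EHom (base_cat V' i A) a b"
      have "?f a b = ?g a b" using n * by (simp add: enriched_natural_def)
      from i_eq_act[OF this, of \<alpha>]
      show "EComp (base_cat V' i B) (EFo (base_fun V' i A F) a) (EFo (base_fun V' i A F) b) (EFo (base_fun V' i A G) b) \<star>
          ((FAr i (\<phi> b) \<cdot> FUnt i) \<star> unit_elt V' \<parallel> EFh (base_fun V' i A F) a b \<star> \<alpha>) =
         EComp (base_cat V' i B) (EFo (base_fun V' i A F) a) (EFo (base_fun V' i A G) a) (EFo (base_fun V' i A G) b) \<star>
          (EFh (base_fun V' i A G) a b \<star> \<alpha> \<parallel> (FAr i (\<phi> a) \<cdot> FUnt i) \<star> unit_elt V')"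
        using * s by simp
    qed
  next
    assume n: "enriched_natural V' (base_cat V' i A) (base_cat V' i B) (base_fun V' i A F) (base_fun V' i A G) (\<lambda>a. FAr i (\<phi> a) \<cdot> FUnt i)"
    show "enriched_natural V A B F G \<phi>"
      unfolding enriched_natural_def
    proof (intro conjI ballI assms(3))
      fix a b assume ab: "a \<in> EOb A" "b \<in> EOb A"
      have e: "FAr i (?f a b) \<star> \<alpha> = FAr i (?g a b) \<star> \<alpha>" if \<alpha>: "elt V' \<alpha>" "ty V' \<alpha> = FOb i (EHom A a b)" for \<alpha>
        using b.naturalD[OF n, of a b \<alpha>] ab \<alpha> s by simp
      have "FAr i (?f a b) = FAr i (?g a b)"
        by (rule W.ext1[where X="FOb i (EHom A a b)" and Y="FOb i (EHom B (EFo F a) (EFo G b))"])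
          (use ab s e in \<open>simp_all add: W.hom_iff del: i_Comp\<close>)
      then show "?f a b = ?g a b"
        by (rule faithful[rotated 2]) (use ab s in \<open>auto simp: V.hom_iff\<close>)
    qed
  qed
qed

end

section \<open>Powers\<close>

context symmetric_monoidal_closed
begin

text \<open>Naturality into \<open>self V\<close> is phrased with names of arrows and composition of
  internal homs. Evaluating both reduces it to a commuting square for the arrows
  \<open>\<theta> x\<close> themselves.\<close>

lemma natural_selfI:
  assumes ob: "\<And>x y. x \<in> EOb A \<Longrightarrow> y \<in> EOb A \<Longrightarrow> EHom A x y \<in> Obj V"
    and FG: "\<And>x. x \<in> EOb A \<Longrightarrow> \<theta> x \<in> hom V (EFo F x) (EFo G x)"
    and F: "\<And>x y. x \<in> EOb A \<Longrightarrow> y \<in> EOb A \<Longrightarrow> EFh F x y \<in> hom V (EHom A x y) (ihom V (EFo F x) (EFo F y))"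
    and G: "\<And>x y. x \<in> EOb A \<Longrightarrow> y \<in> EOb A \<Longrightarrow> EFh G x y \<in> hom V (EHom A x y) (ihom V (EFo G x) (EFo G y))"
    and eq: "\<And>x y f. x \<in> EOb A \<Longrightarrow> y \<in> EOb A \<Longrightarrow>
      \<theta> y \<cdot> (ev V (EFo F x) (EFo F y) \<cdot> (EFh F x y \<odot> Idt V (EFo F x))) =
      ev V (EFo G x) (EFo G y) \<cdot> (EFh G x y \<odot> \<theta> x)"
  shows "enriched_natural V A (self V) F G (\<lambda>x. name_of V (\<theta> x))"
  unfolding enriched_natural_def
proof (intro conjI ballI)
  have s: "\<theta> x \<in> Arr V" "Dom V (\<theta> x) = EFo F x" "Cod V (\<theta> x) = EFo G x" "EFo F x \<in> Obj V" "EFo G x \<in> Obj V"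
    if "x \<in> EOb A" for x using FG[OF that] Dom_Obj[of "\<theta> x"] Cod_Obj[of "\<theta> x"] by (auto simp: hom_iff)
  have f: "EFh F x y \<in> Arr V" "Dom V (EFh F x y) = EHom A x y" "Cod V (EFh F x y) = ihom V (EFo F x) (EFo F y)"
    "EFh G x y \<in> Arr V" "Dom V (EFh G x y) = EHom A x y" "Cod V (EFh G x y) = ihom V (EFo G x) (EFo G y)"
    if "x \<in> EOb A" "y \<in> EOb A" for x y using F[OF that] G[OF that] by (auto simp: hom_iff)
  fix x assume x: "x \<in> EOb A"
  show "name_of V (\<theta> x) \<in> hom V \<one> (EHom (self V) (EFo F x) (EFo G x))" using s[OF x] by (simp add: hom_iff)
  fix y assume y: "y \<in> EOb A"
  have e: "\<theta> y \<star> (ev V (EFo F x) (EFo F y) \<star> (EFh F x y \<star> \<alpha> \<parallel> p)) = ev V (EFo G x) (EFo G y) \<star> (EFh G x y \<star> \<alpha> \<parallel> \<theta> x \<star> p)"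
    if "elt V \<alpha>" "ty V \<alpha> = EHom A x y" "elt V p" "ty V p = EFo F x" "dj \<alpha> p" for \<alpha> p
    using arg_cong[OF eq[OF x y], of "\<lambda>h. h \<star> (\<alpha> \<parallel> p)"] that s[OF x] s[OF y] f[OF x y] by simp
  show "EComp (self V) (EFo F x) (EFo F y) (EFo G y) \<cdot> (name_of V (\<theta> y) \<odot> EFh F x y) \<cdot> inv_arr V (lun V (EHom A x y)) =
    EComp (self V) (EFo F x) (EFo G x) (EFo G y) \<cdot> (EFh G x y \<odot> name_of V (\<theta> x)) \<cdot> inv_arr V (run V (EHom A x y))"
    by (rule ihom_ext[where Z="EHom A x y" and X="EFo F x" and Y="EFo G y"])
      (use x y ob[OF x y] s[OF x] s[OF y] f[OF x y] e in \<open>auto simp: hom_iff\<close>)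
qed

lemma natural_selfD:
  assumes n: "enriched_natural V A (self V) F G (\<lambda>x. name_of V (\<theta> x))"
    and xy: "x \<in> EOb A" "y \<in> EOb A" "EHom A x y \<in> Obj V"
    and th: "\<theta> x \<in> hom V (EFo F x) (EFo G x)" "\<theta> y \<in> hom V (EFo F y) (EFo G y)"
    and F: "EFh F x y \<in> hom V (EHom A x y) (ihom V (EFo F x) (EFo F y))"
    and G: "EFh G x y \<in> hom V (EHom A x y) (ihom V (EFo G x) (EFo G y))"
    and el: "elt V \<alpha>" "ty V \<alpha> = EHom A x y" "elt V p" "ty V p = EFo F x" "dj \<alpha> p"
  shows "\<theta> y \<star> (ev V (EFo F x) (EFo F y) \<star> (EFh F x y \<star> \<alpha> \<parallel> p)) = ev V (EFo G x) (EFo G y) \<star> (EFh G x y \<star> \<alpha> \<parallel> \<theta> x \<star> p)"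
proof -
  have s: "\<theta> x \<in> Arr V" "Dom V (\<theta> x) = EFo F x" "Cod V (\<theta> x) = EFo G x" "EFo F x \<in> Obj V" "EFo G x \<in> Obj V"
    "\<theta> y \<in> Arr V" "Dom V (\<theta> y) = EFo F y" "Cod V (\<theta> y) = EFo G y" "EFo F y \<in> Obj V" "EFo G y \<in> Obj V"
    using th Dom_Obj[of "\<theta> x"] Cod_Obj[of "\<theta> x"] Dom_Obj[of "\<theta> y"] Cod_Obj[of "\<theta> y"] by (auto simp: hom_iff)
  have f: "EFh F x y \<in> Arr V" "Dom V (EFh F x y) = EHom A x y" "Cod V (EFh F x y) = ihom V (EFo F x) (EFo F y)"
    "EFh G x y \<in> Arr V" "Dom V (EFh G x y) = EHom A x y" "Cod V (EFh G x y) = ihom V (EFo G x) (EFo G y)"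
    using F G by (auto simp: hom_iff)
  have "EComp (self V) (EFo F x) (EFo F y) (EFo G y) \<cdot> (name_of V (\<theta> y) \<odot> EFh F x y) \<cdot> inv_arr V (lun V (EHom A x y)) =
    EComp (self V) (EFo F x) (EFo G x) (EFo G y) \<cdot> (EFh G x y \<odot> name_of V (\<theta> x)) \<cdot> inv_arr V (run V (EHom A x y))"
    using n xy by (simp add: enriched_natural_def)
  from arg_cong[OF this, of "\<lambda>h. ev V (EFo F x) (EFo G y) \<star> (h \<star> \<alpha> \<parallel> p)"]
  show ?thesis using xy el s f by simp
qed

text \<open>Interchanges two arguments: \<open>[Y, Q] \<cong> [X, [Y, D]]\<close> whenever \<open>Q \<cong> [X, D]\<close>.\<close>

definition exch :: "'o \<Rightarrow> 'o \<Rightarrow> 'o \<Rightarrow> 'm \<Rightarrow> 'o \<Rightarrow> 'm" where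
  "exch X D Q u Y = curry_arr V (ihom V Y Q) X (curry_arr V (ihom V Y Q \<otimes> X) Y
     (ev V X D \<cdot> (((u \<cdot> ev V Y Q) \<odot> Idt V X) \<cdot>
       (inv_arr V (asc V (ihom V Y Q) Y X) \<cdot> ((Idt V (ihom V Y Q) \<odot> braid V X Y) \<cdot> asc V (ihom V Y Q) X Y)))))"

definition exch_inv :: "'o \<Rightarrow> 'o \<Rightarrow> 'o \<Rightarrow> 'm \<Rightarrow> 'o \<Rightarrow> 'm" where
  "exch_inv X D Q u Y = curry_arr V (ihom V X (ihom V Y D)) Y (inv_arr V u \<cdot>
     curry_arr V (ihom V X (ihom V Y D) \<otimes> Y) X
     (ev V Y D \<cdot> ((ev V X (ihom V Y D) \<odot> Idt V Y) \<cdot>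
       (inv_arr V (asc V (ihom V X (ihom V Y D)) X Y) \<cdot>
         ((Idt V (ihom V X (ihom V Y D)) \<odot> braid V Y X) \<cdot> asc V (ihom V X (ihom V Y D)) Y X)))))"

end

text \<open>Abstracts the situation in which a functor \<open>C(c, -)\<close> meets a power:
  \<open>Q\<close> will be \<open>C(c, P)\<close>, \<open>D\<close> will be \<open>C(c, a)\<close>,
  and \<open>u\<close> the component at \<open>c\<close> of the isomorphism that makes
  \<open>P\<close> a power of \<open>a\<close>.\<close>

locale exchange = symmetric_monoidal_closed V for V :: "('o, 'm) smc" (structure) +
  fixes X D Q :: 'o and u :: 'm
  assumes u: "u \<in> hom V Q (ihom V X D)" "is_iso V u" and XD: "X \<in> Obj V" "D \<in> Obj V"
begin

lemma exch_u [simp]: "u \<in> Arr V" "Dom V u = Q" "Cod V u = ihom V X D" "Q \<in> Obj V" "is_iso V u" "X \<in> Obj V" "D \<in> Obj V"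
  using u XD by (auto simp: hom_iff)

lemma exch [simp]:
  assumes [simp]: "Y \<in> Obj V"
  shows "exch X D Q u Y \<in> Arr V" "Dom V (exch X D Q u Y) = ihom V Y Q" "Cod V (exch X D Q u Y) = ihom V X (ihom V Y D)"
    "elt V h \<Longrightarrow> elt V x \<Longrightarrow> elt V y \<Longrightarrow> ty V h = ihom V Y Q \<Longrightarrow> ty V x = X \<Longrightarrow> ty V y = Y \<Longrightarrow> dj h x \<Longrightarrow> dj h y \<Longrightarrow> dj x y \<Longrightarrow> dj y x \<Longrightarrow>
      ev V Y D \<star> (ev V X (ihom V Y D) \<star> (exch X D Q u Y \<star> h \<parallel> x) \<parallel> y) = ev V X D \<star> (u \<star> (ev V Y Q \<star> (h \<parallel> y)) \<parallel> x)"
  by (simp_all add: exch_def)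

lemma exch_inv [simp]:
  assumes [simp]: "Y \<in> Obj V"
  shows "exch_inv X D Q u Y \<in> Arr V" "Cod V (exch_inv X D Q u Y) = ihom V Y Q" "Dom V (exch_inv X D Q u Y) = ihom V X (ihom V Y D)"
    "elt V k \<Longrightarrow> elt V x \<Longrightarrow> elt V y \<Longrightarrow> ty V k = ihom V X (ihom V Y D) \<Longrightarrow> ty V x = X \<Longrightarrow> ty V y = Y \<Longrightarrow> dj k x \<Longrightarrow> dj k y \<Longrightarrow> dj x y \<Longrightarrow> dj y x \<Longrightarrow>
      ev V X D \<star> (u \<star> (ev V Y Q \<star> (exch_inv X D Q u Y \<star> k \<parallel> y)) \<parallel> x) = ev V Y D \<star> (ev V X (ihom V Y D) \<star> (k \<parallel> x) \<parallel> y)"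
  by (simp_all add: exch_inv_def)

lemma u_inj:
  assumes "elt V h" "elt V k" "ty V h = Q" "ty V k = Q" "u \<star> h = u \<star> k"
  shows "h = k"
proof -
  have "h = inv_arr V u \<star> (u \<star> h)" using act_inv_inverse(1)[of u h] assms(1,3) by simp
  also have "\<dots> = k" unfolding assms(5) using act_inv_inverse(1)[of u k] assms(2,4) by simp
  finally show ?thesis .
qed

lemma exch_iso:
  assumes [simp]: "Y \<in> Obj V"
  shows "is_iso V (exch X D Q u Y)"
proof (rule is_isoI[where g="exch_inv X D Q u Y"])
  show "exch_inv X D Q u Y \<cdot> exch X D Q u Y = Idt V (Dom V (exch X D Q u Y))"
  proof (rule ihom_ext[where Z="ihom V Y Q" and X=Y and Y=Q])
    fix h y assume *: "elt V h" "ty V h = ihom V Y Q" "elt V y" "ty V y = Y" "dj h y" "dj y h"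
    have "u \<star> (ev V Y Q \<star> ((exch_inv X D Q u Y \<cdot> exch X D Q u Y) \<star> h \<parallel> y)) = u \<star> (ev V Y Q \<star> (h \<parallel> y))"
      by (rule elt_ihom_ext[where X=X and Y=D]) (use * in auto)
    from u_inj[OF _ _ _ _ this] show "ev V Y Q \<star> ((exch_inv X D Q u Y \<cdot> exch X D Q u Y) \<star> h \<parallel> y) =
        ev V Y Q \<star> (Idt V (Dom V (exch X D Q u Y)) \<star> h \<parallel> y)"
      using * by simp
  qed (auto simp: hom_iff)
  show "exch X D Q u Y \<cdot> exch_inv X D Q u Y = Idt V (Cod V (exch X D Q u Y))"
  proof (rule ihom_ext[where Z="ihom V X (ihom V Y D)" and X=X and Y="ihom V Y D"])
    fix k x assume *: "elt V k" "ty V k = ihom V X (ihom V Y D)" "elt V x" "ty V x = X" "dj k x" "dj x k"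
    show "ev V X (ihom V Y D) \<star> ((exch X D Q u Y \<cdot> exch_inv X D Q u Y) \<star> k \<parallel> x) =
        ev V X (ihom V Y D) \<star> (Idt V (Cod V (exch X D Q u Y)) \<star> k \<parallel> x)"
      by (rule elt_ihom_ext[where X=Y and Y=D]) (use * in auto)
  qed (auto simp: hom_iff)
qed auto

text \<open>Exchanging two arguments commutes with precomposition in one of them, which is the
  required naturality. The counit is computed as well, because preservation of powers is expressed
  by counits.\<close>

lemma power_self:
  "is_power V (self V) X D Q (exch X D Q u)"
  "elt V x \<Longrightarrow> ty V x = X \<Longrightarrow> elt V y \<Longrightarrow> ty V y = Q \<Longrightarrow> dj x y \<Longrightarrow> dj y x \<Longrightarrow>
     ev V Q D \<star> (power_counit V (self V) X D Q (exch X D Q u) \<star> x \<parallel> y) = ev V X D \<star> (u \<star> y \<parallel> x)"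
  "power_counit V (self V) X D Q (exch X D Q u) \<in> hom V X (ihom V Q D)"
proof -
  interpret S: enriched_category V "self V" by (rule enriched_self)
  interpret O: enriched_category V "op_cat V (self V)" by (rule S.enriched_op)
  interpret rQ: enriched_fun V "op_cat V (self V)" "self V" "rep V (op_cat V (self V)) Q" by (rule O.rep_fun) simp
  interpret rD: enriched_fun V "op_cat V (self V)" "self V" "rep V (op_cat V (self V)) D" by (rule O.rep_fun) simp
  interpret rX: enriched_fun V "self V" "self V" "rep V (self V) X" by (rule S.rep_fun) simp
  interpret c: enriched_fun V "op_cat V (self V)" "self V"
    "comp_fun V (op_cat V (self V)) (rep V (self V) X) (rep V (op_cat V (self V)) D)"
    by (rule comp_fun_fun[OF rD.enriched_fun_axioms rX.enriched_fun_axioms])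
  have n: "enriched_natural V (op_cat V (self V)) (self V) (rep V (op_cat V (self V)) Q)
     (comp_fun V (op_cat V (self V)) (rep V (self V) X) (rep V (op_cat V (self V)) D)) (\<lambda>b. name_of V (exch X D Q u b))"
  proof (rule natural_selfI)
    fix b b' assume b: "b \<in> EOb (op_cat V (self V))" "b' \<in> EOb (op_cat V (self V))"
    let ?F = "rep V (op_cat V (self V)) Q" and ?G = "comp_fun V (op_cat V (self V)) (rep V (self V) X) (rep V (op_cat V (self V)) D)"
    have [simp]: "b \<in> Obj V" "b' \<in> Obj V" using b by auto
    have rQ: "ev V (ihom V b Q) (ihom V b' Q) \<star> (EFh ?F b b' \<star> \<beta> \<parallel> h) = EComp (self V) b' b Q \<star> (h \<parallel> \<beta>)"
      if "elt V \<beta>" "ty V \<beta> = ihom V b' b" "elt V h" "ty V h = ihom V b Q" "dj \<beta> h" for \<beta> h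
      using O.rep_simps(2)[of Q b b' \<beta> h] that by simp
    have rD: "ev V (ihom V b D) (ihom V b' D) \<star> (EFh (rep V (op_cat V (self V)) D) b b' \<star> \<beta> \<parallel> h) = EComp (self V) b' b D \<star> (h \<parallel> \<beta>)"
      if "elt V \<beta>" "ty V \<beta> = ihom V b' b" "elt V h" "ty V h = ihom V b D" "dj \<beta> h" for \<beta> h
      using O.rep_simps(2)[of D b b' \<beta> h] that by simp
    have rDt: "EFh (rep V (op_cat V (self V)) D) b b' \<in> Arr V" "Dom V (EFh (rep V (op_cat V (self V)) D) b b') = ihom V b' b"
      "Cod V (EFh (rep V (op_cat V (self V)) D) b b') = ihom V (ihom V b D) (ihom V b' D)"
      "EFh ?F b b' \<in> Arr V" "Dom V (EFh ?F b b') = ihom V b' b"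
      "Cod V (EFh ?F b b') = ihom V (ihom V b Q) (ihom V b' Q)"
      using rD.Fh[of b b'] rQ.Fh[of b b'] by simp_all
    have rXt: "EFh (rep V (self V) X) (ihom V b D) (ihom V b' D) \<in> Arr V"
      "Dom V (EFh (rep V (self V) X) (ihom V b D) (ihom V b' D)) = ihom V (ihom V b D) (ihom V b' D)"
      "Cod V (EFh (rep V (self V) X) (ihom V b D) (ihom V b' D)) = ihom V (ihom V X (ihom V b D)) (ihom V X (ihom V b' D))"
      using rX.Fh[of "ihom V b D" "ihom V b' D"] by simp_all
    have rX: "ev V (ihom V X (ihom V b D)) (ihom V X (ihom V b' D)) \<star> (EFh (rep V (self V) X) (ihom V b D) (ihom V b' D) \<star> g \<parallel> k) =
        EComp (self V) X (ihom V b D) (ihom V b' D) \<star> (g \<parallel> k)"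
      if "elt V g" "ty V g = ihom V (ihom V b D) (ihom V b' D)" "elt V k" "ty V k = ihom V X (ihom V b D)" "dj g k" for g k
      using S.rep_simps(2)[of X "ihom V b D" "ihom V b' D" g k] that by simp
    have "exch X D Q u b' \<star> (EComp (self V) b' b Q \<star> (h \<parallel> \<beta>)) =
        EComp (self V) X (ihom V b D) (ihom V b' D) \<star> (EFh (rep V (op_cat V (self V)) D) b b' \<star> \<beta> \<parallel> exch X D Q u b \<star> h)"
      if *: "elt V \<beta>" "ty V \<beta> = ihom V b' b" "elt V h" "ty V h = ihom V b Q" "dj \<beta> h" "dj h \<beta>" for \<beta> h
    proof (rule elt_ihom_ext[where X=X and Y="ihom V b' D"])
      fix x assume x: "elt V x" "ty V x = X" "dj (exch X D Q u b' \<star> (EComp (self V) b' b Q \<star> (h \<parallel> \<beta>))) x"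
        "dj x (exch X D Q u b' \<star> (EComp (self V) b' b Q \<star> (h \<parallel> \<beta>)))"
      show "ev V X (ihom V b' D) \<star> (exch X D Q u b' \<star> (EComp (self V) b' b Q \<star> (h \<parallel> \<beta>)) \<parallel> x) =
        ev V X (ihom V b' D) \<star> (EComp (self V) X (ihom V b D) (ihom V b' D) \<star> (EFh (rep V (op_cat V (self V)) D) b b' \<star> \<beta> \<parallel> exch X D Q u b \<star> h) \<parallel> x)"
        by (rule elt_ihom_ext[where X=b' and Y=D]) (use * x in \<open>auto simp: rD rDt\<close>)
    qed (use * in \<open>auto simp: rDt\<close>)
    then show "exch X D Q u b' \<cdot> (ev V (EFo ?F b) (EFo ?F b') \<cdot> (EFh ?F b b' \<odot> Idt V (EFo ?F b))) =
      ev V (EFo ?G b) (EFo ?G b') \<cdot> (EFh ?G b b' \<odot> exch X D Q u b)"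
      by (intro ext2[where X="ihom V b' b" and Y="ihom V b Q" and Z="ihom V X (ihom V b' D)"])
        (auto simp: hom_iff rDt rXt rQ rX)
  next
    show "EFh (rep V (op_cat V (self V)) Q) x y \<in> hom V (EHom (op_cat V (self V)) x y)
       (ihom V (EFo (rep V (op_cat V (self V)) Q) x) (EFo (rep V (op_cat V (self V)) Q) y))"
      if "x \<in> EOb (op_cat V (self V))" "y \<in> EOb (op_cat V (self V))" for x y
      using rQ.Fh[OF that] by (simp add: hom_iff)
    show "EFh (comp_fun V (op_cat V (self V)) (rep V (self V) X) (rep V (op_cat V (self V)) D)) x y \<in> hom V (EHom (op_cat V (self V)) x y)
       (ihom V (EFo (comp_fun V (op_cat V (self V)) (rep V (self V) X) (rep V (op_cat V (self V)) D)) x)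
          (EFo (comp_fun V (op_cat V (self V)) (rep V (self V) X) (rep V (op_cat V (self V)) D)) y))"
      if "x \<in> EOb (op_cat V (self V))" "y \<in> EOb (op_cat V (self V))" for x y
      using c.Fh[OF that] by (simp add: hom_iff del: comp_fun_simps)
  qed (auto simp: hom_iff)
  then show "is_power V (self V) X D Q (exch X D Q u)"
    by (auto simp: is_power_def enriched_natural_iso_def hom_iff exch_iso)
  show "ev V Q D \<star> (power_counit V (self V) X D Q (exch X D Q u) \<star> x \<parallel> y) = ev V X D \<star> (u \<star> y \<parallel> x)"
    if "elt V x" "ty V x = X" "elt V y" "ty V y = Q" "dj x y" "dj y x"
    using that by (simp add: power_counit_def)
  show "power_counit V (self V) X D Q (exch X D Q u) \<in> hom V X (ihom V Q D)"
    by (simp add: power_counit_def hom_iff)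
qed

end

section \<open>Counits of powers, and preservation of powers by representables\<close>

context enriched_category
begin

text \<open>The last clause is the Yoneda lemma: naturality along \<open>\<beta>\<close>, evaluated
  at the identity of \<open>P\<close>, expresses the whole isomorphism through its counit.\<close>

lemma powerD:
  assumes p: "is_power V A X c P \<theta>" and X: "X \<in> Obj V" and c: "c \<in> EOb A"
  shows "P \<in> EOb A" "b \<in> EOb A \<Longrightarrow> \<theta> b \<in> hom V (EHom A b P) (ihom V X (EHom A b c))"
    "b \<in> EOb A \<Longrightarrow> is_iso V (\<theta> b)"
    "power_counit V A X c P \<theta> \<in> hom V X (EHom A P c)"
    "b \<in> EOb A \<Longrightarrow> elt V t \<Longrightarrow> ty V t = X \<Longrightarrow> elt V \<beta> \<Longrightarrow> ty V \<beta> = EHom A b P \<Longrightarrow> dj t \<beta> \<Longrightarrow> dj \<beta> t \<Longrightarrow>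
      ev V X (EHom A b c) \<star> (\<theta> b \<star> \<beta> \<parallel> t) = EComp A b P c \<star> (power_counit V A X c P \<theta> \<star> t \<parallel> \<beta>)"
proof -
  interpret S: enriched_category V "self V" by (rule enriched_self)
  interpret O: enriched_category V "op_cat V A" by (rule enriched_op)
  show P: "P \<in> EOb A" using p by (simp add: is_power_def)
  interpret rP: enriched_fun V "op_cat V A" "self V" "rep V (op_cat V A) P" by (rule O.rep_fun) (simp add: P)
  interpret rc: enriched_fun V "op_cat V A" "self V" "rep V (op_cat V A) c" by (rule O.rep_fun) (simp add: c)
  interpret rX: enriched_fun V "self V" "self V" "rep V (self V) X" by (rule S.rep_fun) (simp add: X)
  interpret cf: enriched_fun V "op_cat V A" "self V"
    "comp_fun V (op_cat V A) (rep V (self V) X) (rep V (op_cat V A) c)"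
    by (rule comp_fun_fun[OF rc.enriched_fun_axioms rX.enriched_fun_axioms])
  have th: "\<theta> b \<in> hom V (EHom A b P) (ihom V X (EHom A b c))" "is_iso V (\<theta> b)" if "b \<in> EOb A" for b
  proof -
    have "b \<in> EOb (op_cat V A)" using that by simp
    then have "\<theta> b \<in> hom V (EFo (rep V (op_cat V A) P) b)
        (EFo (comp_fun V (op_cat V A) (rep V (self V) X) (rep V (op_cat V A) c)) b) \<and> is_iso V (\<theta> b)"
      using p unfolding is_power_def enriched_natural_iso_def by blast
    then show "\<theta> b \<in> hom V (EHom A b P) (ihom V X (EHom A b c))" "is_iso V (\<theta> b)"
      using that P c X by simp_all
  qed
  show "b \<in> EOb A \<Longrightarrow> \<theta> b \<in> hom V (EHom A b P) (ihom V X (EHom A b c))"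
    "b \<in> EOb A \<Longrightarrow> is_iso V (\<theta> b)" by (fact th)+
  have tha: "\<theta> b \<in> Arr V" "Dom V (\<theta> b) = EHom A b P" "Cod V (\<theta> b) = ihom V X (EHom A b c)" if "b \<in> EOb A" for b
    using th(1)[OF that] unfolding hom_iff by blast+
  show "power_counit V A X c P \<theta> \<in> hom V X (EHom A P c)"
    using P X c tha[OF P] by (simp add: power_counit_def hom_iff)
  assume b: "b \<in> EOb A" and t: "elt V t" "ty V t = X" "elt V \<beta>" "ty V \<beta> = EHom A b P" "dj t \<beta>" "dj \<beta> t"
  have nat: "enriched_natural V (op_cat V A) (self V) (rep V (op_cat V A) P)
     (comp_fun V (op_cat V A) (rep V (self V) X) (rep V (op_cat V A) c)) (\<lambda>b. name_of V (\<theta> b))"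
    using p by (simp add: is_power_def enriched_natural_iso_def)
  let ?G = "comp_fun V (op_cat V A) (rep V (self V) X) (rep V (op_cat V A) c)"
  have rct: "EFh (rep V (op_cat V A) c) P b \<in> Arr V" "Dom V (EFh (rep V (op_cat V A) c) P b) = EHom A b P"
    "Cod V (EFh (rep V (op_cat V A) c) P b) = ihom V (EHom A P c) (EHom A b c)"
    using rc.Fh[of P b] P b c by simp_all
  have rXt: "EFh (rep V (self V) X) (EHom A P c) (EHom A b c) \<in> Arr V"
    "Dom V (EFh (rep V (self V) X) (EHom A P c) (EHom A b c)) = ihom V (EHom A P c) (EHom A b c)"
    "Cod V (EFh (rep V (self V) X) (EHom A P c) (EHom A b c)) = ihom V (ihom V X (EHom A P c)) (ihom V X (EHom A b c))"
    using rX.Fh[of "EHom A P c" "EHom A b c"] P b c X by simp_all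
  have cft: "EFh ?G P b \<in> hom V (EHom A b P) (ihom V (EFo ?G P) (EFo ?G b))"
    using cf.Fh[of P b] P b by (simp add: hom_iff del: comp_fun_simps)
  have rPt: "EFh (rep V (op_cat V A) P) P b \<in> hom V (EHom A b P) (ihom V (EHom A P P) (EHom A b P))"
    using rP.Fh[of P b] P b by (simp add: hom_iff)
  let ?F = "rep V (op_cat V A) P" and ?id = "EId A P \<star> unit_elt V"
  have id: "elt V ?id" "ty V ?id = EHom A P P" "dj \<beta> ?id" "dj ?id \<beta>" using P by simp_all
  have ob: "EFo ?F P = EHom A P P" "EFo ?F b = EHom A b P" "EFo ?G P = ihom V X (EHom A P c)" "EFo ?G b = ihom V X (EHom A b c)"
    using P b c X by simp_all
  have "\<theta> b \<star> (ev V (EFo ?F P) (EFo ?F b) \<star> (EFh ?F P b \<star> \<beta> \<parallel> ?id)) =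
      ev V (EFo ?G P) (EFo ?G b) \<star> (EFh ?G P b \<star> \<beta> \<parallel> \<theta> P \<star> ?id)"
    by (rule natural_selfD[OF nat]) (use P b c X t id th cft rPt in \<open>simp_all only: ob op_simps op_Ob EHom_Obj\<close>)
  also have "ev V (EFo ?F P) (EFo ?F b) \<star> (EFh ?F P b \<star> \<beta> \<parallel> ?id) = EComp A b P P \<star> (?id \<parallel> \<beta>)"
    using O.rep_simps(2)[of P P b \<beta> ?id] P b t id by (simp only: ob op_Ob op_simps op_comp)
  also have "EComp A b P P \<star> (?id \<parallel> \<beta>) = \<beta>"
    using P b t by (intro comp_id)
  also have "ev V (EFo ?G P) (EFo ?G b) \<star> (EFh ?G P b \<star> \<beta> \<parallel> \<theta> P \<star> ?id) =
     EComp (self V) X (EHom A P c) (EHom A b c) \<star> (EFh (rep V (op_cat V A) c) P b \<star> \<beta> \<parallel> \<theta> P \<star> ?id)"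
    using S.rep_simps(2)[of X "EHom A P c" "EHom A b c" "EFh (rep V (op_cat V A) c) P b \<star> \<beta>" "\<theta> P \<star> ?id"]
      P b c X t rct rXt tha[OF P] id by simp
  finally have "ev V X (EHom A b c) \<star> (\<theta> b \<star> \<beta> \<parallel> t) = ev V X (EHom A b c) \<star>
      (EComp (self V) X (EHom A P c) (EHom A b c) \<star> (EFh (rep V (op_cat V A) c) P b \<star> \<beta> \<parallel> \<theta> P \<star> (EId A P \<star> unit_elt V)) \<parallel> t)"
    by (rule arg_cong)
  also have "\<dots> = ev V (EHom A P c) (EHom A b c) \<star> (EFh (rep V (op_cat V A) c) P b \<star> \<beta> \<parallel> power_counit V A X c P \<theta> \<star> t)"
    using P b c X t rct tha[OF P] by (simp add: power_counit_def)
  also have "\<dots> = EComp A b P c \<star> (power_counit V A X c P \<theta> \<star> t \<parallel> \<beta>)"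
    using O.rep_simps(2)[of c P b \<beta> "power_counit V A X c P \<theta> \<star> t"] P b c X t tha[OF P] by (simp add: power_counit_def)
  finally show "ev V X (EHom A b c) \<star> (\<theta> b \<star> \<beta> \<parallel> t) = EComp A b P c \<star> (power_counit V A X c P \<theta> \<star> t \<parallel> \<beta>)" .
qed

end

text \<open>Representables preserve powers: the definition of a power makes \<open>C(c, E P)\<close>
  isomorphic to \<open>[X, C(c, E a)]\<close>, and any such object is a power in \<open>V\<close>.
  The counits agree because \<open>powerD\<close> writes that isomorphism as composition with the
  counit.\<close>

lemma bracket_at_algebra:
  assumes "enriched_fun V T C E" "preserves_powers V J T C E" "J \<subseteq> Obj V" "c \<in> EOb C"
  shows "enriched_fun V T (self V) (bracket_at V T C E c)" "bracket_at V T C E c \<in> algebras V J T (self V)"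
proof -
  interpret E: enriched_fun V T C E by fact
  interpret r: enriched_fun V C "self V" "rep V C c" by (rule E.B.rep_fun) fact
  show f: "enriched_fun V T (self V) (bracket_at V T C E c)"
    unfolding bracket_at_def by (rule comp_fun_fun[OF E.enriched_fun_axioms r.enriched_fun_axioms])
  have "preserves_powers V J T (self V) (bracket_at V T C E c)"
    unfolding preserves_powers_def
  proof (intro ballI allI impI)
    fix X a P \<theta> assume X: "X \<in> J" and a: "a \<in> EOb T" and p: "is_power V T X a P \<theta>"
    have [simp]: "X \<in> Obj V" using X assms(3) by auto
    obtain \<theta>1 where p1: "is_power V C X (EFo E a) (EFo E P) \<theta>1"
      and c1: "power_counit V C X (EFo E a) (EFo E P) \<theta>1 = EFh E P a \<cdot>\<^bsub>V\<^esub> power_counit V T X a P \<theta>"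
      using assms(2) X a p unfolding preserves_powers_def by blast
    have P: "P \<in> EOb T" using E.A.powerD(1)[OF p] a by simp
    have nu: "power_counit V T X a P \<theta> \<in> hom V X (EHom T P a)" using E.A.powerD(4)[OF p] a by simp
    have u: "\<theta>1 c \<in> hom V (EHom C c (EFo E P)) (ihom V X (EHom C c (EFo E a)))" "is_iso V (\<theta>1 c)"
      using E.B.powerD(2,3)[OF p1, of c] a assms(4) by auto
    note pd = E.B.powerD(5)[OF p1, of c]
    interpret x: exchange V X "EHom C c (EFo E a)" "EHom C c (EFo E P)" "\<theta>1 c"
      by unfold_locales (use u a assms(4) in simp_all)
    note ps = x.power_self
    have ob: "EHom C c (EFo E a) \<in> Obj V" using a assms(4) by simp
    have "power_counit V (self V) X (EHom C c (EFo E a)) (EHom C c (EFo E P)) (E.A.exch X (EHom C c (EFo E a)) (EHom C c (EFo E P)) (\<theta>1 c)) =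
       EFh (bracket_at V T C E c) P a \<cdot>\<^bsub>V\<^esub> power_counit V T X a P \<theta>"
    proof (rule E.A.ihom_ext[where Z=X and X="EHom C c (EFo E P)" and Y="EHom C c (EFo E a)"])
      fix x y assume *: "elt V x" "ty V x = X" "elt V y" "ty V y = EHom C c (EFo E P)" "dj x y" "dj y x"
      show "ev V (EHom C c (EFo E P)) (EHom C c (EFo E a)) \<star>\<^bsub>V\<^esub> (power_counit V (self V) X (EHom C c (EFo E a)) (EHom C c (EFo E P)) (E.A.exch X (EHom C c (EFo E a)) (EHom C c (EFo E P)) (\<theta>1 c)) \<star>\<^bsub>V\<^esub> x \<parallel>\<^bsub>V\<^esub> y) =
         ev V (EHom C c (EFo E P)) (EHom C c (EFo E a)) \<star>\<^bsub>V\<^esub> ((EFh (bracket_at V T C E c) P a \<cdot>\<^bsub>V\<^esub> power_counit V T X a P \<theta>) \<star>\<^bsub>V\<^esub> x \<parallel>\<^bsub>V\<^esub> y)"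
        using * a P assms(4) nu[unfolded E.A.hom_iff] r.Fh[of "EFo E P" "EFo E a"]
        by (simp add: ps ob pd c1 bracket_at_def)
    qed (use ps(3) ob a P assms(4) nu r.Fh[of "EFo E P" "EFo E a"] in \<open>auto simp: E.A.hom_iff bracket_at_def\<close>)
    then show "\<exists>\<theta>'. is_power V (self V) X (EFo (bracket_at V T C E c) a) (EFo (bracket_at V T C E c) P) \<theta>' \<and>
      power_counit V (self V) X (EFo (bracket_at V T C E c) a) (EFo (bracket_at V T C E c) P) \<theta>' =
      EFh (bracket_at V T C E c) P a \<cdot>\<^bsub>V\<^esub> power_counit V T X a P \<theta>"
      using ps(1) ob a P assms(4) by (auto simp: bracket_at_def)
  qed
  then show "bracket_at V T C E c \<in> algebras V J T (self V)"
    using enriched_fun.F[OF f] by (simp add: algebras_def)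
qed

section \<open>Algebras\<close>

locale theory_algebras = T: enriched_category V T for V :: "('v, 'a) smc" (structure) and T :: "('v, 'v, 'a) ecat" +
  fixes J :: "'v set"
  assumes Alg_exists: "Alg_exists V J T"
begin

abbreviation "AlgT \<equiv> Alg V J T"
abbreviation "algs \<equiv> algebras V J T (self V)"

lemma alg_fun: "A \<in> algs \<Longrightarrow> enriched_fun V T (self V) A"
  by (rule enriched_funI[OF T.enriched_category_axioms T.enriched_self]) (simp add: algebras_def)

lemma alg_end: "A \<in> algs \<Longrightarrow> B \<in> algs \<Longrightarrow> has_end V T (nat_bifunctor V T (self V) A B)"
  using Alg_exists by (simp add: Alg_exists_def)

lemma Alg_Ob [simp]: "EOb AlgT = algs"
  by (simp add: Alg_def full_sub_def)

lemma Alg_enriched: "enriched_category V AlgT"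
  unfolding Alg_def
  by (rule enriched_functor_cat[OF T.enriched_category_axioms T.enriched_self alg_fun alg_end])

sublocale Alg: enriched_category V AlgT
  by (rule Alg_enriched)

lemma Alg_hom: "EHom AlgT A B = end_obj V T (nat_bifunctor V T (self V) A B)"
  by (simp add: Alg_def full_sub_def functor_cat_def)

lemma alg_nat_end: "A \<in> algs \<Longrightarrow> B \<in> algs \<Longrightarrow> nat_end V T (self V) A B (EHom AlgT A B) (Alg_proj V T A B)"
  unfolding Alg_hom Alg_proj_def by (rule chosen_nat_end[OF alg_fun alg_fun alg_end])

lemma alg_ob [simp]: "A \<in> algs \<Longrightarrow> K \<in> EOb T \<Longrightarrow> EFo A K \<in> Obj V"
  using enriched_fun.Fo[OF alg_fun, of A K] by simp

lemma alg_arr [simp]: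
  assumes "A \<in> algs" "K \<in> EOb T" "M \<in> EOb T"
  shows "EFh A K M \<in> Arr V" "Dom V (EFh A K M) = EHom T K M" "Cod V (EFh A K M) = ihom V (EFo A K) (EFo A M)"
  using enriched_fun.Fh[OF alg_fun, of A K M] assms by simp_all

lemma proj_arr [simp]:
  assumes "A \<in> algs" "B \<in> algs" "K \<in> EOb T"
  shows "Alg_proj V T A B K \<in> Arr V" "Dom V (Alg_proj V T A B K) = EHom AlgT A B"
    "Cod V (Alg_proj V T A B K) = ihom V (EFo A K) (EFo B K)"
proof -
  interpret nat_end V T "self V" A B "EHom AlgT A B" "Alg_proj V T A B"
    by (rule alg_nat_end) fact+
  show "Alg_proj V T A B K \<in> Arr V" "Dom V (Alg_proj V T A B K) = EHom AlgT A B"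
    "Cod V (Alg_proj V T A B K) = ihom V (EFo A K) (EFo B K)" using assms by simp_all
qed

lemma proj_comp:
  assumes "A \<in> algs" "B \<in> algs" "D \<in> algs" "K \<in> EOb T" "elt V g" "elt V f" "ty V g = EHom AlgT B D" "ty V f = EHom AlgT A B" "dj g f"
  shows "Alg_proj V T A D K \<star> (EComp AlgT A B D \<star> (g \<parallel> f)) =
    EComp (self V) (EFo A K) (EFo B K) (EFo D K) \<star> (Alg_proj V T B D K \<star> g \<parallel> Alg_proj V T A B K \<star> f)"
  using functor_cat_comp(2)[OF alg_fun alg_fun alg_fun alg_end alg_end alg_end, of A B D K g f] assms
  unfolding Alg_hom
  by (simp add: Alg_proj_def Alg_def full_sub_def)

lemma proj_id:
  assumes "A \<in> algs" "K \<in> EOb T"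
  shows "Alg_proj V T A A K \<star> (EId AlgT A \<star> unit_elt V) = EId (self V) (EFo A K) \<star> unit_elt V"
  using functor_cat_id(2)[OF alg_fun alg_end, of A K] assms
  by (simp add: Alg_proj_def Alg_def full_sub_def)

lemma evaluation_fun:
  assumes "K \<in> EOb T"
  shows "enriched_fun V AlgT (self V) (evaluation V J T K)"
  unfolding evaluation_def
proof (rule mk_enriched_fun[OF Alg_enriched T.enriched_self])
qed (use assms in \<open>auto simp: T.hom_iff proj_comp proj_id\<close>)

lemma evaluation_simps [simp]:
  "A \<in> algs \<Longrightarrow> EFo (evaluation V J T K) A = EFo A K"
  "A \<in> algs \<Longrightarrow> B \<in> algs \<Longrightarrow> EFh (evaluation V J T K) A B = Alg_proj V T A B K"
  by (simp_all add: evaluation_def)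

end

section \<open>The bracket as a functor into algebras\<close>

locale bracketing = theory_algebras V T J + C: enriched_category V C
  for V :: "('v, 'a) smc" (structure) and T :: "('v, 'v, 'a) ecat" and J :: "'v set" and C :: "('x, 'v, 'a) ecat" +
  assumes J: "J \<subseteq> Obj V"
begin

abbreviation "algC \<equiv> algebras V J T C"

lemma algC_fun: "E \<in> algC \<Longrightarrow> enriched_fun V T C E"
  by (rule enriched_funI[OF T.enriched_category_axioms C.enriched_category_axioms]) (simp add: algebras_def)

lemma algC_ob [simp]: "E \<in> algC \<Longrightarrow> K \<in> EOb T \<Longrightarrow> EFo E K \<in> EOb C"
  by (rule enriched_fun.Fo[OF algC_fun])

lemma algC_arr [simp]:
  assumes "E \<in> algC" "K \<in> EOb T" "M \<in> EOb T"
  shows "EFh E K M \<in> Arr V" "Dom V (EFh E K M) = EHom T K M" "Cod V (EFh E K M) = EHom C (EFo E K) (EFo E M)"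
  using enriched_fun.Fh[OF algC_fun, of E K M] assms by simp_all

lemma bracket_alg [simp]: "E \<in> algC \<Longrightarrow> c \<in> EOb C \<Longrightarrow> bracket_at V T C E c \<in> algs"
  using bracket_at_algebra(2)[OF algC_fun _ J, of E c] by (simp add: algebras_def)

lemma bracket_at_simps [simp]:
  assumes "E \<in> algC" "c \<in> EOb C" "K \<in> EOb T"
  shows "EFo (bracket_at V T C E c) K = EHom C c (EFo E K)"
    "M \<in> EOb T \<Longrightarrow> elt V \<alpha> \<Longrightarrow> ty V \<alpha> = EHom T K M \<Longrightarrow> elt V f \<Longrightarrow> ty V f = EHom C c (EFo E K) \<Longrightarrow> dj \<alpha> f \<Longrightarrow>
      ev V (EHom C c (EFo E K)) (EHom C c (EFo E M)) \<star> (EFh (bracket_at V T C E c) K M \<star> \<alpha> \<parallel> f) =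
      EComp C c (EFo E K) (EFo E M) \<star> (EFh E K M \<star> \<alpha> \<parallel> f)"
proof -
  show "EFo (bracket_at V T C E c) K = EHom C c (EFo E K)" using assms by (simp add: bracket_at_def)
  interpret r: enriched_fun V C "self V" "rep V C c" by (rule C.rep_fun) fact
  show "ev V (EHom C c (EFo E K)) (EHom C c (EFo E M)) \<star> (EFh (bracket_at V T C E c) K M \<star> \<alpha> \<parallel> f) =
      EComp C c (EFo E K) (EFo E M) \<star> (EFh E K M \<star> \<alpha> \<parallel> f)"
    if "M \<in> EOb T" "elt V \<alpha>" "ty V \<alpha> = EHom T K M" "elt V f" "ty V f = EHom C c (EFo E K)" "dj \<alpha> f"
    using assms that r.Fh[of "EFo E K" "EFo E M"] by (simp add: bracket_at_def)
qed

lemma precomp: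
  assumes "E \<in> algC" "c \<in> EOb C" "d \<in> EOb C" "K \<in> EOb T"
  shows "EFh (rep V (op_cat V C) (EFo E K)) c d \<in> hom V (EHom C d c) (ihom V (EHom C c (EFo E K)) (EHom C d (EFo E K)))"
    "elt V f \<Longrightarrow> ty V f = EHom C d c \<Longrightarrow> elt V g \<Longrightarrow> ty V g = EHom C c (EFo E K) \<Longrightarrow> dj f g \<Longrightarrow>
      ev V (EHom C c (EFo E K)) (EHom C d (EFo E K)) \<star> (EFh (rep V (op_cat V C) (EFo E K)) c d \<star> f \<parallel> g) =
      EComp C d c (EFo E K) \<star> (g \<parallel> f)"
proof -
  interpret O: enriched_category V "op_cat V C" by (rule C.enriched_op)
  interpret r: enriched_fun V "op_cat V C" "self V" "rep V (op_cat V C) (EFo E K)"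
    by (rule O.rep_fun) (simp add: assms)
  show "EFh (rep V (op_cat V C) (EFo E K)) c d \<in> hom V (EHom C d c) (ihom V (EHom C c (EFo E K)) (EHom C d (EFo E K)))"
    using r.Fh[of c d] assms by (simp add: T.hom_iff)
  show "ev V (EHom C c (EFo E K)) (EHom C d (EFo E K)) \<star> (EFh (rep V (op_cat V C) (EFo E K)) c d \<star> f \<parallel> g) =
      EComp C d c (EFo E K) \<star> (g \<parallel> f)"
    if "elt V f" "ty V f = EHom C d c" "elt V g" "ty V g = EHom C c (EFo E K)" "dj f g"
    using O.rep_simps(2)[of "EFo E K" c d f g] assms that by simp
qed

text \<open>Precomposition with an arrow \<open>d \<rightarrow> c\<close> and postcomposition with
  images under \<open>E\<close> commute by associativity in \<open>C\<close>; so precomposition is a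
  map of algebras.\<close>

lemma bracket_wedge:
  assumes "E \<in> algC" "c \<in> EOb C" "d \<in> EOb C"
  shows "wedge V T (nat_bifunctor V T (self V) (bracket_at V T C E c) (bracket_at V T C E d)) (EHom C d c)
    (\<lambda>K. EFh (rep V (op_cat V C) (EFo E K)) c d)"
proof -
  interpret fp: fun_pair V T "self V" "bracket_at V T C E c" "bracket_at V T C E d"
    using assms by (simp add: fun_pair_def alg_fun)
  note pt = precomp(1)[OF assms, unfolded T.hom_iff] and pa = precomp(2)[OF assms]
  show ?thesis
  proof (rule fp.wedge_natI)
    fix K M \<alpha> f
    assume *: "K \<in> EOb T" "M \<in> EOb T" "elt V \<alpha>" "ty V \<alpha> = EHom T K M" "elt V f" "ty V f = EHom C d c" "dj \<alpha> f" "dj f \<alpha>"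
    show "EComp (self V) (EFo (bracket_at V T C E c) K) (EFo (bracket_at V T C E d) K) (EFo (bracket_at V T C E d) M) \<star>
        (EFh (bracket_at V T C E d) K M \<star> \<alpha> \<parallel> EFh (rep V (op_cat V C) (EFo E K)) c d \<star> f) =
      EComp (self V) (EFo (bracket_at V T C E c) K) (EFo (bracket_at V T C E c) M) (EFo (bracket_at V T C E d) M) \<star>
        (EFh (rep V (op_cat V C) (EFo E M)) c d \<star> f \<parallel> EFh (bracket_at V T C E c) K M \<star> \<alpha>)"
      by (rule T.elt_ihom_ext[where X="EHom C c (EFo E K)" and Y="EHom C d (EFo E M)"])
        (use * assms in \<open>auto simp: pt pa C.comp_assoc\<close>)
  qed (use assms pt in \<open>auto simp: T.hom_iff\<close>)
qed

lemma bracket_hom: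
  assumes "E \<in> algC" "c \<in> EOb C" "d \<in> EOb C"
  shows "EFh (bracket V T C E) c d \<in> hom V (EHom C d c) (EHom AlgT (bracket_at V T C E c) (bracket_at V T C E d))"
    "K \<in> EOb T \<Longrightarrow> elt V f \<Longrightarrow> ty V f = EHom C d c \<Longrightarrow>
      Alg_proj V T (bracket_at V T C E c) (bracket_at V T C E d) K \<star> (EFh (bracket V T C E) c d \<star> f) =
      EFh (rep V (op_cat V C) (EFo E K)) c d \<star> f"
proof -
  interpret fp: fun_pair V T "self V" "bracket_at V T C E c" "bracket_at V T C E d"
    using assms by (simp add: fun_pair_def alg_fun)
  have e: "EFh (bracket V T C E) c d = end_lift V T (nat_bifunctor V T (self V) (bracket_at V T C E c) (bracket_at V T C E d))
      (EHom C d c) (\<lambda>K. EFh (rep V (op_cat V C) (EFo E K)) c d)"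
    using assms by (simp add: bracket_def)
  have ob: "EHom C d c \<in> Obj V" using assms by simp
  note l = end_lift[OF T.enriched_category_axioms fp.bif_nat alg_end bracket_wedge[OF assms] ob]
  show "EFh (bracket V T C E) c d \<in> hom V (EHom C d c) (EHom AlgT (bracket_at V T C E c) (bracket_at V T C E d))"
    unfolding e Alg_hom using l assms by (simp add: T.hom_iff)
  show "Alg_proj V T (bracket_at V T C E c) (bracket_at V T C E d) K \<star> (EFh (bracket V T C E) c d \<star> f) =
      EFh (rep V (op_cat V C) (EFo E K)) c d \<star> f"
    if "K \<in> EOb T" "elt V f" "ty V f = EHom C d c"
    using that l(5)[of K f] assms unfolding e Alg_proj_def by simp
qed

lemma bracket_ob [simp]: "c \<in> EOb C \<Longrightarrow> EFo (bracket V T C E) c = bracket_at V T C E c"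
  by (simp add: bracket_def)

lemma alg_hom_ext:
  assumes "A \<in> algs" "B \<in> algs" "elt V h" "elt V k" "fst h = fst k" "ty V h = EHom AlgT A B" "ty V k = EHom AlgT A B"
    "\<And>K x. K \<in> EOb T \<Longrightarrow> elt V x \<Longrightarrow> ty V x = EFo A K \<Longrightarrow> dj h x \<Longrightarrow> dj x h \<Longrightarrow> dj k x \<Longrightarrow> dj x k \<Longrightarrow>
      ev V (EFo A K) (EFo B K) \<star> (Alg_proj V T A B K \<star> h \<parallel> x) = ev V (EFo A K) (EFo B K) \<star> (Alg_proj V T A B K \<star> k \<parallel> x)"
  shows "h = k"
proof -
  interpret n: nat_end V T "self V" A B "EHom AlgT A B" "Alg_proj V T A B"
    by (rule alg_nat_end) fact+
  show ?thesis
  proof (rule n.E.elt_end_ext[OF assms(3-7)])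
    fix K assume K: "K \<in> EOb T"
    show "Alg_proj V T A B K \<star> h = Alg_proj V T A B K \<star> k"
      by (rule T.elt_ihom_ext[where X="EFo A K" and Y="EFo B K"]) (use K assms in auto)
  qed
qed

lemma bracket_fun:
  assumes "E \<in> algC"
  shows "enriched_fun V (op_cat V C) AlgT (bracket V T C E)"
proof -
  interpret O: enriched_category V "op_cat V C" by (rule C.enriched_op)
  \<comment> \<open>The bracket is built by \<open>mk_efun\<close> already, so truncating its own
    hom map again changes nothing and \<open>mk_enriched_fun\<close> becomes applicable.\<close>
  have e: "bracket V T C E = mk_efun (op_cat V C) (bracket_at V T C E) (EFh (bracket V T C E))"
    by (simp add: bracket_def mk_efun_def fun_eq_iff)
  have h: "EFh (bracket V T C E) c d \<in> Arr V" "Dom V (EFh (bracket V T C E) c d) = EHom C d c"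
    "Cod V (EFh (bracket V T C E) c d) = EHom AlgT (bracket_at V T C E c) (bracket_at V T C E d)"
    if "c \<in> EOb C" "d \<in> EOb C" for c d
    using bracket_hom(1)[OF assms that] by (auto simp: T.hom_iff)
  have p: "EFh (rep V (op_cat V C) (EFo E K)) c d \<in> Arr V" "Dom V (EFh (rep V (op_cat V C) (EFo E K)) c d) = EHom C d c"
    "Cod V (EFh (rep V (op_cat V C) (EFo E K)) c d) = ihom V (EHom C c (EFo E K)) (EHom C d (EFo E K))"
    if "c \<in> EOb C" "d \<in> EOb C" "K \<in> EOb T" for c d K
    using precomp(1)[OF assms that] by (auto simp: T.hom_iff)
  note simps = h p bracket_hom(2)[OF assms] precomp(2)[OF assms] proj_comp proj_id assms
  have "enriched_fun V (op_cat V C) AlgT (mk_efun (op_cat V C) (bracket_at V T C E) (EFh (bracket V T C E)))"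
  proof (rule mk_enriched_fun[OF C.enriched_op Alg_enriched])
    fix x y z g f
    assume *: "x \<in> EOb (op_cat V C)" "y \<in> EOb (op_cat V C)" "z \<in> EOb (op_cat V C)" "elt V g" "elt V f"
      "ty V g = EHom (op_cat V C) y z" "ty V f = EHom (op_cat V C) x y" "dj g f" "dj f g"
    show "EFh (bracket V T C E) x z \<star> (EComp (op_cat V C) x y z \<star> (g \<parallel> f)) =
       EComp AlgT (bracket_at V T C E x) (bracket_at V T C E y) (bracket_at V T C E z) \<star>
       (EFh (bracket V T C E) y z \<star> g \<parallel> EFh (bracket V T C E) x y \<star> f)"
      by (rule alg_hom_ext[of "bracket_at V T C E x" "bracket_at V T C E z"])
        (use * in \<open>auto simp: simps C.comp_assoc\<close>)
  next
    fix x assume *: "x \<in> EOb (op_cat V C)"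
    show "EFh (bracket V T C E) x x \<star> (EId (op_cat V C) x \<star> unit_elt V) = EId AlgT (bracket_at V T C E x) \<star> unit_elt V"
      by (rule alg_hom_ext[of "bracket_at V T C E x" "bracket_at V T C E x"])
        (use * in \<open>auto simp: simps C.comp_id\<close>)
  qed (auto simp: T.hom_iff simps)
  then show ?thesis by (simp only: e[symmetric])
qed

abbreviation "sec_left S E \<equiv> \<lambda>L. comp_fun V (op_cat V T) (evaluation V J T L) (comp_fun V (op_cat V T) S (op_fun E))"
abbreviation "sec_right S E \<equiv> \<lambda>K. EFo S (EFo E K)"

lemma section_bifun:
  assumes S: "enriched_fun V (op_cat V C) AlgT S" and E: "E \<in> algC"
  shows "bifun V T (sec_left S E) (sec_right S E)"
proof -
  interpret S: enriched_fun V "op_cat V C" AlgT S by fact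
  interpret E: enriched_fun V T C E by (rule algC_fun[OF E])
  show ?thesis
  proof (rule bifun.intro[OF T.enriched_category_axioms bifun_axioms.intro])
    fix b assume b: "b \<in> EOb T"
    show "enriched_fun V (op_cat V T) (self V) (comp_fun V (op_cat V T) (evaluation V J T b) (comp_fun V (op_cat V T) S (op_fun E)))"
      by (intro comp_fun_fun[OF comp_fun_fun[OF op_fun_fun[OF E.enriched_fun_axioms] S] evaluation_fun[OF b]])
    show "enriched_fun V T (self V) (EFo S (EFo E b))"
      using S.Fo[of "EFo E b"] b by (intro alg_fun) simp
  next
    fix a b assume "a \<in> EOb T" "b \<in> EOb T"
    then show "EFo (comp_fun V (op_cat V T) (evaluation V J T b) (comp_fun V (op_cat V T) S (op_fun E))) a = EFo (EFo S (EFo E a)) b"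
      using S.Fo[of "EFo E a"] by simp
  qed
qed

end

section \<open>Algebras after change of base\<close>

locale correspondence = base_change V V' i + bracketing V T J C
  for V :: "('v, 'a) smc" and V' :: "('w, 'b) smc" (structure) and i :: "('v, 'a, 'w, 'b) mfun"
    and T :: "('v, 'v, 'a) ecat" and J :: "'v set" and C :: "('x, 'v, 'a) ecat" +
  fixes U :: "'u set"
  assumes U: "infinite U" "small U (EOb T)" "small U (EOb C)" and complete: "small_complete U V'"
    and limits: "preserves_limits U V V' i"
begin

abbreviation "bT \<equiv> base_cat V' i T"
abbreviation "bC \<equiv> base_cat V' i C"
abbreviation "bO \<equiv> base_cat V' i (op_cat V C)"
abbreviation "bAlg \<equiv> base_cat V' i AlgT"

sublocale bT: enriched_category V' bT by (rule base_enriched[OF T.enriched_category_axioms])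
sublocale bC: enriched_category V' bC by (rule base_enriched[OF C.enriched_category_axioms])
sublocale O: enriched_category V "op_cat V C" by (rule C.enriched_op)
sublocale bO: enriched_category V' bO by (rule base_enriched[OF C.enriched_op])
sublocale bAlg: enriched_category V' bAlg by (rule base_enriched[OF Alg_enriched])

text \<open>\<open>apl A B K h x\<close> applies the component at \<open>K\<close> of an element \<open>h\<close> of \<open>T-Alg(A, B)\<close> to an element
  \<open>x\<close> of \<open>A K\<close>, and \<open>ac A K M\<close> is the action \<open>T(K, M) \<otimes> A K \<rightarrow> A M\<close>, both after embedding into \<open>V'\<close>.\<close>

definition apl :: "('v, 'v, 'a) efun \<Rightarrow> ('v, 'v, 'a) efun \<Rightarrow> 'v \<Rightarrow> ('w, 'b) elt \<Rightarrow> ('w, 'b) elt \<Rightarrow> ('w, 'b) elt" where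
  "apl A B K h x = FAr i (ev V (EFo A K) (EFo B K)) \<star> (FMul i (ihom V (EFo A K) (EFo B K)) (EFo A K) \<star>
     (FAr i (Alg_proj V T A B K) \<star> h \<parallel> x))"

definition ac :: "('v, 'v, 'a) efun \<Rightarrow> 'v \<Rightarrow> 'v \<Rightarrow> ('w, 'b) elt \<Rightarrow> ('w, 'b) elt \<Rightarrow> ('w, 'b) elt" where
  "ac A K M \<alpha> x = FAr i (ev V (EFo A K) (EFo A M)) \<star> (FMul i (ihom V (EFo A K) (EFo A M)) (EFo A K) \<star>
     (FAr i (EFh A K M) \<star> \<alpha> \<parallel> x))"

lemma apl_fst [simp]: "fst (apl A B K h x) = fst h \<union> fst x" "fst (ac A K M \<alpha> x) = fst \<alpha> \<union> fst x"
  by (simp_all add: apl_def ac_def)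

lemma apl_dj [simp]:
  "dj (apl A B K h x) y \<longleftrightarrow> dj h y \<and> dj x y" "dj y (apl A B K h x) \<longleftrightarrow> dj y h \<and> dj y x"
  "dj (ac A K M h x) y \<longleftrightarrow> dj h y \<and> dj x y" "dj y (ac A K M h x) \<longleftrightarrow> dj y h \<and> dj y x"
  by (simp_all add: apl_def ac_def)

lemma apl_elt [simp]:
  assumes "A \<in> algs" "K \<in> EOb T" "elt V' h" "elt V' x" "dj h x" "ty V' x = FOb i (EFo A K)"
  shows "B \<in> algs \<Longrightarrow> ty V' h = FOb i (EHom AlgT A B) \<Longrightarrow> elt V' (apl A B K h x)"
    "B \<in> algs \<Longrightarrow> ty V' h = FOb i (EHom AlgT A B) \<Longrightarrow> ty V' (apl A B K h x) = FOb i (EFo B K)"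
    "M \<in> EOb T \<Longrightarrow> ty V' h = FOb i (EHom T K M) \<Longrightarrow> elt V' (ac A K M h x)"
    "M \<in> EOb T \<Longrightarrow> ty V' h = FOb i (EHom T K M) \<Longrightarrow> ty V' (ac A K M h x) = FOb i (EFo A M)"
  using assms by (simp_all add: apl_def ac_def)

text \<open>In \<open>V\<close>, composition in \<open>T-Alg\<close> is composition of components,
  which evaluates to successive application; \<open>i_eq_act\<close> carries this over to elements
  of \<open>V'\<close>.\<close>

lemma apl_comp:
  assumes "A \<in> algs" "B \<in> algs" "D \<in> algs" "K \<in> EOb T" "elt V' g" "elt V' f" "elt V' x"
    "ty V' g = FOb i (EHom AlgT B D)" "ty V' f = FOb i (EHom AlgT A B)" "ty V' x = FOb i (EFo A K)"
    "dj g f" "dj f g" "dj g x" "dj x g" "dj f x" "dj x f"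
  shows "apl A D K (EComp bAlg A B D \<star> (g \<parallel> f)) x = apl B D K g (apl A B K f x)"
proof -
  have "ev V (EFo A K) (EFo D K) \<cdot>\<^bsub>V\<^esub> ((Alg_proj V T A D K \<cdot>\<^bsub>V\<^esub> EComp AlgT A B D) \<odot>\<^bsub>V\<^esub> Idt V (EFo A K)) =
    ev V (EFo B K) (EFo D K) \<cdot>\<^bsub>V\<^esub> ((Alg_proj V T B D K \<odot>\<^bsub>V\<^esub> (ev V (EFo A K) (EFo B K) \<cdot>\<^bsub>V\<^esub> (Alg_proj V T A B K \<odot>\<^bsub>V\<^esub> Idt V (EFo A K)))) \<cdot>\<^bsub>V\<^esub>
      asc V (EHom AlgT B D) (EHom AlgT A B) (EFo A K))"
    by (rule V.ext3[where X="EHom AlgT B D" and Y="EHom AlgT A B" and Z="EFo A K" and W="EFo D K"])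
      (use assms in \<open>auto simp: V.hom_iff proj_comp\<close>)
  from i_eq_act[OF this, of "FMul i (EHom AlgT B D \<otimes>\<^bsub>V\<^esub> EHom AlgT A B) (EFo A K) \<star> (FMul i (EHom AlgT B D) (EHom AlgT A B) \<star> (g \<parallel> f) \<parallel> x)"]
  show ?thesis using assms by (simp add: apl_def)
qed

lemma apl_id:
  assumes "A \<in> algs" "K \<in> EOb T" "elt V' x" "ty V' x = FOb i (EFo A K)"
  shows "apl A A K (EId bAlg A \<star> unit_elt V') x = x"
proof -
  have "(ev V (EFo A K) (EFo A K) \<cdot>\<^bsub>V\<^esub> ((Alg_proj V T A A K \<cdot>\<^bsub>V\<^esub> EId AlgT A) \<odot>\<^bsub>V\<^esub> Idt V (EFo A K))) \<cdot>\<^bsub>V\<^esub> inv_arr V (lun V (EFo A K)) =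
    Idt V (EFo A K)"
    by (rule V.ext1[where X="EFo A K" and Y="EFo A K"]) (use assms in \<open>auto simp: V.hom_iff proj_id\<close>)
  from i_eq_act[OF this, of x] show ?thesis using assms by (simp add: apl_def)
qed

text \<open>Elements of an embedded hom-object act as homomorphisms. In \<open>V\<close> this is
  naturality of the end projections, with the internal homs evaluated at an element of
  \<open>A K\<close>.\<close>

lemma apl_nat:
  assumes "A \<in> algs" "B \<in> algs" "K \<in> EOb T" "M \<in> EOb T" "elt V' h" "elt V' \<alpha>" "elt V' x"
    "ty V' h = FOb i (EHom AlgT A B)" "ty V' \<alpha> = FOb i (EHom T K M)" "ty V' x = FOb i (EFo A K)"
    "dj h \<alpha>" "dj \<alpha> h" "dj h x" "dj x h" "dj \<alpha> x" "dj x \<alpha>"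
  shows "ac B K M \<alpha> (apl A B K h x) = apl A B M h (ac A K M \<alpha> x)"
proof -
  interpret n: nat_end V T "self V" A B "EHom AlgT A B" "Alg_proj V T A B"
    by (rule alg_nat_end) fact+
  let ?P = "EHom T K M" and ?Q = "EHom AlgT A B" and ?R = "EFo A K"
  have n: "ev V (EFo B K) (EFo B M) \<star>\<^bsub>V\<^esub> (EFh B K M \<star>\<^bsub>V\<^esub> a \<parallel>\<^bsub>V\<^esub> ev V (EFo A K) (EFo B K) \<star>\<^bsub>V\<^esub> (Alg_proj V T A B K \<star>\<^bsub>V\<^esub> t \<parallel>\<^bsub>V\<^esub> r)) =
     ev V (EFo A M) (EFo B M) \<star>\<^bsub>V\<^esub> (Alg_proj V T A B M \<star>\<^bsub>V\<^esub> t \<parallel>\<^bsub>V\<^esub> ev V (EFo A K) (EFo A M) \<star>\<^bsub>V\<^esub> (EFh A K M \<star>\<^bsub>V\<^esub> a \<parallel>\<^bsub>V\<^esub> r))"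
    if "elt V a" "ty V a = ?P" "elt V t" "ty V t = ?Q" "elt V r" "ty V r = ?R" "dj a t" "dj t a" "dj a r" "dj r a" "dj t r" "dj r t" for a t r
    using arg_cong[OF n.natural[of K M a t], of "\<lambda>h. ev V (EFo A K) (EFo B M) \<star>\<^bsub>V\<^esub> (h \<parallel>\<^bsub>V\<^esub> r)"] that assms(1-4) by simp
  have "ev V (EFo B K) (EFo B M) \<cdot>\<^bsub>V\<^esub> ((EFh B K M \<odot>\<^bsub>V\<^esub> (ev V (EFo A K) (EFo B K) \<cdot>\<^bsub>V\<^esub> (Alg_proj V T A B K \<odot>\<^bsub>V\<^esub> Idt V ?R))) \<cdot>\<^bsub>V\<^esub> asc V ?P ?Q ?R) =
     ev V (EFo A M) (EFo B M) \<cdot>\<^bsub>V\<^esub> ((Alg_proj V T A B M \<odot>\<^bsub>V\<^esub> (ev V (EFo A K) (EFo A M) \<cdot>\<^bsub>V\<^esub> (EFh A K M \<odot>\<^bsub>V\<^esub> Idt V ?R))) \<cdot>\<^bsub>V\<^esub>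
       (asc V ?Q ?P ?R \<cdot>\<^bsub>V\<^esub> (braid V ?P ?Q \<odot>\<^bsub>V\<^esub> Idt V ?R)))"
    by (rule V.ext3[where X="?P" and Y="?Q" and Z="?R" and W="EFo B M"])
      (use assms(1-4) in \<open>auto simp: V.hom_iff n\<close>)
  from i_eq_act[OF this, of "FMul i (?P \<otimes>\<^bsub>V\<^esub> ?Q) ?R \<star> (FMul i ?P ?Q \<star> (\<alpha> \<parallel> h) \<parallel> x)"]
  show ?thesis using assms by (simp add: apl_def ac_def)
qed

text \<open>The crucial use of limit preservation: an embedded hom-object of \<open>T-Alg\<close>
  remains an end in \<open>V'\<close>, so arrows of \<open>V'\<close> into it can be tested and
  defined at each \<open>K\<close>.\<close>

lemma alg_end_base:
  assumes "A \<in> algs" "B \<in> algs"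
  shows "base_bifun V V' i T (\<lambda>b. comp_fun V (op_cat V T) (rep V (op_cat V (self V)) (EFo B b)) (op_fun A))
      (\<lambda>a. comp_fun V T (rep V (self V) (EFo A a)) B)"
    "an_end V' bT (base_bifunctor V V' i T (nat_bifunctor V T (self V) A B)) (FOb i (EHom AlgT A B)) (\<lambda>K. FAr i (Alg_proj V T A B K))"
proof -
  interpret n: nat_end V T "self V" A B "EHom AlgT A B" "Alg_proj V T A B"
    by (rule alg_nat_end) fact+
  show b: "base_bifun V V' i T (\<lambda>b. comp_fun V (op_cat V T) (rep V (op_cat V (self V)) (EFo B b)) (op_fun A))
      (\<lambda>a. comp_fun V T (rep V (self V) (EFo A a)) B)"
    using n.nat_bifun by (simp add: base_bifun_def base_change_axioms)
  then interpret b: base_bifun V V' i T "\<lambda>b. comp_fun V (op_cat V T) (rep V (op_cat V (self V)) (EFo B b)) (op_fun A)"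
      "\<lambda>a. comp_fun V T (rep V (self V) (EFo A a)) B" .
  show "an_end V' bT (base_bifunctor V V' i T (nat_bifunctor V T (self V) A B)) (FOb i (EHom AlgT A B)) (\<lambda>K. FAr i (Alg_proj V T A B K))"
    using b.preserves_end[OF limits U(1,2), of "EHom AlgT A B" "Alg_proj V T A B"] n.E.is_end b.bF_bif bT.enriched_category_axioms
    by (simp add: an_end_def an_end_axioms_def hom_bifunctor_def)
qed

lemma iev_inj:
  assumes "X \<in> Obj V" "Y \<in> Obj V" "elt V' h" "elt V' k" "fst h = fst k" "ty V' h = FOb i (ihom V X Y)" "ty V' k = FOb i (ihom V X Y)"
    "\<And>x. elt V' x \<Longrightarrow> ty V' x = FOb i X \<Longrightarrow> dj h x \<Longrightarrow> dj x h \<Longrightarrow> dj k x \<Longrightarrow> dj x k \<Longrightarrow>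
      FAr i (ev V X Y) \<star> (FMul i (ihom V X Y) X \<star> (h \<parallel> x)) = FAr i (ev V X Y) \<star> (FMul i (ihom V X Y) X \<star> (k \<parallel> x))"
  shows "h = k"
proof (rule comparison_inj[OF assms(1-4,6,7)])
  show "ihom_comparison V V' i X Y \<star> h = ihom_comparison V V' i X Y \<star> k"
    by (rule W.elt_ihom_ext[where X="FOb i X" and Y="FOb i Y"]) (use assms in auto)
qed

text \<open>The embedded projections are jointly monic, and an element of an embedded internal hom
  is determined by evaluation since the comparison map is invertible.\<close>

lemma apl_ext:
  assumes "A \<in> algs" "B \<in> algs" "elt V' h" "elt V' k" "fst h = fst k" "ty V' h = FOb i (EHom AlgT A B)" "ty V' k = FOb i (EHom AlgT A B)"
    "\<And>K x. K \<in> EOb T \<Longrightarrow> elt V' x \<Longrightarrow> ty V' x = FOb i (EFo A K) \<Longrightarrow> dj h x \<Longrightarrow> dj x h \<Longrightarrow> dj k x \<Longrightarrow> dj x k \<Longrightarrow>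
      apl A B K h x = apl A B K k x"
  shows "h = k"
proof -
  interpret e: an_end V' bT "base_bifunctor V V' i T (nat_bifunctor V T (self V) A B)" "FOb i (EHom AlgT A B)" "\<lambda>K. FAr i (Alg_proj V T A B K)"
    by (rule alg_end_base) fact+
  show ?thesis
  proof (rule e.elt_end_ext[OF assms(3-7)])
    fix K assume K: "K \<in> EOb bT"
    show "FAr i (Alg_proj V T A B K) \<star> h = FAr i (Alg_proj V T A B K) \<star> k"
      by (rule iev_inj[of "EFo A K" "EFo B K"]) (use K assms in \<open>auto simp: apl_def\<close>)
  qed
qed

text \<open>Compatible components glue to a homomorphism. The hypothesis \<open>nat\<close> is the
  wedge condition for the end \<open>T-Alg(A, B)\<close>, rewritten by evaluating all internal homs
  so that it speaks of operations and arguments only.\<close>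

lemma alg_lift:
  assumes A: "A \<in> algs" "B \<in> algs" and Y: "Y \<in> Obj V'"
    and r: "\<And>K. K \<in> EOb T \<Longrightarrow> \<rho> K \<in> hom V' Y (FOb i (ihom V (EFo A K) (EFo B K)))"
    and nat: "\<And>K M \<alpha> y x. K \<in> EOb T \<Longrightarrow> M \<in> EOb T \<Longrightarrow> elt V' \<alpha> \<Longrightarrow> elt V' y \<Longrightarrow> elt V' x \<Longrightarrow>
      ty V' \<alpha> = FOb i (EHom T K M) \<Longrightarrow> ty V' y = Y \<Longrightarrow> ty V' x = FOb i (EFo A K) \<Longrightarrow>
      dj \<alpha> y \<Longrightarrow> dj y \<alpha> \<Longrightarrow> dj \<alpha> x \<Longrightarrow> dj x \<alpha> \<Longrightarrow> dj y x \<Longrightarrow> dj x y \<Longrightarrow>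
      ac B K M \<alpha> (FAr i (ev V (EFo A K) (EFo B K)) \<star> (FMul i (ihom V (EFo A K) (EFo B K)) (EFo A K) \<star> (\<rho> K \<star> y \<parallel> x))) =
      FAr i (ev V (EFo A M) (EFo B M)) \<star> (FMul i (ihom V (EFo A M) (EFo B M)) (EFo A M) \<star> (\<rho> M \<star> y \<parallel> ac A K M \<alpha> x))"
  shows "\<exists>!h. h \<in> hom V' Y (FOb i (EHom AlgT A B)) \<and> (\<forall>K\<in>EOb T. FAr i (Alg_proj V T A B K) \<cdot> h = \<rho> K)"
proof -
  let ?L = "\<lambda>b. comp_fun V (op_cat V T) (rep V (op_cat V (self V)) (EFo B b)) (op_fun A)"
  let ?R = "\<lambda>a. comp_fun V T (rep V (self V) (EFo A a)) B"
  interpret fp: fun_pair V T "self V" A B using A by (simp add: fun_pair_def alg_fun)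
  interpret e: an_end V' bT "base_bifunctor V V' i T (nat_bifunctor V T (self V) A B)" "FOb i (EHom AlgT A B)" "\<lambda>K. FAr i (Alg_proj V T A B K)"
    by (rule alg_end_base) fact+
  interpret b: base_bifun V V' i T ?L ?R by (rule alg_end_base(1)) fact+
  interpret S: enriched_category V "self V" by (rule V.enriched_self)
  have rt: "\<rho> K \<in> Arr V'" "Dom V' (\<rho> K) = Y" "Cod V' (\<rho> K) = FOb i (ihom V (EFo A K) (EFo B K))" if "K \<in> EOb T" for K
    using r[OF that] by (auto simp: W.hom_iff)
  have "wedge V' bT (base_bifunctor V V' i T (nat_bifunctor V T (self V) A B)) Y \<rho>"
    unfolding hom_bifunctor_def
  proof (rule b.wedge_baseI)
    show "\<rho> K \<in> hom V' Y (FOb i (EFo (?R K) K))" if "K \<in> EOb T" for K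
      using r[OF that] that A by simp
    fix K M \<alpha> y
    assume *: "K \<in> EOb T" "M \<in> EOb T" "elt V' \<alpha>" "ty V' \<alpha> = FOb i (EHom T K M)" "elt V' y" "ty V' y = Y" "dj \<alpha> y" "dj y \<alpha>"
    let ?AK = "EFo A K" and ?BM = "EFo B M" and ?BK = "EFo B K" and ?AM = "EFo A M"
    have [simp]: "?AK \<in> Obj V" "?BM \<in> Obj V" "?BK \<in> Obj V" "?AM \<in> Obj V" using * A by simp_all
    have t: "EFh (?R K) K M \<in> Arr V" "Dom V (EFh (?R K) K M) = EHom T K M" "Cod V (EFh (?R K) K M) = ihom V (ihom V ?AK ?BK) (ihom V ?AK ?BM)"
      "EFh (?L M) M K \<in> Arr V" "Dom V (EFh (?L M) M K) = EHom T K M" "Cod V (EFh (?L M) M K) = ihom V (ihom V ?AM ?BM) (ihom V ?AK ?BM)"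
      using b.R_arr[of K K M] b.R_arr[of M K M] * A by (simp_all del: comp_fun_simps(2))
    have tA: "EFh A K M \<in> Arr V" "Dom V (EFh A K M) = EHom T K M" "Cod V (EFh A K M) = ihom V ?AK ?AM"
      "EFh B K M \<in> Arr V" "Dom V (EFh B K M) = EHom T K M" "Cod V (EFh B K M) = ihom V ?BK ?BM" using A * by simp_all
    \<comment> \<open>Here and in \<open>e2\<close> the two partial actions of
      \<open>[A -, B -]\<close> are evaluated in \<open>V\<close>, as applying an operation after,
      respectively before, a component; both equations are transported by
      \<open>i_eq_act\<close>.\<close>
    have e1: "ev V ?AK ?BM \<cdot>\<^bsub>V\<^esub> ((ev V (ihom V ?AK ?BK) (ihom V ?AK ?BM) \<cdot>\<^bsub>V\<^esub> (EFh (?R K) K M \<odot>\<^bsub>V\<^esub> Idt V (ihom V ?AK ?BK))) \<odot>\<^bsub>V\<^esub> Idt V ?AK) =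
      ev V ?BK ?BM \<cdot>\<^bsub>V\<^esub> ((EFh B K M \<odot>\<^bsub>V\<^esub> ev V ?AK ?BK) \<cdot>\<^bsub>V\<^esub> asc V (EHom T K M) (ihom V ?AK ?BK) ?AK)"
      by (rule V.ext3[where X="EHom T K M" and Y="ihom V ?AK ?BK" and Z="?AK" and W="?BM"])
        (use * t tA fp.nat_left[of K M] in \<open>auto simp: V.hom_iff simp del: comp_fun_simps\<close>)
    have e2: "ev V ?AK ?BM \<cdot>\<^bsub>V\<^esub> ((ev V (ihom V ?AM ?BM) (ihom V ?AK ?BM) \<cdot>\<^bsub>V\<^esub> (EFh (?L M) M K \<odot>\<^bsub>V\<^esub> Idt V (ihom V ?AM ?BM))) \<odot>\<^bsub>V\<^esub> Idt V ?AK) =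
      ev V ?AM ?BM \<cdot>\<^bsub>V\<^esub> ((Idt V (ihom V ?AM ?BM) \<odot>\<^bsub>V\<^esub> (ev V ?AK ?AM \<cdot>\<^bsub>V\<^esub> (EFh A K M \<odot>\<^bsub>V\<^esub> Idt V ?AK))) \<cdot>\<^bsub>V\<^esub>
        (asc V (ihom V ?AM ?BM) (EHom T K M) ?AK \<cdot>\<^bsub>V\<^esub> (braid V (EHom T K M) (ihom V ?AM ?BM) \<odot>\<^bsub>V\<^esub> Idt V ?AK)))"
      by (rule V.ext3[where X="EHom T K M" and Y="ihom V ?AM ?BM" and Z="?AK" and W="?BM"])
        (use * t tA fp.nat_right[of K M] in \<open>auto simp: V.hom_iff simp del: comp_fun_simps\<close>)
    have ob: "EFo (?R K) K = ihom V ?AK ?BK" "EFo (?R K) M = ihom V ?AK ?BM" "EFo (?R M) M = ihom V ?AM ?BM"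
      using * by simp_all
    show "FAr i (ev V (EFo (?R K) K) (EFo (?R K) M)) \<star> (FMul i (ihom V (EFo (?R K) K) (EFo (?R K) M)) (EFo (?R K) K) \<star>
         (FAr i (EFh (?R K) K M) \<star> \<alpha> \<parallel> \<rho> K \<star> y)) =
       FAr i (ev V (EFo (?R M) M) (EFo (?R K) M)) \<star> (FMul i (ihom V (EFo (?R M) M) (EFo (?R K) M)) (EFo (?R M) M) \<star>
         (FAr i (EFh (?L M) M K) \<star> \<alpha> \<parallel> \<rho> M \<star> y))"
      unfolding ob
    proof (rule iev_inj[of ?AK ?BM])
      fix x assume "elt V' x" "ty V' x = FOb i ?AK"
        "dj (FAr i (ev V (ihom V ?AK ?BK) (ihom V ?AK ?BM)) \<star> (FMul i (ihom V (ihom V ?AK ?BK) (ihom V ?AK ?BM)) (ihom V ?AK ?BK) \<star> (FAr i (EFh (?R K) K M) \<star> \<alpha> \<parallel> \<rho> K \<star> y))) x"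
        "dj x (FAr i (ev V (ihom V ?AK ?BK) (ihom V ?AK ?BM)) \<star> (FMul i (ihom V (ihom V ?AK ?BK) (ihom V ?AK ?BM)) (ihom V ?AK ?BK) \<star> (FAr i (EFh (?R K) K M) \<star> \<alpha> \<parallel> \<rho> K \<star> y)))"
      then have x: "elt V' x" "ty V' x = FOb i ?AK" "dj \<alpha> x" "dj x \<alpha>" "dj y x" "dj x y" by simp_all
      note n = nat[OF *(1,2,3,5) x(1) *(4,6) x(2) *(7,8) x(3-6), unfolded ac_def]
      show "FAr i (ev V ?AK ?BM) \<star> (FMul i (ihom V ?AK ?BM) ?AK \<star>
          (FAr i (ev V (ihom V ?AK ?BK) (ihom V ?AK ?BM)) \<star> (FMul i (ihom V (ihom V ?AK ?BK) (ihom V ?AK ?BM)) (ihom V ?AK ?BK) \<star> (FAr i (EFh (?R K) K M) \<star> \<alpha> \<parallel> \<rho> K \<star> y)) \<parallel> x)) =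
        FAr i (ev V ?AK ?BM) \<star> (FMul i (ihom V ?AK ?BM) ?AK \<star>
          (FAr i (ev V (ihom V ?AM ?BM) (ihom V ?AK ?BM)) \<star> (FMul i (ihom V (ihom V ?AM ?BM) (ihom V ?AK ?BM)) (ihom V ?AM ?BM) \<star> (FAr i (EFh (?L M) M K) \<star> \<alpha> \<parallel> \<rho> M \<star> y)) \<parallel> x))"
        using i_eq_act[OF e1, of "FMul i (EHom T K M \<otimes>\<^bsub>V\<^esub> ihom V ?AK ?BK) ?AK \<star> (FMul i (EHom T K M) (ihom V ?AK ?BK) \<star> (\<alpha> \<parallel> \<rho> K \<star> y) \<parallel> x)"]
          i_eq_act[OF e2, of "FMul i (EHom T K M \<otimes>\<^bsub>V\<^esub> ihom V ?AM ?BM) ?AK \<star> (FMul i (EHom T K M) (ihom V ?AM ?BM) \<star> (\<alpha> \<parallel> \<rho> M \<star> y) \<parallel> x)"]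
          * x t tA rt n by (simp del: comp_fun_simps)
    qed (use * t rt in \<open>simp_all del: comp_fun_simps\<close>)
  qed
  from e.end_lift_ex[OF this Y] show ?thesis by simp
qed


section \<open>Functor categories and the bracket functor over \<open>V'\<close>\<close>

abbreviation "Fun \<equiv> big_functor_cat V V' i (op_cat V C) AlgT"
abbreviation "AlgC \<equiv> big_Alg V V' i J T C"
abbreviation "br E \<equiv> bracket V T C E"
abbreviation "bra E c \<equiv> bracket_at V T C E c"
abbreviation "prF S S' \<equiv> big_proj V V' i (op_cat V C) AlgT S S'"
abbreviation "prA E E' \<equiv> big_proj V V' i T C E E'"

lemma Fun_fun: "S \<in> EOb Fun \<Longrightarrow> enriched_fun V (op_cat V C) AlgT S"
  by (rule enriched_funI[OF C.enriched_op Alg_enriched]) (simp add: big_functor_cat_def Let_def)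

lemma Fun_funI: "enriched_fun V (op_cat V C) AlgT S \<Longrightarrow> S \<in> EOb Fun"
  using enriched_fun.F by (auto simp: big_functor_cat_def Let_def)

lemma AlgC_Ob [simp]: "EOb AlgC = algC"
  by (simp add: big_Alg_def full_sub_def)

lemma br_Fun [simp]: "E \<in> algC \<Longrightarrow> br E \<in> EOb Fun"
  by (rule Fun_funI[OF bracket_fun])

lemma S_ob [simp]: "S \<in> EOb Fun \<Longrightarrow> c \<in> EOb C \<Longrightarrow> EFo S c \<in> algs"
  using enriched_fun.Fo[OF Fun_fun, of S c] by simp

lemma S_arr [simp]:
  assumes "S \<in> EOb Fun" "c \<in> EOb C" "d \<in> EOb C"
  shows "EFh S c d \<in> Arr V" "Dom V (EFh S c d) = EHom C d c" "Cod V (EFh S c d) = EHom AlgT (EFo S c) (EFo S d)"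
  using enriched_fun.Fh[OF Fun_fun, of S c d] assms by simp_all

lemma Fun_hom: "EHom Fun S S' = end_obj V' bO (nat_bifunctor V' bO bAlg (base_fun V' i (op_cat V C) S) (base_fun V' i (op_cat V C) S'))"
  by (simp add: big_functor_cat_def Let_def functor_cat_def)

lemma AlgC_hom: "EHom AlgC E E' = end_obj V' bT (nat_bifunctor V' bT bC (base_fun V' i T E) (base_fun V' i T E'))"
  by (simp add: big_Alg_def full_sub_def big_functor_cat_def Let_def functor_cat_def)

text \<open>Smallness of \<open>C\<close> and completeness of \<open>V'\<close> supply the end; over
  \<open>V\<close> itself no such end is assumed, which is why the functor category is enriched in
  \<open>V'\<close>.\<close>

lemma Fun_has_end:
  assumes "S \<in> EOb Fun" "S' \<in> EOb Fun"
  shows "has_end V' bO (nat_bifunctor V' bO bAlg (base_fun V' i (op_cat V C) S) (base_fun V' i (op_cat V C) S'))"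
proof -
  interpret fp: fun_pair V' bO bAlg "base_fun V' i (op_cat V C) S" "base_fun V' i (op_cat V C) S'"
    using assms by (simp add: fun_pair_def base_fun_fun Fun_fun)
  show ?thesis by (rule bO.small_has_end[OF complete U(1) _ fp.bif_nat]) (simp add: U)
qed

lemma Fun_nat_end:
  assumes "S \<in> EOb Fun" "S' \<in> EOb Fun"
  shows "nat_end V' bO bAlg (base_fun V' i (op_cat V C) S) (base_fun V' i (op_cat V C) S') (EHom Fun S S') (prF S S')"
  unfolding Fun_hom big_proj_def
  by (rule chosen_nat_end[OF base_fun_fun[OF Fun_fun] base_fun_fun[OF Fun_fun] Fun_has_end]) fact+

lemma AlgC_has_end:
  assumes "E \<in> algC" "E' \<in> algC"
  shows "has_end V' bT (nat_bifunctor V' bT bC (base_fun V' i T E) (base_fun V' i T E'))"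
proof -
  interpret fp: fun_pair V' bT bC "base_fun V' i T E" "base_fun V' i T E'"
    using assms by (simp add: fun_pair_def base_fun_fun algC_fun)
  show ?thesis by (rule bT.small_has_end[OF complete U(1) _ fp.bif_nat]) (simp add: U)
qed

lemma AlgC_nat_end:
  assumes "E \<in> algC" "E' \<in> algC"
  shows "nat_end V' bT bC (base_fun V' i T E) (base_fun V' i T E') (EHom AlgC E E') (prA E E')"
  unfolding AlgC_hom big_proj_def
  by (rule chosen_nat_end[OF base_fun_fun[OF algC_fun] base_fun_fun[OF algC_fun] AlgC_has_end]) fact+

lemma Fun_proj [simp]:
  assumes "S \<in> EOb Fun" "S' \<in> EOb Fun"
  shows "EHom Fun S S' \<in> Obj V'" "c \<in> EOb C \<Longrightarrow> prF S S' c \<in> Arr V'" "c \<in> EOb C \<Longrightarrow> Dom V' (prF S S' c) = EHom Fun S S'"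
    "c \<in> EOb C \<Longrightarrow> Cod V' (prF S S' c) = FOb i (EHom AlgT (EFo S c) (EFo S' c))"
proof -
  interpret n: nat_end V' bO bAlg "base_fun V' i (op_cat V C) S" "base_fun V' i (op_cat V C) S'" "EHom Fun S S'" "prF S S'"
    by (rule Fun_nat_end) fact+
  show "EHom Fun S S' \<in> Obj V'" "c \<in> EOb C \<Longrightarrow> prF S S' c \<in> Arr V'" "c \<in> EOb C \<Longrightarrow> Dom V' (prF S S' c) = EHom Fun S S'"
    "c \<in> EOb C \<Longrightarrow> Cod V' (prF S S' c) = FOb i (EHom AlgT (EFo S c) (EFo S' c))" by simp_all
qed

lemma AlgC_proj [simp]:
  assumes "E \<in> algC" "E' \<in> algC"
  shows "EHom AlgC E E' \<in> Obj V'" "K \<in> EOb T \<Longrightarrow> prA E E' K \<in> Arr V'" "K \<in> EOb T \<Longrightarrow> Dom V' (prA E E' K) = EHom AlgC E E'"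
    "K \<in> EOb T \<Longrightarrow> Cod V' (prA E E' K) = FOb i (EHom C (EFo E K) (EFo E' K))"
proof -
  interpret n: nat_end V' bT bC "base_fun V' i T E" "base_fun V' i T E'" "EHom AlgC E E'" "prA E E'"
    by (rule AlgC_nat_end) fact+
  show "EHom AlgC E E' \<in> Obj V'" "K \<in> EOb T \<Longrightarrow> prA E E' K \<in> Arr V'" "K \<in> EOb T \<Longrightarrow> Dom V' (prA E E' K) = EHom AlgC E E'"
    "K \<in> EOb T \<Longrightarrow> Cod V' (prA E E' K) = FOb i (EHom C (EFo E K) (EFo E' K))" by simp_all
qed

lemma AlgC_natural:
  assumes "E \<in> algC" "E' \<in> algC" "K \<in> EOb T" "M \<in> EOb T" "elt V' \<alpha>" "ty V' \<alpha> = FOb i (EHom T K M)"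
    "elt V' a" "ty V' a = EHom AlgC E E'" "dj \<alpha> a"
  shows "EComp bC (EFo E K) (EFo E' K) (EFo E' M) \<star> (FAr i (EFh E' K M) \<star> \<alpha> \<parallel> prA E E' K \<star> a) =
    EComp bC (EFo E K) (EFo E M) (EFo E' M) \<star> (prA E E' M \<star> a \<parallel> FAr i (EFh E K M) \<star> \<alpha>)"
proof -
  interpret n: nat_end V' bT bC "base_fun V' i T E" "base_fun V' i T E'" "EHom AlgC E E'" "prA E E'"
    by (rule AlgC_nat_end) fact+
  show ?thesis using n.natural[of K M \<alpha> a] assms by simp
qed

text \<open>Functoriality of \<open>S\<close> is about composition in the opposite category;
  \<open>base_op_comp\<close> reverses it, so that the composite can be taken in
  \<open>bC\<close>.\<close>

lemma S_comp_apl: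
  assumes S: "S \<in> EOb Fun" and *: "c \<in> EOb C" "d \<in> EOb C" "e \<in> EOb C" "K \<in> EOb T" "elt V' g" "elt V' f" "elt V' x"
    "ty V' g = FOb i (EHom C e d)" "ty V' f = FOb i (EHom C d c)" "ty V' x = FOb i (EFo (EFo S c) K)"
    "dj g f" "dj f g" "dj g x" "dj x g" "dj f x" "dj x f"
  shows "apl (EFo S d) (EFo S e) K (FAr i (EFh S d e) \<star> g) (apl (EFo S c) (EFo S d) K (FAr i (EFh S c d) \<star> f) x) =
    apl (EFo S c) (EFo S e) K (FAr i (EFh S c e) \<star> (EComp bC e d c \<star> (f \<parallel> g))) x"
proof -
  interpret b: enriched_fun V' bO bAlg "base_fun V' i (op_cat V C) S" by (rule base_fun_fun[OF Fun_fun[OF S]])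
  have "FAr i (EFh S c e) \<star> (EComp bC e d c \<star> (f \<parallel> g)) = FAr i (EFh S c e) \<star> (EComp bO c d e \<star> (g \<parallel> f))"
    using base_op_comp[OF C.enriched_category_axioms, of c d e g f] * by simp
  also have "\<dots> = EComp bAlg (EFo S c) (EFo S d) (EFo S e) \<star> (FAr i (EFh S d e) \<star> g \<parallel> FAr i (EFh S c d) \<star> f)"
    using b.Fh_comp[of c d e g f] * by simp
  finally show ?thesis using * S by (simp add: apl_comp del: base_simps(3))
qed

lemma S_id_apl:
  assumes S: "S \<in> EOb Fun" and *: "c \<in> EOb C" "K \<in> EOb T" "elt V' x" "ty V' x = FOb i (EFo (EFo S c) K)"
  shows "apl (EFo S c) (EFo S c) K (FAr i (EFh S c c) \<star> (EId bC c \<star> unit_elt V')) x = x"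
proof -
  interpret b: enriched_fun V' bO bAlg "base_fun V' i (op_cat V C) S" by (rule base_fun_fun[OF Fun_fun[OF S]])
  have "FAr i (EFh S c c) \<star> (EId bC c \<star> unit_elt V') = EId bAlg (EFo S c) \<star> unit_elt V'"
    using b.Fh_id[of c] * by simp
  then show ?thesis using * S by (simp add: apl_id del: base_simps(4))
qed

lemma Fun_natural_apl:
  assumes S: "S \<in> EOb Fun" "S' \<in> EOb Fun" and *: "c \<in> EOb C" "d \<in> EOb C" "K \<in> EOb T" "elt V' f" "elt V' t" "elt V' x"
    "ty V' f = FOb i (EHom C d c)" "ty V' t = EHom Fun S S'" "ty V' x = FOb i (EFo (EFo S c) K)"
    "dj f t" "dj t f" "dj f x" "dj x f" "dj t x" "dj x t"
  shows "apl (EFo S' c) (EFo S' d) K (FAr i (EFh S' c d) \<star> f) (apl (EFo S c) (EFo S' c) K (prF S S' c \<star> t) x) =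
    apl (EFo S d) (EFo S' d) K (prF S S' d \<star> t) (apl (EFo S c) (EFo S d) K (FAr i (EFh S c d) \<star> f) x)"
proof -
  interpret n: nat_end V' bO bAlg "base_fun V' i (op_cat V C) S" "base_fun V' i (op_cat V C) S'" "EHom Fun S S'" "prF S S'"
    by (rule Fun_nat_end) fact+
  have "EComp bAlg (EFo S c) (EFo S' c) (EFo S' d) \<star> (FAr i (EFh S' c d) \<star> f \<parallel> prF S S' c \<star> t) =
      EComp bAlg (EFo S c) (EFo S d) (EFo S' d) \<star> (prF S S' d \<star> t \<parallel> FAr i (EFh S c d) \<star> f)"
    using n.natural[of c d f t] * by simp
  from arg_cong[OF this, of "\<lambda>h. apl (EFo S c) (EFo S' d) K h x"] show ?thesis
    using * S by (simp add: apl_comp del: base_simps(3))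
qed

lemma irep:
  assumes "c \<in> EOb C" "b \<in> EOb C" "d \<in> EOb C" "elt V' g" "elt V' f" "ty V' g = FOb i (EHom C b d)" "ty V' f = FOb i (EHom C c b)" "dj g f"
  shows "FAr i (ev V (EHom C c b) (EHom C c d)) \<star> (FMul i (ihom V (EHom C c b) (EHom C c d)) (EHom C c b) \<star> (FAr i (EFh (rep V C c) b d) \<star> g \<parallel> f)) =
    EComp bC c b d \<star> (g \<parallel> f)"
  using assms by (simp add: rep_def)

text \<open>Together with \<open>bra_ac\<close> this reduces calculations with brackets to
  associativity and unit laws in \<open>bC\<close>: arrows of \<open>C\<close> precompose,
  operations of \<open>T\<close> postcompose.\<close>

lemma bra_apl:
  assumes E: "E \<in> algC" and *: "c \<in> EOb C" "d \<in> EOb C" "K \<in> EOb T" "elt V' f" "elt V' g"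
    "ty V' f = FOb i (EHom C d c)" "ty V' g = FOb i (EHom C c (EFo E K))" "dj f g" "dj g f"
  shows "apl (bra E c) (bra E d) K (FAr i (EFh (br E) c d) \<star> f) g = EComp bC d c (EFo E K) \<star> (g \<parallel> f)"
proof -
  note bh = bracket_hom(1)[OF E *(1,2), unfolded V.hom_iff]
  note pc = precomp(1)[OF E *(1-3), unfolded V.hom_iff]
  have "ev V (EHom C c (EFo E K)) (EHom C d (EFo E K)) \<cdot>\<^bsub>V\<^esub> ((Alg_proj V T (bra E c) (bra E d) K \<cdot>\<^bsub>V\<^esub> EFh (br E) c d) \<odot>\<^bsub>V\<^esub> Idt V (EHom C c (EFo E K))) =
      EComp C d c (EFo E K) \<cdot>\<^bsub>V\<^esub> braid V (EHom C d c) (EHom C c (EFo E K))"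
    by (rule V.ext2[where X="EHom C d c" and Y="EHom C c (EFo E K)" and Z="EHom C d (EFo E K)"])
      (use E * bh pc in \<open>auto simp: V.hom_iff bracket_hom(2) precomp(2)\<close>)
  from i_eq_act[OF this, of "FMul i (EHom C d c) (EHom C c (EFo E K)) \<star> (f \<parallel> g)"]
  show ?thesis using E * bh by (simp add: apl_def)
qed

lemma bra_ac:
  assumes E: "E \<in> algC" and *: "c \<in> EOb C" "K \<in> EOb T" "M \<in> EOb T" "elt V' \<alpha>" "elt V' f"
    "ty V' \<alpha> = FOb i (EHom T K M)" "ty V' f = FOb i (EHom C c (EFo E K))" "dj \<alpha> f"
  shows "ac (bra E c) K M \<alpha> f = EComp bC c (EFo E K) (EFo E M) \<star> (FAr i (EFh E K M) \<star> \<alpha> \<parallel> f)"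
proof -
  have t: "EFh (bra E c) K M \<in> Arr V" "Dom V (EFh (bra E c) K M) = EHom T K M"
    "Cod V (EFh (bra E c) K M) = ihom V (EHom C c (EFo E K)) (EHom C c (EFo E M))"
    using alg_arr[OF bracket_alg[OF E *(1)], of K M] E * by simp_all
  have "ev V (EHom C c (EFo E K)) (EHom C c (EFo E M)) \<cdot>\<^bsub>V\<^esub> (EFh (bra E c) K M \<odot>\<^bsub>V\<^esub> Idt V (EHom C c (EFo E K))) =
      EComp C c (EFo E K) (EFo E M) \<cdot>\<^bsub>V\<^esub> (EFh E K M \<odot>\<^bsub>V\<^esub> Idt V (EHom C c (EFo E K)))"
    by (rule V.ext2[where X="EHom T K M" and Y="EHom C c (EFo E K)" and Z="EHom C c (EFo E M)"])
      (use E * t in \<open>auto simp: V.hom_iff\<close>)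
  from i_eq_act[OF this, of "FMul i (EHom T K M) (EHom C c (EFo E K)) \<star> (\<alpha> \<parallel> f)"]
  show ?thesis using E * t by (simp add: ac_def)
qed

abbreviation "action E E' c \<equiv> bracket_action V V' i J T C E E' c"

lemma rep_arr [simp]:
  assumes "c \<in> EOb C" "b \<in> EOb C" "d \<in> EOb C"
  shows "EFh (rep V C c) b d \<in> Arr V" "Dom V (EFh (rep V C c) b d) = EHom C b d"
    "Cod V (EFh (rep V C c) b d) = ihom V (EHom C c b) (EHom C c d)"
  using assms by (simp_all add: rep_def)

text \<open>The description inside \<open>bracket_action\<close> has a unique solution by
  \<open>alg_lift\<close>: postcomposition with components natural in \<open>K\<close> respects the
  operations, by associativity and \<open>AlgC_natural\<close>.\<close>

lemma action_facts:
  assumes E: "E \<in> algC" "E' \<in> algC" and c: "c \<in> EOb C"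
  shows "action E E' c \<in> hom V' (EHom AlgC E E') (FOb i (EHom AlgT (bra E c) (bra E' c)))"
    "K \<in> EOb T \<Longrightarrow> FAr i (Alg_proj V T (bra E c) (bra E' c) K) \<cdot> action E E' c = FAr i (EFh (rep V C c) (EFo E K) (EFo E' K)) \<cdot> prA E E' K"
proof -
  have "\<exists>!h. h \<in> hom V' (EHom AlgC E E') (FOb i (EHom AlgT (bra E c) (bra E' c))) \<and>
     (\<forall>K\<in>EOb T. FAr i (Alg_proj V T (bra E c) (bra E' c) K) \<cdot> h = FAr i (EFh (rep V C c) (EFo E K) (EFo E' K)) \<cdot> prA E E' K)"
  proof (rule alg_lift)
    fix K M \<alpha> y x
    assume *: "K \<in> EOb T" "M \<in> EOb T" "elt V' \<alpha>" "elt V' y" "elt V' x"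
      "ty V' \<alpha> = FOb i (EHom T K M)" "ty V' y = EHom AlgC E E'" "ty V' x = FOb i (EFo (bra E c) K)"
      "dj \<alpha> y" "dj y \<alpha>" "dj \<alpha> x" "dj x \<alpha>" "dj y x" "dj x y"
    have 1: "EComp bC c (EFo E' K) (EFo E' M) \<star> (FAr i (EFh E' K M) \<star> \<alpha> \<parallel> EComp bC c (EFo E K) (EFo E' K) \<star> (prA E E' K \<star> y \<parallel> x)) =
        EComp bC c (EFo E K) (EFo E' M) \<star> (EComp bC (EFo E K) (EFo E' K) (EFo E' M) \<star> (FAr i (EFh E' K M) \<star> \<alpha> \<parallel> prA E E' K \<star> y) \<parallel> x)"
      using bC.comp_assoc[of c "EFo E K" "EFo E' K" "EFo E' M" "FAr i (EFh E' K M) \<star> \<alpha>" "prA E E' K \<star> y" x] E c *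
      by (simp del: base_simps(3))
    also have "\<dots> = EComp bC c (EFo E K) (EFo E' M) \<star> (EComp bC (EFo E K) (EFo E M) (EFo E' M) \<star> (prA E E' M \<star> y \<parallel> FAr i (EFh E K M) \<star> \<alpha>) \<parallel> x)"
      using AlgC_natural[OF E *(1,2,3,6,4,7,9)] by (simp only:)
    also have "\<dots> = EComp bC c (EFo E M) (EFo E' M) \<star> (prA E E' M \<star> y \<parallel> EComp bC c (EFo E K) (EFo E M) \<star> (FAr i (EFh E K M) \<star> \<alpha> \<parallel> x))"
      using bC.comp_assoc[of c "EFo E K" "EFo E M" "EFo E' M" "prA E E' M \<star> y" "FAr i (EFh E K M) \<star> \<alpha>" x] E c *
      by (simp del: base_simps(3))
    finally show "ac (bra E' c) K M \<alpha> (FAr i (ev V (EFo (bra E c) K) (EFo (bra E' c) K)) \<star> (FMul i (ihom V (EFo (bra E c) K) (EFo (bra E' c) K)) (EFo (bra E c) K) \<star>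
          ((FAr i (EFh (rep V C c) (EFo E K) (EFo E' K)) \<cdot> prA E E' K) \<star> y \<parallel> x))) =
       FAr i (ev V (EFo (bra E c) M) (EFo (bra E' c) M)) \<star> (FMul i (ihom V (EFo (bra E c) M) (EFo (bra E' c) M)) (EFo (bra E c) M) \<star>
          ((FAr i (EFh (rep V C c) (EFo E M) (EFo E' M)) \<cdot> prA E E' M) \<star> y \<parallel> ac (bra E c) K M \<alpha> x))"
      using E c * by (simp add: bra_ac irep del: base_simps(3))
  qed (use E c in \<open>auto simp: W.hom_iff\<close>)
  from theI'[OF this] show "action E E' c \<in> hom V' (EHom AlgC E E') (FOb i (EHom AlgT (bra E c) (bra E' c)))"
    "K \<in> EOb T \<Longrightarrow> FAr i (Alg_proj V T (bra E c) (bra E' c) K) \<cdot> action E E' c = FAr i (EFh (rep V C c) (EFo E K) (EFo E' K)) \<cdot> prA E E' K"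
    by (auto simp: bracket_action_def)
qed

lemma action_arr [simp]:
  assumes "E \<in> algC" "E' \<in> algC" "c \<in> EOb C"
  shows "action E E' c \<in> Arr V'" "Dom V' (action E E' c) = EHom AlgC E E'" "Cod V' (action E E' c) = FOb i (EHom AlgT (bra E c) (bra E' c))"
  using action_facts(1)[OF assms] by (auto simp: W.hom_iff)

lemma action_apl:
  assumes E: "E \<in> algC" "E' \<in> algC" and c: "c \<in> EOb C" and *: "K \<in> EOb T" "elt V' a" "elt V' f" "ty V' a = EHom AlgC E E'"
    "ty V' f = FOb i (EHom C c (EFo E K))" "dj a f"
  shows "apl (bra E c) (bra E' c) K (action E E' c \<star> a) f = EComp bC c (EFo E K) (EFo E' K) \<star> (prA E E' K \<star> a \<parallel> f)"
proof -
  have "FAr i (Alg_proj V T (bra E c) (bra E' c) K) \<star> (action E E' c \<star> a) = FAr i (EFh (rep V C c) (EFo E K) (EFo E' K)) \<star> (prA E E' K \<star> a)"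
    using arg_cong[OF action_facts(2)[OF E c *(1)], of "\<lambda>h. h \<star> a"] E c * by simp
  then show ?thesis using E c * irep[of c "EFo E K" "EFo E' K" "prA E E' K \<star> a" f]
    by (simp add: apl_def)
qed

abbreviation "BF \<equiv> bracket_functor V V' i J T C"

lemma BF_ob [simp]: "E \<in> algC \<Longrightarrow> EFo BF E = br E"
  by (simp add: bracket_functor_def)

text \<open>The actions have to be natural in \<open>c\<close>. This holds because postcomposition
  with a component from \<open>E\<close> to \<open>E'\<close> commutes with precomposition along
  \<open>d \<rightarrow> c\<close>.\<close>

lemma BF_hom:
  assumes E: "E \<in> algC" "E' \<in> algC"
  shows "EFh BF E E' \<in> Arr V'" "Dom V' (EFh BF E E') = EHom AlgC E E'" "Cod V' (EFh BF E E') = EHom Fun (br E) (br E')"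
    "c \<in> EOb C \<Longrightarrow> elt V' a \<Longrightarrow> ty V' a = EHom AlgC E E' \<Longrightarrow> prF (br E) (br E') c \<star> (EFh BF E E' \<star> a) = action E E' c \<star> a"
proof -
  interpret fp: fun_pair V' bO bAlg "base_fun V' i (op_cat V C) (br E)" "base_fun V' i (op_cat V C) (br E')"
    using E by (simp add: fun_pair_def base_fun_fun Fun_fun)
  have w: "wedge V' bO (nat_bifunctor V' bO bAlg (base_fun V' i (op_cat V C) (br E)) (base_fun V' i (op_cat V C) (br E'))) (EHom AlgC E E') (action E E')"
  proof (rule fp.wedge_natI)
    fix c d f a
    assume *: "c \<in> EOb bO" "d \<in> EOb bO" "elt V' f" "ty V' f = EHom bO c d" "elt V' a" "ty V' a = EHom AlgC E E'" "dj f a" "dj a f"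
    then have cd: "c \<in> EOb C" "d \<in> EOb C" and f: "ty V' f = FOb i (EHom C d c)" by simp_all
    have "EComp bAlg (bra E c) (bra E' c) (bra E' d) \<star> (FAr i (EFh (br E') c d) \<star> f \<parallel> action E E' c \<star> a) =
       EComp bAlg (bra E c) (bra E d) (bra E' d) \<star> (action E E' d \<star> a \<parallel> FAr i (EFh (br E) c d) \<star> f)"
    proof (rule apl_ext[of "bra E c" "bra E' d"])
      fix K x
      assume K: "K \<in> EOb T" and x: "elt V' x" "ty V' x = FOb i (EFo (bra E c) K)"
        "dj (EComp bAlg (bra E c) (bra E' c) (bra E' d) \<star> (FAr i (EFh (br E') c d) \<star> f \<parallel> action E E' c \<star> a)) x"
        "dj x (EComp bAlg (bra E c) (bra E' c) (bra E' d) \<star> (FAr i (EFh (br E') c d) \<star> f \<parallel> action E E' c \<star> a))"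
      have x': "ty V' x = FOb i (EHom C c (EFo E K))" "dj f x" "dj x f" "dj a x" "dj x a" using x E cd K by simp_all
      have sa: "EFh (br E') c d \<in> Arr V" "Dom V (EFh (br E') c d) = EHom C d c" "Cod V (EFh (br E') c d) = EHom AlgT (bra E' c) (bra E' d)"
        "EFh (br E) c d \<in> Arr V" "Dom V (EFh (br E) c d) = EHom C d c" "Cod V (EFh (br E) c d) = EHom AlgT (bra E c) (bra E d)"
        using S_arr[OF br_Fun[OF E(1)] cd] S_arr[OF br_Fun[OF E(2)] cd] cd by simp_all
      have l: "apl (bra E c) (bra E' d) K (EComp bAlg (bra E c) (bra E' c) (bra E' d) \<star> (FAr i (EFh (br E') c d) \<star> f \<parallel> action E E' c \<star> a)) x =
         EComp bC d c (EFo E' K) \<star> (EComp bC c (EFo E K) (EFo E' K) \<star> (prA E E' K \<star> a \<parallel> x) \<parallel> f)"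
        using E cd K x(1) x' * f sa by (simp add: apl_comp bra_apl action_apl del: base_simps(3))
      have r: "apl (bra E c) (bra E' d) K (EComp bAlg (bra E c) (bra E d) (bra E' d) \<star> (action E E' d \<star> a \<parallel> FAr i (EFh (br E) c d) \<star> f)) x =
         EComp bC d (EFo E K) (EFo E' K) \<star> (prA E E' K \<star> a \<parallel> EComp bC d c (EFo E K) \<star> (x \<parallel> f))"
        using E cd K x(1) x' * f sa by (simp add: apl_comp bra_apl action_apl del: base_simps(3))
      show "apl (bra E c) (bra E' d) K (EComp bAlg (bra E c) (bra E' c) (bra E' d) \<star> (FAr i (EFh (br E') c d) \<star> f \<parallel> action E E' c \<star> a)) x =
        apl (bra E c) (bra E' d) K (EComp bAlg (bra E c) (bra E d) (bra E' d) \<star> (action E E' d \<star> a \<parallel> FAr i (EFh (br E) c d) \<star> f)) x"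
        unfolding l r
        using bC.comp_assoc[of d c "EFo E K" "EFo E' K" "prA E E' K \<star> a" x f] E cd K x(1) x' * f
        by (simp del: base_simps(3))
    qed (use E cd * f S_arr[OF br_Fun[OF E(1)] cd] S_arr[OF br_Fun[OF E(2)] cd] in \<open>auto\<close>)
    then show "EComp bAlg (EFo (base_fun V' i (op_cat V C) (br E)) c) (EFo (base_fun V' i (op_cat V C) (br E')) c) (EFo (base_fun V' i (op_cat V C) (br E')) d) \<star>
        (EFh (base_fun V' i (op_cat V C) (br E')) c d \<star> f \<parallel> action E E' c \<star> a) =
      EComp bAlg (EFo (base_fun V' i (op_cat V C) (br E)) c) (EFo (base_fun V' i (op_cat V C) (br E)) d) (EFo (base_fun V' i (op_cat V C) (br E')) d) \<star>
        (action E E' d \<star> a \<parallel> EFh (base_fun V' i (op_cat V C) (br E)) c d \<star> f)"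
      using cd by (simp del: base_simps(3))
  qed (use E in \<open>auto simp: W.hom_iff\<close>)
  have e: "EFh BF E E' = end_lift V' bO (nat_bifunctor V' bO bAlg (base_fun V' i (op_cat V C) (br E)) (base_fun V' i (op_cat V C) (br E'))) (EHom AlgC E E') (action E E')"
    using E by (simp add: bracket_functor_def big_lift_def)
  note l = end_lift[OF bO.enriched_category_axioms fp.bif_nat Fun_has_end[OF br_Fun[OF E(1)] br_Fun[OF E(2)]] w AlgC_proj(1)[OF E]]
  show "EFh BF E E' \<in> Arr V'" "Dom V' (EFh BF E E') = EHom AlgC E E'" "Cod V' (EFh BF E E') = EHom Fun (br E) (br E')"
    unfolding e Fun_hom by (rule l)+
  show "prF (br E) (br E') c \<star> (EFh BF E E' \<star> a) = action E E' c \<star> a"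
    if "c \<in> EOb C" "elt V' a" "ty V' a = EHom AlgC E E'"
    unfolding e big_proj_def by (rule l(5)) (use that in simp_all)
qed

end

section \<open>The isomorphism\<close>

context correspondence
begin

section \<open>The end of sections in \<open>V'\<close>\<close>

abbreviation "bS S E \<equiv> big_section_bifunctor V V' i J T C S E"
abbreviation "Sec S E \<equiv> section_object V V' i J T C S E"
abbreviation "sp S E \<equiv> end_proj V' bT (bS S E)"
abbreviation "sob S E K \<equiv> EFo S (EFo E K)"

lemma sec_base: "S \<in> EOb Fun \<Longrightarrow> E \<in> algC \<Longrightarrow> base_bifun V V' i T (sec_left S E) (sec_right S E)"
  by (simp add: base_bifun_def base_change_axioms section_bifun Fun_fun)

lemma bS_eq: "bS S E = base_bifunctor V V' i T (bifunctor V (op_cat V T) T (sec_left S E) (sec_right S E))"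
  by (simp add: big_section_bifunctor_def section_bifunctor_def)

lemma sec_bif: "S \<in> EOb Fun \<Longrightarrow> E \<in> algC \<Longrightarrow> bif V' bT (bS S E)"
  unfolding bS_eq by (rule base_bifun.bF_bif[OF sec_base])

lemma sec_has_end:
  assumes "S \<in> EOb Fun" "E \<in> algC"
  shows "has_end V' bT (bS S E)"
  by (rule bT.small_has_end[OF complete U(1) _ sec_bif[OF assms]]) (simp add: U)

lemma sec_end: "S \<in> EOb Fun \<Longrightarrow> E \<in> algC \<Longrightarrow> an_end V' bT (bS S E) (Sec S E) (sp S E)"
  unfolding section_object_def by (rule chosen_end[OF bT.enriched_category_axioms sec_bif sec_has_end])

lemma bS_ob [simp]: "S \<in> EOb Fun \<Longrightarrow> E \<in> algC \<Longrightarrow> K \<in> EOb T \<Longrightarrow> M \<in> EOb T \<Longrightarrow> EFo (bS S E) (K, M) = FOb i (EFo (sob S E K) M)"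
  unfolding bS_eq by (rule base_bifun.bF_ob[OF sec_base])

lemma sec_proj [simp]:
  assumes "S \<in> EOb Fun" "E \<in> algC"
  shows "Sec S E \<in> Obj V'" "K \<in> EOb T \<Longrightarrow> sp S E K \<in> Arr V'" "K \<in> EOb T \<Longrightarrow> Dom V' (sp S E K) = Sec S E"
    "K \<in> EOb T \<Longrightarrow> Cod V' (sp S E K) = FOb i (EFo (sob S E K) K)"
proof -
  interpret e: an_end V' bT "bS S E" "Sec S E" "sp S E" by (rule sec_end) fact+
  show "Sec S E \<in> Obj V'" "K \<in> EOb T \<Longrightarrow> sp S E K \<in> Arr V'" "K \<in> EOb T \<Longrightarrow> Dom V' (sp S E K) = Sec S E"
    "K \<in> EOb T \<Longrightarrow> Cod V' (sp S E K) = FOb i (EFo (sob S E K) K)" using assms by simp_all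
qed

lemma sec_left_apl:
  assumes "S \<in> EOb Fun" "E \<in> algC" "K \<in> EOb T" "M \<in> EOb T" "elt V' \<alpha>" "ty V' \<alpha> = FOb i (EHom T K M)"
  shows "FAr i (ev V (EFo (sob S E M) M) (EFo (sob S E K) M)) \<star>
      (FMul i (ihom V (EFo (sob S E M) M) (EFo (sob S E K) M)) (EFo (sob S E M) M) \<star> (FAr i (EFh (sec_left S E M) M K) \<star> \<alpha> \<parallel> x)) =
    apl (sob S E M) (sob S E K) M (FAr i (EFh S (EFo E M) (EFo E K)) \<star> (FAr i (EFh E K M) \<star> \<alpha>)) x"
  using assms by (simp add: apl_def)

text \<open>For \<open>\<alpha> : K \<rightarrow> M\<close> the section condition lives in
  \<open>(S E K) M\<close>: the operation \<open>\<alpha>\<close> applied to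
  \<open>\<sigma> K\<close> in the algebra \<open>S E K\<close> must agree with
  \<open>\<sigma> M\<close> transported by \<open>S\<close> along \<open>E \<alpha>\<close>.\<close>

lemma sec_wedgeI:
  assumes SE: "S \<in> EOb Fun" "E \<in> algC"
    and ty: "\<And>K. K \<in> EOb T \<Longrightarrow> \<sigma> K \<in> hom V' Z (FOb i (EFo (sob S E K) K))"
    and eq: "\<And>K M \<alpha> z. K \<in> EOb T \<Longrightarrow> M \<in> EOb T \<Longrightarrow> elt V' \<alpha> \<Longrightarrow> ty V' \<alpha> = FOb i (EHom T K M) \<Longrightarrow> elt V' z \<Longrightarrow> ty V' z = Z \<Longrightarrow>
       dj \<alpha> z \<Longrightarrow> dj z \<alpha> \<Longrightarrow>
       ac (sob S E K) K M \<alpha> (\<sigma> K \<star> z) =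
       apl (sob S E M) (sob S E K) M (FAr i (EFh S (EFo E M) (EFo E K)) \<star> (FAr i (EFh E K M) \<star> \<alpha>)) (\<sigma> M \<star> z)"
  shows "wedge V' bT (bS S E) Z \<sigma>"
  unfolding bS_eq
  by (rule base_bifun.wedge_baseI[OF sec_base[OF SE] ty]) (use SE eq[unfolded ac_def] in \<open>simp_all only: sec_left_apl\<close>)

lemma sec_wedgeI2:
  assumes SE: "S \<in> EOb Fun" "E \<in> algC" and XY: "X \<in> Obj V'" "Y \<in> Obj V'"
    and ty: "\<And>K. K \<in> EOb T \<Longrightarrow> \<sigma> K \<in> hom V' (X \<otimes> Y) (FOb i (EFo (sob S E K) K))"
    and eq: "\<And>K M \<alpha> x y. K \<in> EOb T \<Longrightarrow> M \<in> EOb T \<Longrightarrow> elt V' \<alpha> \<Longrightarrow> ty V' \<alpha> = FOb i (EHom T K M) \<Longrightarrow>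
       elt V' x \<Longrightarrow> ty V' x = X \<Longrightarrow> elt V' y \<Longrightarrow> ty V' y = Y \<Longrightarrow>
       dj \<alpha> x \<Longrightarrow> dj x \<alpha> \<Longrightarrow> dj \<alpha> y \<Longrightarrow> dj y \<alpha> \<Longrightarrow> dj x y \<Longrightarrow> dj y x \<Longrightarrow>
       ac (sob S E K) K M \<alpha> (\<sigma> K \<star> (x \<parallel> y)) =
       apl (sob S E M) (sob S E K) M (FAr i (EFh S (EFo E M) (EFo E K)) \<star> (FAr i (EFh E K M) \<star> \<alpha>)) (\<sigma> M \<star> (x \<parallel> y))"
  shows "wedge V' bT (bS S E) (X \<otimes> Y) \<sigma>"
  unfolding bS_eq
  by (rule base_bifun.wedge_baseI2[OF sec_base[OF SE] XY ty]) (use SE eq[unfolded ac_def] in \<open>simp_all only: sec_left_apl\<close>)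

lemma sec_natural:
  assumes SE: "S \<in> EOb Fun" "E \<in> algC"
    and *: "K \<in> EOb T" "M \<in> EOb T" "elt V' \<alpha>" "ty V' \<alpha> = FOb i (EHom T K M)" "elt V' z" "ty V' z = Sec S E" "dj \<alpha> z"
  shows "ac (sob S E K) K M \<alpha> (sp S E K \<star> z) =
       apl (sob S E M) (sob S E K) M (FAr i (EFh S (EFo E M) (EFo E K)) \<star> (FAr i (EFh E K M) \<star> \<alpha>)) (sp S E M \<star> z)"
proof -
  interpret e: an_end V' bT "bS S E" "Sec S E" "sp S E" by (rule sec_end) fact+
  have w: "wedge V' bT (bS S E) (Sec S E) (sp S E)" using e.is_end by (simp add: is_end_def)
  show ?thesis
    using base_bifun.wedge_baseD[OF sec_base[OF SE] w[unfolded bS_eq] *, folded bS_eq] SE *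
    by (simp only: sec_left_apl ac_def)
qed

section \<open>The comparison of transformations with sections and its inverse\<close>

abbreviation "idc E K \<equiv> EId bC (EFo E K) \<star> unit_elt V'"

lemma idc [simp]:
  assumes "E \<in> algC" "K \<in> EOb T"
  shows "elt V' (idc E K)" "ty V' (idc E K) = FOb i (EHom C (EFo E K) (EFo E K))" "fst (idc E K) = {}"
    "dj (idc E K) x" "dj x (idc E K)"
  using assms by simp_all

text \<open>Evaluation of a transformation at the identity of \<open>E K\<close>. As an arrow it
  starts with an inverse right unitor, which makes room for the identity.\<close>

definition phi where
  "phi S E K = FAr i (ev V (EFo (bra E (EFo E K)) K) (EFo (sob S E K) K)) \<cdot>
     (FMul i (ihom V (EFo (bra E (EFo E K)) K) (EFo (sob S E K) K)) (EFo (bra E (EFo E K)) K) \<cdot>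
     (((FAr i (Alg_proj V T (bra E (EFo E K)) (sob S E K) K) \<cdot> prF (br E) S (EFo E K)) \<odot> EId bC (EFo E K)) \<cdot>
      inv_arr V' (run V' (EHom Fun (br E) S))))"

lemma phi [simp]:
  assumes "S \<in> EOb Fun" "E \<in> algC" "K \<in> EOb T"
  shows "phi S E K \<in> Arr V'" "Dom V' (phi S E K) = EHom Fun (br E) S" "Cod V' (phi S E K) = FOb i (EFo (sob S E K) K)"
    "elt V' t \<Longrightarrow> ty V' t = EHom Fun (br E) S \<Longrightarrow>
      phi S E K \<star> t = apl (bra E (EFo E K)) (sob S E K) K (prF (br E) S (EFo E K) \<star> t) (idc E K)"
  using assms by (simp_all add: phi_def apl_def)

text \<open>The Yoneda step: naturality along \<open>f\<close> moves \<open>f\<close> under the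
  transformation, where precomposing the identity with \<open>f\<close> gives \<open>f\<close>. It
  serves for the section condition, for invertibility and for naturality.\<close>

lemma apl_at_id:
  assumes SE: "S \<in> EOb Fun" "E \<in> algC" and *: "c \<in> EOb C" "K \<in> EOb T" "elt V' t" "ty V' t = EHom Fun (br E) S"
    "elt V' f" "ty V' f = FOb i (EHom C c (EFo E K))" "dj f t" "dj t f"
  shows "apl (sob S E K) (EFo S c) K (FAr i (EFh S (EFo E K) c) \<star> f)
      (apl (bra E (EFo E K)) (sob S E K) K (prF (br E) S (EFo E K) \<star> t) (idc E K)) =
    apl (bra E c) (EFo S c) K (prF (br E) S c \<star> t) f"
proof -
  have "apl (sob S E K) (EFo S c) K (FAr i (EFh S (EFo E K) c) \<star> f)
      (apl (bra E (EFo E K)) (sob S E K) K (prF (br E) S (EFo E K) \<star> t) (idc E K)) =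
    apl (bra E c) (EFo S c) K (prF (br E) S c \<star> t) (apl (bra E (EFo E K)) (bra E c) K (FAr i (EFh (br E) (EFo E K) c) \<star> f) (idc E K))"
    using Fun_natural_apl[OF br_Fun[OF SE(2)] SE(1), of "EFo E K" c K f t "idc E K"] SE * by (simp del: base_simps(3,4))
  also have "apl (bra E (EFo E K)) (bra E c) K (FAr i (EFh (br E) (EFo E K) c) \<star> f) (idc E K) = f"
    using bra_apl[OF SE(2), of "EFo E K" c K f "idc E K"] bC.comp_id(1)[of c "EFo E K" f] SE *
    by (simp del: base_simps(3,4))
  finally show ?thesis .
qed

text \<open>Both sides of the section condition are the value of the transformation at
  \<open>E \<alpha>\<close>: on the left because its component at \<open>E K\<close> is a
  homomorphism, on the right by \<open>apl_at_id\<close>.\<close>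

lemma phi_wedge:
  assumes SE: "S \<in> EOb Fun" "E \<in> algC"
  shows "wedge V' bT (bS S E) (EHom Fun (br E) S) (phi S E)"
proof (rule sec_wedgeI[OF SE])
  show "phi S E K \<in> hom V' (EHom Fun (br E) S) (FOb i (EFo (sob S E K) K))" if "K \<in> EOb T" for K
    using SE that by (simp add: W.hom_iff)
  fix K M \<alpha> t
  assume *: "K \<in> EOb T" "M \<in> EOb T" "elt V' \<alpha>" "ty V' \<alpha> = FOb i (EHom T K M)" "elt V' t" "ty V' t = EHom Fun (br E) S" "dj \<alpha> t" "dj t \<alpha>"
  let ?f = "FAr i (EFh E K M) \<star> \<alpha>"
  have f: "elt V' ?f" "ty V' ?f = FOb i (EHom C (EFo E K) (EFo E M))" "dj ?f t" "dj t ?f" using SE * by simp_all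
  have "ac (sob S E K) K M \<alpha> (apl (bra E (EFo E K)) (sob S E K) K (prF (br E) S (EFo E K) \<star> t) (idc E K)) =
      apl (bra E (EFo E K)) (sob S E K) M (prF (br E) S (EFo E K) \<star> t) (ac (bra E (EFo E K)) K M \<alpha> (idc E K))"
    using apl_nat[of "bra E (EFo E K)" "sob S E K" K M "prF (br E) S (EFo E K) \<star> t" \<alpha> "idc E K"] SE *
    by (simp del: base_simps(3,4))
  also have "ac (bra E (EFo E K)) K M \<alpha> (idc E K) = ?f"
    using bra_ac[OF SE(2), of "EFo E K" K M \<alpha> "idc E K"] bC.comp_id(2)[of "EFo E K" "EFo E M" ?f] SE *
    by (simp del: base_simps(3,4))
  also have "apl (bra E (EFo E K)) (sob S E K) M (prF (br E) S (EFo E K) \<star> t) ?f =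
     apl (sob S E M) (sob S E K) M (FAr i (EFh S (EFo E M) (EFo E K)) \<star> ?f)
       (apl (bra E (EFo E M)) (sob S E M) M (prF (br E) S (EFo E M) \<star> t) (idc E M))"
    using apl_at_id[OF SE, of "EFo E K" M t ?f] SE * f by (simp only: algC_ob)
  finally show "ac (sob S E K) K M \<alpha> (phi S E K \<star> t) =
       apl (sob S E M) (sob S E K) M (FAr i (EFh S (EFo E M) (EFo E K)) \<star> ?f) (phi S E M \<star> t)"
    using SE * by (simp only: phi)
qed

definition Phi where "Phi p = end_lift V' bT (bS (snd p) (fst p)) (EHom Fun (br (fst p)) (snd p)) (phi (snd p) (fst p))"

lemma Phi [simp]:
  assumes SE: "S \<in> EOb Fun" "E \<in> algC"
  shows "Phi (E, S) \<in> Arr V'" "Dom V' (Phi (E, S)) = EHom Fun (br E) S" "Cod V' (Phi (E, S)) = Sec S E"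
    "K \<in> EOb T \<Longrightarrow> elt V' t \<Longrightarrow> ty V' t = EHom Fun (br E) S \<Longrightarrow>
      sp S E K \<star> (Phi (E, S) \<star> t) = apl (bra E (EFo E K)) (sob S E K) K (prF (br E) S (EFo E K) \<star> t) (idc E K)"
proof -
  note l = end_lift[OF bT.enriched_category_axioms sec_bif[OF SE] sec_has_end[OF SE] phi_wedge[OF SE] Fun_proj(1)[OF br_Fun[OF SE(2)] SE(1)]]
  show "Phi (E, S) \<in> Arr V'" "Dom V' (Phi (E, S)) = EHom Fun (br E) S" "Cod V' (Phi (E, S)) = Sec S E"
    using l(1-3) by (simp_all add: Phi_def section_object_def)
  show "sp S E K \<star> (Phi (E, S) \<star> t) = apl (bra E (EFo E K)) (sob S E K) K (prF (br E) S (EFo E K) \<star> t) (idc E K)"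
    if "K \<in> EOb T" "elt V' t" "ty V' t = EHom Fun (br E) S"
    using l(5)[of K t] that SE by (simp add: Phi_def)
qed

text \<open>The curried form of the map that sends \<open>f\<close> to \<open>S f\<close> applied to
  the section at \<open>K\<close>. It is transposed in \<open>V'\<close> and then moved into the
  embedded internal hom by inverting the comparison map.\<close>

definition rho where
  "rho S E c K = inv_arr V' (ihom_comparison V V' i (EHom C c (EFo E K)) (EFo (EFo S c) K)) \<cdot>
     curry_arr V' (Sec S E) (FOb i (EHom C c (EFo E K)))
      (FAr i (ev V (EFo (sob S E K) K) (EFo (EFo S c) K)) \<cdot>
       (FMul i (ihom V (EFo (sob S E K) K) (EFo (EFo S c) K)) (EFo (sob S E K) K) \<cdot>
        (((FAr i (Alg_proj V T (sob S E K) (EFo S c) K) \<cdot> FAr i (EFh S (EFo E K) c)) \<odot> sp S E K) \<cdot>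
         braid V' (Sec S E) (FOb i (EHom C c (EFo E K))))))"

lemma rho:
  assumes SE: "S \<in> EOb Fun" "E \<in> algC" and c: "c \<in> EOb C" "K \<in> EOb T"
  shows "rho S E c K \<in> Arr V'" "Dom V' (rho S E c K) = Sec S E" "Cod V' (rho S E c K) = FOb i (ihom V (EHom C c (EFo E K)) (EFo (EFo S c) K))"
    "elt V' s \<Longrightarrow> ty V' s = Sec S E \<Longrightarrow> elt V' f \<Longrightarrow> ty V' f = FOb i (EHom C c (EFo E K)) \<Longrightarrow> dj s f \<Longrightarrow> dj f s \<Longrightarrow>
      FAr i (ev V (EHom C c (EFo E K)) (EFo (EFo S c) K)) \<star> (FMul i (ihom V (EHom C c (EFo E K)) (EFo (EFo S c) K)) (EHom C c (EFo E K)) \<star> (rho S E c K \<star> s \<parallel> f)) =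
      apl (sob S E K) (EFo S c) K (FAr i (EFh S (EFo E K) c) \<star> f) (sp S E K \<star> s)"
proof -
  show t: "rho S E c K \<in> Arr V'" "Dom V' (rho S E c K) = Sec S E" "Cod V' (rho S E c K) = FOb i (ihom V (EHom C c (EFo E K)) (EFo (EFo S c) K))"
    using SE c by (simp_all add: rho_def)
  assume *: "elt V' s" "ty V' s = Sec S E" "elt V' f" "ty V' f = FOb i (EHom C c (EFo E K))" "dj s f" "dj f s"
  have "ev V' (FOb i (EHom C c (EFo E K))) (FOb i (EFo (EFo S c) K)) \<star>
      (ihom_comparison V V' i (EHom C c (EFo E K)) (EFo (EFo S c) K) \<star> (rho S E c K \<star> s) \<parallel> f) =
      apl (sob S E K) (EFo S c) K (FAr i (EFh S (EFo E K) c) \<star> f) (sp S E K \<star> s)"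
    using SE c * unfolding rho_def apl_def by (simp del: comparison(5))
  then show "FAr i (ev V (EHom C c (EFo E K)) (EFo (EFo S c) K)) \<star> (FMul i (ihom V (EHom C c (EFo E K)) (EFo (EFo S c) K)) (EHom C c (EFo E K)) \<star> (rho S E c K \<star> s \<parallel> f)) =
      apl (sob S E K) (EFo S c) K (FAr i (EFh S (EFo E K) c) \<star> f) (sp S E K \<star> s)"
    using comparison(5)[of "EHom C c (EFo E K)" "EFo (EFo S c) K" "rho S E c K \<star> s" f] SE c * t by simp
qed

text \<open>The components \<open>rho\<close> form a homomorphism: an operation passes through
  \<open>S f\<close> since that is one, the section condition moves it into an arrow of
  \<open>C\<close>, and functoriality of \<open>S\<close> composes that arrow with
  \<open>f\<close>.\<close>

lemma psi_ex:
  assumes SE: "S \<in> EOb Fun" "E \<in> algC" and c: "c \<in> EOb C"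
  shows "\<exists>h. h \<in> hom V' (Sec S E) (FOb i (EHom AlgT (bra E c) (EFo S c))) \<and>
     (\<forall>K\<in>EOb T. FAr i (Alg_proj V T (bra E c) (EFo S c) K) \<cdot> h = rho S E c K)"
proof (rule ex1_implies_ex[OF alg_lift])
  fix K M \<alpha> s f
  assume *: "K \<in> EOb T" "M \<in> EOb T" "elt V' \<alpha>" "elt V' s" "elt V' f"
    "ty V' \<alpha> = FOb i (EHom T K M)" "ty V' s = Sec S E" "ty V' f = FOb i (EFo (bra E c) K)"
    "dj \<alpha> s" "dj s \<alpha>" "dj \<alpha> f" "dj f \<alpha>" "dj s f" "dj f s"
  have f: "ty V' f = FOb i (EHom C c (EFo E K))" using * SE c by simp
  let ?a = "FAr i (EFh E K M) \<star> \<alpha>" and ?f = "EComp bC c (EFo E K) (EFo E M) \<star> (FAr i (EFh E K M) \<star> \<alpha> \<parallel> f)"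
  have a: "elt V' ?a" "ty V' ?a = FOb i (EHom C (EFo E K) (EFo E M))" "elt V' ?f" "ty V' ?f = FOb i (EHom C c (EFo E M))"
    using SE c * f by simp_all
  have "ac (EFo S c) K M \<alpha> (apl (sob S E K) (EFo S c) K (FAr i (EFh S (EFo E K) c) \<star> f) (sp S E K \<star> s)) =
      apl (sob S E K) (EFo S c) M (FAr i (EFh S (EFo E K) c) \<star> f) (ac (sob S E K) K M \<alpha> (sp S E K \<star> s))"
    by (rule apl_nat) (use SE c * f in simp_all)
  also have "\<dots> = apl (sob S E K) (EFo S c) M (FAr i (EFh S (EFo E K) c) \<star> f)
      (apl (sob S E M) (sob S E K) M (FAr i (EFh S (EFo E M) (EFo E K)) \<star> ?a) (sp S E M \<star> s))"
    by (subst sec_natural[OF SE]) (use * in simp_all)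
  also have "\<dots> = apl (sob S E M) (EFo S c) M (FAr i (EFh S (EFo E M) c) \<star> ?f) (sp S E M \<star> s)"
    by (rule S_comp_apl[OF SE(1)]) (use SE c * f a in simp_all)
  finally show "ac (EFo S c) K M \<alpha> (FAr i (ev V (EFo (bra E c) K) (EFo (EFo S c) K)) \<star> (FMul i (ihom V (EFo (bra E c) K) (EFo (EFo S c) K)) (EFo (bra E c) K) \<star> (rho S E c K \<star> s \<parallel> f))) =
      FAr i (ev V (EFo (bra E c) M) (EFo (EFo S c) M)) \<star> (FMul i (ihom V (EFo (bra E c) M) (EFo (EFo S c) M)) (EFo (bra E c) M) \<star> (rho S E c M \<star> s \<parallel> ac (bra E c) K M \<alpha> f))"
    using SE c * f a by (simp add: rho bra_ac del: base_simps(3))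
qed (use SE c rho in \<open>auto simp: W.hom_iff\<close>)

definition psi where
  "psi S E c = (SOME h. h \<in> hom V' (Sec S E) (FOb i (EHom AlgT (bra E c) (EFo S c))) \<and>
     (\<forall>K\<in>EOb T. FAr i (Alg_proj V T (bra E c) (EFo S c) K) \<cdot> h = rho S E c K))"

lemma psi:
  assumes SE: "S \<in> EOb Fun" "E \<in> algC" and c: "c \<in> EOb C"
  shows "psi S E c \<in> Arr V'" "Dom V' (psi S E c) = Sec S E" "Cod V' (psi S E c) = FOb i (EHom AlgT (bra E c) (EFo S c))"
    "K \<in> EOb T \<Longrightarrow> elt V' s \<Longrightarrow> ty V' s = Sec S E \<Longrightarrow> elt V' f \<Longrightarrow> ty V' f = FOb i (EHom C c (EFo E K)) \<Longrightarrow> dj s f \<Longrightarrow> dj f s \<Longrightarrow>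
      apl (bra E c) (EFo S c) K (psi S E c \<star> s) f = apl (sob S E K) (EFo S c) K (FAr i (EFh S (EFo E K) c) \<star> f) (sp S E K \<star> s)"
proof -
  note p = someI_ex[OF psi_ex[OF assms], folded psi_def]
  then show t: "psi S E c \<in> Arr V'" "Dom V' (psi S E c) = Sec S E" "Cod V' (psi S E c) = FOb i (EHom AlgT (bra E c) (EFo S c))"
    by (auto simp: W.hom_iff)
  assume *: "K \<in> EOb T" "elt V' s" "ty V' s = Sec S E" "elt V' f" "ty V' f = FOb i (EHom C c (EFo E K))" "dj s f" "dj f s"
  have e: "FAr i (Alg_proj V T (bra E c) (EFo S c) K) \<cdot> psi S E c = rho S E c K" using p *(1) by blast
  have "FAr i (Alg_proj V T (bra E c) (EFo S c) K) \<star> (psi S E c \<star> s) = rho S E c K \<star> s"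
    using arg_cong[OF e, of "\<lambda>h. h \<star> s"] * t SE c by simp
  then show "apl (bra E c) (EFo S c) K (psi S E c \<star> s) f = apl (sob S E K) (EFo S c) K (FAr i (EFh S (EFo E K) c) \<star> f) (sp S E K \<star> s)"
    using rho(4)[OF SE c *(1-5)] * SE c by (simp add: apl_def[of "bra E c"])
qed

text \<open>Naturality in \<open>c\<close> is functoriality of \<open>S\<close> again: precomposing
  \<open>f\<close> with \<open>g\<close> amounts to applying \<open>S g\<close> after
  \<open>S f\<close>.\<close>

lemma psi_wedge:
  assumes SE: "S \<in> EOb Fun" "E \<in> algC"
  shows "wedge V' bO (nat_bifunctor V' bO bAlg (base_fun V' i (op_cat V C) (br E)) (base_fun V' i (op_cat V C) S)) (Sec S E) (psi S E)"
proof -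
  interpret fp: fun_pair V' bO bAlg "base_fun V' i (op_cat V C) (br E)" "base_fun V' i (op_cat V C) S"
    using SE by (simp add: fun_pair_def base_fun_fun Fun_fun)
  show ?thesis
  proof (rule fp.wedge_natI)
    fix c d g s
    assume *: "c \<in> EOb bO" "d \<in> EOb bO" "elt V' g" "ty V' g = EHom bO c d" "elt V' s" "ty V' s = Sec S E" "dj g s" "dj s g"
    then have cd: "c \<in> EOb C" "d \<in> EOb C" and g: "ty V' g = FOb i (EHom C d c)" by simp_all
    have sa: "EFh (br E) c d \<in> Arr V" "Dom V (EFh (br E) c d) = EHom C d c" "Cod V (EFh (br E) c d) = EHom AlgT (bra E c) (bra E d)"
      using S_arr[OF br_Fun[OF SE(2)] cd] cd by simp_all
    have "EComp bAlg (bra E c) (EFo S c) (EFo S d) \<star> (FAr i (EFh S c d) \<star> g \<parallel> psi S E c \<star> s) =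
       EComp bAlg (bra E c) (bra E d) (EFo S d) \<star> (psi S E d \<star> s \<parallel> FAr i (EFh (br E) c d) \<star> g)"
    proof (rule apl_ext[of "bra E c" "EFo S d"])
      fix K f
      assume K: "K \<in> EOb T" and x: "elt V' f" "ty V' f = FOb i (EFo (bra E c) K)"
        "dj (EComp bAlg (bra E c) (EFo S c) (EFo S d) \<star> (FAr i (EFh S c d) \<star> g \<parallel> psi S E c \<star> s)) f"
        "dj f (EComp bAlg (bra E c) (EFo S c) (EFo S d) \<star> (FAr i (EFh S c d) \<star> g \<parallel> psi S E c \<star> s))"
      have f: "ty V' f = FOb i (EHom C c (EFo E K))" "dj g f" "dj f g" "dj s f" "dj f s" using x SE cd K by simp_all
      let ?h = "EComp bC d c (EFo E K) \<star> (f \<parallel> g)"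
      have h: "elt V' ?h" "ty V' ?h = FOb i (EHom C d (EFo E K))" using SE cd K * g x f by simp_all
      have "apl (bra E c) (EFo S d) K (EComp bAlg (bra E c) (EFo S c) (EFo S d) \<star> (FAr i (EFh S c d) \<star> g \<parallel> psi S E c \<star> s)) f =
          apl (EFo S c) (EFo S d) K (FAr i (EFh S c d) \<star> g) (apl (bra E c) (EFo S c) K (psi S E c \<star> s) f)"
        by (rule apl_comp) (use SE cd K * g x f psi in simp_all)
      also have "\<dots> = apl (EFo S c) (EFo S d) K (FAr i (EFh S c d) \<star> g) (apl (sob S E K) (EFo S c) K (FAr i (EFh S (EFo E K) c) \<star> f) (sp S E K \<star> s))"
        by (subst psi(4)) (use SE cd K * x f in simp_all)
      also have "\<dots> = apl (sob S E K) (EFo S d) K (FAr i (EFh S (EFo E K) d) \<star> ?h) (sp S E K \<star> s)"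
        by (rule S_comp_apl[OF SE(1)]) (use SE cd K * g x f in simp_all)
      also have "\<dots> = apl (bra E d) (EFo S d) K (psi S E d \<star> s) ?h"
        by (rule psi(4)[symmetric]) (use SE cd K * x f h in simp_all)
      also have "\<dots> = apl (bra E d) (EFo S d) K (psi S E d \<star> s) (apl (bra E c) (bra E d) K (FAr i (EFh (br E) c d) \<star> g) f)"
        by (subst bra_apl) (use SE cd K * g x f in simp_all)
      also have "\<dots> = apl (bra E c) (EFo S d) K (EComp bAlg (bra E c) (bra E d) (EFo S d) \<star> (psi S E d \<star> s \<parallel> FAr i (EFh (br E) c d) \<star> g)) f"
        by (rule apl_comp[symmetric]) (use SE cd K * g x f psi sa in simp_all)
      finally show "apl (bra E c) (EFo S d) K (EComp bAlg (bra E c) (EFo S c) (EFo S d) \<star> (FAr i (EFh S c d) \<star> g \<parallel> psi S E c \<star> s)) f =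
        apl (bra E c) (EFo S d) K (EComp bAlg (bra E c) (bra E d) (EFo S d) \<star> (psi S E d \<star> s \<parallel> FAr i (EFh (br E) c d) \<star> g)) f" .
    qed (use SE cd * g psi sa in auto)
    then show "EComp bAlg (EFo (base_fun V' i (op_cat V C) (br E)) c) (EFo (base_fun V' i (op_cat V C) S) c) (EFo (base_fun V' i (op_cat V C) S) d) \<star>
        (EFh (base_fun V' i (op_cat V C) S) c d \<star> g \<parallel> psi S E c \<star> s) =
      EComp bAlg (EFo (base_fun V' i (op_cat V C) (br E)) c) (EFo (base_fun V' i (op_cat V C) (br E)) d) (EFo (base_fun V' i (op_cat V C) S) d) \<star>
        (psi S E d \<star> s \<parallel> EFh (base_fun V' i (op_cat V C) (br E)) c d \<star> g)"
      using cd by (simp del: base_simps(3))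
  qed (use SE psi in \<open>auto simp: W.hom_iff\<close>)
qed

text \<open>The inverse \<open>P\<close> glues the arrows \<open>psi S E c\<close> along the end
  over \<open>C\<close>. One round trip is \<open>apl_at_id\<close>, the other is preservation of
  identities by \<open>S\<close>.\<close>

lemma Phi_iso:
  assumes SE: "S \<in> EOb Fun" "E \<in> algC"
  shows "is_iso V' (Phi (E, S))"
proof -
  interpret n: nat_end V' bO bAlg "base_fun V' i (op_cat V C) (br E)" "base_fun V' i (op_cat V C) S" "EHom Fun (br E) S" "prF (br E) S"
    by (rule Fun_nat_end[OF br_Fun[OF SE(2)] SE(1)])
  interpret e: an_end V' bT "bS S E" "Sec S E" "sp S E" by (rule sec_end[OF SE])
  obtain P where P: "P \<in> hom V' (Sec S E) (EHom Fun (br E) S)" and P': "\<And>c. c \<in> EOb C \<Longrightarrow> prF (br E) S c \<cdot> P = psi S E c"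
    using n.E.end_lift_ex[OF psi_wedge[OF SE]] SE by auto
  have Pt: "P \<in> Arr V'" "Dom V' P = Sec S E" "Cod V' P = EHom Fun (br E) S" using P by (auto simp: W.hom_iff)
  have Pp: "prF (br E) S c \<star> (P \<star> s) = psi S E c \<star> s" if "c \<in> EOb C" "elt V' s" "ty V' s = Sec S E" for c s
    using arg_cong[OF P'[OF that(1)], of "\<lambda>h. h \<star> s"] that SE Pt by simp
  show ?thesis
  proof (rule W.is_isoI[where g=P])
    show "P \<cdot> Phi (E, S) = Idt V' (Dom V' (Phi (E, S)))"
    proof (rule W.ext1[where X="EHom Fun (br E) S" and Y="EHom Fun (br E) S"])
      fix t assume t: "elt V' t" "ty V' t = EHom Fun (br E) S"
      have "P \<star> (Phi (E, S) \<star> t) = t"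
      proof (rule n.E.elt_end_ext)
        fix c assume "c \<in> EOb bO"
        then have c: "c \<in> EOb C" by simp
        have "psi S E c \<star> (Phi (E, S) \<star> t) = prF (br E) S c \<star> t"
        proof (rule apl_ext[of "bra E c" "EFo S c"])
          fix K f assume K: "K \<in> EOb T" and f: "elt V' f" "ty V' f = FOb i (EFo (bra E c) K)"
            "dj (psi S E c \<star> (Phi (E, S) \<star> t)) f" "dj f (psi S E c \<star> (Phi (E, S) \<star> t))"
          have "apl (bra E c) (EFo S c) K (psi S E c \<star> (Phi (E, S) \<star> t)) f =
              apl (sob S E K) (EFo S c) K (FAr i (EFh S (EFo E K) c) \<star> f) (sp S E K \<star> (Phi (E, S) \<star> t))"
            by (rule psi(4)) (use SE c K f t in simp_all)
          also have "\<dots> = apl (bra E c) (EFo S c) K (prF (br E) S c \<star> t) f"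
            using SE c K f t apl_at_id[OF SE, of c K t f] by (simp only: Phi) simp
          finally show "apl (bra E c) (EFo S c) K (psi S E c \<star> (Phi (E, S) \<star> t)) f = apl (bra E c) (EFo S c) K (prF (br E) S c \<star> t) f" .
        qed (use SE c t psi in auto)
        then show "prF (br E) S c \<star> (P \<star> (Phi (E, S) \<star> t)) = prF (br E) S c \<star> t"
          using Pp[OF c, of "Phi (E, S) \<star> t"] SE t by simp
      qed (use SE t Pt in auto)
      then show "(P \<cdot> Phi (E, S)) \<star> t = Idt V' (Dom V' (Phi (E, S))) \<star> t" using SE t Pt by simp
    qed (use SE Pt in \<open>auto simp: W.hom_iff\<close>)
    show "Phi (E, S) \<cdot> P = Idt V' (Cod V' (Phi (E, S)))"
    proof (rule W.ext1[where X="Sec S E" and Y="Sec S E"])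
      fix s assume s: "elt V' s" "ty V' s = Sec S E"
      have "Phi (E, S) \<star> (P \<star> s) = s"
      proof (rule e.elt_end_ext)
        fix K assume "K \<in> EOb bT"
        then have K: "K \<in> EOb T" by simp
        have "sp S E K \<star> (Phi (E, S) \<star> (P \<star> s)) = apl (bra E (EFo E K)) (sob S E K) K (prF (br E) S (EFo E K) \<star> (P \<star> s)) (idc E K)"
          by (rule Phi(4)) (use SE K s Pt in simp_all)
        also have "\<dots> = apl (bra E (EFo E K)) (sob S E K) K (psi S E (EFo E K) \<star> s) (idc E K)"
          using Pp[of "EFo E K" s] SE K s by simp
        also have "\<dots> = apl (sob S E K) (sob S E K) K (FAr i (EFh S (EFo E K) (EFo E K)) \<star> idc E K) (sp S E K \<star> s)"
          by (rule psi(4)) (use SE K s in simp_all)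
        also have "\<dots> = sp S E K \<star> s"
          by (rule S_id_apl) (use SE K s in simp_all)
        finally show "sp S E K \<star> (Phi (E, S) \<star> (P \<star> s)) = sp S E K \<star> s" .
      qed (use SE s Pt in auto)
      then show "(Phi (E, S) \<cdot> P) \<star> s = Idt V' (Cod V' (Phi (E, S))) \<star> s" using SE s Pt by simp
    qed (use SE Pt in \<open>auto simp: W.hom_iff\<close>)
  qed (use SE Pt in auto)
qed


section \<open>Actions on both sides and naturality in the algebra and the functor\<close>

lemma Fun_comp [simp]:
  assumes F: "F \<in> EOb Fun" "G \<in> EOb Fun" "H \<in> EOb Fun"
  shows "EComp Fun F G H \<in> Arr V'" "Dom V' (EComp Fun F G H) = EHom Fun G H \<otimes> EHom Fun F G"
    "Cod V' (EComp Fun F G H) = EHom Fun F H"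
    "c \<in> EOb C \<Longrightarrow> elt V' t \<Longrightarrow> elt V' s \<Longrightarrow> dj t s \<Longrightarrow> ty V' t = EHom Fun G H \<Longrightarrow> ty V' s = EHom Fun F G \<Longrightarrow>
      prF F H c \<star> (EComp Fun F G H \<star> (t \<parallel> s)) =
      EComp bAlg (EFo F c) (EFo G c) (EFo H c) \<star> (prF G H c \<star> t \<parallel> prF F G c \<star> s)"
proof -
  note f = functor_cat_comp[OF base_fun_fun[OF Fun_fun] base_fun_fun[OF Fun_fun] base_fun_fun[OF Fun_fun]
      Fun_has_end Fun_has_end Fun_has_end, OF F F(1,2,2,3,1,3)]
  have e: "EComp Fun F G H = EComp (functor_cat V' bO bAlg) (base_fun V' i (op_cat V C) F) (base_fun V' i (op_cat V C) G) (base_fun V' i (op_cat V C) H)"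
    by (simp add: big_functor_cat_def Let_def)
  show "EComp Fun F G H \<in> Arr V'" "Dom V' (EComp Fun F G H) = EHom Fun G H \<otimes> EHom Fun F G"
    "Cod V' (EComp Fun F G H) = EHom Fun F H"
    using f(1) unfolding e Fun_hom by (simp_all add: W.hom_iff)
  show "prF F H c \<star> (EComp Fun F G H \<star> (t \<parallel> s)) =
      EComp bAlg (EFo F c) (EFo G c) (EFo H c) \<star> (prF G H c \<star> t \<parallel> prF F G c \<star> s)"
    if "c \<in> EOb C" "elt V' t" "elt V' s" "dj t s" "ty V' t = EHom Fun G H" "ty V' s = EHom Fun F G"
    using f(2)[of c t s] that unfolding e Fun_hom big_proj_def by (simp del: base_simps(3))
qed

lemma Fun_comp_apl:
  assumes F: "F \<in> EOb Fun" "G \<in> EOb Fun" "H \<in> EOb Fun" and *: "c \<in> EOb C" "K \<in> EOb T" "elt V' t" "elt V' s" "elt V' x"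
    "ty V' t = EHom Fun G H" "ty V' s = EHom Fun F G" "ty V' x = FOb i (EFo (EFo F c) K)"
    "dj t s" "dj s t" "dj t x" "dj x t" "dj s x" "dj x s"
  shows "apl (EFo F c) (EFo H c) K (prF F H c \<star> (EComp Fun F G H \<star> (t \<parallel> s))) x =
    apl (EFo G c) (EFo H c) K (prF G H c \<star> t) (apl (EFo F c) (EFo G c) K (prF F G c \<star> s) x)"
  using F * by (simp add: apl_comp del: base_simps(3))

abbreviation "TF \<equiv> transformations_functor V V' i J T C"
abbreviation "SF \<equiv> sections_functor V V' i J T C"

lemma TF_ob [simp]: "E \<in> algC \<Longrightarrow> S \<in> EOb Fun \<Longrightarrow> EFo TF (E, S) = EHom Fun (br E) S"
  by (simp add: transformations_functor_def Let_def hom_bifunctor_def id_fun_def rep_def)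

lemma TF_hom:
  assumes E: "E \<in> algC" "E' \<in> algC" and S: "S \<in> EOb Fun" "S' \<in> EOb Fun"
  shows "EFh TF (E, S) (E', S') \<in> hom V' (EHom AlgC E' E \<otimes> EHom Fun S S') (ihom V' (EHom Fun (br E) S) (EHom Fun (br E') S'))"
    "elt V' a \<Longrightarrow> elt V' s \<Longrightarrow> elt V' t \<Longrightarrow> ty V' a = EHom AlgC E' E \<Longrightarrow> ty V' s = EHom Fun S S' \<Longrightarrow> ty V' t = EHom Fun (br E) S \<Longrightarrow>
      dj a s \<Longrightarrow> dj s a \<Longrightarrow> dj a t \<Longrightarrow> dj t a \<Longrightarrow> dj s t \<Longrightarrow> dj t s \<Longrightarrow>
      ev V' (EHom Fun (br E) S) (EHom Fun (br E') S') \<star> (EFh TF (E, S) (E', S') \<star> (a \<parallel> s) \<parallel> t) =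
      EComp Fun (br E') (br E) S' \<star> (EComp Fun (br E) S S' \<star> (s \<parallel> t) \<parallel> EFh BF E' E \<star> a)"
proof -
  note b = BF_hom[OF E(2,1)]
  have e: "EFh TF (E, S) (E', S') = EComp (self V') (EHom Fun (br E) S) (EHom Fun (br E) S') (EHom Fun (br E') S') \<cdot>
    ((curry_arr V' (EHom Fun (br E') (br E)) (EHom Fun (br E) S') (EComp Fun (br E') (br E) S' \<cdot> braid V' (EHom Fun (br E') (br E)) (EHom Fun (br E) S')) \<cdot> EFh BF E' E) \<odot>
     (curry_arr V' (EHom Fun S S') (EHom Fun (br E) S) (EComp Fun (br E) S S') \<cdot> Idt V' (EHom Fun S S')))"
    using E S by (simp add: transformations_functor_def Let_def hom_bifunctor_def id_fun_def rep_def op_cat_def[of V'] comp_fun_def op_fun_def)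
  show "EFh TF (E, S) (E', S') \<in> hom V' (EHom AlgC E' E \<otimes> EHom Fun S S') (ihom V' (EHom Fun (br E) S) (EHom Fun (br E') S'))"
    using E S b(1-3) unfolding e by (simp add: W.hom_iff)
  show "ev V' (EHom Fun (br E) S) (EHom Fun (br E') S') \<star> (EFh TF (E, S) (E', S') \<star> (a \<parallel> s) \<parallel> t) =
      EComp Fun (br E') (br E) S' \<star> (EComp Fun (br E) S S' \<star> (s \<parallel> t) \<parallel> EFh BF E' E \<star> a)"
    if "elt V' a" "elt V' s" "elt V' t" "ty V' a = EHom AlgC E' E" "ty V' s = EHom Fun S S'" "ty V' t = EHom Fun (br E) S"
      "dj a s" "dj s a" "dj a t" "dj t a" "dj s t" "dj t s"
    using E S b(1-3) that unfolding e by simp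
qed

text \<open>Replaces the two nested compositions in \<open>Fun\<close> by successive application:
  \<open>f\<close> is postcomposed with the component of \<open>a\<close>, then \<open>t\<close> and
  finally \<open>s\<close> are applied.\<close>

lemma TF_apl:
  assumes E: "E \<in> algC" "E' \<in> algC" and S: "S \<in> EOb Fun" "S' \<in> EOb Fun" and *: "c \<in> EOb C" "K \<in> EOb T"
    "elt V' a" "elt V' s" "elt V' t" "elt V' f" "ty V' a = EHom AlgC E' E" "ty V' s = EHom Fun S S'" "ty V' t = EHom Fun (br E) S"
    "ty V' f = FOb i (EHom C c (EFo E' K))"
    "dj a s" "dj s a" "dj a t" "dj t a" "dj s t" "dj t s" "dj a f" "dj f a" "dj s f" "dj f s" "dj t f" "dj f t"
  shows "apl (bra E' c) (EFo S' c) K (prF (br E') S' c \<star>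
      (ev V' (EHom Fun (br E) S) (EHom Fun (br E') S') \<star> (EFh TF (E, S) (E', S') \<star> (a \<parallel> s) \<parallel> t))) f =
    apl (EFo S c) (EFo S' c) K (prF S S' c \<star> s) (apl (bra E c) (EFo S c) K (prF (br E) S c \<star> t)
      (EComp bC c (EFo E' K) (EFo E K) \<star> (prA E' E K \<star> a \<parallel> f)))"
proof -
  note b = BF_hom[OF E(2,1)]
  have "apl (bra E' c) (EFo S' c) K (prF (br E') S' c \<star>
      (EComp Fun (br E') (br E) S' \<star> (EComp Fun (br E) S S' \<star> (s \<parallel> t) \<parallel> EFh BF E' E \<star> a))) f =
    apl (bra E c) (EFo S' c) K (prF (br E) S' c \<star> (EComp Fun (br E) S S' \<star> (s \<parallel> t))) (apl (bra E' c) (bra E c) K (prF (br E') (br E) c \<star> (EFh BF E' E \<star> a)) f)"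
    using Fun_comp_apl[of "br E'" "br E" S' c K "EComp Fun (br E) S S' \<star> (s \<parallel> t)" "EFh BF E' E \<star> a" f] E S * b(1-3)
    by (simp del: base_simps(3) Fun_comp(4))
  also have "apl (bra E' c) (bra E c) K (prF (br E') (br E) c \<star> (EFh BF E' E \<star> a)) f = EComp bC c (EFo E' K) (EFo E K) \<star> (prA E' E K \<star> a \<parallel> f)"
    using b(4)[of c a] action_apl[OF E(2,1), of c K a f] * by (simp del: base_simps(3))
  also have "apl (bra E c) (EFo S' c) K (prF (br E) S' c \<star> (EComp Fun (br E) S S' \<star> (s \<parallel> t))) (EComp bC c (EFo E' K) (EFo E K) \<star> (prA E' E K \<star> a \<parallel> f)) =
     apl (EFo S c) (EFo S' c) K (prF S S' c \<star> s) (apl (bra E c) (EFo S c) K (prF (br E) S c \<star> t)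
      (EComp bC c (EFo E' K) (EFo E K) \<star> (prA E' E K \<star> a \<parallel> f)))"
    using Fun_comp_apl[of "br E" S S' c K s t "EComp bC c (EFo E' K) (EFo E K) \<star> (prA E' E K \<star> a \<parallel> f)"] E S *
    by (simp del: Fun_comp(4))
  finally show ?thesis using TF_hom(2)[OF E S, of a s t] * by (simp only:)
qed

text \<open>A global name for the local \<open>act\<close> of
  \<open>sections_functor\<close>.\<close>

definition alg_act where
  "alg_act A B K = ihom_comparison V V' i (EFo A K) (EFo B K) \<cdot> FAr i (Alg_proj V T A B K)"

lemma alg_act [simp]:
  assumes "A \<in> algs" "B \<in> algs" "K \<in> EOb T"
  shows "alg_act A B K \<in> Arr V'" "Dom V' (alg_act A B K) = FOb i (EHom AlgT A B)" "Cod V' (alg_act A B K) = ihom V' (FOb i (EFo A K)) (FOb i (EFo B K))"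
    "elt V' h \<Longrightarrow> ty V' h = FOb i (EHom AlgT A B) \<Longrightarrow> elt V' x \<Longrightarrow> ty V' x = FOb i (EFo A K) \<Longrightarrow> dj h x \<Longrightarrow>
      ev V' (FOb i (EFo A K)) (FOb i (EFo B K)) \<star> (alg_act A B K \<star> h \<parallel> x) = apl A B K h x"
  using assms by (simp_all add: alg_act_def apl_def)

text \<open>The common pattern of both variables. The hypothesis \<open>eq\<close> says that the
  family \<open>h\<close> sends sections to sections; it makes the integrand of
  \<open>end_action\<close> a wedge, so that the induced arrow can be computed at each
  \<open>K\<close>.\<close>

lemma sec_end_action:
  assumes SE: "S \<in> EOb Fun" "E \<in> algC" "S' \<in> EOb Fun" "E' \<in> algC" and H: "H \<in> Obj V'"
    and h: "\<And>K. K \<in> EOb T \<Longrightarrow> h K \<in> hom V' H (FOb i (EHom AlgT (sob S E K) (sob S' E' K)))"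
    and eq: "\<And>K M \<alpha> a s. K \<in> EOb T \<Longrightarrow> M \<in> EOb T \<Longrightarrow> elt V' \<alpha> \<Longrightarrow> ty V' \<alpha> = FOb i (EHom T K M) \<Longrightarrow>
       elt V' a \<Longrightarrow> ty V' a = H \<Longrightarrow> elt V' s \<Longrightarrow> ty V' s = Sec S E \<Longrightarrow>
       dj \<alpha> a \<Longrightarrow> dj a \<alpha> \<Longrightarrow> dj \<alpha> s \<Longrightarrow> dj s \<alpha> \<Longrightarrow> dj a s \<Longrightarrow> dj s a \<Longrightarrow>
       ac (sob S' E' K) K M \<alpha> (apl (sob S E K) (sob S' E' K) K (h K \<star> a) (sp S E K \<star> s)) =
       apl (sob S' E' M) (sob S' E' K) M (FAr i (EFh S' (EFo E' M) (EFo E' K)) \<star> (FAr i (EFh E' K M) \<star> \<alpha>))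
         (apl (sob S E M) (sob S' E' M) M (h M \<star> a) (sp S E M \<star> s))"
  defines "r \<equiv> end_action V' bT (bS S E) (bS S' E') H (\<lambda>K. alg_act (sob S E K) (sob S' E' K) K \<cdot> h K)"
  shows "r \<in> hom V' H (ihom V' (Sec S E) (Sec S' E'))"
    "K \<in> EOb T \<Longrightarrow> elt V' a \<Longrightarrow> elt V' s \<Longrightarrow> ty V' a = H \<Longrightarrow> ty V' s = Sec S E \<Longrightarrow> dj a s \<Longrightarrow>
      sp S' E' K \<star> (ev V' (Sec S E) (Sec S' E') \<star> (r \<star> a \<parallel> s)) = apl (sob S E K) (sob S' E' K) K (h K \<star> a) (sp S E K \<star> s)"
proof -
  let ?\<sigma> = "\<lambda>K. ev V' (EFo (bS S E) (K, K)) (EFo (bS S' E') (K, K)) \<cdot> ((alg_act (sob S E K) (sob S' E' K) K \<cdot> h K) \<odot> sp S E K)"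
  have ha: "h K \<in> Arr V'" "Dom V' (h K) = H" "Cod V' (h K) = FOb i (EHom AlgT (sob S E K) (sob S' E' K))" if "K \<in> EOb T" for K
    using h[OF that] by (auto simp: W.hom_iff)
  have \<sigma>: "?\<sigma> K \<star> (a \<parallel> s) = apl (sob S E K) (sob S' E' K) K (h K \<star> a) (sp S E K \<star> s)"
    if "K \<in> EOb T" "elt V' a" "elt V' s" "ty V' a = H" "ty V' s = Sec S E" "dj a s" for K a s
    using that SE ha by simp
  have w: "wedge V' bT (bS S' E') (H \<otimes> Sec S E) ?\<sigma>"
  proof (rule sec_wedgeI2[OF SE(3,4) H sec_proj(1)[OF SE(1,2)]])
    show "?\<sigma> K \<in> hom V' (H \<otimes> Sec S E) (FOb i (EFo (sob S' E' K) K))" if "K \<in> EOb T" for K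
      using that SE ha by (simp add: W.hom_iff)
  qed (simp only: \<sigma> eq)
  have Z: "H \<otimes> Sec S E \<in> Obj V'" using H SE by simp
  note l = end_lift[OF bT.enriched_category_axioms sec_bif[OF SE(3,4)] sec_has_end[OF SE(3,4)] w Z, folded section_object_def]
  have r: "r = curry_arr V' H (Sec S E) (end_lift V' bT (bS S' E') (H \<otimes> Sec S E) ?\<sigma>)"
    by (simp add: r_def end_action_def section_object_def)
  show "r \<in> hom V' H (ihom V' (Sec S E) (Sec S' E'))"
    unfolding r using l(1-3) SE H by (simp add: W.hom_iff)
  show "sp S' E' K \<star> (ev V' (Sec S E) (Sec S' E') \<star> (r \<star> a \<parallel> s)) = apl (sob S E K) (sob S' E' K) K (h K \<star> a) (sp S E K \<star> s)"
    if "K \<in> EOb T" "elt V' a" "elt V' s" "ty V' a = H" "ty V' s = Sec S E" "dj a s"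
    unfolding r using l(1-3) l(5)[of K "a \<parallel> s"] \<sigma>[OF that] SE H that by simp
qed


text \<open>A transformation from \<open>S\<close> to \<open>S'\<close> sends sections to sections
  because its components are homomorphisms and are natural along the arrows
  \<open>E \<alpha>\<close>.\<close>

lemma sec_action_right:
  assumes S: "S \<in> EOb Fun" "S' \<in> EOb Fun" and E: "E \<in> algC"
  defines "r \<equiv> end_action V' bT (bS S E) (bS S' E) (EHom Fun S S') (\<lambda>K. alg_act (sob S E K) (sob S' E K) K \<cdot> prF S S' (EFo E K))"
  shows "r \<in> hom V' (EHom Fun S S') (ihom V' (Sec S E) (Sec S' E))"
    "K \<in> EOb T \<Longrightarrow> elt V' a \<Longrightarrow> elt V' s \<Longrightarrow> ty V' a = EHom Fun S S' \<Longrightarrow> ty V' s = Sec S E \<Longrightarrow> dj a s \<Longrightarrow>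
      sp S' E K \<star> (ev V' (Sec S E) (Sec S' E) \<star> (r \<star> a \<parallel> s)) = apl (sob S E K) (sob S' E K) K (prF S S' (EFo E K) \<star> a) (sp S E K \<star> s)"
proof -
  have eq: "ac (sob S' E K) K M \<alpha> (apl (sob S E K) (sob S' E K) K (prF S S' (EFo E K) \<star> a) (sp S E K \<star> s)) =
       apl (sob S' E M) (sob S' E K) M (FAr i (EFh S' (EFo E M) (EFo E K)) \<star> (FAr i (EFh E K M) \<star> \<alpha>))
         (apl (sob S E M) (sob S' E M) M (prF S S' (EFo E M) \<star> a) (sp S E M \<star> s))"
    if *: "K \<in> EOb T" "M \<in> EOb T" "elt V' \<alpha>" "ty V' \<alpha> = FOb i (EHom T K M)" "elt V' a" "ty V' a = EHom Fun S S'"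
      "elt V' s" "ty V' s = Sec S E" "dj \<alpha> a" "dj a \<alpha>" "dj \<alpha> s" "dj s \<alpha>" "dj a s" "dj s a" for K M \<alpha> a s
  proof -
    let ?f = "FAr i (EFh E K M) \<star> \<alpha>"
    have f: "elt V' ?f" "ty V' ?f = FOb i (EHom C (EFo E K) (EFo E M))" using E * by simp_all
    have "ac (sob S' E K) K M \<alpha> (apl (sob S E K) (sob S' E K) K (prF S S' (EFo E K) \<star> a) (sp S E K \<star> s)) =
        apl (sob S E K) (sob S' E K) M (prF S S' (EFo E K) \<star> a) (ac (sob S E K) K M \<alpha> (sp S E K \<star> s))"
      by (rule apl_nat) (use S E * in simp_all)
    also have "\<dots> = apl (sob S E K) (sob S' E K) M (prF S S' (EFo E K) \<star> a)
        (apl (sob S E M) (sob S E K) M (FAr i (EFh S (EFo E M) (EFo E K)) \<star> ?f) (sp S E M \<star> s))"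
      by (subst sec_natural[OF S(1) E]) (use * in simp_all)
    also have "\<dots> = apl (sob S' E M) (sob S' E K) M (FAr i (EFh S' (EFo E M) (EFo E K)) \<star> ?f)
         (apl (sob S E M) (sob S' E M) M (prF S S' (EFo E M) \<star> a) (sp S E M \<star> s))"
      by (rule Fun_natural_apl[OF S, symmetric]) (use S E * f in simp_all)
    finally show ?thesis .
  qed
  note l = sec_end_action[OF S(1) E S(2) E, of "EHom Fun S S'" "\<lambda>K. prF S S' (EFo E K)", folded r_def]
  show "r \<in> hom V' (EHom Fun S S') (ihom V' (Sec S E) (Sec S' E))"
    by (rule l(1)) (use S E eq in \<open>simp_all add: W.hom_iff\<close>)
  show "sp S' E K \<star> (ev V' (Sec S E) (Sec S' E) \<star> (r \<star> a \<parallel> s)) = apl (sob S E K) (sob S' E K) K (prF S S' (EFo E K) \<star> a) (sp S E K \<star> s)"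
    if "K \<in> EOb T" "elt V' a" "elt V' s" "ty V' a = EHom Fun S S'" "ty V' s = Sec S E" "dj a s"
    by (rule l(2)) (use S E eq that in \<open>simp_all add: W.hom_iff\<close>)
qed

text \<open>Here the section is transported by \<open>S\<close> along a component from
  \<open>E' K\<close> to \<open>E K\<close>, which itself depends on \<open>K\<close>. Naturality of
  these components exchanges them with the images of \<open>\<alpha>\<close>, and functoriality of
  \<open>S\<close> regroups the composites.\<close>

lemma sec_action_left:
  assumes S: "S \<in> EOb Fun" and E: "E \<in> algC" "E' \<in> algC"
  defines "r \<equiv> end_action V' bT (bS S E) (bS S E') (EHom AlgC E' E)
     (\<lambda>K. alg_act (sob S E K) (sob S E' K) K \<cdot> (FAr i (EFh S (EFo E K) (EFo E' K)) \<cdot> prA E' E K))"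
  shows "r \<in> hom V' (EHom AlgC E' E) (ihom V' (Sec S E) (Sec S E'))"
    "K \<in> EOb T \<Longrightarrow> elt V' a \<Longrightarrow> elt V' s \<Longrightarrow> ty V' a = EHom AlgC E' E \<Longrightarrow> ty V' s = Sec S E \<Longrightarrow> dj a s \<Longrightarrow>
      sp S E' K \<star> (ev V' (Sec S E) (Sec S E') \<star> (r \<star> a \<parallel> s)) =
      apl (sob S E K) (sob S E' K) K (FAr i (EFh S (EFo E K) (EFo E' K)) \<star> (prA E' E K \<star> a)) (sp S E K \<star> s)"
proof -
  have eq: "ac (sob S E' K) K M \<alpha> (apl (sob S E K) (sob S E' K) K (FAr i (EFh S (EFo E K) (EFo E' K)) \<star> (prA E' E K \<star> a)) (sp S E K \<star> s)) =
       apl (sob S E' M) (sob S E' K) M (FAr i (EFh S (EFo E' M) (EFo E' K)) \<star> (FAr i (EFh E' K M) \<star> \<alpha>))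
         (apl (sob S E M) (sob S E' M) M (FAr i (EFh S (EFo E M) (EFo E' M)) \<star> (prA E' E M \<star> a)) (sp S E M \<star> s))"
    if *: "K \<in> EOb T" "M \<in> EOb T" "elt V' \<alpha>" "ty V' \<alpha> = FOb i (EHom T K M)" "elt V' a" "ty V' a = EHom AlgC E' E"
      "elt V' s" "ty V' s = Sec S E" "dj \<alpha> a" "dj a \<alpha>" "dj \<alpha> s" "dj s \<alpha>" "dj a s" "dj s a" for K M \<alpha> a s
  proof -
    let ?f = "FAr i (EFh E K M) \<star> \<alpha>" and ?f' = "FAr i (EFh E' K M) \<star> \<alpha>" and ?a = "\<lambda>K. prA E' E K \<star> a"
    have f: "elt V' ?f" "ty V' ?f = FOb i (EHom C (EFo E K) (EFo E M))" "elt V' ?f'" "ty V' ?f' = FOb i (EHom C (EFo E' K) (EFo E' M))"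
      using E * by simp_all
    have "ac (sob S E' K) K M \<alpha> (apl (sob S E K) (sob S E' K) K (FAr i (EFh S (EFo E K) (EFo E' K)) \<star> ?a K) (sp S E K \<star> s)) =
        apl (sob S E K) (sob S E' K) M (FAr i (EFh S (EFo E K) (EFo E' K)) \<star> ?a K) (ac (sob S E K) K M \<alpha> (sp S E K \<star> s))"
      by (rule apl_nat) (use S E * in simp_all)
    also have "\<dots> = apl (sob S E K) (sob S E' K) M (FAr i (EFh S (EFo E K) (EFo E' K)) \<star> ?a K)
        (apl (sob S E M) (sob S E K) M (FAr i (EFh S (EFo E M) (EFo E K)) \<star> ?f) (sp S E M \<star> s))"
      by (subst sec_natural[OF S E(1)]) (use * in simp_all)
    also have "\<dots> = apl (sob S E M) (sob S E' K) M (FAr i (EFh S (EFo E M) (EFo E' K)) \<star>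
        (EComp bC (EFo E' K) (EFo E K) (EFo E M) \<star> (?f \<parallel> ?a K))) (sp S E M \<star> s)"
      by (rule S_comp_apl[OF S]) (use S E * f in simp_all)
    also have "EComp bC (EFo E' K) (EFo E K) (EFo E M) \<star> (?f \<parallel> ?a K) = EComp bC (EFo E' K) (EFo E' M) (EFo E M) \<star> (?a M \<parallel> ?f')"
      by (rule AlgC_natural) (use E * in simp_all)
    also have "apl (sob S E M) (sob S E' K) M (FAr i (EFh S (EFo E M) (EFo E' K)) \<star>
        (EComp bC (EFo E' K) (EFo E' M) (EFo E M) \<star> (?a M \<parallel> ?f'))) (sp S E M \<star> s) =
       apl (sob S E' M) (sob S E' K) M (FAr i (EFh S (EFo E' M) (EFo E' K)) \<star> ?f')
         (apl (sob S E M) (sob S E' M) M (FAr i (EFh S (EFo E M) (EFo E' M)) \<star> ?a M) (sp S E M \<star> s))"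
      by (rule S_comp_apl[OF S, symmetric]) (use S E * f in simp_all)
    finally show ?thesis .
  qed
  note l = sec_end_action[OF S E(1) S E(2), of "EHom AlgC E' E" "\<lambda>K. FAr i (EFh S (EFo E K) (EFo E' K)) \<cdot> prA E' E K", folded r_def]
  show "r \<in> hom V' (EHom AlgC E' E) (ihom V' (Sec S E) (Sec S E'))"
    by (rule l(1)) (use S E eq in \<open>simp_all add: W.hom_iff\<close>)
  have "sp S E' K \<star> (ev V' (Sec S E) (Sec S E') \<star> (r \<star> a \<parallel> s)) =
      apl (sob S E K) (sob S E' K) K ((FAr i (EFh S (EFo E K) (EFo E' K)) \<cdot> prA E' E K) \<star> a) (sp S E K \<star> s)"
    if "K \<in> EOb T" "elt V' a" "elt V' s" "ty V' a = EHom AlgC E' E" "ty V' s = Sec S E" "dj a s" for K a s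
    by (rule l(2)) (use S E eq that in \<open>simp_all add: W.hom_iff\<close>)
  then show "K \<in> EOb T \<Longrightarrow> elt V' a \<Longrightarrow> elt V' s \<Longrightarrow> ty V' a = EHom AlgC E' E \<Longrightarrow> ty V' s = Sec S E \<Longrightarrow> dj a s \<Longrightarrow>
      sp S E' K \<star> (ev V' (Sec S E) (Sec S E') \<star> (r \<star> a \<parallel> s)) =
      apl (sob S E K) (sob S E' K) K (FAr i (EFh S (EFo E K) (EFo E' K)) \<star> (prA E' E K \<star> a)) (sp S E K \<star> s)"
    using S E by simp
qed

lemma SF_ob [simp]: "E \<in> algC \<Longrightarrow> S \<in> EOb Fun \<Longrightarrow> EFo SF (E, S) = Sec S E"
  by (simp add: sections_functor_def Let_def)

lemma SF_hom:
  assumes E: "E \<in> algC" "E' \<in> algC" and S: "S \<in> EOb Fun" "S' \<in> EOb Fun"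
  shows "EFh SF (E, S) (E', S') \<in> hom V' (EHom AlgC E' E \<otimes> EHom Fun S S') (ihom V' (Sec S E) (Sec S' E'))"
    "K \<in> EOb T \<Longrightarrow> elt V' a \<Longrightarrow> elt V' s \<Longrightarrow> elt V' u \<Longrightarrow> ty V' a = EHom AlgC E' E \<Longrightarrow> ty V' s = EHom Fun S S' \<Longrightarrow> ty V' u = Sec S E \<Longrightarrow>
      dj a s \<Longrightarrow> dj s a \<Longrightarrow> dj a u \<Longrightarrow> dj u a \<Longrightarrow> dj s u \<Longrightarrow> dj u s \<Longrightarrow>
      sp S' E' K \<star> (ev V' (Sec S E) (Sec S' E') \<star> (EFh SF (E, S) (E', S') \<star> (a \<parallel> s) \<parallel> u)) =
      apl (sob S' E K) (sob S' E' K) K (FAr i (EFh S' (EFo E K) (EFo E' K)) \<star> (prA E' E K \<star> a))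
        (apl (sob S E K) (sob S' E K) K (prF S S' (EFo E K) \<star> s) (sp S E K \<star> u))"
proof -
  let ?l = "end_action V' bT (bS S' E) (bS S' E') (EHom AlgC E' E)
     (\<lambda>K. alg_act (sob S' E K) (sob S' E' K) K \<cdot> (FAr i (EFh S' (EFo E K) (EFo E' K)) \<cdot> prA E' E K))"
  let ?r = "end_action V' bT (bS S E) (bS S' E) (EHom Fun S S') (\<lambda>K. alg_act (sob S E K) (sob S' E K) K \<cdot> prF S S' (EFo E K))"
  note l = sec_action_left[OF S(2) E] and r = sec_action_right[OF S E(1)]
  have lr: "?l \<in> Arr V'" "Dom V' ?l = EHom AlgC E' E" "Cod V' ?l = ihom V' (Sec S' E) (Sec S' E')"
    "?r \<in> Arr V'" "Dom V' ?r = EHom Fun S S'" "Cod V' ?r = ihom V' (Sec S E) (Sec S' E)"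
    using l(1) r(1) by (auto simp: W.hom_iff)
  have e: "EFh SF (E, S) (E', S') = EComp (self V') (Sec S E) (Sec S' E) (Sec S' E') \<cdot> (?l \<odot> ?r)"
    using E S by (simp add: sections_functor_def Let_def alg_act_def op_cat_def[of V'])
  show "EFh SF (E, S) (E', S') \<in> hom V' (EHom AlgC E' E \<otimes> EHom Fun S S') (ihom V' (Sec S E) (Sec S' E'))"
    using E S lr unfolding e by (simp add: W.hom_iff)
  assume *: "K \<in> EOb T" "elt V' a" "elt V' s" "elt V' u" "ty V' a = EHom AlgC E' E" "ty V' s = EHom Fun S S'" "ty V' u = Sec S E"
      "dj a s" "dj s a" "dj a u" "dj u a" "dj s u" "dj u s"
  have "ev V' (Sec S E) (Sec S' E') \<star> ((EComp (self V') (Sec S E) (Sec S' E) (Sec S' E') \<cdot> (?l \<odot> ?r)) \<star> (a \<parallel> s) \<parallel> u) =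
     ev V' (Sec S' E) (Sec S' E') \<star> (?l \<star> a \<parallel> ev V' (Sec S E) (Sec S' E) \<star> (?r \<star> s \<parallel> u))"
    using * lr E S by simp
  moreover have "sp S' E' K \<star> (ev V' (Sec S' E) (Sec S' E') \<star> (?l \<star> a \<parallel> ev V' (Sec S E) (Sec S' E) \<star> (?r \<star> s \<parallel> u))) =
     apl (sob S' E K) (sob S' E' K) K (FAr i (EFh S' (EFo E K) (EFo E' K)) \<star> (prA E' E K \<star> a))
        (sp S' E K \<star> (ev V' (Sec S E) (Sec S' E) \<star> (?r \<star> s \<parallel> u)))"
    by (rule l(2)) (use * lr E S in simp_all)
  moreover have "sp S' E K \<star> (ev V' (Sec S E) (Sec S' E) \<star> (?r \<star> s \<parallel> u)) =
     apl (sob S E K) (sob S' E K) K (prF S S' (EFo E K) \<star> s) (sp S E K \<star> u)"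
    by (rule r(2)) (use * in simp_all)
  ultimately show "sp S' E' K \<star> (ev V' (Sec S E) (Sec S' E') \<star> (EFh SF (E, S) (E', S') \<star> (a \<parallel> s) \<parallel> u)) =
      apl (sob S' E K) (sob S' E' K) K (FAr i (EFh S' (EFo E K) (EFo E' K)) \<star> (prA E' E K \<star> a))
        (apl (sob S E K) (sob S' E K) K (prF S S' (EFo E K) \<star> s) (sp S E K \<star> u))"
    unfolding e by (simp only:)
qed

text \<open>At the identity of \<open>E' K\<close> the new transformation is \<open>s\<close>
  applied to the value of \<open>t\<close> at the component of \<open>a\<close>. By
  \<open>apl_at_id\<close> that value comes from the identity of \<open>E K\<close>, and naturality
  of \<open>s\<close> exchanges the two remaining actions.\<close>

lemma Phi_natural_elt:
  assumes E: "E \<in> algC" "E' \<in> algC" and S: "S \<in> EOb Fun" "S' \<in> EOb Fun"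
    and *: "elt V' a" "elt V' s" "elt V' t" "ty V' a = EHom AlgC E' E" "ty V' s = EHom Fun S S'" "ty V' t = EHom Fun (br E) S"
      "dj a s" "dj s a" "dj a t" "dj t a" "dj s t" "dj t s"
  shows "Phi (E', S') \<star> (ev V' (EHom Fun (br E) S) (EHom Fun (br E') S') \<star> (EFh TF (E, S) (E', S') \<star> (a \<parallel> s) \<parallel> t)) =
    ev V' (Sec S E) (Sec S' E') \<star> (EFh SF (E, S) (E', S') \<star> (a \<parallel> s) \<parallel> Phi (E, S) \<star> t)"
proof -
  interpret e: an_end V' bT "bS S' E'" "Sec S' E'" "sp S' E'" by (rule sec_end) fact+
  have TFa: "EFh TF (E, S) (E', S') \<in> Arr V'" "Dom V' (EFh TF (E, S) (E', S')) = EHom AlgC E' E \<otimes> EHom Fun S S'"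
    "Cod V' (EFh TF (E, S) (E', S')) = ihom V' (EHom Fun (br E) S) (EHom Fun (br E') S')"
    using TF_hom(1)[OF E S] by (auto simp: W.hom_iff)
  have SFa: "EFh SF (E, S) (E', S') \<in> Arr V'" "Dom V' (EFh SF (E, S) (E', S')) = EHom AlgC E' E \<otimes> EHom Fun S S'"
    "Cod V' (EFh SF (E, S) (E', S')) = ihom V' (Sec S E) (Sec S' E')"
    using SF_hom(1)[OF E S] by (auto simp: W.hom_iff)
  let ?t = "ev V' (EHom Fun (br E) S) (EHom Fun (br E') S') \<star> (EFh TF (E, S) (E', S') \<star> (a \<parallel> s) \<parallel> t)"
  have t: "elt V' ?t" "ty V' ?t = EHom Fun (br E') S'" using E S * TFa by simp_all
  show ?thesis
  proof (rule e.elt_end_ext)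
    fix K assume "K \<in> EOb bT" then have K: "K \<in> EOb T" by simp
    let ?a = "prA E' E K \<star> a"
    have a: "elt V' ?a" "ty V' ?a = FOb i (EHom C (EFo E' K) (EFo E K))" using E K * by simp_all
    have "sp S' E' K \<star> (Phi (E', S') \<star> ?t) = apl (bra E' (EFo E' K)) (sob S' E' K) K (prF (br E') S' (EFo E' K) \<star> ?t) (idc E' K)"
      by (rule Phi(4)[OF S(2) E(2) K t])
    also have "\<dots> = apl (sob S E' K) (sob S' E' K) K (prF S S' (EFo E' K) \<star> s) (apl (bra E (EFo E' K)) (sob S E' K) K (prF (br E) S (EFo E' K) \<star> t)
        (EComp bC (EFo E' K) (EFo E' K) (EFo E K) \<star> (?a \<parallel> idc E' K)))"
      by (rule TF_apl[OF E S]) (use E K * idc[OF E(2) K] in \<open>simp_all del: base_simps(3,4)\<close>)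
    also have "EComp bC (EFo E' K) (EFo E' K) (EFo E K) \<star> (?a \<parallel> idc E' K) = ?a"
      by (rule bC.comp_id(2)) (use E K a in simp_all)
    also have "apl (bra E (EFo E' K)) (sob S E' K) K (prF (br E) S (EFo E' K) \<star> t) ?a =
        apl (sob S E K) (sob S E' K) K (FAr i (EFh S (EFo E K) (EFo E' K)) \<star> ?a)
          (apl (bra E (EFo E K)) (sob S E K) K (prF (br E) S (EFo E K) \<star> t) (idc E K))"
      by (rule apl_at_id[OF S(1) E(1), symmetric]) (use E K a * in simp_all)
    also have "apl (bra E (EFo E K)) (sob S E K) K (prF (br E) S (EFo E K) \<star> t) (idc E K) = sp S E K \<star> (Phi (E, S) \<star> t)"
      by (rule Phi(4)[OF S(1) E(1) K *(3,6), symmetric])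
    also have "apl (sob S E' K) (sob S' E' K) K (prF S S' (EFo E' K) \<star> s) (apl (sob S E K) (sob S E' K) K (FAr i (EFh S (EFo E K) (EFo E' K)) \<star> ?a)
          (sp S E K \<star> (Phi (E, S) \<star> t))) =
        apl (sob S' E K) (sob S' E' K) K (FAr i (EFh S' (EFo E K) (EFo E' K)) \<star> ?a)
        (apl (sob S E K) (sob S' E K) K (prF S S' (EFo E K) \<star> s) (sp S E K \<star> (Phi (E, S) \<star> t)))"
      by (rule Fun_natural_apl[OF S, symmetric]) (use E S K a * in \<open>simp_all del: Phi(4)\<close>)
    also have "\<dots> = sp S' E' K \<star> (ev V' (Sec S E) (Sec S' E') \<star> (EFh SF (E, S) (E', S') \<star> (a \<parallel> s) \<parallel> Phi (E, S) \<star> t))"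
      by (rule SF_hom(2)[OF E S K, symmetric]) (use E S * in simp_all)
    finally show "sp S' E' K \<star> (Phi (E', S') \<star> ?t) =
      sp S' E' K \<star> (ev V' (Sec S E) (Sec S' E') \<star> (EFh SF (E, S) (E', S') \<star> (a \<parallel> s) \<parallel> Phi (E, S) \<star> t))" .
  qed (use E S * t SFa in \<open>auto\<close>)
qed

lemma tensor_hom: "EHom (tensor_cat V' (op_cat V' AlgC) Fun) (E, S) (E', S') = EHom AlgC E' E \<otimes> EHom Fun S S'"
  by (simp add: tensor_cat_def op_cat_def[of V'])

lemma Phi_natural: "enriched_natural_iso V' (tensor_cat V' (op_cat V' AlgC) Fun) TF SF Phi"
proof -
  have "enriched_natural V' (tensor_cat V' (op_cat V' AlgC) Fun) (self V') TF SF (\<lambda>x. name_of V' (Phi x))"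
  proof (rule W.natural_selfI; clarsimp simp: tensor_hom)
    fix E E' S S' assume E: "E \<in> algC" "E' \<in> algC" and S: "S \<in> EOb Fun" "S' \<in> EOb Fun"
    have TFa: "EFh TF (E, S) (E', S') \<in> Arr V'" "Dom V' (EFh TF (E, S) (E', S')) = EHom AlgC E' E \<otimes> EHom Fun S S'"
      "Cod V' (EFh TF (E, S) (E', S')) = ihom V' (EHom Fun (br E) S) (EHom Fun (br E') S')"
      using TF_hom(1)[OF E S] by (auto simp: W.hom_iff)
    have SFa: "EFh SF (E, S) (E', S') \<in> Arr V'" "Dom V' (EFh SF (E, S) (E', S')) = EHom AlgC E' E \<otimes> EHom Fun S S'"
      "Cod V' (EFh SF (E, S) (E', S')) = ihom V' (Sec S E) (Sec S' E')"
      using SF_hom(1)[OF E S] by (auto simp: W.hom_iff)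
    show "Phi (E', S') \<cdot> (ev V' (EHom Fun (br E) S) (EHom Fun (br E') S') \<cdot> (EFh TF (E, S) (E', S') \<odot> Idt V' (EHom Fun (br E) S))) =
      ev V' (Sec S E) (Sec S' E') \<cdot> (EFh SF (E, S) (E', S') \<odot> Phi (E, S))"
      by (rule W.ext3[where X="EHom AlgC E' E" and Y="EHom Fun S S'" and Z="EHom Fun (br E) S" and W="Sec S' E'"])
        (use E S TFa SFa Phi_natural_elt[OF E S] in \<open>simp_all add: W.hom_iff del: Phi(4)\<close>)
  qed (use TF_hom(1) SF_hom(1) in \<open>auto simp: W.hom_iff\<close>)
  then show ?thesis
    unfolding enriched_natural_iso_def by (auto simp: W.hom_iff op_cat_def[of V'] Phi_iso)
qed

end

section \<open>Elements over the unit: ordinary transformations and sections\<close>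

lemma wedge_cong: "(\<And>a. a \<in> EOb A \<Longrightarrow> \<sigma> a = \<tau> a) \<Longrightarrow> wedge V A F Z \<sigma> \<longleftrightarrow> wedge V A F Z \<tau>"
  by (simp add: wedge_def)

lemma (in category) iso_comp_bij:
  assumes "is_iso C f" "f \<in> hom C X Y" "Z \<in> Obj C"
  shows "bij_betw (\<lambda>t. f \<cdot> t) (hom C Z X) (hom C Z Y)"
  by (rule bij_betw_byWitness[where f' = "\<lambda>t. inv_arr C f \<cdot> t"]) (use assms in \<open>auto simp: hom_iff\<close>)

text \<open>Arrows from the unit of \<open>V'\<close> into an end of embedded objects are wedges
  from that unit, and since \<open>i\<close> is fully faithful and \<open>FUnt i\<close> invertible
  their components come uniquely from \<open>V\<close>. The predicate \<open>N\<close> will be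
  naturality or the section condition.\<close>

lemma (in base_change) unit_lift_bij:
  assumes B: "enriched_category V' (base_cat V' i A)" "bif V' (base_cat V' i A) B" "has_end V' (base_cat V' i A) B"
    and Q: "\<And>a. a \<in> EOb A \<Longrightarrow> EFo B (a, a) = FOb i (Q a)" "\<And>a. a \<in> EOb A \<Longrightarrow> Q a \<in> Obj V"
    and N: "\<And>\<sigma>. (\<And>a. a \<in> EOb A \<Longrightarrow> \<sigma> a \<in> hom V \<one>\<^bsub>V\<^esub> (Q a)) \<Longrightarrow>
      wedge V' (base_cat V' i A) B \<one> (\<lambda>a. FAr i (\<sigma> a) \<cdot> FUnt i) \<longleftrightarrow> N \<sigma>"
    and N_hom: "\<And>\<sigma> a. N \<sigma> \<Longrightarrow> a \<in> EOb A \<Longrightarrow> \<sigma> a \<in> hom V \<one>\<^bsub>V\<^esub> (Q a)"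
  shows "bij_betw (\<lambda>\<sigma>. end_lift V' (base_cat V' i A) B \<one> (\<lambda>a. FAr i (\<sigma> a) \<cdot> FUnt i)) {\<sigma> \<in> extensional (EOb A). N \<sigma>}
    (hom V' \<one> (end_obj V' (base_cat V' i A) B))"
proof -
  interpret e: an_end V' "base_cat V' i A" B "end_obj V' (base_cat V' i A) B" "end_proj V' (base_cat V' i A) B"
    by (rule chosen_end[OF B])
  let ?l = "\<lambda>\<sigma>. end_lift V' (base_cat V' i A) B \<one> (\<lambda>a. FAr i (\<sigma> a) \<cdot> FUnt i)" and ?Z = "end_obj V' (base_cat V' i A) B"
    and ?\<pi> = "end_proj V' (base_cat V' i A) B"
  have w: "wedge V' (base_cat V' i A) B \<one> (\<lambda>a. FAr i (\<sigma> a) \<cdot> FUnt i)" if "N \<sigma>" for \<sigma>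
    using N[OF N_hom[OF that]] that by blast
  note l = end_lift[OF B w W.Unt_Obj]
  show ?thesis
  proof (rule bij_betw_imageI)
    show "inj_on ?l {\<sigma> \<in> extensional (EOb A). N \<sigma>}"
    proof (rule inj_onI; clarsimp)
      fix \<sigma> \<tau> assume *: "\<sigma> \<in> extensional (EOb A)" "N \<sigma>" "\<tau> \<in> extensional (EOb A)" "N \<tau>" "?l \<sigma> = ?l \<tau>"
      show "\<sigma> = \<tau>"
      proof (rule extensionalityI[OF *(1,3)])
        fix a assume a: "a \<in> EOb A"
        note st = N_hom[OF *(2) a] N_hom[OF *(4) a]
        have "FAr i (\<sigma> a) \<cdot> FUnt i = FAr i (\<tau> a) \<cdot> FUnt i"
          using l(4)[OF *(2), of a] l(4)[OF *(4), of a] *(5) a by simp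
        then have "FAr i (\<sigma> a) = FAr i (\<tau> a)"
          by (rule W.iso_epic[rotated]) (use st in \<open>auto simp: V.hom_iff\<close>)
        with st show "\<sigma> a = \<tau> a" by (rule faithful)
      qed
    qed
    show "?l ` {\<sigma> \<in> extensional (EOb A). N \<sigma>} = hom V' \<one> ?Z"
    proof (intro equalityI subsetI)
      fix h assume "h \<in> ?l ` {\<sigma> \<in> extensional (EOb A). N \<sigma>}"
      then show "h \<in> hom V' \<one> ?Z" using l(1-3) by (auto simp: W.hom_iff)
    next
      fix h assume h: "h \<in> hom V' \<one> ?Z"
      have "\<exists>f. f \<in> hom V \<one>\<^bsub>V\<^esub> (Q a) \<and> FAr i f = (?\<pi> a \<cdot> h) \<cdot> inv_arr V' (FUnt i)" if a: "a \<in> EOb A" for a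
      proof -
        have "(?\<pi> a \<cdot> h) \<cdot> inv_arr V' (FUnt i) \<in> hom V' (FOb i \<one>\<^bsub>V\<^esub>) (FOb i (Q a))"
          using h Q a by (simp add: W.hom_iff)
        from full[OF this V.Unt_Obj Q(2)[OF a]] show ?thesis by blast
      qed
      then obtain \<sigma>0 where \<sigma>0: "\<And>a. a \<in> EOb A \<Longrightarrow> \<sigma>0 a \<in> hom V \<one>\<^bsub>V\<^esub> (Q a) \<and> FAr i (\<sigma>0 a) = (?\<pi> a \<cdot> h) \<cdot> inv_arr V' (FUnt i)"
        by metis
      \<comment> \<open>Off the objects of \<open>A\<close> the chosen components are arbitrary;
        truncation makes the preimage extensional.\<close>
      define \<sigma> where "\<sigma> = restrict \<sigma>0 (EOb A)"
      have \<sigma>: "\<sigma> a \<in> hom V \<one>\<^bsub>V\<^esub> (Q a)" "FAr i (\<sigma> a) \<cdot> FUnt i = ?\<pi> a \<cdot> h" if "a \<in> EOb A" for a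
        using \<sigma>0[OF that] that h Q by (auto simp: \<sigma>_def W.hom_iff)
      have "wedge V' (base_cat V' i A) B \<one> (\<lambda>a. ?\<pi> a \<cdot> h)"
        using e.is_end h by (intro e.wedge_precomp[OF e.bif]) (auto simp: is_end_def)
      then have n: "N \<sigma>" using N[OF \<sigma>(1)] \<sigma>(2) wedge_cong[of "base_cat V' i A" "\<lambda>a. FAr i (\<sigma> a) \<cdot> FUnt i" "\<lambda>a. ?\<pi> a \<cdot> h"] by simp
      have "?l \<sigma> = h"
        by (rule e.end_ext[of _ \<one>]) (use l(1-4)[OF n] h \<sigma> in \<open>auto simp: W.hom_iff\<close>)
      moreover have "\<sigma> \<in> extensional (EOb A)" by (simp add: \<sigma>_def)
      ultimately show "h \<in> ?l ` {\<sigma> \<in> extensional (EOb A). N \<sigma>}" using n by blast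
    qed
  qed
qed

context correspondence
begin

lemma transformation_element_bij:
  assumes S: "S \<in> EOb Fun" "S' \<in> EOb Fun"
  shows "bij_betw (transformation_element V V' i (op_cat V C) AlgT S S') (natural_transformations V (op_cat V C) AlgT S S')
    (hom V' \<one> (EHom Fun S S'))"
proof -
  interpret fp: fun_pair V' bO bAlg "base_fun V' i (op_cat V C) S" "base_fun V' i (op_cat V C) S'"
    using S by (simp add: fun_pair_def base_fun_fun Fun_fun)
  have n: "wedge V' bO (nat_bifunctor V' bO bAlg (base_fun V' i (op_cat V C) S) (base_fun V' i (op_cat V C) S')) \<one> (\<lambda>a. FAr i (\<phi> a) \<cdot> FUnt i)
      \<longleftrightarrow> enriched_natural V (op_cat V C) AlgT S S' \<phi>"
    if "\<And>a. a \<in> EOb (op_cat V C) \<Longrightarrow> \<phi> a \<in> hom V \<one>\<^bsub>V\<^esub> (EHom AlgT (EFo S a) (EFo S' a))" for \<phi>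
    using natural_base_iff[OF Fun_fun[OF S(1)] Fun_fun[OF S(2)] that] fp.wedge_unit_natural[of "\<lambda>a. FAr i (\<phi> a) \<cdot> FUnt i"] by simp
  show ?thesis
    using unit_lift_bij[OF bO.enriched_category_axioms fp.bif_nat Fun_has_end[OF S], of "\<lambda>a. EHom AlgT (EFo S a) (EFo S' a)"
        "enriched_natural V (op_cat V C) AlgT S S'"] n S
    unfolding transformation_element_def natural_transformations_def big_lift_def Fun_hom
    by (auto simp: enriched_natural_def)
qed

lemma section_element_bij:
  assumes SE: "S \<in> EOb Fun" "E \<in> algC"
  shows "bij_betw (section_element V V' i J T C S E) (sections V J T C S E) (hom V' \<one> (Sec S E))"
proof -
  interpret b: base_bifun V V' i T "sec_left S E" "sec_right S E" by (rule sec_base[OF SE])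
  have n: "wedge V' bT (bS S E) \<one> (\<lambda>a. FAr i (\<sigma> a) \<cdot> FUnt i) \<longleftrightarrow> wedge V T (section_bifunctor V J T C S E) \<one>\<^bsub>V\<^esub> \<sigma>"
    if "\<And>K. K \<in> EOb T \<Longrightarrow> \<sigma> K \<in> hom V \<one>\<^bsub>V\<^esub> (EFo (sob S E K) K)" for \<sigma>
    unfolding bS_eq section_bifunctor_def by (rule b.unit_wedge) (rule that)
  show ?thesis
    using unit_lift_bij[OF bT.enriched_category_axioms sec_bif[OF SE] sec_has_end[OF SE], of "\<lambda>K. EFo (sob S E K) K"
        "wedge V T (section_bifunctor V J T C S E) \<one>\<^bsub>V\<^esub>"] n SE
    unfolding section_element_def sections_def section_object_def
    by (auto simp: wedge_def section_bifunctor_def)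
qed

text \<open>The required square determines the map: both passages to elements are bijections, and so
  is composition with the isomorphism \<open>Phi (E, S)\<close>.\<close>

lemma correspondence_bij:
  assumes SE: "S \<in> EOb Fun" "E \<in> algC"
  shows "\<exists>f. bij_betw f (natural_transformations V (op_cat V C) AlgT (br E) S) (sections V J T C S E) \<and>
    (\<forall>\<phi>\<in>natural_transformations V (op_cat V C) AlgT (br E) S.
       section_element V V' i J T C S E (f \<phi>) = Phi (E, S) \<cdot> transformation_element V V' i (op_cat V C) AlgT (br E) S \<phi>)"
proof (intro exI conjI ballI)
  let ?N = "natural_transformations V (op_cat V C) AlgT (br E) S"
  let ?g = "\<lambda>\<phi>. Phi (E, S) \<cdot> transformation_element V V' i (op_cat V C) AlgT (br E) S \<phi>"
  let ?s = "section_element V V' i J T C S E"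
  note s = section_element_bij[OF SE]
  have g: "bij_betw ?g ?N (hom V' \<one> (Sec S E))"
    using bij_betw_trans[OF transformation_element_bij[OF br_Fun[OF SE(2)] SE(1)]
        W.iso_comp_bij[OF Phi_iso[OF SE], of "EHom Fun (br E) S" "Sec S E" \<one>]] SE
    by (simp add: W.hom_iff o_def)
  show "bij_betw (inv_into (sections V J T C S E) ?s \<circ> ?g) ?N (sections V J T C S E)"
    by (rule bij_betw_trans[OF g bij_betw_inv_into[OF s]])
  show "?s ((inv_into (sections V J T C S E) ?s \<circ> ?g) \<phi>) = ?g \<phi>" if "\<phi> \<in> ?N" for \<phi>
    using bij_betw_inv_into_right[OF s, of "?g \<phi>"] bij_betwE[OF g] that by simp
qed

end

theorem lemma3p6:
  fixes V :: "('v, 'a) smc" and V' :: "('w, 'b) smc" and i :: "('v, 'a, 'w, 'b) mfun"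
    and U :: "'u set" and J :: "'v set"
    and T :: "('v, 'v, 'a) ecat" and \<tau> :: "('v, 'v, 'a) efun"
    and C :: "('c, 'v, 'a) ecat"
    and pw :: "'v \<Rightarrow> 'c \<Rightarrow> 'c" and \<theta> :: "'v \<Rightarrow> 'c \<Rightarrow> 'c \<Rightarrow> 'a"
  assumes "symmetric_monoidal_closed V" and "finitely_complete V"
    and "infinite U" and "small U (Obj V)"
    and "symmetric_monoidal_closed V'" and "small_complete U V'" and "small_cocomplete U V'"
    and "symmetric_strong_monoidal V V' i" and "fully_faithful V V' i"
    and "preserves_limits U V V' i" and "preserves_internal_homs V V' i"
    and "system_of_arities V J" and "amenable V J"
    and "J_theory V J T \<tau>"
    and "enriched_category V C" and "small U (EOb C)" and "designated_powers V J C pw \<theta>"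
  shows
    "let AlgC = big_Alg V V' i J T C;
         Fun = big_functor_cat V V' i (op_cat V C) (Alg V J T);
         Nat = (\<lambda>E S. natural_transformations V (op_cat V C) (Alg V J T) (bracket V T C E) S)
     in \<exists>\<Phi>. enriched_natural_iso V' (tensor_cat V' (op_cat V' AlgC) Fun)
              (transformations_functor V V' i J T C) (sections_functor V V' i J T C) \<Phi> \<and>
            (\<forall>E\<in>EOb AlgC. \<forall>S\<in>EOb Fun.
               \<Phi> (E, S) \<in> hom V' (EHom Fun (bracket V T C E) S) (section_object V V' i J T C S E) \<and>
               (\<exists>f. bij_betw f (Nat E S) (sections V J T C S E) \<and>
                    (\<forall>\<phi>\<in>Nat E S.
                       section_element V V' i J T C S E (f \<phi>) =
                       \<Phi> (E, S) \<cdot>\<^bsub>V'\<^esub>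
                         transformation_element V V' i (op_cat V C) (Alg V J T)
                           (bracket V T C E) S \<phi>)))"
proof -
  have T: "enriched_category V T" "EOb T = J" using \<open>J_theory V J T \<tau>\<close> by (auto simp: J_theory_def)
  have J: "J \<subseteq> Obj V" using \<open>system_of_arities V J\<close> by (simp add: system_of_arities_def)
  \<comment> \<open>The objects of \<open>T\<close> are the arities, a subset of
    \<open>Obj V\<close>; this is what makes ends over \<open>T\<close> small.\<close>
  then have JU: "small U J"
    using \<open>small U (Obj V)\<close> unfolding small_def by (rule lesspoll_trans1[OF subset_imp_lepoll])
  have "Alg_exists V J T" using \<open>amenable V J\<close> \<open>J_theory V J T \<tau>\<close> by (auto simp: amenable_def)
  then interpret correspondence V V' i T J C U
    using assms T J JU
    by (simp add: correspondence_def correspondence_axioms_def base_change_def base_change_axioms_def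
        bracketing_def bracketing_axioms_def theory_algebras_def theory_algebras_axioms_def)
  show ?thesis
    unfolding Let_def
    by (intro exI[of _ Phi] conjI ballI Phi_natural correspondence_bij) (auto simp: W.hom_iff)
qed

end
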